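(* For every integer $N\ge1$ and every $\varphi=(\varphi_1,\varphi_2) \in H^N_c$: (i) $\displaystyle \dot\lambda_n=n\pi +\sum_{k=1}^{N+1}\frac{c_k}{n^k}+\frac{\ell^2_n}{n^{N+1}}$ as $|n|\to \infty$; (ii) $\displaystyle \tau_n=n\pi +\sum_{k=1}^{N+1}\frac{c_k}{n^k}+\frac{\ell^2_n}{n^{N+1}}$ as $|n|\to \infty$; both uniformly on bounded sets of $H^N_c$. Here $c_k=c_k(\varphi)$ are the coefficients defined in the context.
   Context: For an integer $N\ge0$, $H^N$ is the Sobolev space of 1-periodic complex-valued functions on $\mathbb{R}$ with its standard norm, $H^0=L^2$, and $H^N_c:=H^N\times H^N$. For $\varphi=(\varphi_1,\varphi_2)\in L^2_c:=H^0_c$ the Zakharov--Shabat operator is \[L(\varphi)= i \begin{pmatrix}1&0\\0&-1\end{pmatrix}\partial_x + \begin{pmatrix}0& \varphi_1 \\ \varphi_2 &0\end{pmatrix}.\] Lexicographic order: $a\preceq b$ means $\operatorname{Re}a<\operatorname{Re}b$, or $\operatorname{Re}a=\operatorname{Re}b$ and $\operatorname{Im}a\le\operatorname{Im}b$. The periodic spectrum is the spectrum of $L(\varphi)$ on $[0,2]$ with periodic boundary conditions. It is discrete and the eigenvalues, counted with algebraic multiplicities, are listed as $\cdots \preceq\lambda^-_{n}\preceq \lambda^+_n\preceq \lambda^-_{n+1}\preceq\lambda_{n+1}^+ \preceq \cdots$ in such a way that $(\lambda_n^\pm-n\pi)_{n\in\mathbb{Z}}\in\ell^2$. Set $\tau_n:=(\lambda_n^++\lambda_n^-)/2$.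 $M(x,\lambda)=\begin{pmatrix} m_1 & m_2 \\ m_3 & m_4 \end{pmatrix}$ is the fundamental solution of $L(\varphi)M=\lambda M$ with $M(0,\lambda)=\mathrm{Id}$; $\Delta(\lambda):=m_1(1,\lambda)+m_4(1,\lambda)$ and $\dot\Delta:=\partial_\lambda\Delta$. The zeros of $\dot\Delta$, counted with multiplicities, are listed as $\cdots\preceq\dot\lambda_n\preceq\dot\lambda_{n+1}\preceq\cdots$ in such a way that $(\dot\lambda_n-n\pi)_{n\in\mathbb{Z}}\in\ell^2$. Coefficients $c_k$: for $\varphi\in H^N_c$ put $r_1:=-\varphi_2$ and $r_{n+1}:=r_n'+\varphi_1\sum_{k=1}^{n-1}r_kr_{n-k}$ for $1\le n\le N$ (the sum is empty for $n=1$). Let $F(w):=i\sum_{k=1}^{N+1}\frac{\int_0^1\varphi_1r_k\,dt}{(2i)^k}w^k$ and let $\zeta$ be the unique analytic function near $z=0$ with $\zeta(0)=0$ and $\zeta(z)+F\big(\frac{z}{\pi+z\zeta(z)}\big)=0$. Then $c_k$, $1\le k\le N+1$, is the coefficient of $z^k$ in the Taylor series of $\zeta$ at $0$ (it does not depend on the choice of $N\geq \max(1,k-1)$). Notation: $x_n=y_n+\frac{\ell^p_n}{n^{s}}$ as $|n|\to\infty$ means that $x_n=y_n+\frac{e_n}{|n|^{s}}$ for $|n|$ large with $\sum|e_n|^p<\infty$. "Uniformly on bounded sets" means that for every bounded set of potentials there are $n_0\ge1$ and $C>0$ such that $\sum_{|n|\ge n_0}|e_n|^p\le C$ for all potentials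 in that set. *)

theory Defs
  imports "HOL-Complex_Analysis.Complex_Analysis" "HOL-Library.Function_Algebras"
begin

section \<open>Sobolev spaces of periodic functions\<close>

text \<open>Elements of \<open>L\<^sup>2\<close> and \<open>H\<^sup>N\<close> are represented by \<open>T\<close>-periodic measurable functions on the line;
  all notions of this section depend only on the class of the function modulo null sets.\<close>

definition periodic_L2 :: "real \<Rightarrow> (real \<Rightarrow> complex) \<Rightarrow> bool" where
  "periodic_L2 T f \<longleftrightarrow> (\<forall>x. f (x + T) = f x) \<and> f \<in> borel_measurable lebesgue \<and>
     set_integrable lebesgue {0..T} (\<lambda>x. (norm (f x))\<^sup>2)"

definition has_weak_deriv :: "real \<Rightarrow> (real \<Rightarrow> complex) \<Rightarrow> (real \<Rightarrow> complex) \<Rightarrow> bool" where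
  "has_weak_deriv T f g \<longleftrightarrow>
     (\<forall>\<psi> \<psi>' :: real \<Rightarrow> complex.
        (\<forall>x. \<psi> (x + T) = \<psi> x) \<and> (\<forall>x. (\<psi> has_vector_derivative \<psi>' x) (at x)) \<and>
        continuous_on UNIV \<psi>' \<longrightarrow>
        (LINT x:{0..T}|lebesgue. f x * \<psi>' x) = - (LINT x:{0..T}|lebesgue. g x * \<psi> x))"

text \<open>A representative of the weak derivative, which is unique up to null sets if it exists.\<close>

definition weak_deriv :: "real \<Rightarrow> (real \<Rightarrow> complex) \<Rightarrow> real \<Rightarrow> complex" where
  "weak_deriv T f = (SOME g. periodic_L2 T g \<and> has_weak_deriv T f g)"

fun sobolev :: "real \<Rightarrow> nat \<Rightarrow> (real \<Rightarrow> complex) \<Rightarrow> bool" where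
  "sobolev T 0 f \<longleftrightarrow> periodic_L2 T f"
| "sobolev T (Suc N) f \<longleftrightarrow> periodic_L2 T f \<and> (\<exists>g. sobolev T N g \<and> has_weak_deriv T f g)"

definition sobolev_norm :: "nat \<Rightarrow> (real \<Rightarrow> complex) \<Rightarrow> real" where
  "sobolev_norm N f =
     sqrt (\<Sum>k\<le>N. LINT x:{0..1}|lebesgue. (norm ((weak_deriv 1 ^^ k) f x))\<^sup>2)"

definition Hc :: "nat \<Rightarrow> ((real \<Rightarrow> complex) \<times> (real \<Rightarrow> complex)) set" where
  "Hc N = {(\<phi>1, \<phi>2). sobolev 1 N \<phi>1 \<and> sobolev 1 N \<phi>2}"

definition bounded_in_Hc :: "nat \<Rightarrow> ((real \<Rightarrow> complex) \<times> (real \<Rightarrow> complex)) set \<Rightarrow> bool" where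
  "bounded_in_Hc N B \<longleftrightarrow> B \<subseteq> Hc N \<and>
     (\<exists>R. \<forall>(\<phi>1, \<phi>2)\<in>B. sqrt ((sobolev_norm N \<phi>1)\<^sup>2 + (sobolev_norm N \<phi>2)\<^sup>2) \<le> R)"


section \<open>The Zakharov--Shabat operator and its periodic eigenvalues\<close>

definition zs_J :: "complex^2^2" where
  "zs_J = vector [vector [\<i>, 0], vector [0, -\<i>]]"

definition zs_pot :: "(real \<Rightarrow> complex) \<Rightarrow> (real \<Rightarrow> complex) \<Rightarrow> real \<Rightarrow> complex^2^2" where
  "zs_pot \<phi>1 \<phi>2 x = vector [vector [0, \<phi>1 x], vector [\<phi>2 x, 0]]"

text \<open>The domain of \<open>L(\<phi>)\<close> on \<open>[0,2]\<close> with periodic boundary conditions is \<open>H\<^sup>1\<close> of the circle of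
  length 2. Each class has exactly one continuous representative; taking only these makes the
  root spaces below spaces of functions, so that their dimension is the right one.\<close>

definition zs_dom :: "(real \<Rightarrow> complex^2) set" where
  "zs_dom = {F. continuous_on UNIV F \<and> (\<forall>j. sobolev 2 1 (\<lambda>x. F x $ j))}"

definition zs_op :: "(real \<Rightarrow> complex) \<Rightarrow> (real \<Rightarrow> complex) \<Rightarrow> (real \<Rightarrow> complex^2) \<Rightarrow> real \<Rightarrow> complex^2"
  where
  "zs_op \<phi>1 \<phi>2 F x = zs_J *v (\<chi> j. weak_deriv 2 (\<lambda>t. F t $ j) x) + zs_pot \<phi>1 \<phi>2 x *v F x"

text \<open>\<open>zs_ker \<phi>1 \<phi>2 \<mu> k\<close> is the kernel of \<open>(L(\<phi>) - \<mu>)\<^sup>k\<close>.\<close>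

fun zs_ker :: "(real \<Rightarrow> complex) \<Rightarrow> (real \<Rightarrow> complex) \<Rightarrow> complex \<Rightarrow> nat \<Rightarrow> (real \<Rightarrow> complex^2) set"
  where
  "zs_ker \<phi>1 \<phi>2 \<mu> 0 = {\<lambda>x. 0}"
| "zs_ker \<phi>1 \<phi>2 \<mu> (Suc k) = {F \<in> zs_dom. \<exists>G \<in> zs_ker \<phi>1 \<phi>2 \<mu> k.
     AE x in lebesgue. zs_op \<phi>1 \<phi>2 F x - \<mu> *s F x = G x}"

definition cscale :: "complex \<Rightarrow> (real \<Rightarrow> complex^2) \<Rightarrow> real \<Rightarrow> complex^2" where
  "cscale c F = (\<lambda>x. c *s F x)"

lemma vector_space_cscale: "vector_space cscale"
  by unfold_locales
    (auto simp: cscale_def fun_eq_iff vec_eq_iff algebra_simps vector_scalar_mult_def)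

definition alg_mult :: "(real \<Rightarrow> complex) \<Rightarrow> (real \<Rightarrow> complex) \<Rightarrow> complex \<Rightarrow> nat" where
  "alg_mult \<phi>1 \<phi>2 \<mu> = vector_space.dim cscale (\<Union>k. zs_ker \<phi>1 \<phi>2 \<mu> k)"

definition lex_le :: "complex \<Rightarrow> complex \<Rightarrow> bool" where
  "lex_le a b \<longleftrightarrow> Re a < Re b \<or> (Re a = Re b \<and> Im a \<le> Im b)"

text \<open>\<open>a\<close> lists in lexicographic order the points \<open>z\<close> with \<open>m z > 0\<close>, each \<open>m z\<close> times.\<close>

definition ordered_listing :: "(complex \<Rightarrow> nat) \<Rightarrow> (int \<Rightarrow> complex) \<Rightarrow> bool" where
  "ordered_listing m a \<longleftrightarrow> (\<forall>n. lex_le (a n) (a (n + 1))) \<and>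
     (\<forall>z. finite {n. a n = z} \<and> card {n. a n = z} = m z)"

definition l2_near_npi :: "(int \<Rightarrow> complex) \<Rightarrow> bool" where
  "l2_near_npi a \<longleftrightarrow>
     (\<lambda>n. (norm (a n - of_int n * of_real pi))\<^sup>2) summable_on (UNIV :: int set)"

definition periodic_eigenvalues ::
  "(real \<Rightarrow> complex) \<Rightarrow> (real \<Rightarrow> complex) \<Rightarrow> (int \<Rightarrow> complex) \<Rightarrow> (int \<Rightarrow> complex) \<Rightarrow> bool" where
  "periodic_eigenvalues \<phi>1 \<phi>2 lm lp \<longleftrightarrow>
     ordered_listing (alg_mult \<phi>1 \<phi>2) (\<lambda>j. if even j then lm (j div 2) else lp (j div 2)) \<and>
     l2_near_npi lm \<and> l2_near_npi lp"


section \<open>Fundamental solution, discriminant and its critical points\<close>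

text \<open>Since \<open>\<phi>\<close> is in general only in \<open>L\<^sup>2\<close>, \<open>M\<close> solves the equation in the sense of Caratheodory:
  it is absolutely continuous, with density \<open>D\<close>, and solves \<open>L(\<phi>) M = \<mu> M\<close> almost everywhere.
  This determines \<open>M\<close> on \<open>x \<ge> 0\<close>.\<close>

definition is_fund_sol ::
  "(real \<Rightarrow> complex) \<Rightarrow> (real \<Rightarrow> complex) \<Rightarrow> complex \<Rightarrow> (real \<Rightarrow> complex^2^2) \<Rightarrow> bool" where
  "is_fund_sol \<phi>1 \<phi>2 \<mu> M \<longleftrightarrow> (\<exists>D.
     (\<forall>x\<ge>0. set_integrable lebesgue {0..x} D \<and> M x = mat 1 + (LINT t:{0..x}|lebesgue. D t)) \<and>
     (AE x in lebesgue. x \<ge> 0 \<longrightarrow> zs_J ** D x + zs_pot \<phi>1 \<phi>2 x ** M x = mat \<mu> ** M x))"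

definition fund_sol ::
  "(real \<Rightarrow> complex) \<Rightarrow> (real \<Rightarrow> complex) \<Rightarrow> complex \<Rightarrow> real \<Rightarrow> complex^2^2" where
  "fund_sol \<phi>1 \<phi>2 \<mu> = (SOME M. is_fund_sol \<phi>1 \<phi>2 \<mu> M)"

definition discr :: "(real \<Rightarrow> complex) \<Rightarrow> (real \<Rightarrow> complex) \<Rightarrow> complex \<Rightarrow> complex" where
  "discr \<phi>1 \<phi>2 \<mu> = fund_sol \<phi>1 \<phi>2 \<mu> 1 $ 1 $ 1 + fund_sol \<phi>1 \<phi>2 \<mu> 1 $ 2 $ 2"

definition zero_mult :: "(complex \<Rightarrow> complex) \<Rightarrow> complex \<Rightarrow> nat" where
  "zero_mult f z = (if f z = 0 then nat (zorder f z) else 0)"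

definition critical_points ::
  "(real \<Rightarrow> complex) \<Rightarrow> (real \<Rightarrow> complex) \<Rightarrow> (int \<Rightarrow> complex) \<Rightarrow> bool" where
  "critical_points \<phi>1 \<phi>2 ld \<longleftrightarrow>
     ordered_listing (zero_mult (deriv (discr \<phi>1 \<phi>2))) ld \<and> l2_near_npi ld"


section \<open>The coefficients\<close>

text \<open>The value at 0 is a dummy; \<open>zs_r \<phi>1 \<phi>2 n\<close> is meaningful for \<open>1 \<le> n \<le> N + 1\<close> if
  \<open>(\<phi>1, \<phi>2) \<in> Hc N\<close>.\<close>

fun zs_r :: "(real \<Rightarrow> complex) \<Rightarrow> (real \<Rightarrow> complex) \<Rightarrow> nat \<Rightarrow> real \<Rightarrow> complex" where
  "zs_r \<phi>1 \<phi>2 0 = (\<lambda>x. 0)"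
| "zs_r \<phi>1 \<phi>2 (Suc 0) = (\<lambda>x. - \<phi>2 x)"
| "zs_r \<phi>1 \<phi>2 (Suc (Suc n)) = (\<lambda>x. weak_deriv 1 (zs_r \<phi>1 \<phi>2 (Suc n)) x +
     \<phi>1 x * (\<Sum>k=1..n. zs_r \<phi>1 \<phi>2 k x * zs_r \<phi>1 \<phi>2 (Suc n - k) x))"

definition zs_F :: "nat \<Rightarrow> (real \<Rightarrow> complex) \<Rightarrow> (real \<Rightarrow> complex) \<Rightarrow> complex \<Rightarrow> complex" where
  "zs_F N \<phi>1 \<phi>2 w = \<i> * (\<Sum>k=1..N+1.
     (LINT t:{0..1}|lebesgue. \<phi>1 t * zs_r \<phi>1 \<phi>2 k t) / (2 * \<i>) ^ k * w ^ k)"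

text \<open>Only the germ of \<open>zs_zeta\<close> at 0 is determined.\<close>

definition zs_zeta :: "nat \<Rightarrow> (real \<Rightarrow> complex) \<Rightarrow> (real \<Rightarrow> complex) \<Rightarrow> complex \<Rightarrow> complex" where
  "zs_zeta N \<phi>1 \<phi>2 = (SOME \<zeta>. \<zeta> analytic_on {0} \<and> \<zeta> 0 = 0 \<and>
     (\<forall>\<^sub>F z in nhds 0. \<zeta> z + zs_F N \<phi>1 \<phi>2 (z / (of_real pi + z * \<zeta> z)) = 0))"

definition zs_c :: "nat \<Rightarrow> (real \<Rightarrow> complex) \<Rightarrow> (real \<Rightarrow> complex) \<Rightarrow> nat \<Rightarrow> complex" where
  "zs_c N \<phi>1 \<phi>2 k = fps_nth (fps_expansion (zs_zeta N \<phi>1 \<phi>2) 0) k"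


section \<open>Asymptotics\<close>

text \<open>\<open>x\<^sub>n = y\<^sub>n + e\<^sub>n / |n|\<^sup>s\<close> for \<open>|n| \<ge> n0\<close>, where the squares of the \<open>|e\<^sub>n|\<close> sum up to at most \<open>C\<close>.\<close>

definition l2_remainder ::
  "nat \<Rightarrow> real \<Rightarrow> nat \<Rightarrow> (int \<Rightarrow> complex) \<Rightarrow> (int \<Rightarrow> complex) \<Rightarrow> bool" where
  "l2_remainder n0 C s x y \<longleftrightarrow> (\<exists>e :: int \<Rightarrow> complex.
     (\<forall>n. \<bar>n\<bar> \<ge> int n0 \<longrightarrow> x n = y n + e n / of_int \<bar>n\<bar> ^ s) \<and>
     (\<lambda>n. (norm (e n))\<^sup>2) summable_on {n. \<bar>n\<bar> \<ge> int n0} \<and>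
     (\<Sum>\<^sub>\<infinity>n\<in>{n. \<bar>n\<bar> \<ge> int n0}. (norm (e n))\<^sup>2) \<le> C)"

definition zs_expansion :: "nat \<Rightarrow> (real \<Rightarrow> complex) \<Rightarrow> (real \<Rightarrow> complex) \<Rightarrow> int \<Rightarrow> complex" where
  "zs_expansion N \<phi>1 \<phi>2 n =
     of_int n * of_real pi + (\<Sum>k=1..N+1. zs_c N \<phi>1 \<phi>2 k / of_int n ^ k)"

end

theory Submission
  imports Defs
begin

text \<open>The proof rests on a refined expansion of the discriminant. Put \<open>\<kappa> = 1 / (2 i \<lambda>)\<close>. The quotient of the two components of a
  solution satisfies a Riccati equation, whose formal solution in powers of \<open>\<kappa>\<close> is \<open>\<sigma> = - i (r\<^sub>1 \<kappa> + r\<^sub>2 \<kappa>\<^sup>2 + ...)\<close>; this is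
  where the functions \<open>r\<^sub>k\<close> come from. For a potential in \<open>H\<^sup>N\<close> the series can be cut off after \<open>N\<close> terms, and a linear substitution
  built from \<open>\<sigma>\<close> (lemma \<open>gauge\<close>) leads to a system whose off-diagonal entries are \<open>O(\<kappa>\<^sup>N)\<close> and \<open>O(\<kappa>)\<close>. Up to
  \<open>O(\<kappa>^(N+2))\<close> the integral of its diagonal entry is \<open>- i (\<lambda> + F(1/\<lambda>))\<close>, so without the off-diagonal entries the discriminant
  would be \<open>2 cos (\<lambda> + F(1/\<lambda>))\<close>. The off-diagonal entries enter only through their product, which is of order \<open>N + 1\<close>; moreover
  they carry oscillating factors, whence the error also contains Fourier coefficients of \<open>r\<^sub>N\<^sub>+\<^sub>1\<close> and \<open>\<phi>\<^sub>1'\<close>, which are square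
  summable by Bessel's inequality. So, in the disc of radius 2 around \<open>n\<pi>\<close>, the discriminant is \<open>2 cos (\<lambda> + F(1/\<lambda>))\<close> up to
  an error \<open>E\<^sub>n\<close> which is \<open>|n|^(-N-1)\<close> times a square summable sequence (lemma \<open>discr_sharp\<close>). All constants depend on \<open>N\<close> and a bound for the
  potential only.

  By construction of \<open>\<zeta>\<close>, the point \<open>\<lambda>\<^sub>* = n\<pi> + \<zeta>(1/n)\<close> satisfies \<open>\<lambda>\<^sub>* + F(1/\<lambda>\<^sub>*) = n\<pi>\<close>, and the claimed expansion is its
  Taylor polynomial (lemma \<open>expansion_root\<close>). Cauchy's estimate for the derivative of the error shows that a critical point near \<open>n\<pi>\<close>
  differs from \<open>\<lambda>\<^sub>*\<close> by \<open>O(E\<^sub>n)\<close>. Since \<open>2 cos\<close> has a double value at a multiple of \<open>\<pi>\<close>, a periodic eigenvalue is only within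
  \<open>O(\<surd>E\<^sub>n)\<close> of \<open>\<lambda>\<^sub>*\<close>. But the discriminant takes the same value at both eigenvalues near \<open>n\<pi>\<close>, so that its derivative at their
  midpoint is of the order of the square of their distance, that is \<open>O(E\<^sub>n)\<close>, and the midpoint is as good as a critical point
  (lemma \<open>near_midpoint\<close>).

  It remains to see that the points near \<open>n\<pi>\<close> carry the index \<open>n\<close>. By Rouche's theorem each disc of radius 1 around \<open>n\<pi>\<close> contains one
  critical point and two zeros of \<open>4 - \<Delta>\<^sup>2\<close>, and there are no others far from the origin; together with the square summability required
  of the listings this fixes the numbering (lemma \<open>listing_right\<close>). The eigenvalues are listed according to the dimension of their
  root spaces, which equals the order of the zero of \<open>4 - \<Delta>\<^sup>2\<close> (lemma \<open>alg_mult_eq_zero_mult\<close>).\<close>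

type_synonym cfun = "real \<Rightarrow> complex"

abbreviation absint_on (infixr "absint'_on" 46) where "f absint_on S \<equiv> f absolutely_integrable_on S"

lemmas HK_integral_add = Henstock_Kurzweil_Integration.integral_add
lemmas HK_integral_diff = Henstock_Kurzweil_Integration.integral_diff

section \<open>Absolutely continuous functions on an interval\<close>

text \<open>Cut \<open>[a,b]\<close> into \<open>n\<close> pieces on which \<open>V\<close> grows by the same amount: the increments of \<open>F\<close> over them
  sum up to \<open>O(1/n)\<close>. In the product and chain rules below, increments and integrals of the claimed densities differ by such quadratic terms.\<close>

lemma constant_if_quadratic_increments:
  fixes F :: "real \<Rightarrow> 'a::real_normed_vector" and V :: "real \<Rightarrow> real"
  assumes ab: "a \<le> b" and V: "continuous_on {a..b} V" and mono: "V a \<le> V b"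
    and incr: "\<And>s t. a \<le> s \<Longrightarrow> s \<le> t \<Longrightarrow> t \<le> b \<Longrightarrow> norm (F t - F s) \<le> C * (V t - V s)\<^sup>2"
  shows "F b = F a"
proof (rule ccontr)
  assume neq: "F b \<noteq> F a"
  have incr': "norm (F t - F s) \<le> C * (V t - V s)\<^sup>2" if "s \<in> {a..b}" "t \<in> {a..b}" for s t
    using incr[of s t] incr[of t s] that
    by (cases "s \<le> t") (auto simp: norm_minus_commute power2_commute)
  define D where "D = V b - V a"
  have *: "norm (F b - F a) \<le> C * D\<^sup>2 / n" if n: "n > 0" for n :: nat
  proof -
    have "\<exists>x. x \<in> {a..b} \<and> V x = V a + (k / n) * D" if "k \<le> n" for k
    proof -
      have "V a + (k/n) * D \<le> V b"
        using that n mono mult_right_mono[of "real k / n" 1 "V b - V a"] unfolding D_def by simp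
      moreover have "V a \<le> V a + (k/n) * D" using mono by (simp add: D_def)
      ultimately obtain x where "a \<le> x" "x \<le> b" "V x = V a + (k/n) * D"
        using IVT'[of V a "V a + (k/n)*D" b] ab V by auto
      then show ?thesis by auto
    qed
    then obtain x where x: "\<And>k. k \<le> n \<Longrightarrow> x k \<in> {a..b} \<and> V (x k) = V a + (real k / n) * D"
      by metis
    define y where "y = (\<lambda>k. if k = 0 then a else if k = n then b else x k)"
    have y: "y k \<in> {a..b} \<and> V (y k) = V a + (real k / n) * D" if "k \<le> n" for k
      using x[OF that] n ab by (auto simp: y_def D_def)
    have "F b - F a = (\<Sum>k<n. F (y (Suc k)) - F (y k))"
      using sum_lessThan_telescope[of "\<lambda>k. F (y k)" n] n by (simp add: y_def)
    also have "norm ... \<le> (\<Sum>k<n. C * (D/n)\<^sup>2)"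
    proof (rule sum_norm_le)
      fix k assume "k \<in> {..<n}"
      then have "norm (F (y (Suc k)) - F (y k)) \<le> C * (V (y (Suc k)) - V (y k))\<^sup>2"
        using y by (intro incr') auto
      also have "V (y (Suc k)) - V (y k) = D / n"
        using y[of k] y[of "Suc k"] \<open>k \<in> {..<n}\<close> n by (simp add: field_simps)
      finally show "norm (F (y (Suc k)) - F (y k)) \<le> C * (D/n)\<^sup>2" .
    qed
    also have "... = C * D\<^sup>2 / n" using n by (simp add: power2_eq_square field_simps)
    finally show ?thesis .
  qed
  have "(\<lambda>n. C * D\<^sup>2 / real n) \<longlonglongrightarrow> 0" by (rule lim_const_over_n)
  then have "norm (F b - F a) \<le> 0"
    by (rule tendsto_lowerbound) (auto intro!: eventually_sequentiallyI[of 1] *)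
  with neq show False by simp
qed

text \<open>The density \<open>g\<close> is carried along as data, because for solutions of differential equations it is given explicitly.\<close>

definition ac_on :: "real \<Rightarrow> (real \<Rightarrow> 'a::euclidean_space) \<Rightarrow> (real \<Rightarrow> 'a) \<Rightarrow> bool" where
  "ac_on b f g \<longleftrightarrow> g absint_on {0..b} \<and> (\<forall>x\<in>{0..b}. f x = f 0 + integral {0..x} g)"

lemma ac_onI:
  assumes "g absint_on {0..b}" "\<And>x. 0 \<le> x \<Longrightarrow> x \<le> b \<Longrightarrow> f x = f 0 + integral {0..x} g"
  shows "ac_on b f g"
  unfolding ac_on_def using assms by (metis atLeastAtMost_iff)

lemma ac_on_integrable: "ac_on b f g \<Longrightarrow> g absint_on {0..b}"
  by (simp add: ac_on_def)

lemma ac_on_eq: "ac_on b f g \<Longrightarrow> 0 \<le> x \<Longrightarrow> x \<le> b \<Longrightarrow> f x = f 0 + integral {0..x} g"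
  unfolding ac_on_def by (metis atLeastAtMost_iff)

lemma absint_sub:
  assumes "g absint_on {0..b}" "0 \<le> s" "t \<le> b"
  shows "(g::real \<Rightarrow> 'a::euclidean_space) absint_on {s..t}"
  by (rule absolutely_integrable_on_subinterval[OF assms(1)]) (use assms in auto)

lemma absint_int:
  "(g::real \<Rightarrow> 'a::euclidean_space) absint_on S \<Longrightarrow> g integrable_on S"
  by (rule set_lebesgue_integral_eq_integral)

lemma absint_norm_int:
  "(g::real \<Rightarrow> 'a::euclidean_space) absint_on S \<Longrightarrow> (\<lambda>x. norm (g x)) integrable_on S"
  by (simp add: absolutely_integrable_on_def)

lemma ac_on_int_sub: "ac_on b f g \<Longrightarrow> 0 \<le> s \<Longrightarrow> t \<le> b \<Longrightarrow> g integrable_on {s..t}"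
  by (metis ac_on_integrable absint_sub absint_int)

lemma ac_on_diff_eq:
  assumes "ac_on b f g" "0 \<le> s" "s \<le> t" "t \<le> b"
  shows "f t - f s = integral {s..t} g"
proof -
  have "integral {0..s} g + integral {s..t} g = integral {0..t} g"
    by (rule Henstock_Kurzweil_Integration.integral_combine)
       (use assms absint_sub[OF ac_on_integrable[OF assms(1)], of 0 t] in \<open>auto intro: absint_int\<close>)
  moreover have "f t - f s = integral {0..t} g - integral {0..s} g"
    using ac_on_eq[OF assms(1), of s] ac_on_eq[OF assms(1), of t] assms
    by (metis add_diff_cancel_left order_trans)
  ultimately show ?thesis by (metis add_diff_cancel_left')
qed

lemma norm_integral_le_absint:
  fixes g :: "real \<Rightarrow> 'a::euclidean_space"
  assumes "g absint_on {s..t}"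
  shows "norm (integral {s..t} g) \<le> integral {s..t} (\<lambda>x. norm (g x))"
  using assms by (intro integral_norm_bound_integral) (auto intro: absint_int absint_norm_int)

lemma integral_nonneg_mono:
  fixes k :: "real \<Rightarrow> real"
  assumes "k integrable_on {a..d}" "\<And>x. x \<in> {a..d} \<Longrightarrow> k x \<ge> 0" "a \<le> b" "c \<le> d"
  shows "integral {b..c} k \<le> integral {a..d} k"
  by (rule integral_subset_le)
     (use assms integrable_on_subinterval[of k "{a..d}" b c] in auto)

lemma ac_on_norm_diff:
  assumes "ac_on b f g" "0 \<le> s" "s \<le> t" "t \<le> b"
  shows "norm (f t - f s) \<le> integral {s..t} (\<lambda>x. norm (g x))"
  unfolding ac_on_diff_eq[OF assms]
  by (rule norm_integral_le_absint)
     (use assms absint_sub[OF ac_on_integrable[OF assms(1)]] in auto)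

lemma ac_on_indefinite:
  assumes "g absint_on {0..b}"
  shows "ac_on b (\<lambda>x. c + integral {0..x} g) g"
  using assms by (auto simp: ac_on_def)

lemma ac_on_continuous:
  assumes "ac_on b f g" shows "continuous_on {0..b} f"
proof -
  have "continuous_on {0..b} (\<lambda>x. f 0 + integral {0..x} g)"
    by (intro continuous_intros indefinite_integral_continuous_1 absint_int ac_on_integrable[OF assms])
  then show ?thesis
    by (rule continuous_on_eq) (metis assms atLeastAtMost_iff ac_on_eq)
qed

lemma ac_on_const: "ac_on b (\<lambda>x. c) (\<lambda>x. 0)"
  by (auto simp: ac_on_def)

lemma ac_on_add:
  assumes "ac_on b f f'" "ac_on b g g'"
  shows "ac_on b (\<lambda>x. f x + g x) (\<lambda>x. f' x + g' x)"
proof (rule ac_onI)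
  show "(\<lambda>x. f' x + g' x) absint_on {0..b}"
    using assms by (intro set_integral_add) (auto dest: ac_on_integrable)
  fix x assume "0 \<le> x" "x \<le> b"
  moreover have "f' integrable_on {0..x}" "g' integrable_on {0..x}"
    using ac_on_int_sub[OF assms(1) order_refl \<open>x \<le> b\<close>] ac_on_int_sub[OF assms(2) order_refl \<open>x \<le> b\<close>] by auto
  ultimately show "f x + g x = f 0 + g 0 + integral {0..x} (\<lambda>x. f' x + g' x)"
    using ac_on_eq[OF assms(1), of x] ac_on_eq[OF assms(2), of x]
    by (simp only: HK_integral_add) (simp only: ac_simps)
qed

lemma ac_on_cmult:
  fixes c :: "'a::{euclidean_space,real_normed_field}"
  assumes "ac_on b f f'"
  shows "ac_on b (\<lambda>x. c * f x) (\<lambda>x. c * f' x)"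
proof (rule ac_onI)
  show "(\<lambda>x. c * f' x) absint_on {0..b}"
    using absolutely_integrable_linear[OF ac_on_integrable[OF assms] bounded_linear_mult_right[of c]]
    by (simp add: o_def)
  fix x assume "0 \<le> x" "x \<le> b"
  then show "c * f x = c * f 0 + integral {0..x} (\<lambda>x. c * f' x)"
    using ac_on_eq[OF assms, of x] by (simp only: integral_mult_right distrib_left)
qed

lemma ac_on_uminus:
  fixes f :: "real \<Rightarrow> 'a::{euclidean_space,real_normed_field}"
  assumes "ac_on b f f'" shows "ac_on b (\<lambda>x. - f x) (\<lambda>x. - f' x)"
  using ac_on_cmult[OF assms, of "-1"] by simp

lemma ac_on_diff:
  fixes f :: "real \<Rightarrow> 'a::{euclidean_space,real_normed_field}"
  assumes "ac_on b f f'" "ac_on b g g'"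
  shows "ac_on b (\<lambda>x. f x - g x) (\<lambda>x. f' x - g' x)"
  using ac_on_add[OF assms(1) ac_on_uminus[OF assms(2)]] by simp

lemma ac_on_sum:
  assumes "\<And>i. i \<in> I \<Longrightarrow> ac_on b (f i) (g i)"
  shows "ac_on b (\<lambda>x. \<Sum>i\<in>I. f i x) (\<lambda>x. \<Sum>i\<in>I. g i x)"
proof (cases "finite I")
  case True
  then show ?thesis using assms
    by (induction) (auto intro: ac_on_const ac_on_add)
qed (auto intro: ac_on_const)

lemma ac_on_spike:
  assumes "ac_on b f g" "negligible S" "\<And>x. x \<in> {0..b} - S \<Longrightarrow> h x = g x"
  shows "ac_on b f h"
proof (rule ac_onI)
  show "h absint_on {0..b}"
    using absolutely_integrable_spike[OF ac_on_integrable[OF assms(1)] assms(2,3)] .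
  fix x assume "0 \<le> x" "x \<le> b"
  moreover have "integral {0..x} h = integral {0..x} g"
    by (rule integral_spike[OF assms(2)]) (use assms(3) calculation in force)
  ultimately show "f x = f 0 + integral {0..x} h" using ac_on_eq[OF assms(1), of x] by simp
qed

lemma ac_on_AE:
  assumes "ac_on b f g" "AE x in lebesgue. x \<in> {0..b} \<longrightarrow> h x = g x"
  shows "ac_on b f h"
proof -
  obtain S where "negligible S" "{x. \<not> (x \<in> {0..b} \<longrightarrow> h x = g x)} \<subseteq> S"
    using assms(2) unfolding eventually_ae_filter_negligible by blast
  then show ?thesis by (intro ac_on_spike[OF assms(1), of S]) auto
qed

lemma ac_on_cong:
  assumes "ac_on b f g" "\<And>x. x \<in> {0..b} \<Longrightarrow> f2 x = f x" "\<And>x. x \<in> {0..b} \<Longrightarrow> g2 x = g x" 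
  shows "ac_on b f2 g2"
proof (cases "b \<ge> 0")
  case True
  have "ac_on b f g2" by (rule ac_on_spike[OF assms(1), of "{}"]) (use assms in auto)
  show ?thesis
  proof (rule ac_onI)
    show "g2 absint_on {0..b}" by (rule ac_on_integrable) fact
    fix x assume "0 \<le> x" "x \<le> b"
    then show "f2 x = f2 0 + integral {0..x} g2"
      using ac_on_eq[OF \<open>ac_on b f g2\<close>, of x] assms(2)[of x] assms(2)[of 0] by simp
  qed
qed (auto simp: ac_on_def)

lemma absint_continuous_mult:
  fixes f g :: "real \<Rightarrow> 'a::{euclidean_space,real_normed_field}"
  assumes "continuous_on {a..b} f" "g absint_on {a..b}"
  shows "(\<lambda>x. f x * g x) absint_on {a..b}"
proof (rule absolutely_integrable_bounded_measurable_product[of "\<lambda>x y. x * y"])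
  show "bilinear (\<lambda>x y::'a. x * y)"
    unfolding bilinear_def by (auto intro!: linearI simp: algebra_simps)
  show "f \<in> borel_measurable (lebesgue_on {a..b})"
    by (rule continuous_imp_measurable_on_sets_lebesgue[OF assms(1)]) auto
  show "bounded (f ` {a..b})"
    by (intro compact_imp_bounded compact_continuous_image assms compact_Icc)
qed (use assms in auto)

lemma absint_continuous_mult':
  fixes f g :: "real \<Rightarrow> 'a::{euclidean_space,real_normed_field}"
  assumes "continuous_on {a..b} f" "g absint_on {a..b}"
  shows "(\<lambda>x. g x * f x) absint_on {a..b}"
  using absint_continuous_mult[OF assms] by (simp add: mult.commute)

text \<open>Over \<open>[s,t]\<close> the increment of \<open>f * g\<close> differs from the integral of the claimed density by a quantity that is
  quadratic in the integral of \<open>norm f' + norm g'\<close>.\<close>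

lemma ac_on_mult:
  fixes f g :: "real \<Rightarrow> 'a::{euclidean_space,real_normed_field}"
  assumes f: "ac_on b f f'" and g: "ac_on b g g'"
  shows "ac_on b (\<lambda>x. f x * g x) (\<lambda>x. f' x * g x + f x * g' x)"
proof (rule ac_onI)
  note fi = ac_on_integrable[OF f] and gi = ac_on_integrable[OF g]
  have cf: "continuous_on {0..b} f" and cg: "continuous_on {0..b} g"
    using f g by (auto intro: ac_on_continuous)
  show I: "(\<lambda>x. f' x * g x + f x * g' x) absint_on {0..b}"
    by (intro set_integral_add absint_continuous_mult absint_continuous_mult' cf cg fi gi)
  define k where "k = (\<lambda>x. norm (f' x) + norm (g' x))"
  have kabs: "k absint_on {0..b}"
    unfolding k_def by (intro set_integral_add absolutely_integrable_norm[unfolded o_def] fi gi)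
  define V where "V = (\<lambda>x. integral {0..x} k)"
  define P where "P = (\<lambda>t. f t * g t - integral {0..t} (\<lambda>x. f' x * g x + f x * g' x))"
  fix x assume x: "0 \<le> x" "x \<le> b"
  have "P x = P 0"
  proof (rule constant_if_quadratic_increments[of 0 x V P 1])
    show "continuous_on {0..x} V" unfolding V_def
      by (intro indefinite_integral_continuous_1 absint_int absint_sub[OF kabs]) (use x in auto)
    have "0 \<le> integral {0..x} k"
      by (rule integral_nonneg, rule absint_int[OF absint_sub[OF kabs]]) (use x in \<open>auto simp: k_def\<close>)
    then show "V 0 \<le> V x" by (simp add: V_def)
    fix s t assume st: "0 \<le> s" "s \<le> t" "t \<le> x"
    have kst: "k integrable_on {s..t}"
      by (rule absint_int[OF absint_sub[OF kabs]]) (use st x in auto)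
    have VV: "V t - V s = integral {s..t} k"
      using ac_on_diff_eq[OF ac_on_indefinite[OF kabs, of 0], of s t] st x by (simp add: V_def)
    have sm: "integral {p..q} k \<le> V t - V s" if "s \<le> p" "q \<le> t" for p q
      unfolding VV by (rule integral_nonneg_mono[OF kst]) (use that in \<open>auto simp: k_def\<close>)
    have fd: "norm (f q - f p) \<le> V t - V s" "norm (g q - g p) \<le> V t - V s"
      if "s \<le> p" "p \<le> q" "q \<le> t" for p q
    proof -
      have kpq: "k integrable_on {p..q}"
        by (rule absint_int[OF absint_sub[OF kabs]]) (use st x that in auto)
      have "norm (f q - f p) \<le> integral {p..q} (\<lambda>x. norm (f' x))"
        by (rule ac_on_norm_diff[OF f]) (use that st x in auto)
      also have "... \<le> integral {p..q} k"
        by (rule integral_le) (use that st x kpq in \<open>auto simp: k_def intro!: absint_norm_int absint_sub[OF fi]\<close>)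
      finally show "norm (f q - f p) \<le> V t - V s" using sm[of p q] that by simp
      have "norm (g q - g p) \<le> integral {p..q} (\<lambda>x. norm (g' x))"
        by (rule ac_on_norm_diff[OF g]) (use that st x in auto)
      also have "... \<le> integral {p..q} k"
        by (rule integral_le) (use that st x kpq in \<open>auto simp: k_def intro!: absint_norm_int absint_sub[OF gi]\<close>)
      finally show "norm (g q - g p) \<le> V t - V s" using sm[of p q] that by simp
    qed
    have i1: "f' integrable_on {s..t}" "g' integrable_on {s..t}"
      by (rule absint_int[OF absint_sub[OF fi]] absint_int[OF absint_sub[OF gi]]; use st x in auto)+
    have i2: "(\<lambda>x. f' x * g x + f x * g' x) integrable_on {s..t}"
      by (rule absint_int[OF absint_sub[OF I]]) (use st x in auto)
    note ia = integrable_on_mult_left[OF i1(1), of "g t"] and ib = integrable_on_mult_right[OF i1(2), of "f s"]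
    have "P t - P s = (f t - f s) * g t + f s * (g t - g s) - integral {s..t} (\<lambda>x. f' x * g x + f x * g' x)"
      using ac_on_diff_eq[OF ac_on_indefinite[OF I, of 0], of s t] st x
      by (simp add: P_def algebra_simps)
    also have "(f t - f s) * g t = integral {s..t} (\<lambda>u. f' u * g t)"
      using ac_on_diff_eq[OF f, of s t] st x by simp
    also have "f s * (g t - g s) = integral {s..t} (\<lambda>u. f s * g' u)"
      using ac_on_diff_eq[OF g, of s t] st x by simp
    also have "integral {s..t} (\<lambda>u. f' u * g t) + integral {s..t} (\<lambda>u. f s * g' u) - integral {s..t} (\<lambda>x. f' x * g x + f x * g' x)
       = integral {s..t} (\<lambda>u. f' u * g t + f s * g' u - (f' u * g u + f u * g' u))"
      by (simp only: HK_integral_diff[OF integrable_add[OF ia ib] i2] HK_integral_add[OF ia ib])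
    also have "norm ... \<le> integral {s..t} (\<lambda>u. (V t - V s) * k u)"
    proof (rule integral_norm_bound_integral)
      show "(\<lambda>u. f' u * g t + f s * g' u - (f' u * g u + f u * g' u)) integrable_on {s..t}"
        by (rule integrable_diff[OF integrable_add[OF ia ib] i2])
      show "(\<lambda>u. (V t - V s) * k u) integrable_on {s..t}" using kst by (rule integrable_on_mult_right)
      fix u assume u: "u \<in> {s..t}"
      have "f' u * g t + f s * g' u - (f' u * g u + f u * g' u) = f' u * (g t - g u) - (f u - f s) * g' u"
        by (simp add: algebra_simps)
      also have "norm ... \<le> norm (f' u) * norm (g t - g u) + norm (f u - f s) * norm (g' u)"
        by (metis norm_mult norm_triangle_ineq4)
      also have "... \<le> norm (f' u) * (V t - V s) + (V t - V s) * norm (g' u)"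
        using u by (intro add_mono mult_left_mono mult_right_mono fd) auto
      finally show "norm (f' u * g t + f s * g' u - (f' u * g u + f u * g' u)) \<le> (V t - V s) * k u"
        by (simp add: k_def algebra_simps)
    qed
    also have "... = (V t - V s)\<^sup>2" by (simp add: VV power2_eq_square)
    finally show "norm (P t - P s) \<le> 1 * (V t - V s)\<^sup>2" by simp
  qed (use x in auto)
  then show "f x * g x = f 0 * g 0 + integral {0..x} (\<lambda>x. f' x * g x + f x * g' x)"
    by (simp add: P_def algebra_simps)
qed

lemma ac_on_power:
  fixes f :: "real \<Rightarrow> 'a::{euclidean_space,real_normed_field}"
  assumes f: "ac_on b f f'"
  shows "ac_on b (\<lambda>x. f x ^ n) (\<lambda>x. of_nat n * f' x * f x ^ (n - 1))"
proof (induction n)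
  case 0
  show ?case by (simp add: ac_on_const)
next
  case (Suc n)
  show ?case
    by (rule ac_on_cong[OF ac_on_mult[OF f Suc.IH]])
      (cases n; simp add: algebra_simps)+
qed

lemma norm_exp_diff_le:
  fixes z w :: complex
  assumes "norm z \<le> M" "norm w \<le> M"
  shows "norm (exp z - exp w) \<le> exp M * norm (z - w)"
proof (rule field_differentiable_bound[of "cball 0 M" exp exp])
  show "norm (exp u) \<le> exp M" if "u \<in> cball 0 M" for u :: complex
    using that norm_exp[of u] by (auto intro: order_trans)
  show "(exp has_field_derivative exp u) (at u within cball 0 M)" for u :: complex
    using DERIV_exp by (rule DERIV_subset) auto
qed (use assms in auto)

lemma norm_exp_taylor2_le:
  fixes z w :: complex
  assumes "norm z \<le> M" "norm w \<le> M"
  shows "norm (exp z - exp w - exp w * (z - w)) \<le> exp M * (norm (z - w))\<^sup>2"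
proof -
  have "norm ((\<lambda>_. exp) 0 z - (\<Sum>i\<le>1. (\<lambda>_. exp) i w * (z-w) ^ i / (fact i))) \<le> exp M * norm (z - w)^(Suc 1) / fact 1"
  proof (rule complex_Taylor[of "cball 0 M"])
    show "norm (exp u) \<le> exp M" if "u \<in> cball 0 M" for u :: complex
      using that norm_exp[of u] by (auto intro: order_trans)
    show "(exp has_field_derivative exp u) (at u within cball 0 M)" for u :: complex
      using DERIV_exp by (rule DERIV_subset) auto
  qed (use assms in auto)
  then show ?thesis by (simp add: diff_diff_eq power2_eq_square)
qed

lemma ac_on_exp:
  fixes f :: cfun
  assumes f: "ac_on b f f'"
  shows "ac_on b (\<lambda>x. exp (f x)) (\<lambda>x. f' x * exp (f x))"
proof (rule ac_onI)
  note fi = ac_on_integrable[OF f]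
  have cf: "continuous_on {0..b} f" using f by (rule ac_on_continuous)
  show I: "(\<lambda>x. f' x * exp (f x)) absint_on {0..b}"
    by (intro absint_continuous_mult' continuous_intros cf fi)
  obtain M where M: "\<And>x. x \<in> {0..b} \<Longrightarrow> norm (f x) \<le> M"
    using compact_imp_bounded[OF compact_continuous_image[OF cf compact_Icc]] unfolding bounded_iff by blast
  define k where "k = (\<lambda>x. norm (f' x))"
  have kabs: "k absint_on {0..b}"
    unfolding k_def by (intro absolutely_integrable_norm[unfolded o_def] fi)
  define V where "V = (\<lambda>x. integral {0..x} k)"
  define P where "P = (\<lambda>t. exp (f t) - integral {0..t} (\<lambda>x. f' x * exp (f x)))"
  fix x assume x: "0 \<le> x" "x \<le> b"
  have "P x = P 0"
  proof (rule constant_if_quadratic_increments[of 0 x V P "2 * exp M"])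
    show "continuous_on {0..x} V" unfolding V_def
      by (intro indefinite_integral_continuous_1 absint_int absint_sub[OF kabs]) (use x in auto)
    have "0 \<le> integral {0..x} k"
      by (rule integral_nonneg, rule absint_int[OF absint_sub[OF kabs]]) (use x in \<open>auto simp: k_def\<close>)
    then show "V 0 \<le> V x" by (simp add: V_def)
    fix s t assume st: "0 \<le> s" "s \<le> t" "t \<le> x"
    have kst: "k integrable_on {s..t}"
      by (rule absint_int[OF absint_sub[OF kabs]]) (use st x in auto)
    have VV: "V t - V s = integral {s..t} k"
      using ac_on_diff_eq[OF ac_on_indefinite[OF kabs, of 0], of s t] st x by (simp add: V_def)
    have fd: "norm (f q - f s) \<le> V t - V s" if "s \<le> q" "q \<le> t" for q
    proof -
      have "norm (f q - f s) \<le> integral {s..q} k"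
        unfolding k_def by (rule ac_on_norm_diff[OF f]) (use that st x in auto)
      also have "... \<le> integral {s..t} k"
        by (rule integral_nonneg_mono[OF kst]) (use that in \<open>auto simp: k_def\<close>)
      finally show ?thesis by (simp add: VV)
    qed
    have i1: "f' integrable_on {s..t}"
      by (rule absint_int[OF absint_sub[OF fi]]; use st x in auto)
    have i2: "(\<lambda>x. f' x * exp (f x)) integrable_on {s..t}"
      by (rule absint_int[OF absint_sub[OF I]]) (use st x in auto)
    note ia = integrable_on_mult_left[OF i1(1), of "exp (f s)"]
    have "P t - P s = (exp (f t) - exp (f s) - exp (f s) * (f t - f s))
        - (integral {s..t} (\<lambda>x. f' x * exp (f x)) - (f t - f s) * exp (f s))"
      using ac_on_diff_eq[OF ac_on_indefinite[OF I, of 0], of s t] st x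
      by (simp add: P_def algebra_simps)
    also have "(f t - f s) * exp (f s) = integral {s..t} (\<lambda>u. f' u * exp (f s))"
      using ac_on_diff_eq[OF f, of s t] st x by simp
    also have "integral {s..t} (\<lambda>x. f' x * exp (f x)) - ... = integral {s..t} (\<lambda>u. f' u * exp (f u) - f' u * exp (f s))"
      by (simp only: HK_integral_diff[OF i2 ia])
    also have "norm ((exp (f t) - exp (f s) - exp (f s) * (f t - f s)) - ...)
       \<le> exp M * (V t - V s)\<^sup>2 + (exp M * (V t - V s)) * integral {s..t} k"
    proof (rule order_trans[OF norm_triangle_ineq4], rule add_mono)
      have "norm (exp (f t) - exp (f s) - exp (f s) * (f t - f s)) \<le> exp M * (norm (f t - f s))\<^sup>2"
        by (rule norm_exp_taylor2_le) (use M st x in auto)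
      also have "... \<le> exp M * (V t - V s)\<^sup>2"
        using fd[of t] st by (intro mult_left_mono power_mono) auto
      finally show "norm (exp (f t) - exp (f s) - exp (f s) * (f t - f s)) \<le> exp M * (V t - V s)\<^sup>2" .
      have "norm (integral {s..t} (\<lambda>u. f' u * exp (f u) - f' u * exp (f s))) \<le> integral {s..t} (\<lambda>u. (exp M * (V t - V s)) * k u)"
      proof (rule integral_norm_bound_integral)
        fix u assume u: "u \<in> {s..t}"
        have "f' u * exp (f u) - f' u * exp (f s) = f' u * (exp (f u) - exp (f s))" by (simp add: algebra_simps)
        also have "norm ... \<le> k u * (exp M * norm (f u - f s))"
          unfolding norm_mult k_def
          by (intro mult_left_mono norm_exp_diff_le) (use M st x u in auto)
        also have "... \<le> k u * (exp M * (V t - V s))"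
          using u fd[of u] by (intro mult_left_mono) (auto simp: k_def)
        finally show "norm (f' u * exp (f u) - f' u * exp (f s)) \<le> (exp M * (V t - V s)) * k u"
          by (simp add: ac_simps)
      qed (use i2 ia kst in \<open>auto intro: integrable_diff integrable_on_mult_right\<close>)
      then show "norm (integral {s..t} (\<lambda>u. f' u * exp (f u) - f' u * exp (f s))) \<le> (exp M * (V t - V s)) * integral {s..t} k"
        by simp
    qed
    also have "... = 2 * exp M * (V t - V s)\<^sup>2" by (simp add: VV power2_eq_square)
    finally show "norm (P t - P s) \<le> 2 * exp M * (V t - V s)\<^sup>2" .
  qed (use x in auto)
  then show "exp (f x) = exp (f 0) + integral {0..x} (\<lambda>x. f' x * exp (f x))"
    by (simp add: P_def algebra_simps)
qed

lemma ac_on_bounded_linear: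
  fixes f :: "real \<Rightarrow> 'a::euclidean_space" and h :: "'a \<Rightarrow> 'b::euclidean_space"
  assumes "bounded_linear h" "ac_on b f f'"
  shows "ac_on b (\<lambda>x. h (f x)) (\<lambda>x. h (f' x))"
proof (rule ac_onI)
  show "(\<lambda>x. h (f' x)) absint_on {0..b}"
    using absolutely_integrable_linear[OF ac_on_integrable[OF assms(2)] assms(1)] by (simp add: o_def)
  fix x assume x: "0 \<le> x" "x \<le> b"
  have "h (f x) = h (f 0) + h (integral {0..x} f')"
    unfolding ac_on_eq[OF assms(2) x] by (rule linear_add[OF bounded_linear.linear[OF assms(1)]])
  also have "h (integral {0..x} f') = integral {0..x} (\<lambda>x. h (f' x))"
    using integral_linear[OF ac_on_int_sub[OF assms(2) order_refl x(2)] assms(1)] by (simp add: o_def)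
  finally show "h (f x) = h (f 0) + integral {0..x} (\<lambda>x. h (f' x))" .
qed

lemma ac_on_exp_real:
  fixes f :: "real \<Rightarrow> real"
  assumes f: "ac_on b f f'"
  shows "ac_on b (\<lambda>x. exp (f x)) (\<lambda>x. f' x * exp (f x))"
  using ac_on_bounded_linear[OF bounded_linear_Re ac_on_exp[OF ac_on_bounded_linear[OF bounded_linear_of_real f]]]
  by (simp add: Re_exp)

lemma gronwall:
  fixes u k :: "real \<Rightarrow> real"
  assumes k: "k absint_on {0..b}" and k0: "\<And>x. x \<in> {0..b} \<Longrightarrow> 0 \<le> k x"
    and u: "continuous_on {0..b} u"
    and le: "\<And>x. x \<in> {0..b} \<Longrightarrow> u x \<le> a + integral {0..x} (\<lambda>t. k t * u t)"
    and x: "x \<in> {0..b}"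
  shows "u x \<le> a * exp (integral {0..x} k)"
proof -
  have ku: "(\<lambda>t. k t * u t) absint_on {0..b}"
    by (rule absint_continuous_mult'[OF u k])
  define Y where "Y = (\<lambda>x. a + integral {0..x} (\<lambda>t. k t * u t))"
  define K where "K = (\<lambda>x. integral {0..x} k)"
  have Y: "ac_on b Y (\<lambda>t. k t * u t)" unfolding Y_def by (rule ac_on_indefinite[OF ku])
  have K: "ac_on b K k" unfolding K_def using ac_on_indefinite[OF k, of 0] by simp
  have "ac_on b (\<lambda>x. exp (- K x)) (\<lambda>x. - k x * exp (- K x))"
    by (rule ac_on_exp_real[OF ac_on_uminus[OF K]])
  note P = ac_on_mult[OF Y this]
  have "Y x * exp (- K x) = Y 0 * exp (- K 0) + integral {0..x} (\<lambda>x. k x * u x * exp (- K x) + Y x * (- k x * exp (- K x)))"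
    by (rule ac_on_eq[OF P]) (use x in auto)
  also have "integral {0..x} (\<lambda>x. k x * u x * exp (- K x) + Y x * (- k x * exp (- K x))) \<le> integral {0..x} (\<lambda>x. 0)"
  proof (rule integral_le)
    show "(\<lambda>x. k x * u x * exp (- K x) + Y x * (- k x * exp (- K x))) integrable_on {0..x}"
      by (rule ac_on_int_sub[OF P]) (use x in auto)
    fix t assume t: "t \<in> {0..x}"
    have "k t * exp (- K t) * (u t - Y t) \<le> 0"
      by (rule mult_nonneg_nonpos) (use k0[of t] le[of t] t x in \<open>auto simp: Y_def\<close>)
    then show "k t * u t * exp (- K t) + Y t * (- k t * exp (- K t)) \<le> 0" by (simp add: algebra_simps)
  qed auto
  also have "Y 0 * exp (- K 0) + integral {0..x} (\<lambda>x. 0) = a" by (simp add: Y_def K_def)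
  finally have "Y x * exp (- K x) \<le> a" by simp
  then have "Y x \<le> a * exp (K x)" by (simp add: exp_minus field_simps)
  with le[OF x] show ?thesis by (simp add: Y_def K_def)
qed

section \<open>Linear systems with integrable coefficients\<close>

lemma continuous_on_Icc_bounded:
  fixes f :: "real \<Rightarrow> 'a::real_normed_vector"
  assumes "continuous_on {a..b} f" shows "\<exists>C. \<forall>x\<in>{a..b}. norm (f x) \<le> C"
  using compact_imp_bounded[OF compact_continuous_image[OF assms compact_Icc]]
  by (auto simp: bounded_iff)

text \<open>Solutions of \<open>u' = a u + b v + p\<close>, \<open>v' = c u + d v + q\<close> in the sense of Caratheodory.\<close>

definition linsys ::
  "real \<Rightarrow> cfun \<Rightarrow> cfun \<Rightarrow> cfun \<Rightarrow> cfun \<Rightarrow>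
   cfun \<Rightarrow> cfun \<Rightarrow> cfun \<Rightarrow> cfun \<Rightarrow> bool" where
  "linsys X a b c d p q u v \<longleftrightarrow>
     ac_on X u (\<lambda>t. a t * u t + b t * v t + p t) \<and> ac_on X v (\<lambda>t. c t * u t + d t * v t + q t)"

definition coeffs_int :: "real \<Rightarrow> cfun \<Rightarrow> cfun \<Rightarrow> cfun \<Rightarrow> cfun \<Rightarrow> bool"
  where "coeffs_int X a b c d \<longleftrightarrow> a absint_on {0..X} \<and> b absint_on {0..X} \<and>
     c absint_on {0..X} \<and> d absint_on {0..X}"

definition coeffs_norm :: "cfun \<Rightarrow> cfun \<Rightarrow> cfun \<Rightarrow> cfun \<Rightarrow> real \<Rightarrow> real"
  where "coeffs_norm a b c d t = norm (a t) + norm (b t) + norm (c t) + norm (d t)"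

lemma coeffs_norm_absint:
  assumes "coeffs_int X a b c d"
  shows "coeffs_norm a b c d absint_on {0..X}"
proof -
  have "(\<lambda>t. norm (a t) + norm (b t) + norm (c t) + norm (d t)) absint_on {0..X}"
    using assms unfolding coeffs_int_def
    by (intro set_integral_add absolutely_integrable_norm[unfolded o_def]) auto
  then show ?thesis by (simp add: coeffs_norm_def[abs_def])
qed

lemma coeffs_norm_nonneg: "coeffs_norm a b c d t \<ge> 0"
  by (simp add: coeffs_norm_def)

lemma linsys_rhs_le:
  "norm (a t * u + b t * v) + norm (c t * u + d t * v) \<le> coeffs_norm a b c d t * (norm u + norm v)"
proof -
  have "norm (a t * u + b t * v) \<le> norm (a t) * norm u + norm (b t) * norm v"
    by (metis norm_mult norm_triangle_ineq)
  moreover have "norm (c t * u + d t * v) \<le> norm (c t) * norm u + norm (d t) * norm v"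
    by (metis norm_mult norm_triangle_ineq)
  moreover have "0 \<le> norm (a t) * norm v" "0 \<le> norm (b t) * norm u" "0 \<le> norm (c t) * norm v" "0 \<le> norm (d t) * norm u"
    by auto
  ultimately show ?thesis unfolding coeffs_norm_def distrib_left distrib_right by linarith
qed

lemma linsys_bound:
  assumes sys: "linsys X a b c d p q u v" and co: "coeffs_int X a b c d"
    and p: "p absint_on {0..X}" and q: "q absint_on {0..X}"
    and x: "x \<in> {0..X}"
  shows "norm (u x) + norm (v x) \<le>
     (norm (u 0) + norm (v 0) + integral {0..X} (\<lambda>t. norm (p t) + norm (q t)))
       * exp (integral {0..X} (coeffs_norm a b c d))"
proof -
  let ?k = "coeffs_norm a b c d"
  let ?E = "integral {0..X} (\<lambda>t. norm (p t) + norm (q t))"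
  note k = coeffs_norm_absint[OF co]
  have u: "ac_on X u (\<lambda>t. a t * u t + b t * v t + p t)" and v: "ac_on X v (\<lambda>t. c t * u t + d t * v t + q t)"
    using sys by (auto simp: linsys_def)
  have cuv: "continuous_on {0..X} (\<lambda>x. norm (u x) + norm (v x))"
    by (intro continuous_intros ac_on_continuous[OF u] ac_on_continuous[OF v])
  have kuv: "(\<lambda>t. ?k t * (norm (u t) + norm (v t))) absint_on {0..X}"
    by (rule absint_continuous_mult'[OF cuv k])
  have pq: "(\<lambda>t. norm (p t) + norm (q t)) absint_on {0..X}"
    by (intro set_integral_add absolutely_integrable_norm[unfolded o_def] p q)
  have "norm (u x) + norm (v x) \<le> (norm (u 0) + norm (v 0) + ?E) * exp (integral {0..x} ?k)"
  proof (rule gronwall[where b=X])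
    fix x assume x: "x \<in> {0..X}"
    have I1: "(\<lambda>t. norm (a t * u t + b t * v t + p t)) integrable_on {0..x}"
      by (rule absint_norm_int[OF absint_sub[OF ac_on_integrable[OF u]]]) (use x in auto)
    have I2: "(\<lambda>t. norm (c t * u t + d t * v t + q t)) integrable_on {0..x}"
      by (rule absint_norm_int[OF absint_sub[OF ac_on_integrable[OF v]]]) (use x in auto)
    have I3: "(\<lambda>t. ?k t * (norm (u t) + norm (v t))) integrable_on {0..x}"
      by (rule absint_int[OF absint_sub[OF kuv]]) (use x in auto)
    have I4: "(\<lambda>t. norm (p t) + norm (q t)) integrable_on {0..x}"
      by (rule absint_int[OF absint_sub[OF pq]]) (use x in auto)
    have "norm (u x) + norm (v x) \<le> norm (u 0) + norm (v 0) + (norm (u x - u 0) + norm (v x - v 0))"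
      using norm_triangle_ineq2[of "u x" "u 0"] norm_triangle_ineq2[of "v x" "v 0"] by linarith
    also have "norm (u x - u 0) + norm (v x - v 0) \<le>
        integral {0..x} (\<lambda>t. norm (a t * u t + b t * v t + p t)) + integral {0..x} (\<lambda>t. norm (c t * u t + d t * v t + q t))"
      by (intro add_mono ac_on_norm_diff[OF u] ac_on_norm_diff[OF v]) (use x in auto)
    also have "... = integral {0..x} (\<lambda>t. norm (a t * u t + b t * v t + p t) + norm (c t * u t + d t * v t + q t))"
      by (rule HK_integral_add[OF I1 I2, symmetric])
    also have "... \<le> integral {0..x} (\<lambda>t. ?k t * (norm (u t) + norm (v t)) + (norm (p t) + norm (q t)))"
    proof (rule integral_le[OF integrable_add[OF I1 I2] integrable_add[OF I3 I4]])
      fix t assume "t \<in> {0..x}"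
      show "norm (a t * u t + b t * v t + p t) + norm (c t * u t + d t * v t + q t)
        \<le> ?k t * (norm (u t) + norm (v t)) + (norm (p t) + norm (q t))"
        using linsys_rhs_le[of a t "u t" b "v t" c d] norm_triangle_ineq[of "a t * u t + b t * v t" "p t"]
          norm_triangle_ineq[of "c t * u t + d t * v t" "q t"] by linarith
    qed
    also have "... = integral {0..x} (\<lambda>t. ?k t * (norm (u t) + norm (v t))) + integral {0..x} (\<lambda>t. norm (p t) + norm (q t))"
      by (rule HK_integral_add[OF I3 I4])
    also have "integral {0..x} (\<lambda>t. norm (p t) + norm (q t)) \<le> ?E"
      by (rule integral_nonneg_mono) (use x absint_int[OF pq] in auto)
    finally show "norm (u x) + norm (v x) \<le> norm (u 0) + norm (v 0) + ?E + integral {0..x} (\<lambda>t. ?k t * (norm (u t) + norm (v t)))"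
      by linarith
  qed (use cuv k x coeffs_norm_nonneg in auto)
  also have "... \<le> (norm (u 0) + norm (v 0) + ?E) * exp (integral {0..X} ?k)"
  proof (intro mult_left_mono add_nonneg_nonneg)
    show "exp (integral {0..x} ?k) \<le> exp (integral {0..X} ?k)"
      using x by (simp add: integral_nonneg_mono[OF absint_int[OF k]] coeffs_norm_nonneg)
    show "0 \<le> ?E" by (rule integral_nonneg[OF absint_int[OF pq]]) auto
  qed auto
  finally show ?thesis .
qed

lemma linsys_diff:
  assumes "linsys X a b c d p q u v" "linsys X a b c d p' q' u' v'"
  shows "linsys X a b c d (\<lambda>t. p t - p' t) (\<lambda>t. q t - q' t) (\<lambda>t. u t - u' t) (\<lambda>t. v t - v' t)"
  using assms unfolding linsys_def
  by (elim conjE, intro conjI) (erule (1) ac_on_cong[OF ac_on_diff]; simp add: algebra_simps)+ 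

lemma linsys_add:
  assumes "linsys X a b c d p q u v" "linsys X a b c d p' q' u' v'"
  shows "linsys X a b c d (\<lambda>t. p t + p' t) (\<lambda>t. q t + q' t) (\<lambda>t. u t + u' t) (\<lambda>t. v t + v' t)"
  using assms unfolding linsys_def
  by (elim conjE, intro conjI) (erule (1) ac_on_cong[OF ac_on_add]; simp add: algebra_simps)+

lemma linsys_scale:
  assumes "linsys X a b c d p q u v"
  shows "linsys X a b c d (\<lambda>t. z * p t) (\<lambda>t. z * q t) (\<lambda>t. z * u t) (\<lambda>t. z * v t)"
  using assms unfolding linsys_def
  by (elim conjE, intro conjI) (erule ac_on_cong[OF ac_on_cmult]; simp add: algebra_simps)+

lemma linsys_unique:
  assumes "linsys X a b c d p q u v" "linsys X a b c d p q u' v'" "coeffs_int X a b c d"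
    and "u 0 = u' 0" "v 0 = v' 0" "x \<in> {0..X}"
  shows "u x = u' x \<and> v x = v' x"
proof -
  have "norm (u x - u' x) + norm (v x - v' x) \<le> 0"
    using linsys_bound[OF linsys_diff[OF assms(1,2)] assms(3) _ _ assms(6)] assms(4,5) by simp
  then have "norm (u x - u' x) = 0" "norm (v x - v' x) = 0"
    using norm_ge_zero[of "u x - u' x"] norm_ge_zero[of "v x - v' x"] by linarith+
  then show ?thesis by simp
qed

text \<open>Picard iteration: the \<open>n\<close>-th increment is bounded by \<open>C * K x ^ n / fact n\<close>, where \<open>K\<close> is the indefinite integral
  of the size of the coefficients. Hence the series of the increments converges and can be integrated term by term, on all
  intervals \<open>{0..X}\<close> at once.\<close>

lemma linsys_exists:
  assumes co: "\<And>X. coeffs_int X a b c d"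
    and p: "\<And>X. p absint_on {0..X}" and q: "\<And>X. q absint_on {0..X}"
  shows "\<exists>u v. u 0 = u0 \<and> v 0 = v0 \<and> (\<forall>X. linsys X a b c d p q u v)"
proof -
  let ?k = "coeffs_norm a b c d"
  note k = coeffs_norm_absint[OF co]
  have sg: "(\<Sum>n::nat. if n = 0 then z else 0) = z" for z :: complex
    using sums_unique[OF sums_single[of 0 "\<lambda>_. z"]] by simp
  define K where "K = (\<lambda>x. integral {0..x} ?k)"
  have K: "ac_on X K ?k" for X unfolding K_def using ac_on_indefinite[OF k, where c=0] by simp
  have K0: "K x \<ge> 0" for x unfolding K_def
    by (rule integral_nonneg[OF absint_int[OF k]]) (rule coeffs_norm_nonneg)
  have Kmono: "K x \<le> K y" if "x \<le> y" for x y unfolding K_def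
    by (rule integral_nonneg_mono[OF absint_int[OF k]]) (use that coeffs_norm_nonneg in auto)
  define W :: "nat \<Rightarrow> real \<Rightarrow> complex \<times> complex" where
    "W = rec_nat (\<lambda>x. (u0 + integral {0..x} p, v0 + integral {0..x} q))
      (\<lambda>n w x. (integral {0..x} (\<lambda>t. a t * fst (w t) + b t * snd (w t)),
               integral {0..x} (\<lambda>t. c t * fst (w t) + d t * snd (w t))))"
  define U V where "U n x = fst (W n x)" and "V n x = snd (W n x)" for n x
  have U0: "U 0 = (\<lambda>x. u0 + integral {0..x} p)" and V0: "V 0 = (\<lambda>x. v0 + integral {0..x} q)"
    by (auto simp: U_def V_def W_def)
  have US: "U (Suc n) = (\<lambda>x. integral {0..x} (\<lambda>t. a t * U n t + b t * V n t))"
    and VS: "V (Suc n) = (\<lambda>x. integral {0..x} (\<lambda>t. c t * U n t + d t * V n t))" for n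
    by (auto simp: U_def V_def W_def)
  have cont: "continuous_on {0..X} (U n) \<and> continuous_on {0..X} (V n)" for n X
  proof (induction n)
    case 0
    show ?case unfolding U0 V0
      by (intro conjI continuous_intros indefinite_integral_continuous_1 absint_int p q)
  next
    case (Suc n)
    show ?case unfolding US VS
      using Suc co[of X] unfolding coeffs_int_def
      by (intro conjI continuous_intros indefinite_integral_continuous_1 absint_int set_integral_add absint_continuous_mult') auto
  qed
  have aiU: "(\<lambda>t. a t * U n t + b t * V n t) absint_on {0..X}"
    and aiV: "(\<lambda>t. c t * U n t + d t * V n t) absint_on {0..X}" for n X
    using cont[of X n] co[of X] unfolding coeffs_int_def
    by (intro set_integral_add absint_continuous_mult'; simp)+
  have bnd: "\<exists>C\<ge>0. \<forall>n. \<forall>x\<in>{0..X}. norm (U n x) + norm (V n x) \<le> C * K x ^ n / fact n" if X: "X \<ge> 0" for X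
  proof -
    have "continuous_on {0..X} (\<lambda>x. norm (U 0 x) + norm (V 0 x))"
      using cont[of X 0] by (intro continuous_intros) auto
    then obtain C where C: "\<And>x. x \<in> {0..X} \<Longrightarrow> norm (norm (U 0 x) + norm (V 0 x)) \<le> C"
      using continuous_on_Icc_bounded by blast
    have C0: "C \<ge> 0" by (rule order_trans[OF norm_ge_zero C[of 0]]) (use X in auto)
    have "norm (U n x) + norm (V n x) \<le> C * K x ^ n / fact n" if "x \<in> {0..X}" for n x
      using that
    proof (induction n arbitrary: x)
      case 0
      then show ?case using C[of x] by simp
    next
      case (Suc n)
      have P: "ac_on x (\<lambda>x. C / fact (Suc n) * K x ^ Suc n) (\<lambda>x. C / fact (Suc n) * (of_nat (Suc n) * ?k x * K x ^ (Suc n - 1)))"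
        by (intro ac_on_cmult ac_on_power K)
      have I1: "(\<lambda>t. norm (a t * U n t + b t * V n t)) integrable_on {0..x}"
        by (rule absint_norm_int[OF aiU])
      have I2: "(\<lambda>t. norm (c t * U n t + d t * V n t)) integrable_on {0..x}"
        by (rule absint_norm_int[OF aiV])
      have "norm (U (Suc n) x) + norm (V (Suc n) x) \<le>
        integral {0..x} (\<lambda>t. norm (a t * U n t + b t * V n t)) + integral {0..x} (\<lambda>t. norm (c t * U n t + d t * V n t))"
        unfolding US VS by (intro add_mono norm_integral_le_absint aiU aiV)
      also have "... = integral {0..x} (\<lambda>t. norm (a t * U n t + b t * V n t) + norm (c t * U n t + d t * V n t))"
        by (rule HK_integral_add[OF I1 I2, symmetric])
      also have "... \<le> integral {0..x} (\<lambda>x. C / fact (Suc n) * (of_nat (Suc n) * ?k x * K x ^ (Suc n - 1)))"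
      proof (rule integral_le[OF integrable_add[OF I1 I2]])
        show "(\<lambda>x. C / fact (Suc n) * (of_nat (Suc n) * ?k x * K x ^ (Suc n - 1))) integrable_on {0..x}"
          by (rule absint_int[OF ac_on_integrable[OF P]])
        fix t assume t: "t \<in> {0..x}"
        have "norm (a t * U n t + b t * V n t) + norm (c t * U n t + d t * V n t) \<le> ?k t * (norm (U n t) + norm (V n t))"
          by (rule linsys_rhs_le)
        also have "... \<le> ?k t * (C * K t ^ n / fact n)"
          using Suc.IH[of t] t Suc.prems by (intro mult_left_mono coeffs_norm_nonneg) auto
        also have "... = C / fact (Suc n) * (of_nat (Suc n) * ?k t * K t ^ (Suc n - 1))"
          unfolding fact_Suc by (simp del: of_nat_Suc fact_Suc)
        finally show "norm (a t * U n t + b t * V n t) + norm (c t * U n t + d t * V n t)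
            \<le> C / fact (Suc n) * (of_nat (Suc n) * ?k t * K t ^ (Suc n - 1))" .
      qed
      also have "... = C / fact (Suc n) * K x ^ Suc n"
        using ac_on_eq[OF P, of x] Suc.prems by (simp add: K_def)
      finally show ?case by simp
    qed
    with C0 show ?thesis by blast
  qed
  define u v where "u x = (\<Sum>n. U n x)" and "v x = (\<Sum>n. V n x)" for x
  have smm: "summable (\<lambda>n. U n x) \<and> summable (\<lambda>n. V n x)" if x: "x \<ge> 0" for x
  proof -
    obtain C where C: "\<And>n. norm (U n x) + norm (V n x) \<le> C * K x ^ n / fact n"
      using bnd[OF x] x by force
    have S: "summable (\<lambda>n. C * (inverse (fact n) * K x ^ n))"
      by (intro summable_mult summable_exp)
    have le: "norm (U n x) \<le> C * (inverse (fact n) * K x ^ n)" "norm (V n x) \<le> C * (inverse (fact n) * K x ^ n)" for n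
    proof -
      have "C * (inverse (fact n) * K x ^ n) = C * K x ^ n / fact n" by (simp add: field_simps)
      then show "norm (U n x) \<le> C * (inverse (fact n) * K x ^ n)" "norm (V n x) \<le> C * (inverse (fact n) * K x ^ n)"
        using C[of n] norm_ge_zero[of "U n x"] norm_ge_zero[of "V n x"] by linarith+
    qed
    show ?thesis
      by (intro conjI summable_comparison_test[OF _ S] exI[of _ 0] allI impI le)
  qed
  have main: "linsys X a b c d p q u v" if X: "X \<ge> 0" for X
  proof -
    obtain C where C0: "C \<ge> 0" and C: "\<And>n x. x \<in> {0..X} \<Longrightarrow> norm (U n x) + norm (V n x) \<le> C * K x ^ n / fact n"
      using bnd[OF X] by blast
    have part: "(\<Sum>n<m. norm (U n x) + norm (V n x)) \<le> C * exp (K X)" if "x \<in> {0..X}" for x m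
    proof -
      have "(\<Sum>n<m. norm (U n x) + norm (V n x)) \<le> (\<Sum>n<m. C * (inverse (fact n) * K x ^ n))"
        by (intro sum_mono order_trans[OF C[OF that]]) (simp add: field_simps)
      also have "... = C * (\<Sum>n<m. inverse (fact n) * K x ^ n)" by (simp add: sum_distrib_left)
      also have "(\<Sum>n<m. inverse (fact n) * K x ^ n) \<le> exp (K x)"
        unfolding exp_def real_scaleR_def
        by (rule sum_le_suminf) (auto intro!: summable_exp mult_nonneg_nonneg zero_le_power K0)
      also have "exp (K x) \<le> exp (K X)" using Kmono that by simp
      finally show ?thesis using C0 by (simp add: mult_left_mono)
    qed
    \<comment> \<open>termwise integration of one of the two equations\<close>
    have swap: "ac_on X w (\<lambda>t. \<alpha> t * u t + \<beta> t * v t + r t)"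
      if WW0: "WW 0 = (\<lambda>x. ini + integral {0..x} r)"
        and WWS: "\<And>n. WW (Suc n) = (\<lambda>x. integral {0..x} (\<lambda>t. \<alpha> t * U n t + \<beta> t * V n t))"
        and w: "w = (\<lambda>x. \<Sum>n. WW n x)" and sW: "\<And>x. x \<ge> 0 \<Longrightarrow> summable (\<lambda>n. WW n x)"
        and \<alpha>: "\<alpha> absint_on {0..X}" and \<beta>: "\<beta> absint_on {0..X}"
        and r: "r absint_on {0..X}"
      for w WW \<alpha> \<beta> r ini
    proof -
      define S where "S m t = \<alpha> t * (\<Sum>n<m. U n t) + \<beta> t * (\<Sum>n<m. V n t)" for m t
      define h where "h t = (norm (\<alpha> t) + norm (\<beta> t)) * (C * exp (K X))" for t
      have S_ai: "S m absint_on {0..X}" for m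
        unfolding S_def using cont by (intro set_integral_add absint_continuous_mult' \<alpha> \<beta> continuous_intros) auto
      have h_ai: "h absint_on {0..X}"
        unfolding h_def
        by (intro absint_continuous_mult' continuous_intros set_integral_add absolutely_integrable_norm[unfolded o_def] \<alpha> \<beta>)
      have S_le: "norm (S m t) \<le> h t" if "t \<in> {0..X}" for m t
      proof -
        have "norm (\<Sum>n<m. U n t) \<le> (\<Sum>n<m. norm (U n t) + norm (V n t))"
          by (rule sum_norm_le) auto
        then have 1: "norm (\<Sum>n<m. U n t) \<le> C * exp (K X)" using part[OF that, of m] by linarith
        have "norm (\<Sum>n<m. V n t) \<le> (\<Sum>n<m. norm (U n t) + norm (V n t))"
          by (rule sum_norm_le) auto
        then have 2: "norm (\<Sum>n<m. V n t) \<le> C * exp (K X)" using part[OF that, of m] by linarith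
        have "norm (S m t) \<le> norm (\<alpha> t) * norm (\<Sum>n<m. U n t) + norm (\<beta> t) * norm (\<Sum>n<m. V n t)"
          unfolding S_def by (metis norm_mult norm_triangle_ineq)
        also have "... \<le> h t" unfolding h_def distrib_right
          by (intro add_mono mult_left_mono 1 2) auto
        finally show ?thesis .
      qed
      have S_lim: "(\<lambda>m. S m t) \<longlonglongrightarrow> \<alpha> t * u t + \<beta> t * v t" if "t \<in> {0..X}" for t
        unfolding S_def u_def v_def using smm[of t] that
        by (intro tendsto_intros summable_LIMSEQ) auto
      have g_ai: "(\<lambda>t. \<alpha> t * u t + \<beta> t * v t) absint_on {0..X}"
      proof (rule absolutely_integrable_integrable_bound)
        show "(\<lambda>t. \<alpha> t * u t + \<beta> t * v t) integrable_on {0..X}"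
          by (rule dominated_convergence(1)[of S _ h]) (use S_ai h_ai S_le S_lim in \<open>auto intro: absint_int\<close>)
        show "norm (\<alpha> t * u t + \<beta> t * v t) \<le> h t" if "t \<in> {0..X}" for t
          by (rule Lim_bounded[OF tendsto_norm[OF S_lim[OF that]]]) (use S_le[OF that] in auto)
      qed (rule absint_int[OF h_ai])
      show ?thesis
      proof (rule ac_onI)
        show "(\<lambda>t. \<alpha> t * u t + \<beta> t * v t + r t) absint_on {0..X}"
          by (intro set_integral_add g_ai r)
        fix x assume x: "0 \<le> x" "x \<le> X"
        have e: "(\<Sum>n<Suc m. WW n x) = ini + integral {0..x} r + integral {0..x} (S m)" for m
        proof -
          have "(\<Sum>n<Suc m. WW n x) = WW 0 x + (\<Sum>n<m. WW (Suc n) x)"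
            by (rule sum.lessThan_Suc_shift)
          also have "(\<Sum>n<m. WW (Suc n) x) = integral {0..x} (\<lambda>t. \<Sum>n<m. \<alpha> t * U n t + \<beta> t * V n t)"
            unfolding WWS
            by (rule integral_sum[symmetric])
               (use cont x in \<open>auto intro!: absint_int set_integral_add absint_continuous_mult' absint_sub[OF \<alpha>] absint_sub[OF \<beta>]\<close>)
          also have "(\<lambda>t. \<Sum>n<m. \<alpha> t * U n t + \<beta> t * V n t) = S m"
            by (auto simp: S_def sum.distrib sum_distrib_left)
          finally show ?thesis by (simp add: WW0)
        qed
        have "(\<lambda>m. integral {0..x} (S m)) \<longlonglongrightarrow> integral {0..x} (\<lambda>t. \<alpha> t * u t + \<beta> t * v t)"
          by (rule dominated_convergence(2)[of S _ h])
             (use S_ai h_ai S_le S_lim x in \<open>auto intro!: absint_int absint_sub[OF S_ai] absint_sub[OF h_ai]\<close>)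
        then have 1: "(\<lambda>m. \<Sum>n<Suc m. WW n x) \<longlonglongrightarrow> ini + integral {0..x} r + integral {0..x} (\<lambda>t. \<alpha> t * u t + \<beta> t * v t)"
          unfolding e by (intro tendsto_intros)
        have 2: "(\<lambda>m. \<Sum>n<Suc m. WW n x) \<longlonglongrightarrow> w x"
          unfolding w using LIMSEQ_Suc[OF summable_LIMSEQ[OF sW[OF x(1)]]] .
        have wx: "w x = ini + integral {0..x} r + integral {0..x} (\<lambda>t. \<alpha> t * u t + \<beta> t * v t)"
          by (rule LIMSEQ_unique[OF 2 1])
        have "WW n 0 = (if n = 0 then ini else 0)" for n
          by (cases n) (simp_all add: WW0 WWS)
        then have w00: "w 0 = ini" unfolding w by (simp add: sg)
        have "r integrable_on {0..x}" "(\<lambda>t. \<alpha> t * u t + \<beta> t * v t) integrable_on {0..x}"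
          by (rule absint_int[OF absint_sub[OF r]] absint_int[OF absint_sub[OF g_ai]]; use x in auto)+
        then show "w x = w 0 + integral {0..x} (\<lambda>t. \<alpha> t * u t + \<beta> t * v t + r t)"
          unfolding wx w00 by (simp add: HK_integral_add)
      qed
    qed
    show ?thesis unfolding linsys_def
      using co[of X] p[of X] q[of X] smm unfolding coeffs_int_def
      by (intro conjI swap[where WW=U and ini=u0] swap[where WW=V and ini=v0])
         (auto simp: U0 V0 US VS u_def v_def)
  qed
  have neg: "linsys X a b c d p q u v" if "\<not> X \<ge> 0" for X
    using that by (auto simp: linsys_def ac_on_def)
  have "U n 0 = (if n = 0 then u0 else 0)" "V n 0 = (if n = 0 then v0 else 0)" for n
    by (cases n; simp add: U0 V0 US VS)+
  then have "u 0 = u0" "v 0 = v0" unfolding u_def v_def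
    by (simp_all add: sg)
  with main neg show ?thesis by blast
qed

section \<open>Square integrable functions and Bessel's inequality\<close>

text \<open>The bound is a parameter because all constants have to be uniform on bounded sets of potentials.\<close>

definition L2b :: "cfun \<Rightarrow> real \<Rightarrow> bool" where
  "L2b f K \<longleftrightarrow> f \<in> borel_measurable (lebesgue_on {0..1}) \<and> (\<lambda>x. (norm (f x))\<^sup>2) integrable_on {0..1} \<and>
     integral {0..1} (\<lambda>x. (norm (f x))\<^sup>2) \<le> K\<^sup>2 \<and> 0 \<le> K"

lemma L2b_nonneg: "L2b f K \<Longrightarrow> 0 \<le> K" by (simp add: L2b_def)

lemma L2b_mono: "L2b f K \<Longrightarrow> K \<le> K' \<Longrightarrow> L2b f K'"
  unfolding L2b_def by (auto intro: order_trans power_mono)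

text \<open>The optimal choice of \<open>s\<close> turns this into the Cauchy--Schwarz inequality.\<close>

lemma weighted_am_gm:
  fixes s x y :: real
  assumes "s > 0" shows "x * y \<le> (s * x\<^sup>2 + y\<^sup>2 / s) / 2"
proof -
  have "0 \<le> (s * x - y)\<^sup>2 / s" using assms by simp
  also have "(s * x - y)\<^sup>2 / s = s * x\<^sup>2 - 2 * x * y + y\<^sup>2 / s"
    using assms by (simp add: power2_eq_square field_simps)
  finally show ?thesis by simp
qed

lemma L2b_mult:
  assumes f: "L2b f K" and g: "L2b g S"
  shows "(\<lambda>x. f x * g x) absint_on {0..1}"
    and "integral {0..1} (\<lambda>x. norm (f x * g x)) \<le> K * S"
proof -
  have fi: "(\<lambda>x. (norm (f x))\<^sup>2) integrable_on {0..1}" and gi: "(\<lambda>x. (norm (g x))\<^sup>2) integrable_on {0..1}"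
    using f g by (auto simp: L2b_def)
  have meas: "(\<lambda>x. f x * g x) \<in> borel_measurable (lebesgue_on {0..1})"
    using f g by (auto simp: L2b_def)
  have H: "(\<lambda>x. (s * (norm (f x))\<^sup>2 + (norm (g x))\<^sup>2 / s) / 2) integrable_on {0..1}" for s :: real
    using fi gi by (intro integrable_on_divide integrable_add integrable_on_mult_right)
  have le: "norm (f x * g x) \<le> (s * (norm (f x))\<^sup>2 + (norm (g x))\<^sup>2 / s) / 2" if "s > 0" for s x
    unfolding norm_mult by (rule weighted_am_gm[OF that])
  show ai: "(\<lambda>x. f x * g x) absint_on {0..1}"
    by (rule measurable_bounded_by_integrable_imp_absolutely_integrable[OF meas _ H[of 1]])
       (use le[of 1] in auto)
  have "integral {0..1} (\<lambda>x. norm (f x * g x)) \<le> (K + e) * (S + e)" if e: "e > 0" for e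
  proof -
    have K: "K + e > 0" and S: "S + e > 0" using L2b_nonneg[OF f] L2b_nonneg[OF g] e by auto
    define s where "s = (S + e) / (K + e)"
    have s: "s > 0" using K S by (simp add: s_def)
    have "integral {0..1} (\<lambda>x. norm (f x * g x)) \<le> integral {0..1} (\<lambda>x. (s * (norm (f x))\<^sup>2 + (norm (g x))\<^sup>2 / s) / 2)"
      by (rule integral_le[OF absint_norm_int[OF ai] H]) (use le[OF s] in auto)
    also have "... = (s * integral {0..1} (\<lambda>x. (norm (f x))\<^sup>2) + integral {0..1} (\<lambda>x. (norm (g x))\<^sup>2) / s) / 2"
      using fi gi by (simp add: HK_integral_add integrable_on_divide integrable_on_mult_right)
    also have "... \<le> (s * (K + e)\<^sup>2 + (S + e)\<^sup>2 / s) / 2"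
    proof (intro divide_right_mono add_mono mult_left_mono)
      have "K\<^sup>2 \<le> (K+e)\<^sup>2" "S\<^sup>2 \<le> (S+e)\<^sup>2"
        using L2b_nonneg[OF f] L2b_nonneg[OF g] e by (auto intro: power_mono)
      then show "integral {0..1} (\<lambda>x. (norm (f x))\<^sup>2) \<le> (K+e)\<^sup>2" "integral {0..1} (\<lambda>x. (norm (g x))\<^sup>2) \<le> (S+e)\<^sup>2"
        using f g unfolding L2b_def by auto
    qed (use s in auto)
    also have "... = (K + e) * (S + e)" using K S by (simp add: s_def power2_eq_square)
    finally show ?thesis .
  qed
  then show "integral {0..1} (\<lambda>x. norm (f x * g x)) \<le> K * S"
  proof (intro tendsto_lowerbound[of "\<lambda>e. (K + e) * (S + e)" "K * S" "at_right 0"])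
    show "((\<lambda>e. (K + e) * (S + e)) \<longlongrightarrow> K * S) (at_right 0)"
      by (auto intro!: tendsto_eq_intros)
  qed (auto simp: eventually_at_filter)
qed

lemma L2b_bdd:
  assumes "f \<in> borel_measurable (lebesgue_on {0..1})" "\<And>x. x \<in> {0..1} \<Longrightarrow> norm (f x) \<le> K"
  shows "L2b f K"
proof -
  have K0: "0 \<le> K" by (rule order_trans[OF norm_ge_zero assms(2)[of 0]]) simp
  have le: "(norm (f x))\<^sup>2 \<le> K\<^sup>2" if "x \<in> {0..1}" for x
    using assms(2)[OF that] by (intro power_mono) auto
  have int: "(\<lambda>x. (norm (f x))\<^sup>2) integrable_on {0..1}"
    by (rule measurable_bounded_by_integrable_imp_integrable_real[where g="\<lambda>x. K\<^sup>2"])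
       (use le assms(1) in \<open>auto intro: borel_measurable_power borel_measurable_norm\<close>)
  have "integral {0..1} (\<lambda>x. (norm (f x))\<^sup>2) \<le> integral {0..1} (\<lambda>x::real. K\<^sup>2)"
    by (rule integral_le[OF int]) (use le in auto)
  then show ?thesis using assms(1) int K0 by (simp add: L2b_def)
qed

lemma L2b_const: "L2b (\<lambda>x. c) (norm c)"
  by (rule L2b_bdd) auto

lemma L2b_absint:
  assumes "L2b f K"
  shows "f absint_on {0..1}" "integral {0..1} (\<lambda>x. norm (f x)) \<le> K"
  using L2b_mult[OF assms L2b_const[of 1]] by auto

lemma L2b_add:
  assumes f: "L2b f K" and g: "L2b g S"
  shows "L2b (\<lambda>x. f x + g x) (K + S)"
proof -
  have fi: "(\<lambda>x. (norm (f x))\<^sup>2) integrable_on {0..1}" and gi: "(\<lambda>x. (norm (g x))\<^sup>2) integrable_on {0..1}"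
    using f g by (auto simp: L2b_def)
  have fgi: "(\<lambda>x. norm (f x * g x)) integrable_on {0..1}"
    by (rule absint_norm_int[OF L2b_mult(1)[OF f g]])
  let ?h = "\<lambda>x. (norm (f x))\<^sup>2 + 2 * norm (f x * g x) + (norm (g x))\<^sup>2"
  have hi: "?h integrable_on {0..1}"
    using fi gi fgi by (intro integrable_add integrable_on_mult_right)
  have le: "(norm (f x + g x))\<^sup>2 \<le> ?h x" for x
  proof -
    have "(norm (f x + g x))\<^sup>2 \<le> (norm (f x) + norm (g x))\<^sup>2"
      by (intro power_mono norm_triangle_ineq) auto
    then show ?thesis by (simp add: power2_sum norm_mult)
  qed
  have meas: "(\<lambda>x. f x + g x) \<in> borel_measurable (lebesgue_on {0..1})"
    using f g by (auto simp: L2b_def)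
  have int: "(\<lambda>x. (norm (f x + g x))\<^sup>2) integrable_on {0..1}"
    by (rule measurable_bounded_by_integrable_imp_integrable_real[OF _ hi])
       (use le meas in \<open>auto intro: borel_measurable_power borel_measurable_norm\<close>)
  have "integral {0..1} (\<lambda>x. (norm (f x + g x))\<^sup>2) \<le> integral {0..1} ?h"
    by (rule integral_le[OF int hi]) (use le in auto)
  also have "... = integral {0..1} (\<lambda>x. (norm (f x))\<^sup>2) + 2 * integral {0..1} (\<lambda>x. norm (f x * g x)) + integral {0..1} (\<lambda>x. (norm (g x))\<^sup>2)"
    using fi gi fgi by (simp only: HK_integral_add integrable_add integrable_on_mult_right integral_mult_right)
  also have "... \<le> K\<^sup>2 + 2 * (K * S) + S\<^sup>2"
    using f g L2b_mult(2)[OF f g] unfolding L2b_def by linarith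
  also have "... = (K + S)\<^sup>2" by (simp add: power2_sum)
  finally show ?thesis using int meas L2b_nonneg[OF f] L2b_nonneg[OF g] by (simp add: L2b_def)
qed

lemma L2b_bdd_mult:
  assumes f: "f \<in> borel_measurable (lebesgue_on {0..1})" "\<And>x. x \<in> {0..1} \<Longrightarrow> norm (f x) \<le> K"
    and g: "L2b g S"
  shows "L2b (\<lambda>x. f x * g x) (K * S)"
proof -
  have K0: "0 \<le> K" by (rule order_trans[OF norm_ge_zero f(2)[of 0]]) simp
  have gi: "(\<lambda>x. (norm (g x))\<^sup>2) integrable_on {0..1}" using g by (simp add: L2b_def)
  have le: "(norm (f x * g x))\<^sup>2 \<le> K\<^sup>2 * (norm (g x))\<^sup>2" if "x \<in> {0..1}" for x
    unfolding norm_mult power_mult_distrib using f(2)[OF that] by (intro mult_right_mono power_mono) auto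
  have meas: "(\<lambda>x. f x * g x) \<in> borel_measurable (lebesgue_on {0..1})"
    using f g by (auto simp: L2b_def)
  have int: "(\<lambda>x. (norm (f x * g x))\<^sup>2) integrable_on {0..1}"
    by (rule measurable_bounded_by_integrable_imp_integrable_real[OF _ integrable_on_mult_right[OF gi, of "K\<^sup>2"]])
       (use le meas in \<open>auto intro: borel_measurable_power borel_measurable_norm\<close>)
  have "integral {0..1} (\<lambda>x. (norm (f x * g x))\<^sup>2) \<le> integral {0..1} (\<lambda>x. K\<^sup>2 * (norm (g x))\<^sup>2)"
    by (rule integral_le[OF int integrable_on_mult_right[OF gi]]) (use le in auto)
  also have "... \<le> (K * S)\<^sup>2"
    using g by (simp add: L2b_def power_mult_distrib mult_left_mono)
  finally show ?thesis using meas int K0 L2b_nonneg[OF g] by (simp add: L2b_def)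
qed

lemma L2b_cmult: "L2b g S \<Longrightarrow> L2b (\<lambda>x. c * g x) (norm c * S)"
  by (rule L2b_bdd_mult) auto

lemma L2b_cong_AE:
  assumes "L2b f K" "AE x in lebesgue. x \<in> {0..1} \<longrightarrow> g x = f x"
  shows "L2b g K"
proof -
  obtain S where S: "negligible S" "{x. \<not> (x \<in> {0..1} \<longrightarrow> g x = f x)} \<subseteq> S"
    using assms(2) unfolding eventually_ae_filter_negligible by blast
  have eq: "g x = f x" if "x \<in> {0..1} - S" for x using S that by auto
  have ai: "g absint_on {0..1}"
    by (rule absolutely_integrable_spike[OF L2b_absint(1)[OF assms(1)] S(1)]) (use eq in auto)
  have i: "(\<lambda>x. (norm (f x))\<^sup>2) integrable_on {0..1}" using assms(1) by (simp add: L2b_def)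
  have "(\<lambda>x. (norm (g x))\<^sup>2) integrable_on {0..1}"
    by (rule integrable_spike[OF i S(1)]) (use eq in auto)
  moreover have "integral {0..1} (\<lambda>x. (norm (g x))\<^sup>2) = integral {0..1} (\<lambda>x. (norm (f x))\<^sup>2)"
    by (rule integral_spike[OF S(1)]) (use eq in auto)
  ultimately show ?thesis
    using assms(1) absolutely_integrable_imp_borel_measurable[OF ai] by (simp add: L2b_def)
qed

lemma integral_exp_2pi:
  "integral {0..1} (\<lambda>s. exp (2 * of_real pi * \<i> * of_int k * of_real s)) = (if k = 0 then 1 else 0 :: complex)"
proof (cases "k = 0")
  case False
  let ?c = "2 * of_real pi * \<i> * of_int k :: complex"
  have c: "?c \<noteq> 0" using False by simp
  have "((\<lambda>s. exp (?c * of_real s)) has_integral (exp (?c * of_real 1) / ?c - exp (?c * of_real 0) / ?c)) {0..1}"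
  proof (rule fundamental_theorem_of_calculus)
    fix x :: real
    have "((\<lambda>z. exp (?c * z) / ?c) has_field_derivative exp (?c * of_real x)) (at (of_real x))"
      using c by (auto intro!: derivative_eq_intros)
    then show "((\<lambda>s. exp (?c * of_real s) / ?c) has_vector_derivative exp (?c * of_real x)) (at x within {0..1})"
      using has_vector_derivative_real_field has_vector_derivative_at_within by fastforce
  qed auto
  moreover have "exp ?c = 1"
    using exp_integer_2pi[of "of_int k"] by (simp add: mult_ac)
  ultimately show ?thesis using False by (simp add: integral_unique)
qed simp

text \<open>The Fourier integrals met below are indefinite ones; for fixed \<open>t\<close> they are the Fourier coefficients of the
  function cut off at \<open>t\<close>.\<close>

lemma bessel:
  fixes f :: cfun
  assumes f: "L2b f K" and t: "t \<in> {0..1}" and S: "finite S"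
  shows "(\<Sum>n\<in>S. (norm (integral {0..t} (\<lambda>s. f s * exp (2 * of_real pi * \<i> * of_int n * of_real s))))\<^sup>2) \<le> K\<^sup>2"
proof -
  define e where "e n s = exp (2 * of_real pi * \<i> * of_int n * of_real s)" for n :: int and s :: real
  define c where "c n = integral {0..t} (\<lambda>s. f s * e n s)" for n
  define T where "T = (\<Sum>n\<in>S. (norm (c n))\<^sup>2)"
  define P where "P s = (\<Sum>n\<in>S. cnj (c n) * e n s)" for s
  have T0: "T \<ge> 0" by (auto simp: T_def intro: sum_nonneg)
  have ec: "continuous_on A (e n)" for A n unfolding e_def by (intro continuous_intros)
  have Pc: "continuous_on A P" for A unfolding P_def by (intro continuous_intros ec)
  have ee: "e n s * cnj (e m s) = exp (2 * of_real pi * \<i> * of_int (n - m) * of_real s)" for n m s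
    by (simp add: e_def exp_cnj exp_add[symmetric] algebra_simps)
  have PP: "P s * cnj (P s) = (\<Sum>n\<in>S. \<Sum>m\<in>S. (cnj (c n) * c m) * exp (2 * of_real pi * \<i> * of_int (n - m) * of_real s))" for s
    unfolding P_def ee[symmetric]
    by (simp only: cnj_sum complex_cnj_mult complex_cnj_cnj sum_product) (simp only: mult_ac)
  have "of_real (integral {0..1} (\<lambda>s. (norm (P s))\<^sup>2)) = integral {0..1} (\<lambda>s. P s * cnj (P s))"
  proof -
    have "(\<lambda>s. (norm (P s))\<^sup>2) integrable_on {0..1}"
      by (intro integrable_continuous_real continuous_intros Pc)
    from integral_linear[OF this bounded_linear_of_real[where 'a=complex]]
    show ?thesis by (simp only: o_def complex_norm_square)
  qed
  also have "... = (\<Sum>n\<in>S. \<Sum>m\<in>S. (cnj (c n) * c m) * integral {0..1} (\<lambda>s. exp (2 * of_real pi * \<i> * of_int (n - m) * of_real s)))"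
    unfolding PP
    by (subst integral_sum[OF S], intro integrable_continuous_real continuous_intros,
        intro sum.cong refl, subst integral_sum[OF S], intro integrable_continuous_real continuous_intros,
        intro sum.cong refl integral_mult_right)
  also have "... = (\<Sum>n\<in>S. cnj (c n) * c n)"
    unfolding integral_exp_2pi using S by (intro sum.cong refl) (simp add: if_distrib cong: if_cong)
  also have "... = of_real T"
    by (simp only: T_def of_real_sum complex_norm_square mult.commute)
  finally have PT: "integral {0..1} (\<lambda>s. (norm (P s))\<^sup>2) = T" by (simp only: of_real_eq_iff)
  have LP: "L2b P (sqrt T)"
    unfolding L2b_def using PT T0
    by (auto intro!: integrable_continuous_real continuous_intros Pc continuous_imp_measurable_on_sets_lebesgue)
  have fe: "(\<lambda>s. f s * e n s) absint_on {0..1}" for n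
    by (rule absint_continuous_mult'[OF ec L2b_absint(1)[OF f]])
  have fe': "(\<lambda>s. f s * e n s) integrable_on {0..t}" for n
    by (rule absint_int[OF absint_sub[OF fe]]) (use t in auto)
  have fP: "(\<lambda>s. f s * P s) absint_on {0..1}" by (rule L2b_mult(1)[OF f LP])
  have fPt: "(\<lambda>s. f s * P s) absint_on {0..t}"
    by (rule absint_sub[OF fP]) (use t in auto)
  have "of_real T = (\<Sum>n\<in>S. cnj (c n) * c n)"
    by (simp only: T_def of_real_sum complex_norm_square mult.commute)
  also have "... = integral {0..t} (\<lambda>s. \<Sum>n\<in>S. cnj (c n) * (f s * e n s))"
    by (subst integral_sum[OF S]) (auto intro: integrable_on_mult_right fe' simp: c_def)
  also have "... = integral {0..t} (\<lambda>s. f s * P s)"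
    by (simp add: P_def sum_distrib_left mult_ac)
  finally have "T = norm (integral {0..t} (\<lambda>s. f s * P s))"
    using T0 by (metis abs_of_nonneg norm_of_real)
  also have "... \<le> integral {0..t} (\<lambda>s. norm (f s * P s))" by (rule norm_integral_le_absint[OF fPt])
  also have "... \<le> integral {0..1} (\<lambda>s. norm (f s * P s))"
    by (rule integral_nonneg_mono[OF absint_norm_int[OF fP]]) (use t in auto)
  also have "... \<le> K * sqrt T" by (rule L2b_mult(2)[OF f LP])
  finally have *: "sqrt T * sqrt T \<le> K * sqrt T" using T0 by simp
  have "sqrt T \<le> K"
  proof (cases "T = 0")
    case False
    then show ?thesis using mult_right_le_imp_le[OF *] T0 by simp
  qed (use L2b_nonneg[OF f] in simp)
  then have "(sqrt T)\<^sup>2 \<le> K\<^sup>2" using T0 by (intro power_mono) auto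
  then show ?thesis using T0 by (simp add: T_def c_def e_def)
qed

section \<open>Weak derivatives of periodic functions\<close>

lemma ac_on_C1:
  fixes f :: "real \<Rightarrow> 'a::euclidean_space"
  assumes "\<And>x. x \<in> {0..b} \<Longrightarrow> (f has_vector_derivative f' x) (at x)" "continuous_on {0..b} f'"
  shows "ac_on b f f'"
proof (rule ac_onI)
  show "f' absint_on {0..b}"
    by (rule absolutely_integrable_continuous_real[OF assms(2)])
  fix x assume x: "0 \<le> x" "x \<le> b"
  have "(f' has_integral f x - f 0) {0..x}"
  proof (rule fundamental_theorem_of_calculus)
    fix y assume "y \<in> {0..x}"
    then show "(f has_vector_derivative f' y) (at y within {0..x})"
      using assms(1)[of y] x by (auto intro: has_vector_derivative_at_within)
  qed (use x in auto)
  then show "f x = f 0 + integral {0..x} f'" by (simp add: integral_unique)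
qed

text \<open>Integration by parts against polynomials and Weierstrass' theorem give \<open>integral (g w) = 0\<close> for
  continuous \<open>w\<close>. Now let \<open>w\<close> tend to the conjugate of \<open>sgn g\<close> almost everywhere.\<close>

lemma AE_zero_if_indefinite_integral_zero:
  fixes g :: cfun
  assumes g: "g absint_on {0..T}" and T: "T \<ge> 0"
    and zero: "\<And>x. x \<in> {0..T} \<Longrightarrow> integral {0..x} g = 0"
  shows "AE x in lebesgue. x \<in> {0..T} \<longrightarrow> g x = 0"
proof -
  have ac: "ac_on T (\<lambda>x. 0) g" by (rule ac_onI[OF g]) (use zero in auto)
  have poly: "integral {0..T} (\<lambda>x. g x * p x) = 0" if p: "polynomial_function p" for p :: cfun
  proof -
    obtain p' where p': "polynomial_function p'" "\<And>x. (p has_vector_derivative (p' x)) (at x)"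
      using has_vector_derivative_polynomial_function[OF p] by blast
    have "ac_on T p p'"
      by (rule ac_on_C1) (use p' continuous_on_polymonial_function in auto)
    from ac_on_eq[OF ac_on_mult[OF ac this], of T] T show ?thesis by simp
  qed
  have cont: "integral {0..T} (\<lambda>x. g x * w x) = 0" if w: "continuous_on {0..T} w" for w :: cfun
  proof -
    let ?G = "integral {0..T} (\<lambda>x. norm (g x))"
    have gw: "(\<lambda>x. g x * w x) absint_on {0..T}"
      by (rule absint_continuous_mult'[OF w g])
    have "norm (integral {0..T} (\<lambda>x. g x * w x)) \<le> e * ?G" if e: "e > 0" for e
    proof -
      obtain p where p: "polynomial_function p" "\<And>x. x \<in> {0..T} \<Longrightarrow> norm (w x - p x) < e"
        using Stone_Weierstrass_polynomial_function[OF compact_Icc w e] by blast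
      have gp: "(\<lambda>x. g x * p x) absint_on {0..T}"
        by (rule absint_continuous_mult'[OF continuous_on_polymonial_function[OF p(1)] g])
      have "integral {0..T} (\<lambda>x. g x * w x) = integral {0..T} (\<lambda>x. g x * w x - g x * p x)"
        using poly[OF p(1)] by (simp add: HK_integral_diff[OF absint_int[OF gw] absint_int[OF gp]])
      also have "norm ... \<le> integral {0..T} (\<lambda>x. e * norm (g x))"
      proof (rule integral_norm_bound_integral)
        show "(\<lambda>x. g x * w x - g x * p x) integrable_on {0..T}"
          by (rule integrable_diff[OF absint_int[OF gw] absint_int[OF gp]])
        show "(\<lambda>x. e * norm (g x)) integrable_on {0..T}"
          by (rule integrable_on_mult_right[OF absint_norm_int[OF g]])
        fix x assume "x \<in> {0..T}"
        then have "norm (g x * (w x - p x)) \<le> norm (g x) * e"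
          unfolding norm_mult using p(2) by (intro mult_left_mono) (auto intro: less_imp_le)
        then show "norm (g x * w x - g x * p x) \<le> e * norm (g x)" by (simp add: algebra_simps)
      qed
      finally show ?thesis by simp
    qed
    then have "norm (integral {0..T} (\<lambda>x. g x * w x)) \<le> 0"
      by (intro tendsto_lowerbound[of "\<lambda>e. e * ?G" 0 "at_right 0"])
         (auto intro!: tendsto_eq_intros simp: eventually_at_filter)
    then show ?thesis by simp
  qed
  have "g \<in> borel_measurable (lebesgue_on {0..T})"
    using absolutely_integrable_imp_borel_measurable[OF g] by auto
  then have "(\<lambda>x. sgn (g x)) \<in> borel_measurable (lebesgue_on {0..T})"
    unfolding sgn_div_norm by measurable
  then have "(\<lambda>x. sgn (g x)) measurable_on {0..T}"
    by (subst measurable_on_iff_borel_measurable) auto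
  then obtain N h where N: "negligible N" and h: "\<And>n. continuous_on UNIV (h n)"
    and lim: "\<And>x. x \<notin> N \<Longrightarrow> (\<lambda>n. h n x) \<longlonglongrightarrow> (if x \<in> {0..T} then sgn (g x) else 0)"
    unfolding measurable_on_def by blast
  define w where "w n x = cnj (h n x) / of_real (max 1 (norm (h n x)))" for n x
  have wc: "continuous_on {0..T} (w n)" for n
    unfolding w_def by (intro continuous_intros continuous_on_subset[OF h]) auto
  have w1: "norm (w n x) \<le> 1" for n x
    unfolding w_def norm_divide by simp
  have wlim: "(\<lambda>n. w n x) \<longlonglongrightarrow> cnj (sgn (g x))" if x: "x \<in> {0..T}" "x \<notin> N" for x
  proof -
    have *: "(\<lambda>n. h n x) \<longlonglongrightarrow> sgn (g x)" using lim[OF x(2)] x(1) by simp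
    have "(\<lambda>n. w n x) \<longlonglongrightarrow> cnj (sgn (g x)) / of_real (max 1 (norm (sgn (g x))))"
      unfolding w_def by (intro tendsto_intros *) auto
    then show ?thesis by (simp add: norm_sgn)
  qed
  define F where "F n x = (if x \<in> N then 0 else g x * w n x)" for n x
  have Fint: "F n integrable_on {0..T}" and F0: "integral {0..T} (F n) = 0" for n
  proof -
    have gw: "(\<lambda>x. g x * w n x) integrable_on {0..T}"
      by (rule absint_int[OF absint_continuous_mult'[OF wc g]])
    show "F n integrable_on {0..T}"
      by (rule integrable_spike[OF gw N]) (simp add: F_def)
    have "integral {0..T} (F n) = integral {0..T} (\<lambda>x. g x * w n x)"
      by (rule integral_spike[OF N]) (simp add: F_def)
    then show "integral {0..T} (F n) = 0" using cont[OF wc] by simp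
  qed
  have "(\<lambda>n. integral {0..T} (F n)) \<longlonglongrightarrow> integral {0..T} (\<lambda>x. if x \<in> N then 0 else of_real (norm (g x)))"
  proof (rule dominated_convergence(2)[OF Fint absint_norm_int[OF g]])
    fix n x assume "x \<in> {0..T}"
    show "norm (F n x) \<le> norm (g x)"
      using w1[of n x] by (auto simp: F_def norm_mult mult_left_le)
  next
    fix x assume x: "x \<in> {0..T}"
    show "(\<lambda>n. F n x) \<longlonglongrightarrow> (if x \<in> N then 0 else of_real (norm (g x)))"
    proof (cases "x \<in> N")
      case False
      have "(\<lambda>n. g x * w n x) \<longlonglongrightarrow> g x * cnj (sgn (g x))"
        using wlim[OF x False] by (intro tendsto_intros)
      moreover have "g x * cnj (sgn (g x)) = of_real (norm (g x))"
        using complex_norm_square[of "g x"]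
        by (cases "g x = 0") (auto simp: sgn_div_norm scaleR_conv_of_real field_simps power2_eq_square)
      ultimately show ?thesis using False by (simp add: F_def)
    qed (simp add: F_def)
  qed
  then have "integral {0..T} (\<lambda>x. if x \<in> N then 0 else complex_of_real (norm (g x))) = 0"
    by (simp add: F0 LIMSEQ_const_iff)
  moreover have "integral {0..T} (\<lambda>x. if x \<in> N then 0 else complex_of_real (norm (g x))) = integral {0..T} (\<lambda>x. complex_of_real (norm (g x)))"
    by (rule integral_spike[OF N]) simp
  moreover have "integral {0..T} (\<lambda>x. complex_of_real (norm (g x))) = of_real (integral {0..T} (\<lambda>x. norm (g x)))"
    using integral_linear[OF absint_norm_int[OF g] bounded_linear_of_real[where 'a=complex]] by (simp add: o_def)
  ultimately have I0: "integral {0..T} (\<lambda>x. norm (g x)) = 0" by simp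
  have ng: "(\<lambda>x. norm (g x)) absint_on {0..T}"
    using absolutely_integrable_norm[OF g] by (simp add: o_def)
  have "(LINT x:{0..T}|lebesgue. norm (g x)) = 0"
    using set_lebesgue_integral_eq_integral(2)[OF ng] I0 by simp
  then have "AE x in lebesgue. indicat_real {0..T} x *\<^sub>R norm (g x) = 0"
    unfolding set_lebesgue_integral_def
    by (subst (asm) integral_nonneg_eq_0_iff_AE) (use ng in \<open>auto simp: set_integrable_def\<close>)
  then show ?thesis by eventually_elim (auto simp: indicator_def)
qed

lemma absint_shift:
  fixes f :: "real \<Rightarrow> 'a::euclidean_space"
  assumes "f absint_on {a..b}"
  shows "(\<lambda>x. f (x + c)) absint_on {a-c..b-c}"
  using assms integrable_shift_real_ivl[of f a b c] integrable_shift_real_ivl[of "\<lambda>x. norm (f x)" a b c]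
  by (simp add: absolutely_integrable_on_def)

lemma periodic_nat:
  fixes f :: "real \<Rightarrow> 'a"
  assumes "\<And>x. f (x + T) = f x" shows "f (x + of_nat n * T) = f x"
proof (induction n)
  case (Suc n)
  have "f (x + of_nat (Suc n) * T) = f ((x + of_nat n * T) + T)" by (simp add: algebra_simps)
  then show ?case using assms Suc by simp
qed simp

lemma periodic_int:
  fixes f :: "real \<Rightarrow> 'a"
  assumes "\<And>x. f (x + T) = f x" shows "f (x + of_int k * T) = f x"
proof (cases "k \<ge> 0")
  case True
  then show ?thesis using periodic_nat[of f T x "nat k", OF assms] by simp
next
  case False
  then show ?thesis using periodic_nat[of f T "x + of_int k * T" "nat (- k)", OF assms] by (simp add: algebra_simps)
qed

lemma periodic_absint:
  fixes f :: "real \<Rightarrow> 'a::euclidean_space"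
  assumes T: "T > 0" and per: "\<And>x. f (x + T) = f x" and f: "f absint_on {0..T}"
  shows "f absint_on {0..X}"
proof -
  have "f absint_on {0..of_nat n * T}" for n
  proof (induction n)
    case 0
    have "f absint_on {0..0}" by (rule absolutely_integrable_on_subinterval[OF f]) (use T in auto)
    then show ?case by simp
  next
    case (Suc n)
    have "(\<lambda>x. f (x + of_int (- int n) * T)) absint_on {0 + of_nat n * T..T + of_nat n * T}"
      using absint_shift[OF f, of "- of_nat n * T"] by simp
    then have "f absint_on {of_nat n * T..T + of_nat n * T}"
      using periodic_int[of f T _ "- int n", OF per] by simp
    with Suc have "f absint_on {0..T + of_nat n * T}"
      by (rule absolutely_integrable_on_combine) (use T in auto)
    then show ?case by (simp add: algebra_simps)
  qed
  moreover obtain n :: nat where "X / T \<le> of_nat n" using real_arch_simple by blast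
  then have "X \<le> of_nat n * T" using T by (simp add: field_simps)
  ultimately show ?thesis using absint_sub[of "of_nat n * T" f 0 X] by auto
qed

lemma exists_periodic_extension:
  fixes E :: cfun
  assumes T: "T > 0" and E: "continuous_on {0..T} E" and eq: "E 0 = E T"
  shows "\<exists>e. (\<forall>x. e (x + T) = e x) \<and> continuous_on UNIV e \<and> (\<forall>x\<in>{0..T}. e x = E x)"
proof -
  define e where "e x = E (x - of_int \<lfloor>x / T\<rfloor> * T)" for x
  have per: "e (x + T) = e x" for x
    using T by (simp add: e_def add_divide_distrib algebra_simps)
  have eE: "e x = E (x - of_int k * T)" if x: "x \<in> {of_int k * T..of_int (k+1) * T}" for x k
  proof (cases "x = of_int (k+1) * T")
    case True
    then have "\<lfloor>x / T\<rfloor> = k + 1" using T by simp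
    then show ?thesis using True eq by (simp add: e_def algebra_simps)
  next
    case False
    then have "of_int k \<le> x / T" "x / T < of_int k + 1"
      using x T by (auto simp: field_simps)
    then have "\<lfloor>x / T\<rfloor> = k" by (simp add: floor_eq_iff)
    then show ?thesis by (simp add: e_def)
  qed
  have c1: "continuous_on {of_int k * T..of_int (k+1) * T} e" for k
  proof -
    have "continuous_on {of_int k * T..of_int (k+1) * T} (\<lambda>x. E (x - of_int k * T))"
      by (rule continuous_on_compose2[OF E]) (auto intro!: continuous_intros simp: algebra_simps)
    then show ?thesis by (rule continuous_on_eq) (use eE in auto)
  qed
  have "isCont e x" for x
  proof -
    define k where "k = \<lfloor>x / T\<rfloor>"
    have k: "of_int k * T \<le> x" "x < of_int (k+1) * T"
      using T unfolding k_def by (auto simp: pos_le_divide_eq[symmetric] pos_divide_less_eq[symmetric])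
    have "{of_int (k-1) * T..of_int (k+1) * T} = {of_int (k-1) * T..of_int k * T} \<union> {of_int k * T..of_int (k+1) * T}"
      using T by (auto simp: algebra_simps)
    moreover have "continuous_on ... e"
      using c1[of "k-1"] c1[of k] by (intro continuous_on_closed_Un) auto
    ultimately have "continuous_on {of_int (k-1) * T..of_int (k+1) * T} e" by simp
    moreover have "of_int (k-1) * T < x" using k T by (simp add: algebra_simps)
    ultimately show ?thesis using k by (intro continuous_on_interior[of _ e x]) auto
  qed
  then have "continuous_on UNIV e" by (simp add: continuous_on_eq_continuous_at)
  moreover have "e x = E x" if "x \<in> {0..T}" for x using eE[of x 0] that by simp
  ultimately show ?thesis using per by blast
qed

lemma exists_periodic_antiderivative:
  fixes e :: cfun
  assumes T: "T > 0" and per: "\<And>x. e (x + T) = e x" and c: "continuous_on UNIV e" and z: "integral {0..T} e = 0"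
  shows "\<exists>\<psi>. (\<forall>x. \<psi> (x + T) = \<psi> x) \<and> (\<forall>x. (\<psi> has_vector_derivative e x) (at x))"
proof -
  define \<psi> where "\<psi> u = (LBINT y=0..u. e y)" for u :: real
  have d: "(\<psi> has_vector_derivative e x) (at x)" for x
  proof -
    have "(\<psi> has_vector_derivative e x) (at x within {- \<bar>x\<bar> - 1..\<bar>x\<bar> + 1})"
      unfolding \<psi>_def zero_ereal_def
      by (rule interval_integral_FTC2) (auto intro: continuous_on_subset[OF c])
    then show ?thesis by (subst (asm) at_within_Icc_at) auto
  qed
  have d': "((\<lambda>x. \<psi> (x + T) - \<psi> x) has_derivative (\<lambda>h. 0)) (at x within UNIV)" for x
  proof -
    have "((\<lambda>x. \<psi> (x + T)) has_vector_derivative e (x + T)) (at x)"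
    proof -
      have "((\<lambda>x. x + T) has_vector_derivative 1) (at x)"
        by (auto intro!: derivative_eq_intros simp: has_real_derivative_iff_has_vector_derivative[symmetric])
      from vector_diff_chain_at[OF this d[of "x + T"]] show ?thesis by (simp add: o_def)
    qed
    from has_vector_derivative_diff[OF this d[of x]] show ?thesis
      by (simp add: per has_vector_derivative_def)
  qed
  have "\<psi> (x + T) - \<psi> x = \<psi> (0 + T) - \<psi> 0" for x
    by (rule has_derivative_zero_unique[OF convex_UNIV d']) auto
  moreover have "\<psi> T - \<psi> 0 = 0"
  proof -
    have "ac_on T \<psi> e" by (rule ac_on_C1) (use d continuous_on_subset[OF c] in auto)
    from ac_on_eq[OF this, of T] z T show ?thesis by simp
  qed
  ultimately show ?thesis using d by (intro exI[of _ \<psi>]) simp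
qed

lemma has_weak_deriv_integral:
  assumes T: "T > 0" and f: "f absint_on {0..T}" and g: "g absint_on {0..T}"
  shows "has_weak_deriv T f g \<longleftrightarrow> (\<forall>\<psi> \<psi>'. (\<forall>x. \<psi> (x + T) = \<psi> x) \<and> (\<forall>x. (\<psi> has_vector_derivative \<psi>' x) (at x)) \<and>
        continuous_on UNIV \<psi>' \<longrightarrow> integral {0..T} (\<lambda>x. f x * \<psi>' x) = - integral {0..T} (\<lambda>x. g x * \<psi> x))"
proof -
  have "(LINT x:{0..T}|lebesgue. f x * \<psi>' x) = integral {0..T} (\<lambda>x. f x * \<psi>' x)"
    "(LINT x:{0..T}|lebesgue. g x * \<psi> x) = integral {0..T} (\<lambda>x. g x * \<psi> x)"
    if "\<And>x. (\<psi> has_vector_derivative \<psi>' x) (at x)" "continuous_on UNIV \<psi>'" for \<psi> \<psi>'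
  proof -
    have "continuous_on {0..T} \<psi>"
      by (rule continuous_on_vector_derivative) (use that has_vector_derivative_at_within in blast)
    moreover have "continuous_on {0..T} \<psi>'" by (rule continuous_on_subset[OF that(2)]) auto
    ultimately show "(LINT x:{0..T}|lebesgue. f x * \<psi>' x) = integral {0..T} (\<lambda>x. f x * \<psi>' x)"
      "(LINT x:{0..T}|lebesgue. g x * \<psi> x) = integral {0..T} (\<lambda>x. g x * \<psi> x)"
      by (auto intro!: set_lebesgue_integral_eq_integral(2) absint_continuous_mult' f g)
  qed
  then show ?thesis unfolding has_weak_deriv_def by (metis (no_types, lifting))
qed

lemma weak_deriv_of_ac:
  assumes T: "T > 0" and ac: "ac_on T f g" and eq: "f 0 = f T"
  shows "has_weak_deriv T f g"
proof -
  have f: "f absint_on {0..T}"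
    by (rule absolutely_integrable_continuous_real[OF ac_on_continuous[OF ac]])
  show ?thesis unfolding has_weak_deriv_integral[OF T f ac_on_integrable[OF ac]]
  proof (intro allI impI, elim conjE)
    fix \<psi> \<psi>' :: cfun
    assume per: "\<forall>x. \<psi> (x + T) = \<psi> x" and d: "\<forall>x. (\<psi> has_vector_derivative \<psi>' x) (at x)" and c: "continuous_on UNIV \<psi>'"
    have psi: "ac_on T \<psi> \<psi>'" by (rule ac_on_C1) (use d continuous_on_subset[OF c] in auto)
    have i1: "(\<lambda>x. g x * \<psi> x) integrable_on {0..T}"
      by (rule absint_int[OF absint_continuous_mult'[OF ac_on_continuous[OF psi] ac_on_integrable[OF ac]]])
    have i2: "(\<lambda>x. f x * \<psi>' x) integrable_on {0..T}"
      by (rule absint_int[OF absint_continuous_mult[OF ac_on_continuous[OF ac] ac_on_integrable[OF psi]]])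
    have "\<psi> T = \<psi> 0" using per[rule_format, of 0] by simp
    then have "integral {0..T} (\<lambda>x. g x * \<psi> x + f x * \<psi>' x) = 0"
      using ac_on_eq[OF ac_on_mult[OF ac psi], of T] T eq by simp
    then show "integral {0..T} (\<lambda>x. f x * \<psi>' x) = - integral {0..T} (\<lambda>x. g x * \<psi> x)"
      by (simp add: HK_integral_add[OF i1 i2] add_eq_0_iff)
  qed
qed

text \<open>Subtract from \<open>f\<close> the indefinite integral of \<open>g\<close> and a constant, so that the difference \<open>d\<close> has mean zero, and let
  \<open>E\<close> be its indefinite integral, normalised to mean zero. Integrating the conjugate of \<open>E\<close> twice gives a periodic test function,
  for which the hypothesis says that the integral of the square of \<open>norm E\<close> vanishes.\<close>

lemma du_bois_reymond:
  assumes T: "T > 0" and f: "f absint_on {0..T}" and g: "g absint_on {0..T}"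
    and w: "has_weak_deriv T f g"
  shows "integral {0..T} g = 0" "\<exists>c. AE x in lebesgue. x \<in> {0..T} \<longrightarrow> f x = c + integral {0..x} g"
proof -
  note W = w[unfolded has_weak_deriv_integral[OF T f g], rule_format]
  show g0: "integral {0..T} g = 0"
    using W[of "\<lambda>_. 1" "\<lambda>_. 0"] by simp
  define G where "G x = integral {0..x} g" for x
  have G: "ac_on T G g" unfolding G_def using ac_on_indefinite[OF g, where c=0] by simp
  have Gi: "G absint_on {0..T}"
    by (rule absolutely_integrable_continuous_real[OF ac_on_continuous[OF G]])
  have GT: "G T = 0" "G 0 = 0" using g0 by (auto simp: G_def)
  define h where "h x = f x - G x" for x
  have hi: "h absint_on {0..T}" unfolding h_def by (intro set_integral_diff f Gi)
  define c where "c = integral {0..T} h / of_real T"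
  define d where "d x = h x - c" for x
  have di: "d absint_on {0..T}" unfolding d_def by (intro set_integral_diff hi) auto
  have d0: "integral {0..T} d = 0"
    unfolding d_def using T
    by (subst HK_integral_diff) (auto simp: absint_int[OF hi] c_def scaleR_conv_of_real)
  define D where "D x = integral {0..x} d" for x
  have D: "ac_on T D d" unfolding D_def using ac_on_indefinite[OF di, where c=0] by simp
  have DT: "D T = 0" "D 0 = 0" using d0 by (auto simp: D_def)
  note Dc = ac_on_continuous[OF D]
  define m where "m = integral {0..T} D / of_real T"
  define E where "E x = D x - m" for x
  have Ec: "continuous_on {0..T} E" unfolding E_def by (intro continuous_intros Dc)
  have E0: "integral {0..T} E = 0"
    unfolding E_def using T
    by (subst HK_integral_diff) (auto simp: integrable_continuous_real[OF Dc] m_def scaleR_conv_of_real)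
  have cEc: "continuous_on {0..T} (\<lambda>x. cnj (E x))" by (intro continuous_intros Ec)
  have cE0: "integral {0..T} (\<lambda>x. cnj (E x)) = 0"
    using integral_linear[OF integrable_continuous_real[OF Ec] bounded_linear_cnj] E0 by (simp add: o_def)
  define xi where "xi x = integral {0..x} (\<lambda>x. cnj (E x))" for x
  have xi: "ac_on T xi (\<lambda>x. cnj (E x))"
    unfolding xi_def using ac_on_indefinite[OF absolutely_integrable_continuous_real[OF cEc], where c=0] by simp
  have xiT: "xi T = 0" "xi 0 = 0" using cE0 by (auto simp: xi_def)
  note xic = ac_on_continuous[OF xi]
  define m2 where "m2 = integral {0..T} xi / of_real T"
  have "\<exists>e. (\<forall>x. e (x + T) = e x) \<and> continuous_on UNIV e \<and> (\<forall>x\<in>{0..T}. e x = xi x - m2)"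
    by (rule exists_periodic_extension[OF T]) (use xiT in \<open>auto intro!: continuous_intros xic\<close>)
  then obtain e where e: "\<And>x. e (x + T) = e x" "continuous_on UNIV e" "\<And>x. x \<in> {0..T} \<Longrightarrow> e x = xi x - m2" by blast
  have e0: "integral {0..T} e = 0"
  proof -
    have "integral {0..T} e = integral {0..T} (\<lambda>x. xi x - m2)"
      by (rule integral_cong) (use e in auto)
    also have "... = 0" using T
      by (subst HK_integral_diff) (auto simp: integrable_continuous_real[OF xic] m2_def scaleR_conv_of_real)
    finally show ?thesis .
  qed
  obtain \<psi> where \<psi>: "\<And>x. \<psi> (x + T) = \<psi> x" "\<And>x. (\<psi> has_vector_derivative e x) (at x)"
    using exists_periodic_antiderivative[OF T e(1,2) e0] by blast
  have fe: "integral {0..T} (\<lambda>x. f x * e x) = - integral {0..T} (\<lambda>x. g x * \<psi> x)"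
    using W[of \<psi> e] \<psi> e by blast
  have psi: "ac_on T \<psi> e" by (rule ac_on_C1) (use \<psi> continuous_on_subset[OF e(2)] in auto)
  have ec: "continuous_on {0..T} e" by (rule continuous_on_subset[OF e(2)]) auto
  have i1: "(\<lambda>x. g x * \<psi> x) integrable_on {0..T}"
    by (rule absint_int[OF absint_continuous_mult'[OF ac_on_continuous[OF psi] g]])
  have i2: "(\<lambda>x. G x * e x) integrable_on {0..T}"
    by (rule absint_int[OF absint_continuous_mult'[OF ec Gi]])
  have i3: "(\<lambda>x. f x * e x) integrable_on {0..T}"
    by (rule absint_int[OF absint_continuous_mult'[OF ec f]])
  have i4: "(\<lambda>x. d x * xi x) integrable_on {0..T}"
    by (rule absint_int[OF absint_continuous_mult'[OF xic di]])
  have i5: "(\<lambda>x. D x * cnj (E x)) integrable_on {0..T}"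
    by (intro integrable_continuous_real continuous_intros Dc Ec)
  have "integral {0..T} (\<lambda>x. g x * \<psi> x + G x * e x) = 0"
    using ac_on_eq[OF ac_on_mult[OF G psi], of T] T GT by simp
  then have Ge: "integral {0..T} (\<lambda>x. G x * e x) = - integral {0..T} (\<lambda>x. g x * \<psi> x)"
    by (simp add: HK_integral_add[OF i1 i2] add_eq_0_iff)
  have "integral {0..T} (\<lambda>x. d x * xi x) = integral {0..T} (\<lambda>x. (f x * e x - G x * e x) + (m2 * d x - c * e x))"
  proof (rule integral_cong)
    fix x assume "x \<in> {0..T}"
    then have "xi x = e x + m2" using e(3) by simp
    then show "d x * xi x = (f x * e x - G x * e x) + (m2 * d x - c * e x)"
      by (simp only: d_def h_def) (simp add: algebra_simps)
  qed
  also have "... = integral {0..T} (\<lambda>x. f x * e x) - integral {0..T} (\<lambda>x. G x * e x) + (m2 * integral {0..T} d - c * integral {0..T} e)"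
    using i2 i3 absint_int[OF di] integrable_continuous_real[OF ec]
    by (simp only: HK_integral_add HK_integral_diff
        integrable_diff integrable_on_mult_right integral_mult_right)
  also have "... = 0" using fe Ge d0 e0 by simp
  finally have "integral {0..T} (\<lambda>x. d x * xi x) = 0" .
  moreover have "integral {0..T} (\<lambda>x. d x * xi x + D x * cnj (E x)) = 0"
    using ac_on_eq[OF ac_on_mult[OF D xi], of T] T DT by simp
  ultimately have DE: "integral {0..T} (\<lambda>x. D x * cnj (E x)) = 0"
    by (simp add: HK_integral_add[OF i4 i5])
  have "integral {0..T} (\<lambda>x. complex_of_real ((norm (E x))\<^sup>2)) = integral {0..T} (\<lambda>x. D x * cnj (E x) - m * cnj (E x))"
    unfolding complex_norm_square by (simp add: E_def algebra_simps)
  also have "... = 0"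
    using i5 integrable_continuous_real[OF cEc]
    by (simp only: HK_integral_diff integrable_on_mult_right integral_mult_right DE cE0) simp
  finally have "integral {0..T} (\<lambda>x. complex_of_real ((norm (E x))\<^sup>2)) = 0" .
  moreover have "integral {0..T} (\<lambda>x. complex_of_real ((norm (E x))\<^sup>2)) = of_real (integral {0..T} (\<lambda>x. (norm (E x))\<^sup>2))"
  proof -
    have "(\<lambda>s. (norm (E s))\<^sup>2) integrable_on {0..T}"
      by (intro integrable_continuous_real continuous_intros Ec)
    from integral_linear[OF this bounded_linear_of_real[where 'a=complex]]
    show ?thesis by (simp only: o_def)
  qed
  ultimately have "integral {0..T} (\<lambda>x. (norm (E x))\<^sup>2) = 0" by simp
  moreover have "continuous_on {0..T} (\<lambda>x. (norm (E x))\<^sup>2)" by (intro continuous_intros Ec)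
  ultimately have "\<forall>x\<in>{0..T}. (norm (E x))\<^sup>2 = 0"
    using T by (subst (asm) integral_eq_0_iff) auto
  then have EZ: "E x = 0" if "x \<in> {0..T}" for x using that by auto
  have "D x = 0" if "x \<in> {0..T}" for x
    using EZ[OF that] EZ[of 0] T DT by (simp add: E_def)
  then have "AE x in lebesgue. x \<in> {0..T} \<longrightarrow> d x = 0"
    using AE_zero_if_indefinite_integral_zero[OF di] T by (simp add: D_def)
  then have "AE x in lebesgue. x \<in> {0..T} \<longrightarrow> f x = c + integral {0..x} g"
    by eventually_elim (auto simp: d_def h_def G_def algebra_simps)
  then show "\<exists>c. AE x in lebesgue. x \<in> {0..T} \<longrightarrow> f x = c + integral {0..x} g" by blast
qed

section \<open>Sobolev bounds for the functions of the recursion\<close>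

lemma periodic_L2_meas:
  assumes "periodic_L2 T f" shows "f \<in> borel_measurable (lebesgue_on A)"
  using assms unfolding periodic_L2_def by (auto intro: measurable_restrict_space1)

lemma periodic_L2_absint:
  assumes T: "T > 0" and f: "periodic_L2 T f"
  shows "f absint_on {0..X}"
proof (rule periodic_absint[OF T])
  show "f (x + T) = f x" for x using f by (simp add: periodic_L2_def)
  have "(\<lambda>x. (norm (f x))\<^sup>2) integrable_on {0..T}"
    using f by (auto simp: periodic_L2_def intro: set_lebesgue_integral_eq_integral)
  then have i: "(\<lambda>x. 1 + (norm (f x))\<^sup>2) integrable_on {0..T}"
    by (intro integrable_add) auto
  have le: "norm (f x) \<le> 1 + (norm (f x))\<^sup>2" for x
    using weighted_am_gm[of 1 "norm (f x)" 1] by simp (smt (verit) zero_le_power2)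
  show "f absint_on {0..T}"
    by (rule measurable_bounded_by_integrable_imp_absolutely_integrable[OF periodic_L2_meas[OF f] _ i])
       (use le in auto)
qed

lemma periodic_L2I:
  assumes "\<And>x. f (x + 1) = f x" "f \<in> borel_measurable lebesgue" "L2b f K"
  shows "periodic_L2 1 f"
  using assms unfolding periodic_L2_def L2b_def
  by (auto intro!: nonnegative_absolutely_integrable_1)

lemma periodic_L2_L2b:
  assumes "periodic_L2 1 f" "(LINT x:{0..1}|lebesgue. (norm (f x))\<^sup>2) \<le> R\<^sup>2" "R \<ge> 0"
  shows "L2b f R"
proof -
  have "set_integrable lebesgue {0..1} (\<lambda>x. (norm (f x))\<^sup>2)" using assms(1) by (simp add: periodic_L2_def)
  from set_lebesgue_integral_eq_integral[OF this] assms show ?thesis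
    by (simp add: L2b_def periodic_L2_meas)
qed

lemma AE_integral_eq:
  fixes f g :: "real \<Rightarrow> 'a::euclidean_space"
  assumes "AE x in lebesgue. x \<in> S \<longrightarrow> f x = g x"
  shows "integral S f = integral S g"
proof -
  obtain N where "negligible N" "{x. \<not> (x \<in> S \<longrightarrow> f x = g x)} \<subseteq> N"
    using assms unfolding eventually_ae_filter_negligible by blast
  then show ?thesis by (intro integral_spike[of N]) auto
qed

lemma AE_absint:
  fixes f g :: "real \<Rightarrow> 'a::euclidean_space"
  assumes "AE x in lebesgue. x \<in> S \<longrightarrow> f x = g x" "f absint_on S"
  shows "g absint_on S"
proof -
  obtain N where "negligible N" "{x. \<not> (x \<in> S \<longrightarrow> f x = g x)} \<subseteq> N"
    using assms unfolding eventually_ae_filter_negligible by blast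
  then show ?thesis by (intro absolutely_integrable_spike[OF assms(2), of N]) auto
qed

lemma has_weak_deriv_cong_AE:
  assumes w: "has_weak_deriv T f g" and T: "T > 0"
    and f: "f absint_on {0..T}" and g: "g absint_on {0..T}"
    and ff: "AE x in lebesgue. x \<in> {0..T} \<longrightarrow> f x = f2 x" and gg: "AE x in lebesgue. x \<in> {0..T} \<longrightarrow> g x = g2 x"
  shows "has_weak_deriv T f2 g2"
proof -
  have eq: "integral {0..T} (\<lambda>x. f2 x * h x) = integral {0..T} (\<lambda>x. f x * h x)"
    "integral {0..T} (\<lambda>x. g2 x * h x) = integral {0..T} (\<lambda>x. g x * h x)" for h
    by (rule AE_integral_eq, use ff in eventually_elim, auto)
       (rule AE_integral_eq, use gg in eventually_elim, auto)
  show ?thesis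
    using w unfolding has_weak_deriv_integral[OF T f g]
      has_weak_deriv_integral[OF T AE_absint[OF ff f] AE_absint[OF gg g]] eq .
qed

lemma weak_deriv_unique_AE:
  assumes T: "T > 0" and f: "f absint_on {0..T}"
    and g: "g absint_on {0..T}" and h: "h absint_on {0..T}"
    and w: "has_weak_deriv T f g" "has_weak_deriv T f h"
  shows "AE x in lebesgue. x \<in> {0..T} \<longrightarrow> g x = h x"
proof -
  define d where "d x = g x - h x" for x
  have d: "d absint_on {0..T}" unfolding d_def by (intro set_integral_diff g h)
  have z: "(\<lambda>x::real. 0::complex) absint_on {0..T}" by simp
  have wd: "has_weak_deriv T (\<lambda>x. 0) d"
    unfolding has_weak_deriv_integral[OF T z d]
  proof (intro allI impI)
    fix \<psi> \<psi>' :: cfun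
    assume a: "(\<forall>x. \<psi> (x + T) = \<psi> x) \<and> (\<forall>x. (\<psi> has_vector_derivative \<psi>' x) (at x)) \<and> continuous_on UNIV \<psi>'"
    have "continuous_on {0..T} \<psi>"
      by (rule continuous_on_vector_derivative) (use a has_vector_derivative_at_within in blast)
    then have i: "(\<lambda>x. g x * \<psi> x) integrable_on {0..T}" "(\<lambda>x. h x * \<psi> x) integrable_on {0..T}"
      by (auto intro!: absint_int absint_continuous_mult' g h)
    have "integral {0..T} (\<lambda>x. g x * \<psi> x) = integral {0..T} (\<lambda>x. h x * \<psi> x)"
      using w[unfolded has_weak_deriv_integral[OF T f g] has_weak_deriv_integral[OF T f h]] a
      by (metis (no_types, lifting) neg_equal_iff_equal)
    then show "integral {0..T} (\<lambda>x. 0 * \<psi>' x) = - integral {0..T} (\<lambda>x. d x * \<psi> x)"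
      by (simp add: d_def left_diff_distrib HK_integral_diff[OF i])
  qed
  obtain c where c: "AE x in lebesgue. x \<in> {0..T} \<longrightarrow> 0 = c + integral {0..x} d"
    using du_bois_reymond(2)[OF T z d wd] by blast
  have D: "ac_on T (\<lambda>x. c + integral {0..x} d) d" by (rule ac_on_indefinite[OF d])
  then have cD: "continuous_on {0..T} (\<lambda>x. c + integral {0..x} d)" by (rule ac_on_continuous)
  have cN: "continuous_on {0..T} (\<lambda>x. (norm (c + integral {0..x} d))\<^sup>2)" by (intro continuous_intros cD)
  have "integral {0..T} (\<lambda>x. (norm (c + integral {0..x} d))\<^sup>2) = integral {0..T} (\<lambda>x. 0)"
    by (rule AE_integral_eq, use c in eventually_elim) (metis norm_zero zero_power2)
  then have Z: "\<forall>x\<in>{0..T}. (norm (c + integral {0..x} d))\<^sup>2 = 0"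
    by (subst integral_eq_0_iff[OF cN T, symmetric]) auto
  then have "c = 0" using T by (auto dest: bspec[of _ _ 0])
  with Z have "AE x in lebesgue. x \<in> {0..T} \<longrightarrow> d x = 0"
    by (intro AE_zero_if_indefinite_integral_zero[OF d]) (use T in auto)
  then show ?thesis by eventually_elim (auto simp: d_def)
qed

text \<open>A quantitative form of \<open>sobolev 1\<close>, with one bound for the whole chain of weak derivatives.\<close>

fun sobc :: "nat \<Rightarrow> real \<Rightarrow> cfun \<Rightarrow> bool" where
  "sobc 0 R f \<longleftrightarrow> periodic_L2 1 f \<and> L2b f R"
| "sobc (Suc m) R f \<longleftrightarrow> periodic_L2 1 f \<and> L2b f R \<and> (\<exists>g. has_weak_deriv 1 f g \<and> sobc m R g)"

lemma sobcD: "sobc m R f \<Longrightarrow> periodic_L2 1 f" "sobc m R f \<Longrightarrow> L2b f R"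
  by (cases m; auto)+

lemma sobc_absint: "sobc m R f \<Longrightarrow> f absint_on {0..X}"
  using periodic_L2_absint[OF zero_less_one] sobcD(1) by blast

lemma sobc_Suc: "sobc (Suc m) R f \<Longrightarrow> sobc m R f"
  by (induction m arbitrary: f) auto

lemma sobc_le: "sobc m R f \<Longrightarrow> l \<le> m \<Longrightarrow> sobc l R f"
  by (induction m) (auto simp: le_Suc_eq intro: sobc_Suc simp del: sobc.simps)

lemma sobc_cong_AE:
  assumes "sobc m R f" "periodic_L2 1 h" and AE: "AE x in lebesgue. x \<in> {0..1} \<longrightarrow> f x = h x"
  shows "sobc m R h"
proof -
  have AE': "AE x in lebesgue. x \<in> {0..1} \<longrightarrow> h x = f x" using AE by eventually_elim auto
  show ?thesis
  proof (cases m)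
    case 0
    then show ?thesis using assms L2b_cong_AE[OF _ AE'] by auto
  next
    case (Suc l)
    then obtain g where g: "has_weak_deriv 1 f g" "sobc l R g" using assms(1) by auto
    have "has_weak_deriv 1 h g"
      by (rule has_weak_deriv_cong_AE[OF g(1) _ sobc_absint[OF assms(1)] sobc_absint[OF g(2)] AE]) auto
    then show ?thesis using assms g L2b_cong_AE[OF _ AE'] Suc by auto
  qed
qed

lemma sobc_weak_deriv:
  assumes "sobc (Suc m) R f"
  shows "sobc m R (weak_deriv 1 f)" "has_weak_deriv 1 f (weak_deriv 1 f)" "periodic_L2 1 (weak_deriv 1 f)"
proof -
  obtain g where g: "has_weak_deriv 1 f g" "sobc m R g" using assms by auto
  have *: "periodic_L2 1 (weak_deriv 1 f) \<and> has_weak_deriv 1 f (weak_deriv 1 f)"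
    unfolding weak_deriv_def by (rule someI[of _ g]) (use g sobcD in auto)
  then show w: "has_weak_deriv 1 f (weak_deriv 1 f)" and p: "periodic_L2 1 (weak_deriv 1 f)" by auto
  have "AE x in lebesgue. x \<in> {0..1} \<longrightarrow> g x = weak_deriv 1 f x"
    by (rule weak_deriv_unique_AE[OF _ sobc_absint[OF assms] sobc_absint[OF g(2)] periodic_L2_absint[OF _ p] g(1) w]) auto
  then show "sobc m R (weak_deriv 1 f)" by (rule sobc_cong_AE[OF g(2) p])
qed

text \<open>The maximum of an absolutely continuous function is at most its mean plus its variation, both bounded by \<open>R\<close>.\<close>

lemma sobc_ac:
  assumes f: "sobc (Suc m) R f" and w: "has_weak_deriv 1 f g" and g: "sobc m R g"
  shows "\<exists>f2. ac_on 1 f2 g \<and> f2 0 = f2 1 \<and> (AE x in lebesgue. x \<in> {0..1} \<longrightarrow> f x = f2 x) \<and>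
    (\<forall>x\<in>{0..1}. norm (f2 x) \<le> 2 * R)"
proof -
  note gi = sobc_absint[OF g, of 1]
  obtain c where c: "AE x in lebesgue. x \<in> {0..1} \<longrightarrow> f x = c + integral {0..x} g"
    using du_bois_reymond(2)[OF zero_less_one sobc_absint[OF f] gi w] by blast
  have g0: "integral {0..1} g = 0"
    using du_bois_reymond(1)[OF zero_less_one sobc_absint[OF f] gi w] .
  define f2 where "f2 x = c + integral {0..x} g" for x
  have ac: "ac_on 1 f2 g" unfolding f2_def by (rule ac_on_indefinite[OF gi])
  have L: "L2b f2 R"
    by (rule L2b_cong_AE[OF sobcD(2)[OF f]], use c in eventually_elim) (auto simp: f2_def)
  have "norm (f2 x) \<le> 2 * R" if x: "x \<in> {0..1}" for x
  proof -
    have d: "norm (f2 x) \<le> norm (f2 y) + R" if y: "y \<in> {0..1}" for y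
    proof -
      have *: "norm (f2 t - f2 s) \<le> R" if "0 \<le> s" "s \<le> t" "t \<le> 1" for s t
      proof -
        have "norm (f2 t - f2 s) \<le> integral {s..t} (\<lambda>x. norm (g x))"
          by (rule ac_on_norm_diff[OF ac that])
        also have "... \<le> integral {0..1} (\<lambda>x. norm (g x))"
          by (rule integral_nonneg_mono[OF absint_norm_int[OF gi]]) (use that in auto)
        also have "... \<le> R" by (rule L2b_absint(2)[OF sobcD(2)[OF g]])
        finally show ?thesis .
      qed
      have "norm (f2 x - f2 y) \<le> R"
        using *[of x y] *[of y x] x y by (cases "x \<le> y") (auto simp: norm_minus_commute)
      then show ?thesis using norm_triangle_ineq2[of "f2 x" "f2 y"] by linarith
    qed
    have i: "(\<lambda>y. norm (f2 y)) integrable_on {0..1}"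
      by (rule absint_norm_int[OF L2b_absint(1)[OF L]])
    have "integral {0..1} (\<lambda>y::real. norm (f2 x)) \<le> integral {0..1} (\<lambda>y. norm (f2 y) + R)"
      by (rule integral_le) (use d i in \<open>auto intro: integrable_add\<close>)
    also have "... = integral {0..1} (\<lambda>y. norm (f2 y)) + R"
      by (subst HK_integral_add[OF i]) auto
    also have "... \<le> R + R" using L2b_absint(2)[OF L] by simp
    finally show ?thesis by simp
  qed
  then show ?thesis using ac c g0 by (intro exI[of _ f2]) (auto simp: f2_def)
qed

lemma sobc_cmult:
  assumes "sobc m R f" shows "sobc m (norm c * R) (\<lambda>x. c * f x)"
  using assms
proof (induction m arbitrary: f)
  case 0
  then have L: "L2b (\<lambda>x. c * f x) (norm c * R)" by (auto intro: L2b_cmult)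
  then have "periodic_L2 1 (\<lambda>x. c * f x)" by (rule periodic_L2I[rotated 2]) (use 0 in \<open>auto simp: periodic_L2_def\<close>)
  with L show ?case by auto
next
  case (Suc m)
  then have L: "L2b (\<lambda>x. c * f x) (norm c * R)" by (auto intro: L2b_cmult)
  then have p: "periodic_L2 1 (\<lambda>x. c * f x)" by (rule periodic_L2I[rotated 2]) (use Suc in \<open>auto simp: periodic_L2_def\<close>)
  from Suc.prems obtain g where g: "has_weak_deriv 1 f g" "sobc m R g" by auto
  obtain f2 where f2: "ac_on 1 f2 g" "f2 0 = f2 1" "AE x in lebesgue. x \<in> {0..1} \<longrightarrow> f x = f2 x"
    using sobc_ac[OF Suc.prems g] by blast
  have ac: "ac_on 1 (\<lambda>x. c * f2 x) (\<lambda>x. c * g x)" by (rule ac_on_cmult[OF f2(1)])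
  have "has_weak_deriv 1 (\<lambda>x. c * f2 x) (\<lambda>x. c * g x)"
    by (rule weak_deriv_of_ac[OF _ ac]) (use f2 in auto)
  then have "has_weak_deriv 1 (\<lambda>x. c * f x) (\<lambda>x. c * g x)"
  proof (rule has_weak_deriv_cong_AE)
    show "AE x in lebesgue. x \<in> {0..1} \<longrightarrow> c * f2 x = c * f x" using f2(3) by eventually_elim auto
  qed (auto intro: absolutely_integrable_continuous_real[OF ac_on_continuous[OF ac]] ac_on_integrable[OF ac])
  then show ?case using L p Suc.IH[OF g(2)] by auto
qed

lemma sobc_add:
  assumes "sobc m R f" "sobc m S h" shows "sobc m (R + S) (\<lambda>x. f x + h x)"
  using assms
proof (induction m arbitrary: f h)
  case 0
  then have L: "L2b (\<lambda>x. f x + h x) (R + S)" by (auto intro: L2b_add)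
  then have "periodic_L2 1 (\<lambda>x. f x + h x)" by (rule periodic_L2I[rotated 2]) (use 0 in \<open>auto simp: periodic_L2_def\<close>)
  with L show ?case by auto
next
  case (Suc m)
  then have L: "L2b (\<lambda>x. f x + h x) (R + S)" by (auto intro: L2b_add)
  then have p: "periodic_L2 1 (\<lambda>x. f x + h x)" by (rule periodic_L2I[rotated 2]) (use Suc in \<open>auto simp: periodic_L2_def\<close>)
  from Suc.prems obtain g where g: "has_weak_deriv 1 f g" "sobc m R g" by auto
  from Suc.prems obtain k where k: "has_weak_deriv 1 h k" "sobc m S k" by auto
  obtain f2 where f2: "ac_on 1 f2 g" "f2 0 = f2 1" "AE x in lebesgue. x \<in> {0..1} \<longrightarrow> f x = f2 x"
    using sobc_ac[OF Suc.prems(1) g] by blast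
  obtain h2 where h2: "ac_on 1 h2 k" "h2 0 = h2 1" "AE x in lebesgue. x \<in> {0..1} \<longrightarrow> h x = h2 x"
    using sobc_ac[OF Suc.prems(2) k] by blast
  have ac: "ac_on 1 (\<lambda>x. f2 x + h2 x) (\<lambda>x. g x + k x)" by (rule ac_on_add[OF f2(1) h2(1)])
  have "has_weak_deriv 1 (\<lambda>x. f2 x + h2 x) (\<lambda>x. g x + k x)"
    by (rule weak_deriv_of_ac[OF _ ac]) (use f2 h2 in auto)
  then have "has_weak_deriv 1 (\<lambda>x. f x + h x) (\<lambda>x. g x + k x)"
  proof (rule has_weak_deriv_cong_AE)
    show "AE x in lebesgue. x \<in> {0..1} \<longrightarrow> f2 x + h2 x = f x + h x" using f2(3) h2(3) by eventually_elim auto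
  qed (auto intro: absolutely_integrable_continuous_real[OF ac_on_continuous[OF ac]] ac_on_integrable[OF ac])
  then show ?case using L p Suc.IH[OF g(2) k(2)] by auto
qed

lemma L2b_mult_sobc:
  assumes "sobc (Suc m) R f" "L2b g S"
  shows "L2b (\<lambda>x. f x * g x) (2 * R * S)"
proof -
  obtain f' where f': "has_weak_deriv 1 f f'" "sobc m R f'" using assms by auto
  obtain f2 where f2: "ac_on 1 f2 f'" "AE x in lebesgue. x \<in> {0..1} \<longrightarrow> f x = f2 x" "\<forall>x\<in>{0..1}. norm (f2 x) \<le> 2 * R"
    using sobc_ac[OF assms(1) f'] by blast
  have "L2b (\<lambda>x. f2 x * g x) (2 * R * S)"
    by (rule L2b_bdd_mult) (use f2 assms ac_on_continuous[OF f2(1)] in \<open>auto intro: continuous_imp_measurable_on_sets_lebesgue\<close>)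
  then show ?thesis by (rule L2b_cong_AE) (use f2(2) in eventually_elim, auto)
qed

text \<open>Leibniz' rule. In each product one factor is bounded pointwise by \<open>sobc_ac\<close> and the other one in the mean square.\<close>

lemma sobc_mult:
  assumes "sobc (Suc m) R f" "sobc (Suc m) S h" shows "sobc (Suc m) (4 * 2 ^ m * R * S) (\<lambda>x. f x * h x)"
  using assms
proof (induction m arbitrary: f h)
  case (0 f h)
  have R: "0 \<le> R" "0 \<le> S" using 0 sobcD L2b_nonneg by blast+
  from 0 obtain g where g: "has_weak_deriv 1 f g" "sobc 0 R g" by auto
  from 0 obtain k where k: "has_weak_deriv 1 h k" "sobc 0 S k" by auto
  obtain f2 where f2: "ac_on 1 f2 g" "f2 0 = f2 1" "AE x in lebesgue. x \<in> {0..1} \<longrightarrow> f x = f2 x"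
    using sobc_ac[OF 0(1) g] by blast
  obtain h2 where h2: "ac_on 1 h2 k" "h2 0 = h2 1" "AE x in lebesgue. x \<in> {0..1} \<longrightarrow> h x = h2 x"
    using sobc_ac[OF 0(2) k] by blast
  have L: "L2b (\<lambda>x. f x * h x) (2 * R * S)" by (rule L2b_mult_sobc[OF 0(1) sobcD(2)[OF 0(2)]])
  then have p: "periodic_L2 1 (\<lambda>x. f x * h x)"
    by (rule periodic_L2I[rotated 2]) (use 0 in \<open>auto simp: periodic_L2_def\<close>)
  have L2: "L2b (\<lambda>x. g x * h x + f x * k x) (4 * 2 ^ 0 * R * S)"
    using L2b_add[OF L2b_mult_sobc[OF 0(2) sobcD(2)[OF g(2)]] L2b_mult_sobc[OF 0(1) sobcD(2)[OF k(2)]]]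
    by (simp add: mult_ac)
  then have p2: "periodic_L2 1 (\<lambda>x. g x * h x + f x * k x)"
    by (rule periodic_L2I[rotated 2]) (use 0 g k in \<open>auto simp: periodic_L2_def\<close>)
  have ac: "ac_on 1 (\<lambda>x. f2 x * h2 x) (\<lambda>x. g x * h2 x + f2 x * k x)" by (rule ac_on_mult[OF f2(1) h2(1)])
  have "has_weak_deriv 1 (\<lambda>x. f2 x * h2 x) (\<lambda>x. g x * h2 x + f2 x * k x)"
    by (rule weak_deriv_of_ac[OF _ ac]) (use f2 h2 in auto)
  then have "has_weak_deriv 1 (\<lambda>x. f x * h x) (\<lambda>x. g x * h x + f x * k x)"
  proof (rule has_weak_deriv_cong_AE)
    show "AE x in lebesgue. x \<in> {0..1} \<longrightarrow> f2 x * h2 x = f x * h x" using f2(3) h2(3) by eventually_elim auto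
    show "AE x in lebesgue. x \<in> {0..1} \<longrightarrow> g x * h2 x + f2 x * k x = g x * h x + f x * k x" using f2(3) h2(3) by eventually_elim auto
  qed (auto intro: absolutely_integrable_continuous_real[OF ac_on_continuous[OF ac]] ac_on_integrable[OF ac])
  moreover have "L2b (\<lambda>x. f x * h x) (4 * 2 ^ 0 * R * S)" by (rule L2b_mono[OF L]) (use R in auto)
  ultimately show ?case using L2 p p2 by auto
next
  case (Suc m f h)
  have R: "0 \<le> R" "0 \<le> S" using Suc.prems sobcD L2b_nonneg by blast+
  from Suc.prems obtain g where g: "has_weak_deriv 1 f g" "sobc (Suc m) R g" by auto
  from Suc.prems obtain k where k: "has_weak_deriv 1 h k" "sobc (Suc m) S k" by auto
  obtain f2 where f2: "ac_on 1 f2 g" "f2 0 = f2 1" "AE x in lebesgue. x \<in> {0..1} \<longrightarrow> f x = f2 x"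
    using sobc_ac[OF Suc.prems(1) g] by blast
  obtain h2 where h2: "ac_on 1 h2 k" "h2 0 = h2 1" "AE x in lebesgue. x \<in> {0..1} \<longrightarrow> h x = h2 x"
    using sobc_ac[OF Suc.prems(2) k] by blast
  note 1 = Suc.IH[OF g(2) sobc_Suc[OF Suc.prems(2)]]
  note 2 = Suc.IH[OF sobc_Suc[OF Suc.prems(1)] k(2)]
  have s: "sobc (Suc m) (4 * 2 ^ Suc m * R * S) (\<lambda>x. g x * h x + f x * k x)"
    using sobc_add[OF 1 2] by (simp add: mult_ac del: sobc.simps)
  note b = Suc.IH[OF sobc_Suc[OF Suc.prems(1)] sobc_Suc[OF Suc.prems(2)]]
  have ac: "ac_on 1 (\<lambda>x. f2 x * h2 x) (\<lambda>x. g x * h2 x + f2 x * k x)" by (rule ac_on_mult[OF f2(1) h2(1)])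
  have "has_weak_deriv 1 (\<lambda>x. f2 x * h2 x) (\<lambda>x. g x * h2 x + f2 x * k x)"
    by (rule weak_deriv_of_ac[OF _ ac]) (use f2 h2 in auto)
  then have "has_weak_deriv 1 (\<lambda>x. f x * h x) (\<lambda>x. g x * h x + f x * k x)"
  proof (rule has_weak_deriv_cong_AE)
    show "AE x in lebesgue. x \<in> {0..1} \<longrightarrow> f2 x * h2 x = f x * h x" using f2(3) h2(3) by eventually_elim auto
    show "AE x in lebesgue. x \<in> {0..1} \<longrightarrow> g x * h2 x + f2 x * k x = g x * h x + f x * k x" using f2(3) h2(3) by eventually_elim auto
  qed (auto intro: absolutely_integrable_continuous_real[OF ac_on_continuous[OF ac]] ac_on_integrable[OF ac])
  moreover have "L2b (\<lambda>x. f x * h x) (4 * 2 ^ Suc m * R * S)"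
    by (rule L2b_mono[OF sobcD(2)[OF b]]) (use R in \<open>auto intro!: mult_right_mono\<close>)
  ultimately show ?case using s sobcD(1)[OF b] by (subst sobc.simps) blast
qed

lemma sobc_zero: "sobc m 0 (\<lambda>x. 0)"
proof -
  have L: "L2b (\<lambda>x. 0) 0" using L2b_const[of 0] by simp
  then have p: "periodic_L2 1 (\<lambda>x. 0)" by (rule periodic_L2I[rotated 2]) auto
  have "has_weak_deriv 1 (\<lambda>x. 0) (\<lambda>x. 0)" by (rule weak_deriv_of_ac) (auto intro: ac_on_const)
  then show ?thesis using L p by (induction m) auto
qed

lemma sobc_sum:
  assumes "finite I" "\<And>i. i \<in> I \<Longrightarrow> sobc m (R i) (f i)"
  shows "sobc m (\<Sum>i\<in>I. R i) (\<lambda>x. \<Sum>i\<in>I. f i x)"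
  using assms by (induction I) (auto intro: sobc_zero sobc_add simp del: sobc.simps)

text \<open>Any chain of weak derivatives may be replaced by the iterates of \<open>weak_deriv\<close>, which agree with it almost everywhere.\<close>

lemma sobolev_sobc:
  assumes "sobolev 1 N f" "R \<ge> 0" "\<And>k. k \<le> N \<Longrightarrow> (LINT x:{0..1}|lebesgue. (norm ((weak_deriv 1 ^^ k) f x))\<^sup>2) \<le> R\<^sup>2"
  shows "sobc N R f"
  using assms
proof (induction N arbitrary: f)
  case 0
  then show ?case using periodic_L2_L2b[of f R] by auto
next
  case (Suc N)
  from Suc.prems(1) obtain g where p: "periodic_L2 1 f" and g: "sobolev 1 N g" "has_weak_deriv 1 f g" by auto
  have pg: "periodic_L2 1 g" using g(1) by (cases N) auto
  have *: "periodic_L2 1 (weak_deriv 1 f) \<and> has_weak_deriv 1 f (weak_deriv 1 f)"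
    unfolding weak_deriv_def by (rule someI[of _ g]) (use g pg in auto)
  have AE: "AE x in lebesgue. x \<in> {0..1} \<longrightarrow> g x = weak_deriv 1 f x"
    by (rule weak_deriv_unique_AE[OF _ periodic_L2_absint[OF _ p] periodic_L2_absint[OF _ pg]
          periodic_L2_absint[OF _ conjunct1[OF *]] g(2) conjunct2[OF *]]) auto
  have "sobolev 1 N (weak_deriv 1 f)"
  proof (cases N)
    case (Suc l)
    then obtain k where k: "sobolev 1 l k" "has_weak_deriv 1 g k" using g by auto
    have pk: "periodic_L2 1 k" using k(1) by (cases l) auto
    have "has_weak_deriv 1 (weak_deriv 1 f) k"
      by (rule has_weak_deriv_cong_AE[OF k(2) _ periodic_L2_absint[OF _ pg] periodic_L2_absint[OF _ pk] AE]) auto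
    then show ?thesis using Suc k * by auto
  qed (use * in auto)
  moreover have "(LINT x:{0..1}|lebesgue. (norm ((weak_deriv 1 ^^ k) (weak_deriv 1 f) x))\<^sup>2) \<le> R\<^sup>2" if "k \<le> N" for k
    using Suc.prems(3)[of "Suc k"] that by (simp add: funpow_swap1)
  ultimately have "sobc N R (weak_deriv 1 f)" using Suc.IH Suc.prems by blast
  moreover have "L2b f R" using periodic_L2_L2b[OF p, of R] Suc.prems(2) Suc.prems(3)[of 0] by simp
  ultimately show ?case using p * by auto
qed

text \<open>Each step of the recursion costs one derivative. The bound \<open>R\<close> depends on \<open>N\<close>, \<open>k\<close> and \<open>R0\<close> only, not on the potential.\<close>

lemma zs_r_sobc:
  assumes "1 \<le> k" "k \<le> N + 1"
  shows "\<exists>R. \<forall>\<phi>1 \<phi>2. sobc N R0 \<phi>1 \<longrightarrow> sobc N R0 \<phi>2 \<longrightarrow> sobc (N + 1 - k) R (zs_r \<phi>1 \<phi>2 k)"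
  using assms
proof (induction k rule: less_induct)
  case (less k)
  consider "k = 1" | n where "k = Suc (Suc n)"
    using less.prems(1) by (metis One_nat_def Suc_le_D le_SucE nat.exhaust)
  then show ?case
  proof cases
    case 1
    have "sobc N (norm (-1::complex) * R0) (\<lambda>x. -1 * \<phi>2 x)" if "sobc N R0 \<phi>2" for \<phi>2
      by (rule sobc_cmult[OF that])
    then show ?thesis using 1 by (intro exI[of _ R0]) auto
  next
    case (2 n)
    define m where "m = N + 1 - k"
    have m: "N + 1 - Suc n = Suc m" "Suc m \<le> N" using less.prems 2 by (auto simp: m_def)
    have "\<forall>j\<in>{1..n}. \<exists>R. \<forall>\<phi>1 \<phi>2. sobc N R0 \<phi>1 \<longrightarrow> sobc N R0 \<phi>2 \<longrightarrow> sobc (Suc m) R (zs_r \<phi>1 \<phi>2 j)"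
    proof
      fix j assume j: "j \<in> {1..n}"
      then obtain R where "\<forall>\<phi>1 \<phi>2. sobc N R0 \<phi>1 \<longrightarrow> sobc N R0 \<phi>2 \<longrightarrow> sobc (N + 1 - j) R (zs_r \<phi>1 \<phi>2 j)"
        using less.IH[of j] less.prems 2 by auto
      moreover have "Suc m \<le> N + 1 - j" using j m by auto
      ultimately show "\<exists>R. \<forall>\<phi>1 \<phi>2. sobc N R0 \<phi>1 \<longrightarrow> sobc N R0 \<phi>2 \<longrightarrow> sobc (Suc m) R (zs_r \<phi>1 \<phi>2 j)"
        using sobc_le by blast
    qed
    then obtain Q where Q: "\<And>j \<phi>1 \<phi>2. j \<in> {1..n} \<Longrightarrow> sobc N R0 \<phi>1 \<Longrightarrow> sobc N R0 \<phi>2 \<Longrightarrow> sobc (Suc m) (Q j) (zs_r \<phi>1 \<phi>2 j)"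
      by metis
    obtain R1 where R1: "\<And>\<phi>1 \<phi>2. sobc N R0 \<phi>1 \<Longrightarrow> sobc N R0 \<phi>2 \<Longrightarrow> sobc (Suc m) R1 (zs_r \<phi>1 \<phi>2 (Suc n))"
      using less.IH[of "Suc n"] less.prems 2 m by auto
    define A where "A = (\<Sum>j\<in>{1..n}. 4 * 2 ^ m * Q j * Q (Suc n - j))"
    show ?thesis
    proof (intro exI[of _ "R1 + 4 * 2 ^ m * R0 * A"] allI impI)
      fix \<phi>1 \<phi>2 assume p: "sobc N R0 \<phi>1" "sobc N R0 \<phi>2"
      have "sobc (Suc m) A (\<lambda>x. \<Sum>j\<in>{1..n}. zs_r \<phi>1 \<phi>2 j x * zs_r \<phi>1 \<phi>2 (Suc n - j) x)"
        unfolding A_def by (intro sobc_sum sobc_mult Q p) auto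
      then have "sobc (Suc m) (4 * 2 ^ m * R0 * A) (\<lambda>x. \<phi>1 x * (\<Sum>j\<in>{1..n}. zs_r \<phi>1 \<phi>2 j x * zs_r \<phi>1 \<phi>2 (Suc n - j) x))"
        by (intro sobc_mult sobc_le[OF p(1)] m)
      from sobc_add[OF sobc_weak_deriv(1)[OF R1[OF p]] sobc_Suc[OF this]]
      show "sobc (N + 1 - k) (R1 + 4 * 2 ^ m * R0 * A) (zs_r \<phi>1 \<phi>2 k)"
        by (simp add: 2 m_def del: sobc.simps)
    qed
  qed
qed

text \<open>Everything the asymptotic analysis uses of a potential in a bounded subset of \<open>Hc N\<close>: absolutely continuous
  representatives \<open>p\<close> of \<open>\<phi>1\<close> and \<open>r k\<close> of \<open>zs_r \<phi>1 \<phi>2 k\<close>, with densities \<open>dp\<close> and \<open>dr k\<close>, and one bound \<open>C\<close> for all of them.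
  The last function \<open>r (N + 1)\<close> is merely square integrable.\<close>

definition wkb_data :: "nat \<Rightarrow> real \<Rightarrow> cfun \<Rightarrow> cfun \<Rightarrow> cfun \<Rightarrow>
    cfun \<Rightarrow> (nat \<Rightarrow> real \<Rightarrow> complex) \<Rightarrow> (nat \<Rightarrow> real \<Rightarrow> complex) \<Rightarrow> bool" where
  "wkb_data N C \<phi>1 \<phi>2 p dp r dr \<longleftrightarrow> N \<ge> 1 \<and> C \<ge> 1 \<and> periodic_L2 1 \<phi>1 \<and> periodic_L2 1 \<phi>2 \<and>
     ac_on 1 p dp \<and> p 0 = p 1 \<and> (AE x in lebesgue. x \<in> {0..1} \<longrightarrow> \<phi>1 x = p x) \<and>
     (\<forall>x\<in>{0..1}. norm (p x) \<le> C) \<and> L2b dp C \<and>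
     (\<forall>k\<in>{1..N}. ac_on 1 (r k) (dr k) \<and> r k 0 = r k 1 \<and> (\<forall>x\<in>{0..1}. norm (r k x) \<le> C) \<and>
        (AE x in lebesgue. x \<in> {0..1} \<longrightarrow> r (Suc k) x = dr k x + p x * (\<Sum>j\<in>{1..<k}. r j x * r (k - j) x))) \<and>
     L2b (r (Suc N)) C \<and>
     (\<forall>k\<in>{1..Suc N}. AE x in lebesgue. x \<in> {0..1} \<longrightarrow> zs_r \<phi>1 \<phi>2 k x = r k x) \<and>
     (AE x in lebesgue. x \<in> {0..1} \<longrightarrow> \<phi>2 x = - r 1 x)"

lemma bounded_wkb_data:
  assumes N: "N \<ge> 1" and B: "bounded_in_Hc N B"
  shows "\<exists>C. \<forall>(\<phi>1, \<phi>2)\<in>B. \<exists>p dp r dr. wkb_data N C \<phi>1 \<phi>2 p dp r dr"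
proof -
  obtain R where R: "\<And>\<phi>1 \<phi>2. (\<phi>1, \<phi>2) \<in> B \<Longrightarrow> sqrt ((sobolev_norm N \<phi>1)\<^sup>2 + (sobolev_norm N \<phi>2)\<^sup>2) \<le> R"
    and BH: "B \<subseteq> Hc N" using B unfolding bounded_in_Hc_def by blast
  define R0 where "R0 = max R 0"
  have nonneg: "0 \<le> (LINT x:{0..1}|lebesgue. (norm (h x))\<^sup>2)" for h :: cfun
    unfolding set_lebesgue_integral_def by (rule integral_nonneg_AE) (auto simp: indicator_def)
  have sn: "(LINT x:{0..1}|lebesgue. (norm ((weak_deriv 1 ^^ k) f x))\<^sup>2) \<le> R0\<^sup>2" if "sobolev_norm N f \<le> R0" "k \<le> N" for f k
  proof -
    have "(LINT x:{0..1}|lebesgue. (norm ((weak_deriv 1 ^^ k) f x))\<^sup>2) \<le> (\<Sum>k\<le>N. LINT x:{0..1}|lebesgue. (norm ((weak_deriv 1 ^^ k) f x))\<^sup>2)"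
      by (rule member_le_sum) (use that nonneg in auto)
    also have "... = (sobolev_norm N f)\<^sup>2"
      unfolding sobolev_norm_def by (rule real_sqrt_pow2[symmetric]) (auto intro: sum_nonneg nonneg)
    also have "... \<le> R0\<^sup>2"
      using that by (intro power_mono) (auto simp: sobolev_norm_def intro: sum_nonneg nonneg)
    finally show ?thesis .
  qed
  have S: "sobc N R0 \<phi>1 \<and> sobc N R0 \<phi>2" if "(\<phi>1, \<phi>2) \<in> B" for \<phi>1 \<phi>2
  proof -
    have "sobolev_norm N \<phi>1 \<le> sqrt ((sobolev_norm N \<phi>1)\<^sup>2 + (sobolev_norm N \<phi>2)\<^sup>2)"
      "sobolev_norm N \<phi>2 \<le> sqrt ((sobolev_norm N \<phi>1)\<^sup>2 + (sobolev_norm N \<phi>2)\<^sup>2)"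
      by (auto intro: real_le_rsqrt)
    then have "sobolev_norm N \<phi>1 \<le> R0" "sobolev_norm N \<phi>2 \<le> R0"
      using R[OF that] unfolding R0_def by linarith+
    moreover have "sobolev 1 N \<phi>1" "sobolev 1 N \<phi>2" using BH that by (auto simp: Hc_def)
    ultimately show ?thesis using sobolev_sobc[of N _ R0] sn by (simp add: R0_def)
  qed
  have "\<forall>k\<in>{1..N+1}. \<exists>R. \<forall>\<phi>1 \<phi>2. sobc N R0 \<phi>1 \<longrightarrow> sobc N R0 \<phi>2 \<longrightarrow> sobc (N + 1 - k) R (zs_r \<phi>1 \<phi>2 k)"
    using zs_r_sobc by auto
  then obtain Q where Q: "\<And>k \<phi>1 \<phi>2. k \<in> {1..N+1} \<Longrightarrow> sobc N R0 \<phi>1 \<Longrightarrow> sobc N R0 \<phi>2 \<Longrightarrow> sobc (N + 1 - k) (Q k) (zs_r \<phi>1 \<phi>2 k)"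
    by metis
  define C where "C = 1 + 2 * R0 + 2 * (\<Sum>k\<in>{1..N+1}. \<bar>Q k\<bar>)"
  have QC: "2 * Q k \<le> C" if "k \<in> {1..N+1}" for k
    using member_le_sum[of k "{1..N+1}" "\<lambda>k. \<bar>Q k\<bar>"] that by (simp add: C_def R0_def)
  have "0 \<le> (\<Sum>k\<in>{1..N+1}. \<bar>Q k\<bar>)" "0 \<le> R0" by (auto simp: R0_def intro: sum_nonneg)
  then have R0C: "2 * R0 \<le> C" "1 \<le> C" "R0 \<le> C" unfolding C_def by linarith+
  show ?thesis
  proof (intro exI[of _ C] ballI, clarify)
    fix \<phi>1 \<phi>2 assume b: "(\<phi>1, \<phi>2) \<in> B"
    note s = S[OF b, THEN conjunct1] S[OF b, THEN conjunct2]
    obtain N' where N': "N = Suc N'" using N by (cases N) auto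
    obtain dp where dp: "has_weak_deriv 1 \<phi>1 dp" "sobc N' R0 dp" using s(1) N' by auto
    obtain p where p: "ac_on 1 p dp" "p 0 = p 1" "AE x in lebesgue. x \<in> {0..1} \<longrightarrow> \<phi>1 x = p x" "\<forall>x\<in>{0..1}. norm (p x) \<le> 2 * R0"
      using sobc_ac[OF s(1)[unfolded N'] dp] by blast
    let ?z = "zs_r \<phi>1 \<phi>2"
    define dr where "dr k = weak_deriv 1 (?z k)" for k
    have "\<exists>f2. ac_on 1 f2 (dr k) \<and> f2 0 = f2 1 \<and> (AE x in lebesgue. x \<in> {0..1} \<longrightarrow> ?z k x = f2 x) \<and>
        (\<forall>x\<in>{0..1}. norm (f2 x) \<le> 2 * Q k)" if k: "k \<in> {1..N}" for k
    proof -
      have "sobc (Suc (N - k)) (Q k) (?z k)" using Q[of k, OF _ s] k by (simp add: Suc_diff_le)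
      from sobc_ac[OF this sobc_weak_deriv(2,1)[OF this]] show ?thesis unfolding dr_def .
    qed
    then obtain r0 where r0: "\<And>k. k \<in> {1..N} \<Longrightarrow> ac_on 1 (r0 k) (dr k) \<and> r0 k 0 = r0 k 1 \<and>
        (AE x in lebesgue. x \<in> {0..1} \<longrightarrow> ?z k x = r0 k x) \<and> (\<forall>x\<in>{0..1}. norm (r0 k x) \<le> 2 * Q k)"
      using bchoice[of "{1..N}" "\<lambda>k f2. ac_on 1 f2 (dr k) \<and> f2 0 = f2 1 \<and> (AE x in lebesgue. x \<in> {0..1} \<longrightarrow> ?z k x = f2 x) \<and>
        (\<forall>x\<in>{0..1}. norm (f2 x) \<le> 2 * Q k)"] by blast
    define r where "r k = (if k = Suc N then ?z k else r0 k)" for k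
    have r: "AE x in lebesgue. x \<in> {0..1} \<longrightarrow> ?z k x = r k x" if "k \<in> {1..Suc N}" for k
      using r0[of k] that by (cases "k = Suc N") (auto simp: r_def)
    have rec: "AE x in lebesgue. x \<in> {0..1} \<longrightarrow> r (Suc k) x = dr k x + p x * (\<Sum>j\<in>{1..<k}. r j x * r (k - j) x)"
      if k: "k \<in> {1..N}" for k
    proof -
      obtain n where n: "k = Suc n" using k by (cases k) auto
      have "AE x in lebesgue. \<forall>j\<in>{1..Suc N}. x \<in> {0..1} \<longrightarrow> ?z j x = r j x"
        using r by (intro AE_finite_allI) auto
      then show ?thesis using p(3)
      proof eventually_elim
        case (elim x)
        show ?case
        proof
          assume x: "x \<in> {0..1}"
          have *: "?z j x = r j x" if "j \<in> {1..Suc N}" for j using elim(1) that x by blast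
          have "r (Suc k) x = ?z (Suc k) x" using *[of "Suc k"] k by simp
          also have "... = dr k x + \<phi>1 x * (\<Sum>j=1..n. ?z j x * ?z (Suc n - j) x)"
            by (simp add: n dr_def)
          also have "(\<Sum>j=1..n. ?z j x * ?z (Suc n - j) x) = (\<Sum>j\<in>{1..<k}. r j x * r (k - j) x)"
          proof (rule sum.cong)
            fix j assume "j \<in> {1..<k}"
            then have "j \<in> {1..Suc N}" "k - j \<in> {1..Suc N}" using k by auto
            then show "?z j x * ?z (Suc n - j) x = r j x * r (k - j) x"
              using *[of j] *[of "k - j"] n by simp
          qed (use n in auto)
          also have "\<phi>1 x = p x" using elim(2) x by simp
          finally show "r (Suc k) x = dr k x + p x * (\<Sum>j\<in>{1..<k}. r j x * r (k - j) x)" .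
        qed
      qed
    qed
    have "L2b (r (Suc N)) C"
      using L2b_mono[OF sobcD(2)[OF Q[of "Suc N", OF _ s]], of C] QC[of "Suc N"] 
        L2b_nonneg[OF sobcD(2)[OF Q[of "Suc N", OF _ s]]] by (simp add: r_def)
    moreover have "L2b dp C" by (rule L2b_mono[OF sobcD(2)[OF dp(2)] R0C(3)])
    moreover have "AE x in lebesgue. x \<in> {0..1} \<longrightarrow> \<phi>2 x = - r 1 x"
    proof -
      have "AE x in lebesgue. x \<in> {0..1} \<longrightarrow> ?z 1 x = r 1 x" by (rule r) simp
      then show ?thesis
      proof eventually_elim
        case (elim x)
        have "?z 1 x = - \<phi>2 x" by simp
        then show ?case using elim by (metis add.inverse_inverse)
      qed
    qed
    moreover have "norm (p x) \<le> C" if "x \<in> {0..1}" for x using p(4) that R0C by force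
    moreover have "ac_on 1 (r k) (dr k) \<and> r k 0 = r k 1 \<and> (\<forall>x\<in>{0..1}. norm (r k x) \<le> C)" if k: "k \<in> {1..N}" for k
    proof -
      have "r k = r0 k" using k by (auto simp: r_def)
      moreover have "2 * Q k \<le> C" using QC[of k] k by simp
      ultimately show ?thesis using r0[OF k] by (metis order_trans)
    qed
    ultimately show "\<exists>p dp r dr. wkb_data N C \<phi>1 \<phi>2 p dp r dr"
      using N R0C p r rec sobcD(1)[OF s(1)] sobcD(1)[OF s(2)]
      by (intro exI[of _ p] exI[of _ dp] exI[of _ r] exI[of _ dr]) (simp add: wkb_data_def)
  qed
qed

section \<open>The fundamental solution and the discriminant\<close>

lemma ac_on_shift:
  assumes f: "ac_on (b + c) f g" and c: "c \<ge> 0"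
  shows "ac_on b (\<lambda>x. f (x + c)) (\<lambda>x. g (x + c))"
proof (rule ac_onI)
  show "(\<lambda>x. g (x + c)) absint_on {0..b}"
    using absint_shift[OF absint_sub[OF ac_on_integrable[OF f] c order_refl], of c] by simp
  fix x assume x: "0 \<le> x" "x \<le> b"
  have "f (x + c) - f c = integral {c..x + c} g"
    by (rule ac_on_diff_eq[OF f]) (use x c in auto)
  also have "... = integral {0..x} (\<lambda>x. g (x + c))"
    using integral_shift_real_ivl[of c c "x + c" g] by simp
  finally show "f (x + c) = f (0 + c) + integral {0..x} (\<lambda>x. g (x + c))" by (simp add: algebra_simps)
qed

lemma continuous_absint:
  fixes f :: "real \<Rightarrow> 'a::euclidean_space"
  shows "continuous_on {a..b} f \<Longrightarrow> f absint_on {a..b}"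
  by (rule absolutely_integrable_continuous_real)

locale zs =
  fixes \<phi>1 \<phi>2 :: cfun
  assumes per1: "periodic_L2 1 \<phi>1" and per2: "periodic_L2 1 \<phi>2"
begin

abbreviation "\<Delta> \<equiv> discr \<phi>1 \<phi>2"

text \<open>The equation \<open>L(\<phi>) F = la F\<close>, solved for the derivative, with an inhomogeneous term.\<close>

abbreviation ZS :: "real \<Rightarrow> complex \<Rightarrow> cfun \<Rightarrow> cfun \<Rightarrow> cfun \<Rightarrow> cfun \<Rightarrow> bool" where
  "ZS X la p q u v \<equiv> linsys X (\<lambda>t. - \<i> * la) (\<lambda>t. \<i> * \<phi>1 t) (\<lambda>t. - \<i> * \<phi>2 t) (\<lambda>t. \<i> * la) p q u v"

abbreviation "CN la \<equiv> coeffs_norm (\<lambda>t. - \<i> * la) (\<lambda>t. \<i> * \<phi>1 t) (\<lambda>t. - \<i> * \<phi>2 t) (\<lambda>t. \<i> * la)"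

lemma phi_absint: "\<phi>1 absint_on {0..X}" "\<phi>2 absint_on {0..X}"
  using per1 per2 by (auto intro: periodic_L2_absint[OF zero_less_one])

lemma coeffs: "coeffs_int X (\<lambda>t. - \<i> * la) (\<lambda>t. \<i> * \<phi>1 t) (\<lambda>t. - \<i> * \<phi>2 t) (\<lambda>t. \<i> * la)"
  unfolding coeffs_int_def
  by (intro conjI absint_continuous_mult continuous_intros phi_absint) auto

lemma CN_integral:
  assumes "X \<ge> 0"
  shows "integral {0..X} (CN la) = 2 * norm la * X + integral {0..X} (\<lambda>t. norm (\<phi>1 t) + norm (\<phi>2 t))"
proof -
  have i: "(\<lambda>t. norm (\<phi>1 t) + norm (\<phi>2 t)) integrable_on {0..X}"
    by (intro integrable_add absint_norm_int phi_absint)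
  have "integral {0..X} (CN la) = integral {0..X} (\<lambda>t. 2 * norm la + (norm (\<phi>1 t) + norm (\<phi>2 t)))"
    by (rule integral_cong) (simp add: coeffs_norm_def norm_mult)
  also have "... = 2 * norm la * X + integral {0..X} (\<lambda>t. norm (\<phi>1 t) + norm (\<phi>2 t))"
    using assms by (subst HK_integral_add[OF _ i]) auto
  finally show ?thesis .
qed

definition sol :: "complex \<Rightarrow> cfun \<Rightarrow> cfun \<Rightarrow> complex \<Rightarrow> complex \<Rightarrow> cfun \<times> cfun" where
  "sol la p q c d = (SOME w. fst w 0 = c \<and> snd w 0 = d \<and> (\<forall>X. ZS X la p q (fst w) (snd w)))"

lemma sol:
  assumes "\<And>X. p absint_on {0..X}" "\<And>X. q absint_on {0..X}"
  shows "fst (sol la p q c d) 0 = c" "snd (sol la p q c d) 0 = d" "ZS X la p q (fst (sol la p q c d)) (snd (sol la p q c d))"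
proof -
  obtain u v where "u 0 = c \<and> v 0 = d \<and> (\<forall>X. ZS X la p q u v)"
    using linsys_exists[OF coeffs assms] by blast
  then have "\<exists>w. fst w 0 = c \<and> snd w 0 = d \<and> (\<forall>X. ZS X la p q (fst w) (snd w))"
    by (intro exI[of _ "(u, v)"]) simp
  from someI_ex[OF this] show "fst (sol la p q c d) 0 = c" "snd (sol la p q c d) 0 = d" "ZS X la p q (fst (sol la p q c d)) (snd (sol la p q c d))"
    unfolding sol_def by blast+
qed

lemma ZS_continuous: "ZS X la p q u v \<Longrightarrow> continuous_on {0..X} u" "ZS X la p q u v \<Longrightarrow> continuous_on {0..X} v"
  by (auto simp: linsys_def intro: ac_on_continuous)

text \<open>A column of the fundamental matrix and its first two Taylor coefficients in \<open>la\<close>. Differentiating the equation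
  in \<open>la\<close> shows that each coefficient solves the equation with the preceding one as inhomogeneous term.\<close>

definition col0 where "col0 la c d = sol la (\<lambda>t. 0) (\<lambda>t. 0) c d"
definition col1 where "col1 la c d = sol la (\<lambda>t. - \<i> * fst (col0 la c d) t) (\<lambda>t. \<i> * snd (col0 la c d) t) 0 0"
definition col2 where "col2 la c d = sol la (\<lambda>t. - \<i> * fst (col1 la c d) t) (\<lambda>t. \<i> * snd (col1 la c d) t) 0 0"

lemma col0: "fst (col0 la c d) 0 = c" "snd (col0 la c d) 0 = d"
  "ZS X la (\<lambda>t. 0) (\<lambda>t. 0) (fst (col0 la c d)) (snd (col0 la c d))"
  unfolding col0_def by (rule sol; simp)+

lemma col_forcing:
  assumes "\<And>X. ZS X la p q u v"
  shows "(\<lambda>t. - \<i> * u t) absint_on {0..X}" "(\<lambda>t. \<i> * v t) absint_on {0..X}"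
  by (intro continuous_absint continuous_intros ZS_continuous[OF assms])+

lemma col1: "fst (col1 la c d) 0 = 0" "snd (col1 la c d) 0 = 0"
  "ZS X la (\<lambda>t. - \<i> * fst (col0 la c d) t) (\<lambda>t. \<i> * snd (col0 la c d) t) (fst (col1 la c d)) (snd (col1 la c d))"
  unfolding col1_def by (rule sol; rule col_forcing[OF col0(3)])+

lemma col2: "fst (col2 la c d) 0 = 0" "snd (col2 la c d) 0 = 0"
  "ZS X la (\<lambda>t. - \<i> * fst (col1 la c d) t) (\<lambda>t. \<i> * snd (col1 la c d) t) (fst (col2 la c d)) (snd (col2 la c d))"
  unfolding col2_def by (rule sol; rule col_forcing[OF col1(3)])+

lemma ZS_unique:
  assumes "ZS X la p q u v" "ZS X la p q u' v'" "u 0 = u' 0" "v 0 = v' 0" "x \<in> {0..X}"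
  shows "u x = u' x \<and> v x = v' x"
  by (rule linsys_unique[OF assms(1,2) coeffs assms(3-5)])

lemma ZS_small:
  assumes Z: "ZS X la (\<lambda>x. - \<i> * t * a x) (\<lambda>x. \<i> * t * b x) u v" and "u 0 = 0" "v 0 = 0"
    and ab: "continuous_on {0..X} a" "continuous_on {0..X} b"
    and K: "\<And>x. x \<in> {0..X} \<Longrightarrow> norm (a x) + norm (b x) \<le> K" and x: "x \<in> {0..X}"
  shows "norm (u x) + norm (v x) \<le> (K * X * exp (integral {0..X} (CN la))) * norm t"
proof -
  have ai: "(\<lambda>x. - \<i> * t * a x) absint_on {0..X}" "(\<lambda>x. \<i> * t * b x) absint_on {0..X}"
    by (intro continuous_absint continuous_intros ab)+
  have "norm (u x) + norm (v x) \<le> (norm (u 0) + norm (v 0) + integral {0..X} (\<lambda>x. norm (- \<i> * t * a x) + norm (\<i> * t * b x))) * exp (integral {0..X} (CN la))"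
    by (rule linsys_bound[OF Z coeffs ai x])
  also have "integral {0..X} (\<lambda>x. norm (- \<i> * t * a x) + norm (\<i> * t * b x)) \<le> integral {0..X} (\<lambda>x. norm t * K)"
  proof (rule integral_le)
    show "(\<lambda>x. norm (- \<i> * t * a x) + norm (\<i> * t * b x)) integrable_on {0..X}"
      by (intro integrable_add absint_norm_int ai)
    show "norm (- \<i> * t * a x) + norm (\<i> * t * b x) \<le> norm t * K" if "x \<in> {0..X}" for x
      using mult_left_mono[OF K[OF that] norm_ge_zero[of t]] by (simp add: norm_mult distrib_left)
  qed auto
  also have "integral {0..X} (\<lambda>x. norm t * K) = X * norm t * K" using x by simp
  finally show ?thesis using assms(2,3) by (simp add: mult_ac)
qed

lemma expansion:
  assumes X: "X \<ge> 0"
  shows "\<exists>C. \<forall>t. norm t \<le> 1 \<longrightarrow> (\<forall>x\<in>{0..X}.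
    norm (fst (col0 (la + t) c d) x - fst (col0 la c d) x - t * fst (col1 la c d) x - t\<^sup>2 * fst (col2 la c d) x) \<le> C * norm t ^ 3 \<and>
    norm (snd (col0 (la + t) c d) x - snd (col0 la c d) x - t * snd (col1 la c d) x - t\<^sup>2 * snd (col2 la c d) x) \<le> C * norm t ^ 3)"
proof -
  let ?I = "integral {0..X} (\<lambda>t. norm (\<phi>1 t) + norm (\<phi>2 t))"
  define K0 where "K0 = (norm c + norm d) * exp (2 * (norm la + 1) * X + ?I)"
  define L where "L = X * exp (integral {0..X} (CN la))"
  let ?ua = "fst (col0 la c d)" and ?va = "snd (col0 la c d)"
  let ?ub = "fst (col1 la c d)" and ?vb = "snd (col1 la c d)"
  let ?uc = "fst (col2 la c d)" and ?vc = "snd (col2 la c d)"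
  show ?thesis
  proof (intro exI[of _ "K0 * L * L * L"] allI impI ballI)
    fix t :: complex and x :: real assume t: "norm t \<le> 1" and x: "x \<in> {0..X}"
    let ?u = "fst (col0 (la + t) c d)" and ?v = "snd (col0 (la + t) c d)"
    have bd: "norm (?u y) + norm (?v y) \<le> K0" if "y \<in> {0..X}" for y
    proof -
      have "norm (?u y) + norm (?v y) \<le> (norm c + norm d) * exp (integral {0..X} (CN (la + t)))"
        using linsys_bound[OF col0(3) coeffs _ _ that, of "la + t" c d] by (simp add: col0)
      also have "... \<le> K0" unfolding K0_def CN_integral[OF X]
        using t X norm_triangle_ineq[of la t] by (intro mult_left_mono) (auto intro!: mult_right_mono)
      finally show ?thesis .
    qed
    have Z0: "ZS X la (\<lambda>x. - \<i> * t * ?u x) (\<lambda>x. \<i> * t * ?v x) ?u ?v"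
      using col0(3)[of X "la + t" c d] unfolding linsys_def by (simp add: algebra_simps)
    have D0: "ZS X la (\<lambda>x. - \<i> * t * ?u x) (\<lambda>x. \<i> * t * ?v x) (\<lambda>x. ?u x - ?ua x) (\<lambda>x. ?v x - ?va x)"
      using linsys_diff[OF Z0 col0(3)[of X la c d]] by simp
    have D1: "ZS X la (\<lambda>x. - \<i> * t * (?u x - ?ua x)) (\<lambda>x. \<i> * t * (?v x - ?va x))
       (\<lambda>x. ?u x - ?ua x - t * ?ub x) (\<lambda>x. ?v x - ?va x - t * ?vb x)"
      using linsys_diff[OF D0 linsys_scale[OF col1(3)[of X la c d], of t]] by (simp add: algebra_simps)
    have D2: "ZS X la (\<lambda>x. - \<i> * t * (?u x - ?ua x - t * ?ub x)) (\<lambda>x. \<i> * t * (?v x - ?va x - t * ?vb x))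
       (\<lambda>x. ?u x - ?ua x - t * ?ub x - t\<^sup>2 * ?uc x) (\<lambda>x. ?v x - ?va x - t * ?vb x - t\<^sup>2 * ?vc x)"
      using linsys_diff[OF D1 linsys_scale[OF col2(3)[of X la c d], of "t\<^sup>2"]]
      by (simp add: algebra_simps power2_eq_square)
    have e0: "norm (?u y - ?ua y) + norm (?v y - ?va y) \<le> K0 * L * norm t" if "y \<in> {0..X}" for y
      using ZS_small[OF D0 _ _ _ _ bd that] col0 ZS_continuous[OF col0(3)]
      by (simp add: L_def mult_ac)
    have e1: "norm (?u y - ?ua y - t * ?ub y) + norm (?v y - ?va y - t * ?vb y) \<le> K0 * L * L * (norm t)\<^sup>2" if "y \<in> {0..X}" for y
      using ZS_small[OF D1 _ _ _ _ e0 that] col0 col1 ZS_continuous[OF D0]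
      by (simp add: L_def mult_ac power2_eq_square)
    have e2: "norm (?u x - ?ua x - t * ?ub x - t\<^sup>2 * ?uc x) + norm (?v x - ?va x - t * ?vb x - t\<^sup>2 * ?vc x) \<le> K0 * L * L * L * norm t ^ 3"
      using ZS_small[OF D2 _ _ _ _ e1 x] col0 col1 col2 ZS_continuous[OF D1]
      by (simp add: L_def mult_ac power2_eq_square power3_eq_cube)
    then show "norm (?u x - ?ua x - t * ?ub x - t\<^sup>2 * ?uc x) \<le> K0 * L * L * L * norm t ^ 3 \<and>
       norm (?v x - ?va x - t * ?vb x - t\<^sup>2 * ?vc x) \<le> K0 * L * L * L * norm t ^ 3"
      using norm_ge_zero[of "?u x - ?ua x - t * ?ub x - t\<^sup>2 * ?uc x"] norm_ge_zero[of "?v x - ?va x - t * ?vb x - t\<^sup>2 * ?vc x"]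
      by linarith
  qed
qed

lemma has_field_derivative_of_quadratic_error:
  fixes f :: "complex \<Rightarrow> complex"
  assumes "\<And>t. norm t \<le> 1 \<Longrightarrow> norm (f (la + t) - f la - t * a) \<le> C * (norm t)\<^sup>2"
  shows "(f has_field_derivative a) (at la)"
proof -
  have "((\<lambda>t. (f (la + t) - f la) / t - a) \<longlongrightarrow> 0) (at 0)"
  proof (rule Lim_null_comparison)
    show "((\<lambda>t::complex. C * norm t) \<longlongrightarrow> 0) (at 0)" by (auto intro!: tendsto_eq_intros)
    have "\<forall>\<^sub>F t :: complex in at 0. t \<in> ball 0 1 - {0}"
      by (rule eventually_at_in_open) auto
    then show "\<forall>\<^sub>F t in at 0. norm ((f (la + t) - f la) / t - a) \<le> C * norm t"
    proof eventually_elim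
      case (elim t)
      then have t: "t \<noteq> 0" "norm t \<le> 1" by auto
      have "norm ((f (la + t) - f la) / t - a) = norm (f (la + t) - f la - t * a) / norm t"
        using t by (simp add: field_simps flip: norm_divide)
      also have "... \<le> C * (norm t)\<^sup>2 / norm t" by (intro divide_right_mono assms t) auto
      finally show ?case using t by (simp add: power2_eq_square)
    qed
  qed
  then have "((\<lambda>t. (f (la + t) - f la) / t) \<longlongrightarrow> a) (at 0)" by (simp add: LIM_zero_iff)
  then show ?thesis by (simp add: DERIV_def)
qed

lemma col0_deriv:
  assumes "x \<ge> 0"
  shows "((\<lambda>la. fst (col0 la c d) x) has_field_derivative fst (col1 la c d) x) (at la)"
    "((\<lambda>la. snd (col0 la c d) x) has_field_derivative snd (col1 la c d) x) (at la)"
proof -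
  obtain C where C: "\<And>t. norm t \<le> 1 \<Longrightarrow>
    norm (fst (col0 (la + t) c d) x - fst (col0 la c d) x - t * fst (col1 la c d) x - t\<^sup>2 * fst (col2 la c d) x) \<le> C * norm t ^ 3 \<and>
    norm (snd (col0 (la + t) c d) x - snd (col0 la c d) x - t * snd (col1 la c d) x - t\<^sup>2 * snd (col2 la c d) x) \<le> C * norm t ^ 3"
    using expansion[OF assms, of la c d] assms by (metis atLeastAtMost_iff order_refl)
  have C': "C * norm t ^ 3 \<le> \<bar>C\<bar> * (norm t)\<^sup>2" if "norm t \<le> 1" for t :: complex
    using that by (intro mult_mono) (auto simp: power3_eq_cube power2_eq_square mult_left_le)
  have tri: "norm (a - b - c) \<le> E \<Longrightarrow> norm c = F \<Longrightarrow> norm (a - b) \<le> E + F" for a b c :: complex and E F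
    using norm_triangle_ineq[of "a - b - c" c] by simp
  show "((\<lambda>la. fst (col0 la c d) x) has_field_derivative fst (col1 la c d) x) (at la)"
  proof (rule has_field_derivative_of_quadratic_error)
    fix t :: complex assume t: "norm t \<le> 1"
    show "norm (fst (col0 (la + t) c d) x - fst (col0 la c d) x - t * fst (col1 la c d) x) \<le> (\<bar>C\<bar> + norm (fst (col2 la c d) x)) * (norm t)\<^sup>2"
      using tri[OF C[OF t, THEN conjunct1] refl] C'[OF t] by (simp add: norm_mult norm_power algebra_simps)
  qed
  show "((\<lambda>la. snd (col0 la c d) x) has_field_derivative snd (col1 la c d) x) (at la)"
  proof (rule has_field_derivative_of_quadratic_error)
    fix t :: complex assume t: "norm t \<le> 1"
    show "norm (snd (col0 (la + t) c d) x - snd (col0 la c d) x - t * snd (col1 la c d) x) \<le> (\<bar>C\<bar> + norm (snd (col2 la c d) x)) * (norm t)\<^sup>2"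
      using tri[OF C[OF t, THEN conjunct2] refl] C'[OF t] by (simp add: norm_mult norm_power algebra_simps)
  qed
qed

definition "m1 la = fst (col0 la 1 0)"
definition "m2 la = fst (col0 la 0 1)"
definition "m3 la = snd (col0 la 1 0)"
definition "m4 la = snd (col0 la 0 1)"

lemma m_init: "m1 la 0 = 1" "m2 la 0 = 0" "m3 la 0 = 0" "m4 la 0 = 1"
  by (auto simp: m1_def m2_def m3_def m4_def col0)

lemma m_ac:
  "ac_on X (m1 la) (\<lambda>t. - \<i> * la * m1 la t + \<i> * \<phi>1 t * m3 la t)"
  "ac_on X (m3 la) (\<lambda>t. - \<i> * \<phi>2 t * m1 la t + \<i> * la * m3 la t)"
  "ac_on X (m2 la) (\<lambda>t. - \<i> * la * m2 la t + \<i> * \<phi>1 t * m4 la t)"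
  "ac_on X (m4 la) (\<lambda>t. - \<i> * \<phi>2 t * m2 la t + \<i> * la * m4 la t)"
  using col0(3)[of X la 1 0] col0(3)[of X la 0 1]
  by (simp_all add: linsys_def m1_def m2_def m3_def m4_def)

lemma m_ZS: "ZS X la (\<lambda>t. 0) (\<lambda>t. 0) (m1 la) (m3 la)" "ZS X la (\<lambda>t. 0) (\<lambda>t. 0) (m2 la) (m4 la)"
  using col0(3) by (auto simp: m1_def m2_def m3_def m4_def)

lemma m_holomorphic:
  assumes "x \<ge> 0"
  shows "(\<lambda>la. m1 la x) holomorphic_on A" "(\<lambda>la. m2 la x) holomorphic_on A" "(\<lambda>la. m3 la x) holomorphic_on A" "(\<lambda>la. m4 la x) holomorphic_on A"
  unfolding holomorphic_on_def field_differentiable_def m1_def m2_def m3_def m4_def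
  using col0_deriv[OF assms] DERIV_subset by (meson subset_UNIV)+

text \<open>Links the matrix equation of \<open>is_fund_sol\<close> with the scalar systems used here.\<close>

lemma zs_equation_iff:
  fixes M D :: "complex^2^2"
  shows "zs_J ** D + zs_pot \<phi>1 \<phi>2 x ** M = mat la ** M \<longleftrightarrow>
    (\<forall>j. D $ 1 $ j = - \<i> * la * M $ 1 $ j + \<i> * \<phi>1 x * M $ 2 $ j \<and>
         D $ 2 $ j = - \<i> * \<phi>2 x * M $ 1 $ j + \<i> * la * M $ 2 $ j)"
proof -
  have i1: "\<i> * a + b = c \<longleftrightarrow> a = - \<i> * c + \<i> * b" for a b c :: complex
  proof
    assume "\<i> * a + b = c"
    then show "a = - \<i> * c + \<i> * b" by (auto simp: algebra_simps)
  next
    assume "a = - \<i> * c + \<i> * b"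
    then show "\<i> * a + b = c" by (simp only:) (simp add: algebra_simps)
  qed
  have i2: "- \<i> * a + b = c \<longleftrightarrow> a = - \<i> * b + \<i> * c" for a b c :: complex
  proof
    assume h: "- \<i> * a + b = c"
    show "a = - \<i> * b + \<i> * c" unfolding h[symmetric] by (simp add: algebra_simps)
  next
    assume "a = - \<i> * b + \<i> * c"
    then show "- \<i> * a + b = c" by (simp only:) (simp add: algebra_simps)
  qed
  have c1: "(zs_J ** D) $ 1 $ j = \<i> * D $ 1 $ j" "(zs_J ** D) $ 2 $ j = - \<i> * D $ 2 $ j" for j
    by (simp_all add: matrix_matrix_mult_def zs_J_def sum_2)
  have c2: "(zs_pot \<phi>1 \<phi>2 x ** M) $ 1 $ j = \<phi>1 x * M $ 2 $ j" "(zs_pot \<phi>1 \<phi>2 x ** M) $ 2 $ j = \<phi>2 x * M $ 1 $ j" for j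
    by (simp_all add: matrix_matrix_mult_def zs_pot_def sum_2)
  have c3: "(mat la ** M) $ 1 $ j = la * M $ 1 $ j" "(mat la ** M) $ 2 $ j = la * M $ 2 $ j" for j
    by (simp_all add: matrix_matrix_mult_def mat_def sum_2)
  show ?thesis
    unfolding vec_eq_iff forall_2 vector_add_component c1 c2 c3
    using i1[of "D $ 1 $ 1" "\<phi>1 x * M $ 2 $ 1" "la * M $ 1 $ 1"] i1[of "D $ 1 $ 2" "\<phi>1 x * M $ 2 $ 2" "la * M $ 1 $ 2"]
      i2[of "D $ 2 $ 1" "\<phi>2 x * M $ 1 $ 1" "la * M $ 2 $ 1"] i2[of "D $ 2 $ 2" "\<phi>2 x * M $ 1 $ 2" "la * M $ 2 $ 2"]
    by (simp only: mult.assoc) blast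
qed

lemma fund_sol_exists:
  "is_fund_sol \<phi>1 \<phi>2 la (\<lambda>x. vector [vector [m1 la x, m2 la x], vector [m3 la x, m4 la x]])"
proof -
  define e :: "2 \<Rightarrow> 2 \<Rightarrow> complex \<Rightarrow> complex^2^2" where
    "e i j z = (\<chi> k l. if k = i \<and> l = j then z else 0)" for i j z
  have e: "bounded_linear (e i j)" for i j
  proof -
    have "linear (e i j)"
      by (rule linearI) (auto simp: e_def vec_eq_iff)
    then show ?thesis by (simp add: linear_conv_bounded_linear)
  qed
  have ev: "vector [vector [a, b], vector [c, d]] = e 1 1 a + e 1 2 b + (e 2 1 c + e 2 2 d)" for a b c d
    by (simp add: vec_eq_iff forall_2 e_def)
  define D where "D t = (vector [vector [- \<i> * la * m1 la t + \<i> * \<phi>1 t * m3 la t, - \<i> * la * m2 la t + \<i> * \<phi>1 t * m4 la t],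
     vector [- \<i> * \<phi>2 t * m1 la t + \<i> * la * m3 la t, - \<i> * \<phi>2 t * m2 la t + \<i> * la * m4 la t]] :: complex^2^2)" for t
  let ?M = "\<lambda>x. vector [vector [m1 la x, m2 la x], vector [m3 la x, m4 la x]] :: complex^2^2"
  have ac: "ac_on X ?M D" for X
    unfolding ev D_def
    by (intro ac_on_add ac_on_bounded_linear[OF e] m_ac)
  have M0: "?M 0 = mat 1" by (simp add: m_init vec_eq_iff forall_2 mat_def)
  show ?thesis unfolding is_fund_sol_def
  proof (intro exI[of _ D] conjI allI impI)
    fix x :: real assume x: "x \<ge> 0"
    show s: "set_integrable lebesgue {0..x} D" by (rule ac_on_integrable[OF ac])
    show "?M x = mat 1 + (LINT t:{0..x}|lebesgue. D t)"
      using ac_on_eq[OF ac x order_refl] M0 set_lebesgue_integral_eq_integral(2)[OF s] by simp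
  next
    show "AE x in lebesgue. x \<ge> 0 \<longrightarrow> zs_J ** D x + zs_pot \<phi>1 \<phi>2 x ** ?M x = mat la ** ?M x"
      by (intro always_eventually allI impI) (simp add: zs_equation_iff forall_2 D_def)
  qed
qed

lemma fund_sol_entries:
  assumes "x \<ge> 0"
  shows "fund_sol \<phi>1 \<phi>2 la x = vector [vector [m1 la x, m2 la x], vector [m3 la x, m4 la x]]"
proof -
  let ?M = "fund_sol \<phi>1 \<phi>2 la"
  have "is_fund_sol \<phi>1 \<phi>2 la ?M"
    unfolding fund_sol_def by (rule someI[where P="is_fund_sol \<phi>1 \<phi>2 la", OF fund_sol_exists])
  then obtain D where D: "\<And>x. x \<ge> 0 \<Longrightarrow> set_integrable lebesgue {0..x} D \<and> ?M x = mat 1 + (LINT t:{0..x}|lebesgue. D t)"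
    and eq: "AE x in lebesgue. x \<ge> 0 \<longrightarrow> zs_J ** D x + zs_pot \<phi>1 \<phi>2 x ** ?M x = mat la ** ?M x"
    unfolding is_fund_sol_def by blast
  have Mx: "?M y = mat 1 + integral {0..y} D" if "y \<ge> 0" for y
    using D[OF that] set_lebesgue_integral_eq_integral(2)[of "{0..y}" D] by simp
  have M0: "?M 0 = mat 1" using Mx[of 0] by simp
  have ac: "ac_on x ?M D"
    by (rule ac_onI) (use D[OF assms] Mx M0 in auto)
  have bl: "bounded_linear (\<lambda>M::complex^2^2. M $ i $ j)" for i j
  proof -
    have "linear (\<lambda>M::complex^2^2. M $ i $ j)" by (rule linearI) auto
    then show ?thesis by (simp add: linear_conv_bounded_linear)
  qed
  have "ZS x la (\<lambda>t. 0) (\<lambda>t. 0) (\<lambda>y. ?M y $ 1 $ j) (\<lambda>y. ?M y $ 2 $ j)" for j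
    unfolding linsys_def
  proof (intro conjI)
    show "ac_on x (\<lambda>y. ?M y $ 1 $ j) (\<lambda>t. - \<i> * la * ?M t $ 1 $ j + \<i> * \<phi>1 t * ?M t $ 2 $ j + 0)"
      by (rule ac_on_AE[OF ac_on_bounded_linear[OF bl ac]], use eq in eventually_elim) (auto simp: zs_equation_iff)
    show "ac_on x (\<lambda>y. ?M y $ 2 $ j) (\<lambda>t. - \<i> * \<phi>2 t * ?M t $ 1 $ j + \<i> * la * ?M t $ 2 $ j + 0)"
      by (rule ac_on_AE[OF ac_on_bounded_linear[OF bl ac]], use eq in eventually_elim) (auto simp: zs_equation_iff)
  qed
  note Z = this
  have "?M x $ 1 $ 1 = m1 la x \<and> ?M x $ 2 $ 1 = m3 la x"
    by (rule ZS_unique[OF Z m_ZS(1)]) (use assms in \<open>auto simp: M0 m_init mat_def\<close>)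
  moreover have "?M x $ 1 $ 2 = m2 la x \<and> ?M x $ 2 $ 2 = m4 la x"
    by (rule ZS_unique[OF Z m_ZS(2)]) (use assms in \<open>auto simp: M0 m_init mat_def\<close>)
  ultimately show ?thesis by (simp add: vec_eq_iff forall_2)
qed

lemma discr_eq: "\<Delta> la = m1 la 1 + m4 la 1"
  by (simp add: discr_def fund_sol_entries)

lemma discr_holomorphic: "\<Delta> holomorphic_on A"
  unfolding discr_eq[abs_def] by (intro holomorphic_intros m_holomorphic) auto

lemma wronskian:
  assumes "x \<ge> 0" shows "m1 la x * m4 la x - m2 la x * m3 la x = 1"
proof -
  have "ac_on x (\<lambda>x. m1 la x * m4 la x - m2 la x * m3 la x) (\<lambda>t. 0)"
    by (rule ac_on_cong[OF ac_on_diff[OF ac_on_mult[OF m_ac(1,4)] ac_on_mult[OF m_ac(3,2)]]])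
       (auto simp: algebra_simps)
  from ac_on_eq[OF this assms order_refl] show ?thesis by (simp add: m_init)
qed

lemma linsys_shift:
  assumes "linsys (X + s) a b c d p q u v" "s \<ge> 0"
  shows "linsys X (\<lambda>t. a (t + s)) (\<lambda>t. b (t + s)) (\<lambda>t. c (t + s)) (\<lambda>t. d (t + s)) (\<lambda>t. p (t + s)) (\<lambda>t. q (t + s)) (\<lambda>t. u (t + s)) (\<lambda>t. v (t + s))"
  using assms ac_on_shift[of X s] unfolding linsys_def by blast

lemma ZS_shift: "ZS (X + 1) la (\<lambda>t. 0) (\<lambda>t. 0) u v \<Longrightarrow> ZS X la (\<lambda>t. 0) (\<lambda>t. 0) (\<lambda>t. u (t + 1)) (\<lambda>t. v (t + 1))"
  using linsys_shift[of X 1] per1 per2 unfolding periodic_L2_def by fastforce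

lemma ZS_combination:
  assumes "ZS X la (\<lambda>t. 0) (\<lambda>t. 0) u v" "x \<in> {0..X}"
  shows "u x = m1 la x * u 0 + m2 la x * v 0 \<and> v x = m3 la x * u 0 + m4 la x * v 0"
proof -
  have "ZS X la (\<lambda>t. 0) (\<lambda>t. 0) (\<lambda>x. u 0 * m1 la x + v 0 * m2 la x) (\<lambda>x. u 0 * m3 la x + v 0 * m4 la x)"
    using linsys_add[OF linsys_scale[OF m_ZS(1)[of X la], of "u 0"] linsys_scale[OF m_ZS(2)[of X la], of "v 0"]] by simp
  from ZS_unique[OF assms(1) this _ _ assms(2)] show ?thesis by (simp add: m_init mult_ac)
qed

lemma m_period2:
  "m1 la 2 = m1 la 1 * m1 la 1 + m2 la 1 * m3 la 1" "m3 la 2 = m3 la 1 * m1 la 1 + m4 la 1 * m3 la 1"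
  "m2 la 2 = m1 la 1 * m2 la 1 + m2 la 1 * m4 la 1" "m4 la 2 = m3 la 1 * m2 la 1 + m4 la 1 * m4 la 1"
  using ZS_combination[OF ZS_shift[OF m_ZS(1)[of "1+1" la]], of 1]
    ZS_combination[OF ZS_shift[OF m_ZS(2)[of "1+1" la]], of 1] by simp_all

lemma trace_period2: "m1 la 2 + m4 la 2 = (\<Delta> la)\<^sup>2 - 2"
  using wronskian[of 1 la] unfolding discr_eq m_period2 by (simp add: power2_eq_square algebra_simps) 

text \<open>As \<open>M(1)\<close> has determinant 1 and \<open>M(2) = M(1)\<^sup>2\<close>, the determinant of \<open>M(2) - 1\<close> is
  \<open>(2 - tr M(1)) * (2 + tr M(1))\<close>.\<close>

lemma det_period2: "(m1 la 2 - 1) * (m4 la 2 - 1) - m2 la 2 * m3 la 2 = 4 - (\<Delta> la)\<^sup>2"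
  using wronskian[of 2 la] trace_period2[of la] by (simp add: algebra_simps)

end

section \<open>Root functions as solutions of differential equations\<close>

lemma continuous_AE_zero:
  fixes h :: cfun
  assumes T: "T > 0" and c: "continuous_on {0..T} h" and ae: "AE x in lebesgue. x \<in> {0..T} \<longrightarrow> h x = 0"
    and x: "x \<in> {0..T}"
  shows "h x = 0"
proof -
  have c2: "continuous_on {0..T} (\<lambda>x. (norm (h x))\<^sup>2)" by (intro continuous_intros c)
  have "integral {0..T} (\<lambda>x. (norm (h x))\<^sup>2) = integral {0..T} (\<lambda>x. 0)"
    by (rule AE_integral_eq, use ae in eventually_elim) auto
  then have "\<forall>x\<in>{0..T}. (norm (h x))\<^sup>2 = 0"
    by (subst integral_eq_0_iff[OF c2 T, symmetric]) auto
  then show ?thesis using x by auto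
qed

lemma AE_periodic:
  assumes T: "T > 0" and ae: "AE x in lebesgue. x \<in> {0..T} \<longrightarrow> P x" and per: "\<And>x::real. P (x + T) \<longleftrightarrow> P x"
  shows "AE x in lebesgue. P x"
proof -
  obtain N where N: "negligible N" "{x. \<not> (x \<in> {0..T} \<longrightarrow> P x)} \<subseteq> N"
    using ae unfolding eventually_ae_filter_negligible by blast
  have "negligible (\<Union>k::int. (+) (of_int k * T) ` N)"
    by (rule negligible_countable_Union) (auto intro: negligible_translation N)
  moreover have "{x. \<not> P x} \<subseteq> (\<Union>k::int. (+) (of_int k * T) ` N)"
  proof
    fix x assume "x \<in> {x. \<not> P x}"
    define k where "k = \<lfloor>x / T\<rfloor>"
    have "of_int k * T \<le> x" "x \<le> of_int k * T + T"
    proof -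
      show "of_int k * T \<le> x" using T unfolding k_def by (simp add: pos_le_divide_eq[symmetric])
      have "x < (of_int k + 1) * T" using T unfolding k_def by (simp add: pos_divide_less_eq[symmetric])
      then show "x \<le> of_int k * T + T" by (simp add: algebra_simps)
    qed
    moreover have "P (x - of_int k * T) = P x"
      using periodic_int[of P T x "-k"] per by simp
    ultimately have "x - of_int k * T \<in> N" using N(2) \<open>x \<in> {x. \<not> P x}\<close> by (auto simp: subset_eq)
    then show "x \<in> (\<Union>k::int. (+) (of_int k * T) ` N)" by (force intro!: image_eqI[of _ _ "x - of_int k * T"])
  qed
  ultimately show ?thesis unfolding eventually_ae_filter_negligible by blast
qed

lemma linsys_cong:
  assumes "linsys X a b c d p q u v" "\<And>x. x \<in> {0..X} \<Longrightarrow> p' x = p x \<and> q' x = q x \<and> u' x = u x \<and> v' x = v x"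
  shows "linsys X a b c d p' q' u' v'"
  unfolding linsys_def
proof
  show "ac_on X u' (\<lambda>t. a t * u' t + b t * v' t + p' t)"
    by (rule ac_on_cong[OF conjunct1[OF assms(1)[unfolded linsys_def]]]) (simp_all add: assms(2))
  show "ac_on X v' (\<lambda>t. c t * u' t + d t * v' t + q' t)"
    by (rule ac_on_cong[OF conjunct2[OF assms(1)[unfolded linsys_def]]]) (simp_all add: assms(2))
qed

lemma weak_deriv_spec:
  assumes "periodic_L2 T g" "has_weak_deriv T f g"
  shows "periodic_L2 T (weak_deriv T f) \<and> has_weak_deriv T f (weak_deriv T f)"
  using someI[of "\<lambda>g. periodic_L2 T g \<and> has_weak_deriv T f g" g] assms by (simp add: weak_deriv_def)

context zs
begin

abbreviation "Ker \<equiv> zs_ker \<phi>1 \<phi>2"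

text \<open>Candidates for root functions; the differential equation supplies the differentiability that \<open>zs_dom\<close> asks for.\<close>

definition Per2 :: "(real \<Rightarrow> complex^2) set" where
  "Per2 = {F. continuous_on UNIV F \<and> (\<forall>x. F (x + 2) = F x)}"

abbreviation ZSv :: "complex \<Rightarrow> (real \<Rightarrow> complex^2) \<Rightarrow> (real \<Rightarrow> complex^2) \<Rightarrow> bool" where
  "ZSv la G F \<equiv> ZS 2 la (\<lambda>t. - \<i> * G t $ 1) (\<lambda>t. \<i> * G t $ 2) (\<lambda>t. F t $ 1) (\<lambda>t. F t $ 2)"

lemma Per2_component: "F \<in> Per2 \<Longrightarrow> continuous_on A (\<lambda>x. F x $ j)"
  unfolding Per2_def by (auto intro!: continuous_intros intro: continuous_on_subset)

lemma zs_dom_ac: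
  fixes F :: "real \<Rightarrow> complex^2"
  assumes "F \<in> zs_dom"
  shows "F \<in> Per2" "ac_on 2 (\<lambda>x. F x $ j) (weak_deriv 2 (\<lambda>t. F t $ j))"
proof -
  have c: "continuous_on UNIV F" and s: "\<And>j. sobolev 2 1 (\<lambda>x. F x $ j)"
    using assms by (auto simp: zs_dom_def)
  have s': "periodic_L2 2 (\<lambda>x. F x $ j) \<and> (\<exists>g. periodic_L2 2 g \<and> has_weak_deriv 2 (\<lambda>x. F x $ j) g)" for j
    using s[of j] by (simp add: One_nat_def)
  show P: "F \<in> Per2" using c s' by (auto simp: Per2_def periodic_L2_def vec_eq_iff)
  let ?f = "\<lambda>x. F x $ j" and ?w = "weak_deriv 2 (\<lambda>t. F t $ j)"
  have w: "periodic_L2 2 ?w \<and> has_weak_deriv 2 ?f ?w"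
    using s'[of j] weak_deriv_spec by blast
  have fi: "?f absint_on {0..2}" and wi: "?w absint_on {0..2}"
    using s'[of j] w by (auto intro!: periodic_L2_absint[of 2])
  obtain c where ae: "AE x in lebesgue. x \<in> {0..2} \<longrightarrow> ?f x = c + integral {0..x} ?w"
    using du_bois_reymond(2)[OF _ fi wi] w by auto
  have ac: "ac_on 2 (\<lambda>x. c + integral {0..x} ?w) ?w" by (rule ac_on_indefinite[OF wi])
  have "?f x - (c + integral {0..x} ?w) = 0" if "x \<in> {0..2}" for x
    by (rule continuous_AE_zero[of 2 "\<lambda>x. ?f x - (c + integral {0..x} ?w)"])
       (use that ae in \<open>auto intro!: continuous_on_diff Per2_component[OF P] ac_on_continuous[OF ac]\<close>)
  then show "ac_on 2 ?f ?w" by (intro ac_on_cong[OF ac]) auto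
qed

lemma zs_op_entries:
  "(zs_op \<phi>1 \<phi>2 F x - la *s F x) $ 1 = \<i> * weak_deriv 2 (\<lambda>t. F t $ 1) x + \<phi>1 x * F x $ 2 - la * F x $ 1"
  "(zs_op \<phi>1 \<phi>2 F x - la *s F x) $ 2 = - \<i> * weak_deriv 2 (\<lambda>t. F t $ 2) x + \<phi>2 x * F x $ 1 - la * F x $ 2"
  by (simp_all add: zs_op_def zs_J_def zs_pot_def matrix_vector_mult_def sum_2)

lemma zs_op_imp_ZS:
  fixes F G :: "real \<Rightarrow> complex^2"
  assumes F: "F \<in> zs_dom" and eq: "AE x in lebesgue. zs_op \<phi>1 \<phi>2 F x - la *s F x = G x"
  shows "ZSv la G F"
proof -
  have e: "AE x in lebesgue. \<i> * weak_deriv 2 (\<lambda>t. F t $ 1) x + \<phi>1 x * F x $ 2 - la * F x $ 1 = G x $ 1 \<and>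
     - \<i> * weak_deriv 2 (\<lambda>t. F t $ 2) x + \<phi>2 x * F x $ 1 - la * F x $ 2 = G x $ 2"
    using eq by eventually_elim (metis zs_op_entries)
  show ?thesis unfolding linsys_def
  proof (intro conjI)
    show "ac_on 2 (\<lambda>t. F t $ 1) (\<lambda>t. - \<i> * la * F t $ 1 + \<i> * \<phi>1 t * F t $ 2 + - \<i> * G t $ 1)"
    proof (rule ac_on_AE[OF zs_dom_ac(2)[OF F]], use e in eventually_elim, elim conjE)
      fix x assume h: "\<i> * weak_deriv 2 (\<lambda>t. F t $ 1) x + \<phi>1 x * F x $ 2 - la * F x $ 1 = G x $ 1"
      show "x \<in> {0..2} \<longrightarrow> - \<i> * la * F x $ 1 + \<i> * \<phi>1 x * F x $ 2 + - \<i> * G x $ 1 = weak_deriv 2 (\<lambda>t. F t $ 1) x"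
        unfolding h[symmetric] by (simp add: algebra_simps)
    qed
    show "ac_on 2 (\<lambda>t. F t $ 2) (\<lambda>t. - \<i> * \<phi>2 t * F t $ 1 + \<i> * la * F t $ 2 + \<i> * G t $ 2)"
    proof (rule ac_on_AE[OF zs_dom_ac(2)[OF F]], use e in eventually_elim, elim conjE)
      fix x assume h: "- \<i> * weak_deriv 2 (\<lambda>t. F t $ 2) x + \<phi>2 x * F x $ 1 - la * F x $ 2 = G x $ 2"
      show "x \<in> {0..2} \<longrightarrow> - \<i> * \<phi>2 x * F x $ 1 + \<i> * la * F x $ 2 + \<i> * G x $ 2 = weak_deriv 2 (\<lambda>t. F t $ 2) x"
        unfolding h[symmetric] by (simp add: algebra_simps)
    qed
  qed
qed

lemma phi_periodic2: "\<phi>1 (x + 2) = \<phi>1 x" "\<phi>2 (x + 2) = \<phi>2 x"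
proof -
  have "\<phi>1 (x + 1 + 1) = \<phi>1 x" "\<phi>2 (x + 1 + 1) = \<phi>2 x"
    using per1 per2 by (simp_all only: periodic_L2_def)
  then show "\<phi>1 (x + 2) = \<phi>1 x" "\<phi>2 (x + 2) = \<phi>2 x" by (simp_all add: add.assoc)
qed

lemma periodic_L2_affine:
  assumes phi: "periodic_L2 1 \<phi>" "\<And>x. \<phi> (x + 2) = \<phi> x"
    and ab: "continuous_on UNIV a" "continuous_on UNIV b" "\<And>x. a (x + 2) = a x" "\<And>x. b (x + 2) = b x"
  shows "periodic_L2 2 (\<lambda>x. a x + \<phi> x * b x)"
proof -
  obtain A where A: "\<And>x. x \<in> {0..2} \<Longrightarrow> norm (a x) \<le> A"
    using continuous_on_Icc_bounded[OF continuous_on_subset[OF ab(1) subset_UNIV], of 0 2] by blast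
  obtain B where B: "\<And>x. x \<in> {0..2} \<Longrightarrow> norm (b x) \<le> B"
    using continuous_on_Icc_bounded[OF continuous_on_subset[OF ab(2) subset_UNIV], of 0 2] by blast
  have meas: "(\<lambda>x. a x + \<phi> x * b x) \<in> borel_measurable lebesgue"
  proof -
    have "a \<in> borel_measurable lebesgue" "b \<in> borel_measurable lebesgue"
      using ab by (simp_all add: borel_measurable_continuous_onI measurable_completion)
    moreover have "\<phi> \<in> borel_measurable lebesgue" using phi(1) by (simp add: periodic_L2_def)
    ultimately show ?thesis by (intro borel_measurable_add borel_measurable_times)
  qed
  have phi2: "(\<lambda>x. (norm (\<phi> x))\<^sup>2) absint_on {0..2}"
    by (rule periodic_absint[of 1]) (use phi(1) in \<open>auto simp: periodic_L2_def\<close>)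
  have i: "(\<lambda>x. 2 * A\<^sup>2 + 2 * B\<^sup>2 * (norm (\<phi> x))\<^sup>2) integrable_on {0..2}"
    by (intro integrable_add integrable_on_mult_right absint_int[OF phi2]) auto
  have "(\<lambda>x. (norm (a x + \<phi> x * b x))\<^sup>2) absint_on {0..2}"
  proof (rule measurable_bounded_by_integrable_imp_absolutely_integrable[OF _ _ i])
    show "(\<lambda>x. (norm (a x + \<phi> x * b x))\<^sup>2) \<in> borel_measurable (lebesgue_on {0..2})"
      by (intro measurable_restrict_space1 measurable_compose[OF meas, of "\<lambda>z. (norm z)\<^sup>2"]
          borel_measurable_continuous_onI continuous_intros)
    fix x :: real assume x: "x \<in> {0..2}"
    have "norm (a x + \<phi> x * b x) \<le> A + norm (\<phi> x) * B"
      using A[OF x] B[OF x] by (intro order_trans[OF norm_triangle_ineq] add_mono) (auto simp: norm_mult intro: mult_left_mono)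
    then have "(norm (a x + \<phi> x * b x))\<^sup>2 \<le> (A + norm (\<phi> x) * B)\<^sup>2" by (intro power_mono) auto
    also have "... \<le> 2 * A\<^sup>2 + 2 * B\<^sup>2 * (norm (\<phi> x))\<^sup>2"
      using zero_le_power2[of "A - norm (\<phi> x) * B"] by (simp add: power2_eq_square algebra_simps)
    finally show "norm ((norm (a x + \<phi> x * b x))\<^sup>2) \<le> 2 * A\<^sup>2 + 2 * B\<^sup>2 * (norm (\<phi> x))\<^sup>2" by simp
  qed auto
  then show ?thesis using meas ab phi(2) by (simp add: periodic_L2_def)
qed

lemma ZS_imp_zs_op:
  fixes F G :: "real \<Rightarrow> complex^2"
  assumes F: "F \<in> Per2" and G: "G \<in> Per2" and Z: "ZSv la G F"
  shows "F \<in> zs_dom" "AE x in lebesgue. zs_op \<phi>1 \<phi>2 F x - la *s F x = G x"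
proof -
  define g1 where "g1 x = (- \<i> * la * F x $ 1 - \<i> * G x $ 1) + \<phi>1 x * (\<i> * F x $ 2)" for x
  define g2 where "g2 x = (\<i> * la * F x $ 2 + \<i> * G x $ 2) + \<phi>2 x * (- \<i> * F x $ 1)" for x
  have per: "F (x + 2) = F x" "G (x + 2) = G x" for x using F G by (auto simp: Per2_def)
  have ac1: "ac_on 2 (\<lambda>t. F t $ 1) g1"
    by (rule ac_on_cong[OF conjunct1[OF Z[unfolded linsys_def]]]) (simp_all add: g1_def algebra_simps)
  have ac2: "ac_on 2 (\<lambda>t. F t $ 2) g2"
    by (rule ac_on_cong[OF conjunct2[OF Z[unfolded linsys_def]]]) (simp_all add: g2_def algebra_simps)
  have p1: "periodic_L2 2 g1" unfolding g1_def
    by (rule periodic_L2_affine[OF per1]) (auto intro!: continuous_intros Per2_component F G simp: per phi_periodic2)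
  have p2: "periodic_L2 2 g2" unfolding g2_def
    by (rule periodic_L2_affine[OF per2]) (auto intro!: continuous_intros Per2_component F G simp: per phi_periodic2)
  have F02: "F 0 = F 2" using per[of 0] by simp
  have w1: "has_weak_deriv 2 (\<lambda>t. F t $ 1) g1" by (rule weak_deriv_of_ac[OF _ ac1]) (use F02 in auto)
  have w2: "has_weak_deriv 2 (\<lambda>t. F t $ 2) g2" by (rule weak_deriv_of_ac[OF _ ac2]) (use F02 in auto)
  have pF: "periodic_L2 2 (\<lambda>x. F x $ j)" for j
    using periodic_L2_affine[OF per1, of "\<lambda>x. F x $ j" "\<lambda>x. 0"] phi_periodic2 per by (auto intro: Per2_component[OF F])
  have s: "sobolev 2 1 (\<lambda>x. F x $ 1)" "sobolev 2 1 (\<lambda>x. F x $ 2)"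
    using pF p1 p2 w1 w2 by (auto simp: One_nat_def)
  show dom: "F \<in> zs_dom" using s F by (auto simp: zs_dom_def Per2_def forall_2)
  have uniq: "AE x in lebesgue. weak_deriv 2 f x = g x"
    if f: "periodic_L2 2 f" and g: "periodic_L2 2 g" and w: "has_weak_deriv 2 f g" for f g
  proof (rule AE_periodic[of 2])
    have *: "periodic_L2 2 (weak_deriv 2 f) \<and> has_weak_deriv 2 f (weak_deriv 2 f)"
      by (rule weak_deriv_spec[OF g w])
    show "AE x in lebesgue. x \<in> {0..2} \<longrightarrow> weak_deriv 2 f x = g x"
      by (rule weak_deriv_unique_AE[OF _ periodic_L2_absint[OF _ f] periodic_L2_absint[OF _ conjunct1[OF *]]
            periodic_L2_absint[OF _ g] conjunct2[OF *] w]) auto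
    show "(weak_deriv 2 f (x + 2) = g (x + 2)) = (weak_deriv 2 f x = g x)" for x
      using * g by (simp add: periodic_L2_def)
  qed simp
  show "AE x in lebesgue. zs_op \<phi>1 \<phi>2 F x - la *s F x = G x"
    using uniq[OF pF p1 w1] uniq[OF pF p2 w2]
    by eventually_elim (simp add: vec_eq_iff forall_2 zs_op_entries del: vector_minus_component, simp add: g1_def g2_def algebra_simps)
qed

lemma zs_ker_Per2: "Ker la k \<subseteq> Per2"
  by (cases k) (auto simp: Per2_def[of] zs_dom_ac(1) dest: zs_dom_ac(1))

text \<open>Root spaces become chains of inhomogeneous differential equations with periodic solutions.\<close>

lemma zs_ker_Suc_iff:
  "F \<in> Ker la (Suc k) \<longleftrightarrow> F \<in> Per2 \<and> (\<exists>G\<in>Ker la k. ZSv la G F)"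
proof
  assume "F \<in> Ker la (Suc k)"
  then obtain G where "F \<in> zs_dom" "G \<in> Ker la k" "AE x in lebesgue. zs_op \<phi>1 \<phi>2 F x - la *s F x = G x"
    by auto
  then show "F \<in> Per2 \<and> (\<exists>G\<in>Ker la k. ZSv la G F)"
    using zs_dom_ac(1)[of F] zs_op_imp_ZS[of F la G] by blast
next
  assume "F \<in> Per2 \<and> (\<exists>G\<in>Ker la k. ZSv la G F)"
  then obtain G where F: "F \<in> Per2" and G: "G \<in> Ker la k" and Z: "ZSv la G F" by blast
  have "G \<in> Per2" using G zs_ker_Per2 by blast
  from ZS_imp_zs_op[OF F this Z] G show "F \<in> Ker la (Suc k)"
    unfolding zs_ker.simps by blast
qed

lemma Per2_ext:
  assumes "F \<in> Per2" "G \<in> Per2" "\<And>x. x \<in> {0..2} \<Longrightarrow> F x = G x"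
  shows "F = G"
proof
  fix x :: real
  define k where "k = \<lfloor>x / 2\<rfloor>"
  have "of_int k \<le> x / 2" "x / 2 < of_int k + 1" using floor_correct[of "x / 2"] by (simp_all add: k_def)
  then have "x - of_int k * 2 \<in> {0..2}" by auto
  moreover have "F (x + of_int (-k) * 2) = F x" "G (x + of_int (-k) * 2) = G x"
    using assms periodic_int[of F 2 x "-k"] periodic_int[of G 2 x "-k"] by (auto simp: Per2_def)
  ultimately show "F x = G x" using assms(3)[of "x - of_int k * 2"] by simp
qed

lemma Per2_exists:
  assumes "continuous_on {0..2} u" "continuous_on {0..2} v" "u 0 = u 2" "v 0 = v 2"
  shows "\<exists>F\<in>Per2. \<forall>x\<in>{0..2}. F x $ 1 = u x \<and> F x $ 2 = v x"
proof -
  obtain e1 where e1: "\<And>x. e1 (x + 2) = e1 x" "continuous_on UNIV e1" "\<And>x. x \<in> {0..2} \<Longrightarrow> e1 x = u x"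
    using exists_periodic_extension[OF zero_less_numeral assms(1,3)] by blast
  obtain e2 where e2: "\<And>x. e2 (x + 2) = e2 x" "continuous_on UNIV e2" "\<And>x. x \<in> {0..2} \<Longrightarrow> e2 x = v x"
    using exists_periodic_extension[OF zero_less_numeral assms(2,4)] by blast
  have "continuous_on UNIV (\<lambda>x. (\<chi> i. if i = 1 then e1 x else e2 x) :: complex^2)"
  proof (rule continuous_on_vec_lambda)
    show "continuous_on UNIV (\<lambda>x. if i = 1 then e1 x else e2 x)" for i :: 2
      using e1(2) e2(2) by (cases "i = 1") auto
  qed
  then show ?thesis using e1 e2
    by (intro bexI[of _ "\<lambda>x. (\<chi> i. if i = 1 then e1 x else e2 x)"]) (auto simp: Per2_def)
qed

lemma Per2_linear: "F \<in> Per2 \<Longrightarrow> G \<in> Per2 \<Longrightarrow> (\<lambda>x. z *s F x + w *s G x) \<in> Per2"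
  unfolding Per2_def vector_scalar_mult_def by (auto intro!: continuous_intros)

lemma ZSv_linear:
  fixes F G F' G' :: "real \<Rightarrow> complex^2"
  assumes "ZSv la G F" "ZSv la G' F'"
  shows "ZSv la (\<lambda>x. z *s G x + w *s G' x) (\<lambda>x. z *s F x + w *s F' x)"
  by (rule linsys_cong[OF linsys_add[OF linsys_scale[OF assms(1), of z] linsys_scale[OF assms(2), of w]]])
     (simp add: algebra_simps)

text \<open>Taylor coefficients in \<open>la\<close> of the entries of \<open>A = M(2) - 1\<close> and, in \<open>D0\<close>, \<open>D1\<close>, \<open>D2\<close>, of its determinant.
  The functions \<open>f1\<close>, ..., \<open>h2\<close> are the corresponding coefficients of \<open>M(x)\<close>, applied to the vector \<open>(c, d)\<close>.\<close>

definition "a0 la = m1 la 2 - 1" definition "b0 la = m2 la 2" definition "c0 la = m3 la 2" definition "d0 la = m4 la 2 - 1"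
definition "a1 la = fst (col1 la 1 0) 2" definition "b1 la = fst (col1 la 0 1) 2"
definition "c1 la = snd (col1 la 1 0) 2" definition "d1 la = snd (col1 la 0 1) 2"
definition "a2 la = fst (col2 la 1 0) 2" definition "b2 la = fst (col2 la 0 1) 2"
definition "c2 la = snd (col2 la 1 0) 2" definition "d2 la = snd (col2 la 0 1) 2"
definition "D0 la = a0 la * d0 la - b0 la * c0 la"
definition "D1 la = a0 la * d1 la + a1 la * d0 la - b0 la * c1 la - b1 la * c0 la"
definition "D2 la = a0 la * d2 la + a1 la * d1 la + a2 la * d0 la - b0 la * c2 la - b1 la * c1 la - b2 la * c0 la"

definition "f1 la c d x = c * m1 la x + d * m2 la x"
definition "f2 la c d x = c * m3 la x + d * m4 la x"
definition "g1 la c d x = c * fst (col1 la 1 0) x + d * fst (col1 la 0 1) x"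
definition "g2 la c d x = c * snd (col1 la 1 0) x + d * snd (col1 la 0 1) x"
definition "h1 la c d x = c * fst (col2 la 1 0) x + d * fst (col2 la 0 1) x"
definition "h2 la c d x = c * snd (col2 la 1 0) x + d * snd (col2 la 0 1) x"

lemma ZS_f: "ZS X la (\<lambda>t. 0) (\<lambda>t. 0) (f1 la c d) (f2 la c d)"
  using linsys_add[OF linsys_scale[OF m_ZS(1)[of X la], of c] linsys_scale[OF m_ZS(2)[of X la], of d]]
  by (simp add: f1_def[abs_def] f2_def[abs_def])

lemma ZS_g: "ZS X la (\<lambda>t. - \<i> * f1 la c d t) (\<lambda>t. \<i> * f2 la c d t) (g1 la c d) (g2 la c d)"
  using linsys_add[OF linsys_scale[OF col1(3)[of X la 1 0], of c] linsys_scale[OF col1(3)[of X la 0 1], of d]]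
  by (simp add: f1_def[abs_def] f2_def[abs_def] g1_def[abs_def] g2_def[abs_def] m1_def m2_def m3_def m4_def algebra_simps)

lemma ZS_h: "ZS X la (\<lambda>t. - \<i> * g1 la c d t) (\<lambda>t. \<i> * g2 la c d t) (h1 la c d) (h2 la c d)"
  using linsys_add[OF linsys_scale[OF col2(3)[of X la 1 0], of c] linsys_scale[OF col2(3)[of X la 0 1], of d]]
  by (simp add: g1_def[abs_def] g2_def[abs_def] h1_def[abs_def] h2_def[abs_def] algebra_simps)

lemma init: "f1 la c d 0 = c" "f2 la c d 0 = d" "g1 la c d 0 = 0" "g2 la c d 0 = 0" "h1 la c d 0 = 0" "h2 la c d 0 = 0"
  by (simp_all add: f1_def f2_def g1_def g2_def h1_def h2_def m_init col1 col2)

lemma at2: "f1 la c d 2 = c + (a0 la * c + b0 la * d)" "f2 la c d 2 = d + (c0 la * c + d0 la * d)"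
  "g1 la c d 2 = a1 la * c + b1 la * d" "g2 la c d 2 = c1 la * c + d1 la * d"
  "h1 la c d 2 = a2 la * c + b2 la * d" "h2 la c d 2 = c2 la * c + d2 la * d"
  by (simp_all add: f1_def f2_def g1_def g2_def h1_def h2_def a0_def b0_def c0_def d0_def a1_def b1_def c1_def d1_def
     a2_def b2_def c2_def d2_def algebra_simps)

text \<open>By uniqueness, the members of a chain of root functions are determined by their initial values. Periodicity
  over \<open>[0,2]\<close> then becomes a system of linear equations for these values.\<close>

lemma rep1:
  fixes F G :: "real \<Rightarrow> complex^2"
  assumes "ZSv la (\<lambda>x. 0) F" "x \<in> {0..2}"
  shows "F x $ 1 = f1 la (F 0 $ 1) (F 0 $ 2) x \<and> F x $ 2 = f2 la (F 0 $ 1) (F 0 $ 2) x"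
proof -
  have Z: "ZS 2 la (\<lambda>t. 0) (\<lambda>t. 0) (\<lambda>t. F t $ 1) (\<lambda>t. F t $ 2)" using assms(1) by simp
  show ?thesis using ZS_unique[OF Z ZS_f[of 2 la "F 0 $ 1" "F 0 $ 2"] _ _ assms(2)] by (simp add: init)
qed

lemma rep2:
  fixes F G :: "real \<Rightarrow> complex^2"
  assumes G: "\<And>x. x \<in> {0..2} \<Longrightarrow> G x $ 1 = f1 la c d x \<and> G x $ 2 = f2 la c d x"
    and Z: "ZSv la G F" and x: "x \<in> {0..2}"
  shows "F x $ 1 = f1 la (F 0 $ 1) (F 0 $ 2) x + g1 la c d x \<and> F x $ 2 = f2 la (F 0 $ 1) (F 0 $ 2) x + g2 la c d x"
proof -
  have "ZS 2 la (\<lambda>t. - \<i> * G t $ 1) (\<lambda>t. \<i> * G t $ 2)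
     (\<lambda>x. f1 la (F 0 $ 1) (F 0 $ 2) x + g1 la c d x) (\<lambda>x. f2 la (F 0 $ 1) (F 0 $ 2) x + g2 la c d x)"
    by (rule linsys_cong[OF linsys_add[OF ZS_f ZS_g]]) (use G in auto)
  from ZS_unique[OF Z this _ _ x] show ?thesis by (simp add: init)
qed

lemma rep3:
  fixes F G :: "real \<Rightarrow> complex^2"
  assumes G: "\<And>x. x \<in> {0..2} \<Longrightarrow> G x $ 1 = f1 la c d x + g1 la c' d' x \<and> G x $ 2 = f2 la c d x + g2 la c' d' x"
    and Z: "ZSv la G F" and x: "x \<in> {0..2}"
  shows "F x $ 1 = f1 la (F 0 $ 1) (F 0 $ 2) x + g1 la c d x + h1 la c' d' x \<and>
         F x $ 2 = f2 la (F 0 $ 1) (F 0 $ 2) x + g2 la c d x + h2 la c' d' x"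
proof -
  have "ZS 2 la (\<lambda>t. - \<i> * G t $ 1) (\<lambda>t. \<i> * G t $ 2)
     (\<lambda>x. f1 la (F 0 $ 1) (F 0 $ 2) x + g1 la c d x + h1 la c' d' x) (\<lambda>x. f2 la (F 0 $ 1) (F 0 $ 2) x + g2 la c d x + h2 la c' d' x)"
    by (rule linsys_cong[OF linsys_add[OF linsys_add[OF ZS_f ZS_g] ZS_h]]) (use G in \<open>auto simp: algebra_simps\<close>)
  from ZS_unique[OF Z this _ _ x] show ?thesis by (simp add: init)
qed

end

section \<open>Algebraic multiplicities of periodic eigenvalues\<close>

text \<open>A chain of root functions amounts to a polynomial \<open>v(t)\<close> with \<open>A(t) v(t) = O(t^k)\<close>. Multiplication by the
  adjugate gives \<open>det A(t) v(t) = O(t^k)\<close>, so the order of vanishing of the determinant limits the length of chains.\<close>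

lemma adj_order1:
  fixes a0 :: complex
  assumes "a0 * x + b0 * y = 0" "c0 * x + d0 * y = 0"
    "a0 * x1 + b0 * y1 + (a1 * x + b1 * y) = 0" "c0 * x1 + d0 * y1 + (c1 * x + d1 * y) = 0"
    "a0 * d0 - b0 * c0 = 0"
  shows "(a0 * d1 + a1 * d0 - b0 * c1 - b1 * c0) * x = 0" "(a0 * d1 + a1 * d0 - b0 * c1 - b1 * c0) * y = 0"
proof -
  have "(a0 * d1 + a1 * d0 - b0 * c1 - b1 * c0) * x =
     d0 * (a0 * x1 + b0 * y1 + (a1 * x + b1 * y)) - b0 * (c0 * x1 + d0 * y1 + (c1 * x + d1 * y))
     + d1 * (a0 * x + b0 * y) - b1 * (c0 * x + d0 * y) - (a0 * d0 - b0 * c0) * x1" by algebra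
  then show "(a0 * d1 + a1 * d0 - b0 * c1 - b1 * c0) * x = 0" unfolding assms by simp
  have "(a0 * d1 + a1 * d0 - b0 * c1 - b1 * c0) * y =
     a0 * (c0 * x1 + d0 * y1 + (c1 * x + d1 * y)) - c0 * (a0 * x1 + b0 * y1 + (a1 * x + b1 * y))
     + a1 * (c0 * x + d0 * y) - c1 * (a0 * x + b0 * y) - (a0 * d0 - b0 * c0) * y1" by algebra
  then show "(a0 * d1 + a1 * d0 - b0 * c1 - b1 * c0) * y = 0" unfolding assms by simp
qed

lemma adj_order2:
  fixes a0 :: complex
  assumes "a0 * x + b0 * y = 0" "c0 * x + d0 * y = 0"
    "a0 * x1 + b0 * y1 + (a1 * x + b1 * y) = 0" "c0 * x1 + d0 * y1 + (c1 * x + d1 * y) = 0"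
    "a0 * x2 + b0 * y2 + (a1 * x1 + b1 * y1) + (a2 * x + b2 * y) = 0" "c0 * x2 + d0 * y2 + (c1 * x1 + d1 * y1) + (c2 * x + d2 * y) = 0"
    "a0 * d0 - b0 * c0 = 0" "a0 * d1 + a1 * d0 - b0 * c1 - b1 * c0 = 0"
  shows "(a0 * d2 + a1 * d1 + a2 * d0 - b0 * c2 - b1 * c1 - b2 * c0) * x = 0"
    "(a0 * d2 + a1 * d1 + a2 * d0 - b0 * c2 - b1 * c1 - b2 * c0) * y = 0"
proof -
  have "(a0 * d2 + a1 * d1 + a2 * d0 - b0 * c2 - b1 * c1 - b2 * c0) * x =
     d0 * (a0 * x2 + b0 * y2 + (a1 * x1 + b1 * y1) + (a2 * x + b2 * y)) - b0 * (c0 * x2 + d0 * y2 + (c1 * x1 + d1 * y1) + (c2 * x + d2 * y))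
     + d1 * (a0 * x1 + b0 * y1 + (a1 * x + b1 * y)) - b1 * (c0 * x1 + d0 * y1 + (c1 * x + d1 * y))
     + d2 * (a0 * x + b0 * y) - b2 * (c0 * x + d0 * y) - (a0 * d0 - b0 * c0) * x2
     - (a0 * d1 + a1 * d0 - b0 * c1 - b1 * c0) * x1" by algebra
  then show "(a0 * d2 + a1 * d1 + a2 * d0 - b0 * c2 - b1 * c1 - b2 * c0) * x = 0" unfolding assms by simp
  have "(a0 * d2 + a1 * d1 + a2 * d0 - b0 * c2 - b1 * c1 - b2 * c0) * y =
     a0 * (c0 * x2 + d0 * y2 + (c1 * x1 + d1 * y1) + (c2 * x + d2 * y)) - c0 * (a0 * x2 + b0 * y2 + (a1 * x1 + b1 * y1) + (a2 * x + b2 * y))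
     + a1 * (c0 * x1 + d0 * y1 + (c1 * x + d1 * y)) - c1 * (a0 * x1 + b0 * y1 + (a1 * x + b1 * y))
     + a2 * (c0 * x + d0 * y) - c2 * (a0 * x + b0 * y) - (a0 * d0 - b0 * c0) * y2
     - (a0 * d1 + a1 * d0 - b0 * c1 - b1 * c0) * y1" by algebra
  then show "(a0 * d2 + a1 * d1 + a2 * d0 - b0 * c2 - b1 * c1 - b2 * c0) * y = 0" unfolding assms by simp
qed

text \<open>Solvability for a singular nonzero matrix is tested with its adjugate, because that is how \<open>D1\<close> enters.\<close>

lemma singular_kernel:
  fixes a :: complex
  assumes det: "a * d - b * c = 0" and nz: "\<not> (a = 0 \<and> b = 0 \<and> c = 0 \<and> d = 0)"
  shows "\<exists>p q. (p \<noteq> 0 \<or> q \<noteq> 0) \<and> (\<forall>x y. a * x + b * y = 0 \<and> c * x + d * y = 0 \<longleftrightarrow> (\<exists>z. x = z * p \<and> y = z * q))"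
proof -
  have *: "\<exists>p q. (p \<noteq> 0 \<or> q \<noteq> 0) \<and> (\<forall>x y. a * x + b * y = 0 \<and> c * x + d * y = 0 \<longleftrightarrow> (\<exists>z. x = z * p \<and> y = z * q))"
    if det: "a * d - b * c = 0" and nz: "a \<noteq> 0 \<or> b \<noteq> 0" for a b c d :: complex
  proof (rule exI[of _ "- b"], rule exI[of _ a], intro conjI allI iffI)
    fix x y
    show "\<exists>z. x = z * - b \<and> y = z * a" if h: "a * x + b * y = 0 \<and> c * x + d * y = 0"
    proof (cases "a = 0")
      case True
      then have "y = 0" using h nz by auto
      then show ?thesis using True nz by (intro exI[of _ "- x / b"]) auto
    next
      case False
      have "x = - (b * y) / a" using h False by (simp add: field_simps eq_neg_iff_add_eq_0)
      then show ?thesis using False by (intro exI[of _ "y / a"]) (auto simp: field_simps)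
    qed
    assume "\<exists>z. x = z * - b \<and> y = z * a"
    then obtain z where z: "x = z * - b" "y = z * a" by blast
    show "a * x + b * y = 0" by (simp add: z)
    have "c * x + d * y = z * (a * d - b * c)" by (simp add: z algebra_simps)
    then show "c * x + d * y = 0" using det by simp
  qed (use nz in auto)
  show ?thesis
  proof (cases "a \<noteq> 0 \<or> b \<noteq> 0")
    case True
    then show ?thesis using * det by blast
  next
    case False
    then have "c \<noteq> 0 \<or> d \<noteq> 0" using nz by auto
    moreover have "c * b - d * a = 0" using det by (simp add: algebra_simps)
    ultimately show ?thesis using *[of c b d a] by (simp add: conj_commute)
  qed
qed

lemma singular_range:
  fixes a :: complex
  assumes det: "a * d - b * c = 0" and nz: "\<not> (a = 0 \<and> b = 0 \<and> c = 0 \<and> d = 0)"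
    and h: "d * r - b * s = 0" "a * s - c * r = 0"
  shows "\<exists>x y. a * x + b * y = r \<and> c * x + d * y = s"
proof -
  consider "a \<noteq> 0" | "b \<noteq> 0" | "c \<noteq> 0" | "d \<noteq> 0" using nz by auto
  then show ?thesis
  proof cases
    case 1 then show ?thesis using h by (intro exI[of _ "r / a"] exI[of _ 0]) (auto simp: field_simps)
  next
    case 2 then show ?thesis using h by (intro exI[of _ 0] exI[of _ "r / b"]) (auto simp: field_simps)
  next
    case 3 then show ?thesis using h by (intro exI[of _ "s / c"] exI[of _ 0]) (auto simp: field_simps)
  next
    case 4 then show ?thesis using h by (intro exI[of _ 0] exI[of _ "s / d"]) (auto simp: field_simps)
  qed
qed

interpretation VS: vector_space cscale by (rule vector_space_cscale)

no_notation fps_nth (infixl "$" 75)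

context zs
begin

lemma zs_ker_Suc_subset:
  assumes "Ker la k \<subseteq> Ker la l"
  shows "Ker la (Suc k) \<subseteq> Ker la (Suc l)"
proof
  fix F assume "F \<in> Ker la (Suc k)"
  then obtain G where "F \<in> Per2" "G \<in> Ker la k" "ZSv la G F"
    unfolding zs_ker_Suc_iff by blast
  with assms show "F \<in> Ker la (Suc l)"
    unfolding zs_ker_Suc_iff by (intro conjI bexI[of _ G]) auto
qed

lemma zs_ker_mono: "Ker la k \<subseteq> Ker la (Suc k)"
proof (induction k)
  case 0
  have "(\<lambda>x. 0) \<in> Per2" by (simp add: Per2_def)
  moreover have "ZSv la (\<lambda>x. 0) (\<lambda>x. 0)" by (simp add: linsys_def ac_on_const)
  moreover have "(\<lambda>x. 0) \<in> Ker la 0" by simp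
  ultimately have "(\<lambda>x. 0) \<in> Ker la (Suc 0)" 
    unfolding zs_ker_Suc_iff by (intro conjI bexI[of _ "\<lambda>x. 0"])
  then show ?case unfolding zs_ker.simps(1) by blast
next
  case (Suc k)
  then show ?case by (rule zs_ker_Suc_subset)
qed

lemma zs_ker_stable:
  assumes "Ker la (Suc k) \<subseteq> Ker la k"
  shows "(\<Union>j. Ker la j) = Ker la k"
proof -
  have up: "Ker la (k + j) \<subseteq> Ker la k" for j
  proof (induction j)
    case (Suc j)
    have "Ker la (Suc (k + j)) \<subseteq> Ker la (Suc k)"
      using Suc by (rule zs_ker_Suc_subset)
    then show ?case using assms by simp
  qed simp
  have "Ker la j \<subseteq> Ker la k" for j
  proof -
    have "Ker la j \<subseteq> Ker la (k + j)"
    proof (induction k)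
      case (Suc k) then show ?case using zs_ker_mono[of la "k + j"] by simp
    qed simp
    then show ?thesis using up by blast
  qed
  then show ?thesis by blast
qed

lemma Per2_02: "F \<in> Per2 \<Longrightarrow> F 2 = F 0"
  unfolding Per2_def by (metis (mono_tags, lifting) add_0 mem_Collect_eq)

lemma ker1_D:
  assumes "F \<in> Ker la (Suc 0)"
  shows "F \<in> Per2" "ZSv la (\<lambda>x. 0) F"
    "\<And>x. x \<in> {0..2} \<Longrightarrow> F x $ 1 = f1 la (F 0 $ 1) (F 0 $ 2) x \<and> F x $ 2 = f2 la (F 0 $ 1) (F 0 $ 2) x"
    "a0 la * F 0 $ 1 + b0 la * F 0 $ 2 = 0" "c0 la * F 0 $ 1 + d0 la * F 0 $ 2 = 0"
proof -
  show F: "F \<in> Per2" and Z: "ZSv la (\<lambda>x. 0) F"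
    using assms unfolding zs_ker_Suc_iff by auto
  show rep: "\<And>x. x \<in> {0..2} \<Longrightarrow> F x $ 1 = f1 la (F 0 $ 1) (F 0 $ 2) x \<and> F x $ 2 = f2 la (F 0 $ 1) (F 0 $ 2) x"
    by (rule rep1[OF Z])
  show "a0 la * F 0 $ 1 + b0 la * F 0 $ 2 = 0" "c0 la * F 0 $ 1 + d0 la * F 0 $ 2 = 0"
    using rep[of 2] by (simp_all add: at2 Per2_02[OF F])
qed

lemma ker1_I:
  assumes F: "F \<in> Per2" and Z: "ZSv la (\<lambda>x. 0) F"
  shows "F \<in> Ker la (Suc 0)"
  unfolding zs_ker_Suc_iff using assms by auto

lemma ker1_exists:
  assumes "a0 la * p + b0 la * q = 0" "c0 la * p + d0 la * q = 0"
  shows "\<exists>F\<in>Ker la (Suc 0). F 0 $ 1 = p \<and> F 0 $ 2 = q"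
proof -
  obtain F where F: "F \<in> Per2" "\<And>x. x \<in> {0..2} \<Longrightarrow> F x $ 1 = f1 la p q x \<and> F x $ 2 = f2 la p q x"
  proof -
    have "\<exists>F\<in>Per2. \<forall>x\<in>{0..2}. F x $ 1 = f1 la p q x \<and> F x $ 2 = f2 la p q x"
      by (rule Per2_exists[OF ZS_continuous[OF ZS_f]]) (use assms in \<open>simp_all add: init at2\<close>)
    then show thesis using that by blast
  qed
  have "ZSv la (\<lambda>x. 0) F" by (rule linsys_cong[OF ZS_f[of 2 la p q]]) (use F in auto)
  then show ?thesis using F(2)[of 0] ker1_I[OF F(1)] by (intro bexI[of _ F]) (auto simp: init)
qed

lemma ker1_eqI:
  assumes "F \<in> Ker la (Suc 0)" "G \<in> Ker la (Suc 0)" "F 0 = G 0"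
  shows "F = G"
proof (rule Per2_ext[OF ker1_D(1)[OF assms(1)] ker1_D(1)[OF assms(2)]])
  fix x :: real assume x: "x \<in> {0..2}"
  show "F x = G x"
    unfolding vec_eq_iff forall_2
    using ker1_D(3)[OF assms(1) x] ker1_D(3)[OF assms(2) x] by (simp only: assms(3))
qed

lemma ker1_linear:
  assumes "F \<in> Ker la (Suc 0)" "G \<in> Ker la (Suc 0)"
  shows "(\<lambda>x. z *s F x + w *s G x) \<in> Ker la (Suc 0)"
proof (rule ker1_I)
  show "(\<lambda>x. z *s F x + w *s G x) \<in> Per2"
    by (rule Per2_linear[OF ker1_D(1)[OF assms(1)] ker1_D(1)[OF assms(2)]])
  show "ZSv la (\<lambda>x. 0) (\<lambda>x. z *s F x + w *s G x)"
    using ZSv_linear[OF ker1_D(2)[OF assms(1)] ker1_D(2)[OF assms(2)], of z w] by simp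
qed

lemma ker2_D:
  assumes "F \<in> Ker la (Suc (Suc 0))"
  obtains G where "F \<in> Per2" "G \<in> Ker la (Suc 0)" "ZSv la G F"
    "\<And>x. x \<in> {0..2} \<Longrightarrow> F x $ 1 = f1 la (F 0 $ 1) (F 0 $ 2) x + g1 la (G 0 $ 1) (G 0 $ 2) x \<and>
        F x $ 2 = f2 la (F 0 $ 1) (F 0 $ 2) x + g2 la (G 0 $ 1) (G 0 $ 2) x"
    "a0 la * F 0 $ 1 + b0 la * F 0 $ 2 + (a1 la * G 0 $ 1 + b1 la * G 0 $ 2) = 0"
    "c0 la * F 0 $ 1 + d0 la * F 0 $ 2 + (c1 la * G 0 $ 1 + d1 la * G 0 $ 2) = 0"
proof -
  obtain G where F: "F \<in> Per2" and G: "G \<in> Ker la (Suc 0)" and Z: "ZSv la G F"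
    using assms unfolding zs_ker_Suc_iff[of _ _ "Suc 0"] by blast
  have rep: "F x $ 1 = f1 la (F 0 $ 1) (F 0 $ 2) x + g1 la (G 0 $ 1) (G 0 $ 2) x \<and>
        F x $ 2 = f2 la (F 0 $ 1) (F 0 $ 2) x + g2 la (G 0 $ 1) (G 0 $ 2) x" if "x \<in> {0..2}" for x
    by (rule rep2[OF ker1_D(3)[OF G] Z that])
  have "a0 la * F 0 $ 1 + b0 la * F 0 $ 2 + (a1 la * G 0 $ 1 + b1 la * G 0 $ 2) = 0"
    "c0 la * F 0 $ 1 + d0 la * F 0 $ 2 + (c1 la * G 0 $ 1 + d1 la * G 0 $ 2) = 0"
    using rep[of 2] by (simp_all add: at2 Per2_02[OF F] add.assoc)
  with F G Z rep show ?thesis by (rule that)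
qed

lemma zero_in_ker1: "G 0 $ 1 = 0 \<Longrightarrow> G 0 $ 2 = (0::complex) \<Longrightarrow> G \<in> Ker la (Suc 0) \<Longrightarrow> G x = 0"
proof -
  assume G: "G 0 $ 1 = 0" "G 0 $ 2 = 0" "G \<in> Ker la (Suc 0)"
  have z: "(\<lambda>x. 0) \<in> Ker la (Suc 0)" using zs_ker_mono[of la 0] by (simp add: subset_iff del: zs_ker.simps(2))
  have "G = (\<lambda>x. 0)" by (rule ker1_eqI[OF G(3) z]) (use G in \<open>simp add: vec_eq_iff forall_2\<close>)
  then show ?thesis by simp
qed

lemma ker2_in_ker1:
  assumes F: "F \<in> Per2" and G: "G \<in> Ker la (Suc 0)" and Z: "ZSv la G F" and G0: "G 0 $ 1 = 0" "G 0 $ 2 = 0"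
  shows "F \<in> Ker la (Suc 0)"
proof -
  have "G = (\<lambda>x. 0)" using zero_in_ker1[OF G0 G] by blast
  then show ?thesis using F Z by (intro ker1_I) auto
qed

lemma dim_one:
  assumes F: "F \<noteq> (\<lambda>x. 0)" and S: "S = {cscale z F |z. True}"
  shows "VS.dim S = 1"
proof -
  have "VS.independent {F}" using F VS.independent_insert[of F "{}"] by (simp add: zero_fun_def)
  moreover have "S = VS.span {F}" unfolding S VS.span_singleton by (auto simp: image_def)
  ultimately show ?thesis by (simp add: VS.dim_eq_card_independent)
qed

lemma dim_two:
  assumes F: "F \<noteq> (\<lambda>x. 0)" and H: "\<And>z. H \<noteq> cscale z F" and S: "S = {cscale z F + cscale w H |z w. True}"
  shows "VS.dim S = 2"
proof -
  have i1: "VS.independent {F}" using F VS.independent_insert[of F "{}"] by (simp add: zero_fun_def)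
  have nH: "H \<notin> VS.span {F}" unfolding VS.span_singleton using H by auto
  have i2: "VS.independent {H, F}" using VS.independent_insertI[OF nH i1] .
  have HF: "H \<noteq> F" using H[of 1] by (auto simp: cscale_def)
  have "S = VS.span {H, F}"
    unfolding S VS.span_insert[of H] VS.span_singleton
    by (auto simp: image_def algebra_simps) (metis add.commute add_diff_cancel_left')+
  then show ?thesis using VS.dim_eq_card_independent[OF i2] HF by simp
qed

lemma alg_mult_0:
  assumes "D0 la \<noteq> 0" shows "alg_mult \<phi>1 \<phi>2 la = 0"
proof -
  have "F = (\<lambda>x. 0)" if F: "F \<in> Ker la (Suc 0)" for F
  proof -
    note e = ker1_D(4,5)[OF F]
    have "D0 la * F 0 $ 1 = d0 la * (a0 la * F 0 $ 1 + b0 la * F 0 $ 2) - b0 la * (c0 la * F 0 $ 1 + d0 la * F 0 $ 2)"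
      by (simp add: D0_def algebra_simps)
    moreover have "D0 la * F 0 $ 2 = a0 la * (c0 la * F 0 $ 1 + d0 la * F 0 $ 2) - c0 la * (a0 la * F 0 $ 1 + b0 la * F 0 $ 2)"
      by (simp add: D0_def algebra_simps)
    ultimately have "F 0 $ 1 = 0" "F 0 $ 2 = 0" using e assms by auto
    then show ?thesis using zero_in_ker1[OF _ _ F] by blast
  qed
  then have "Ker la (Suc 0) \<subseteq> Ker la 0" by auto
  from zs_ker_stable[OF this] have "alg_mult \<phi>1 \<phi>2 la = VS.dim {\<lambda>x. 0}" by (simp add: alg_mult_def)
  also have "... = 0" using VS.dim_eq_card_independent[OF VS.independent_empty] VS.dim_span[of "{}"] by (simp add: zero_fun_def)
  finally show ?thesis .
qed

lemma ker1_line: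
  assumes "D0 la = 0" "\<not> (a0 la = 0 \<and> b0 la = 0 \<and> c0 la = 0 \<and> d0 la = 0)"
  shows "\<exists>F\<in>Ker la (Suc 0). F \<noteq> (\<lambda>x. 0) \<and> Ker la (Suc 0) = {cscale z F |z. True}"
proof -
  obtain p q where pq: "p \<noteq> 0 \<or> q \<noteq> 0"
    and eq: "\<And>x y. a0 la * x + b0 la * y = 0 \<and> c0 la * x + d0 la * y = 0 \<longleftrightarrow> (\<exists>z. x = z * p \<and> y = z * q)"
    using singular_kernel[of "a0 la" "d0 la" "b0 la" "c0 la"] assms by (auto simp: D0_def)
  have "a0 la * p + b0 la * q = 0 \<and> c0 la * p + d0 la * q = 0" unfolding eq by (intro exI[of _ 1]) simp
  then obtain F where F: "F \<in> Ker la (Suc 0)" "F 0 $ 1 = p" "F 0 $ 2 = q" using ker1_exists by blast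
  have sF: "cscale z F \<in> Ker la (Suc 0)" for z
    using ker1_linear[OF F(1) F(1), of z 0] by (simp add: cscale_def del: zs_ker.simps)
  have "G \<in> {cscale z F |z. True}" if G: "G \<in> Ker la (Suc 0)" for G
  proof -
    obtain z where z: "G 0 $ 1 = z * p" "G 0 $ 2 = z * q" using eq ker1_D(4,5)[OF G] by blast
    have "G = cscale z F" by (rule ker1_eqI[OF G sF]) (simp add: cscale_def vec_eq_iff forall_2 z F)
    then show ?thesis by blast
  qed
  moreover have "F \<noteq> (\<lambda>x. 0)" using F pq by (metis zero_index)
  ultimately show ?thesis using F(1) sF by blast
qed

text \<open>The matrix \<open>A\<close> is singular but not zero, so its kernel is a line; \<open>D1 la \<noteq> 0\<close> excludes chains of length two.\<close>

lemma alg_mult_1: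
  assumes "D0 la = 0" "D1 la \<noteq> 0" shows "alg_mult \<phi>1 \<phi>2 la = 1"
proof -
  have nz: "\<not> (a0 la = 0 \<and> b0 la = 0 \<and> c0 la = 0 \<and> d0 la = 0)" using assms(2) by (auto simp: D1_def)
  have "Ker la (Suc (Suc 0)) \<subseteq> Ker la (Suc 0)"
  proof
    fix F assume "F \<in> Ker la (Suc (Suc 0))"
    from ker2_D[OF this] obtain G where G: "F \<in> Per2" "G \<in> Ker la (Suc 0)" "ZSv la G F"
      "a0 la * F 0 $ 1 + b0 la * F 0 $ 2 + (a1 la * G 0 $ 1 + b1 la * G 0 $ 2) = 0"
      "c0 la * F 0 $ 1 + d0 la * F 0 $ 2 + (c1 la * G 0 $ 1 + d1 la * G 0 $ 2) = 0" by metis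
    have "D1 la * G 0 $ 1 = 0" "D1 la * G 0 $ 2 = 0"
      using adj_order1[OF ker1_D(4,5)[OF G(2)] G(4,5)] assms by (simp_all add: D0_def D1_def)
    then have "G 0 $ 1 = 0" "G 0 $ 2 = 0" using assms by auto
    then show "F \<in> Ker la (Suc 0)" by (rule ker2_in_ker1[OF G(1-3)])
  qed
  from zs_ker_stable[OF this] have *: "alg_mult \<phi>1 \<phi>2 la = VS.dim (Ker la (Suc 0))" unfolding alg_mult_def by simp
  obtain F where "F \<noteq> (\<lambda>x. 0)" "Ker la (Suc 0) = {cscale z F |z. True}"
    using ker1_line[OF assms(1) nz] by blast
  then show ?thesis unfolding * by (rule dim_one)
qed

text \<open>If \<open>A = 0\<close>, the kernel is a plane and \<open>D2\<close> is the determinant of the first order coefficient of \<open>A\<close>, which excludes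
  chains of length two. Otherwise the kernel is a line; \<open>D1 la = 0\<close> is the condition for a second member of the chain to exist, and
  \<open>D2 la \<noteq> 0\<close> excludes a third one.\<close>

lemma alg_mult_2:
  assumes D: "D0 la = 0" "D1 la = 0" "D2 la \<noteq> 0" shows "alg_mult \<phi>1 \<phi>2 la = 2"
proof (cases "a0 la = 0 \<and> b0 la = 0 \<and> c0 la = 0 \<and> d0 la = 0")
  case True
  then have det: "a1 la * d1 la - b1 la * c1 la \<noteq> 0" using D(3) by (simp add: D2_def)
  have "Ker la (Suc (Suc 0)) \<subseteq> Ker la (Suc 0)"
  proof
    fix F assume "F \<in> Ker la (Suc (Suc 0))"
    from ker2_D[OF this] obtain G where G: "F \<in> Per2" "G \<in> Ker la (Suc 0)" "ZSv la G F"
      "a0 la * F 0 $ 1 + b0 la * F 0 $ 2 + (a1 la * G 0 $ 1 + b1 la * G 0 $ 2) = 0"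
      "c0 la * F 0 $ 1 + d0 la * F 0 $ 2 + (c1 la * G 0 $ 1 + d1 la * G 0 $ 2) = 0" by metis
    have e: "a1 la * G 0 $ 1 + b1 la * G 0 $ 2 = 0" "c1 la * G 0 $ 1 + d1 la * G 0 $ 2 = 0"
      using G(4,5) True by auto
    have "(a1 la * d1 la - b1 la * c1 la) * G 0 $ 1 = d1 la * (a1 la * G 0 $ 1 + b1 la * G 0 $ 2) - b1 la * (c1 la * G 0 $ 1 + d1 la * G 0 $ 2)"
      "(a1 la * d1 la - b1 la * c1 la) * G 0 $ 2 = a1 la * (c1 la * G 0 $ 1 + d1 la * G 0 $ 2) - c1 la * (a1 la * G 0 $ 1 + b1 la * G 0 $ 2)"
      by (simp_all add: algebra_simps)
    then have "G 0 $ 1 = 0" "G 0 $ 2 = 0" using det e by auto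
    then show "F \<in> Ker la (Suc 0)" by (rule ker2_in_ker1[OF G(1-3)])
  qed
  from zs_ker_stable[OF this] have *: "alg_mult \<phi>1 \<phi>2 la = VS.dim (Ker la (Suc 0))" unfolding alg_mult_def by simp
  obtain F where F: "F \<in> Ker la (Suc 0)" "F 0 $ 1 = 1" "F 0 $ 2 = 0"
    using ker1_exists[of la 1 0] True by auto
  obtain H where H: "H \<in> Ker la (Suc 0)" "H 0 $ 1 = 0" "H 0 $ 2 = 1"
    using ker1_exists[of la 0 1] True by auto
  have lin: "cscale z F + cscale w H \<in> Ker la (Suc 0)" for z w
    using ker1_linear[OF F(1) H(1), of z w] by (simp add: cscale_def plus_fun_def del: zs_ker.simps)
  have "G \<in> {cscale z F + cscale w H |z w. True}" if G: "G \<in> Ker la (Suc 0)" for G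
  proof -
    have "G = cscale (G 0 $ 1) F + cscale (G 0 $ 2) H"
      by (rule ker1_eqI[OF G lin]) (simp add: cscale_def plus_fun_def vec_eq_iff forall_2 F H)
    then show ?thesis by blast
  qed
  then have S: "Ker la (Suc 0) = {cscale z F + cscale w H |z w. True}" using lin by blast
  show ?thesis unfolding *
  proof (rule dim_two[OF _ _ S])
    show "F \<noteq> (\<lambda>x. 0)" using F by (metis zero_index zero_neq_one)
    show "H \<noteq> cscale z F" for z
    proof
      assume "H = cscale z F"
      then have "H 0 $ 2 = z * F 0 $ 2" by (simp add: cscale_def)
      then show False using H F by simp
    qed
  qed
next
  case False
  obtain F where F: "F \<in> Ker la (Suc 0)" "F \<noteq> (\<lambda>x. 0)" "Ker la (Suc 0) = {cscale z F |z. True}"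
    using ker1_line[OF D(1) False] by blast
  let ?p = "F 0 $ 1" and ?q = "F 0 $ 2"
  note e = ker1_D(4,5)[OF F(1)]
  have "\<exists>x y. a0 la * x + b0 la * y = - (a1 la * ?p + b1 la * ?q) \<and> c0 la * x + d0 la * y = - (c1 la * ?p + d1 la * ?q)"
  proof (rule singular_range[OF _ False])
    show "a0 la * d0 la - b0 la * c0 la = 0" using D(1) by (simp add: D0_def)
    have "d0 la * - (a1 la * ?p + b1 la * ?q) - b0 la * - (c1 la * ?p + d1 la * ?q) =
       d1 la * (a0 la * ?p + b0 la * ?q) - b1 la * (c0 la * ?p + d0 la * ?q) - D1 la * ?p"
      unfolding D1_def by algebra
    then show "d0 la * - (a1 la * ?p + b1 la * ?q) - b0 la * - (c1 la * ?p + d1 la * ?q) = 0" unfolding e D(2) by simp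
    have "a0 la * - (c1 la * ?p + d1 la * ?q) - c0 la * - (a1 la * ?p + b1 la * ?q) =
       a1 la * (c0 la * ?p + d0 la * ?q) - c1 la * (a0 la * ?p + b0 la * ?q) - D1 la * ?q"
      unfolding D1_def by algebra
    then show "a0 la * - (c1 la * ?p + d1 la * ?q) - c0 la * - (a1 la * ?p + b1 la * ?q) = 0" unfolding e D(2) by simp
  qed
  then obtain r s where rs: "a0 la * r + b0 la * s = - (a1 la * ?p + b1 la * ?q)" "c0 la * r + d0 la * s = - (c1 la * ?p + d1 la * ?q)" by blast
  let ?u = "\<lambda>x. f1 la r s x + g1 la ?p ?q x" and ?v = "\<lambda>x. f2 la r s x + g2 la ?p ?q x"
  have "\<exists>H\<in>Per2. \<forall>x\<in>{0..2}. H x $ 1 = ?u x \<and> H x $ 2 = ?v x"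
    by (rule Per2_exists)
       (use rs in \<open>auto intro!: continuous_intros ZS_continuous[OF ZS_f] ZS_continuous[OF ZS_g] simp: init at2\<close>)
  then obtain H where H: "H \<in> Per2" "\<And>x. x \<in> {0..2} \<Longrightarrow> H x $ 1 = ?u x \<and> H x $ 2 = ?v x" by blast
  have ZH: "ZSv la F H"
  proof (rule linsys_cong[OF linsys_add[OF ZS_f[of 2 la r s] ZS_g[of 2 la ?p ?q]]])
    fix x :: real assume x: "x \<in> {0..2}"
    show "- \<i> * F x $ 1 = 0 + - \<i> * f1 la ?p ?q x \<and> \<i> * F x $ 2 = 0 + \<i> * f2 la ?p ?q x \<and> H x $ 1 = ?u x \<and> H x $ 2 = ?v x"
      using ker1_D(3)[OF F(1) x] H(2)[OF x] by simp
  qed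
  let ?K2 = "Ker la (Suc (Suc 0))"
  have lin: "cscale z F + cscale w H \<in> ?K2" for z w
  proof -
    have "(\<lambda>x. z *s F x + w *s H x) \<in> Per2" by (intro Per2_linear ker1_D(1)[OF F(1)] H)
    moreover have "ZSv la (\<lambda>x. z *s 0 + w *s F x) (\<lambda>x. z *s F x + w *s H x)"
      by (rule ZSv_linear[OF ker1_D(2)[OF F(1)] ZH])
    moreover have "(\<lambda>x. z *s 0 + w *s F x) \<in> Ker la (Suc 0)"
      using ker1_linear[OF F(1) F(1), of 0 w] by (simp del: zs_ker.simps)
    ultimately show ?thesis
      unfolding zs_ker_Suc_iff[of _ _ "Suc 0"] cscale_def plus_fun_def
      by (intro conjI bexI[of _ "\<lambda>x. z *s 0 + w *s F x"])
  qed
  have S: "?K2 = {cscale z F + cscale w H |z w. True}"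
  proof -
    have "G \<in> {cscale z F + cscale w H |z w. True}" if "G \<in> ?K2" for G
    proof -
      obtain E where E: "G \<in> Per2" "E \<in> Ker la (Suc 0)" "ZSv la E G"
        using \<open>G \<in> ?K2\<close> unfolding zs_ker_Suc_iff[of _ _ "Suc 0"] by blast
      obtain w where w: "E = cscale w F" using E(2) F(3) by blast
      have "ZSv la (\<lambda>x. 0) (\<lambda>x. 1 *s G x + (-w) *s H x)"
        by (rule linsys_cong[OF ZSv_linear[OF E(3) ZH, of 1 "-w"]]) (simp add: w cscale_def)
      then have "(\<lambda>x. 1 *s G x + (-w) *s H x) \<in> Ker la (Suc 0)"
        by (rule ker1_I[OF Per2_linear[OF E(1) H(1)]])
      then obtain z where "(\<lambda>x. 1 *s G x + (-w) *s H x) = cscale z F" using F(3) by blast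
      then have "G = cscale z F + cscale w H"
        by (auto simp: fun_eq_iff cscale_def vec_eq_iff algebra_simps)
      then show ?thesis by blast
    qed
    then show ?thesis using lin by blast
  qed
  have "Ker la (Suc (Suc (Suc 0))) \<subseteq> ?K2"
  proof
    fix G assume "G \<in> Ker la (Suc (Suc (Suc 0)))"
    then obtain E where G: "G \<in> Per2" and E: "E \<in> ?K2" and Z: "ZSv la E G"
      unfolding zs_ker_Suc_iff[of _ _ "Suc (Suc 0)"] by blast
    from ker2_D[OF E] obtain W where W: "E \<in> Per2" "W \<in> Ker la (Suc 0)" "ZSv la W E"
      and rep: "\<And>x. x \<in> {0..2} \<Longrightarrow> E x $ 1 = f1 la (E 0 $ 1) (E 0 $ 2) x + g1 la (W 0 $ 1) (W 0 $ 2) x \<and>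
        E x $ 2 = f2 la (E 0 $ 1) (E 0 $ 2) x + g2 la (W 0 $ 1) (W 0 $ 2) x"
      and e1: "a0 la * E 0 $ 1 + b0 la * E 0 $ 2 + (a1 la * W 0 $ 1 + b1 la * W 0 $ 2) = 0"
        "c0 la * E 0 $ 1 + d0 la * E 0 $ 2 + (c1 la * W 0 $ 1 + d1 la * W 0 $ 2) = 0" by metis
    have "a0 la * G 0 $ 1 + b0 la * G 0 $ 2 + (a1 la * E 0 $ 1 + b1 la * E 0 $ 2) + (a2 la * W 0 $ 1 + b2 la * W 0 $ 2) = 0"
      "c0 la * G 0 $ 1 + d0 la * G 0 $ 2 + (c1 la * E 0 $ 1 + d1 la * E 0 $ 2) + (c2 la * W 0 $ 1 + d2 la * W 0 $ 2) = 0"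
      using rep3[OF rep Z, of 2] by (simp_all add: at2 Per2_02[OF G] add.assoc)
    from adj_order2[OF ker1_D(4,5)[OF W(2)] e1 this] D
    have "D2 la * W 0 $ 1 = 0" "D2 la * W 0 $ 2 = 0" by (simp_all add: D0_def D1_def D2_def)
    then have "W 0 $ 1 = 0" "W 0 $ 2 = 0" using D(3) by auto
    then have "E \<in> Ker la (Suc 0)" by (rule ker2_in_ker1[OF W(1-3)])
    then show "G \<in> ?K2" using G Z unfolding zs_ker_Suc_iff[of _ _ "Suc 0"] by blast
  qed
  from zs_ker_stable[OF this] have *: "alg_mult \<phi>1 \<phi>2 la = VS.dim ?K2" unfolding alg_mult_def by simp
  show ?thesis unfolding *
  proof (rule dim_two[OF F(2) _ S])
    fix z show "H \<noteq> cscale z F"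
    proof
      assume "H = cscale z F"
      then have "H \<in> Ker la (Suc 0)" using F(3) by blast
      then have Z0: "ZSv la (\<lambda>x. 0) H" by (rule ker1_D(2))
      have "ZSv la (\<lambda>x. 1 *s F x + (-1) *s 0) (\<lambda>x. 1 *s H x + (-1) *s H x)"
        by (rule ZSv_linear[OF ZH Z0])
      then have Z1: "ZSv la F (\<lambda>x. 0)" by simp
      have zero: "ac_on 2 (\<lambda>x. 0) (\<lambda>t. - \<i> * F t $ 1)" "ac_on 2 (\<lambda>x. 0) (\<lambda>t. \<i> * F t $ 2)"
        using Z1 by (simp_all add: linsys_def)
      have F0: "h 0 = 0" if ac: "ac_on 2 (\<lambda>x. 0) h" and ch: "continuous_on {0..2} h" for h :: cfun
      proof -
        have "AE x in lebesgue. x \<in> {0..2} \<longrightarrow> h x = 0"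
          by (rule AE_zero_if_indefinite_integral_zero[OF ac_on_integrable[OF ac]])
             (use ac_on_eq[OF ac] in auto)
        from continuous_AE_zero[OF _ ch this, of 0] show ?thesis by simp
      qed
      have "- \<i> * ?p = 0"
        by (rule F0[OF zero(1)]) (intro continuous_intros Per2_component[OF ker1_D(1)[OF F(1)]])
      moreover have "\<i> * ?q = 0"
        by (rule F0[OF zero(2)]) (intro continuous_intros Per2_component[OF ker1_D(1)[OF F(1)]])
      ultimately have "?p = 0" "?q = 0" by auto
      then have "F = (\<lambda>x. 0)" using zero_in_ker1[OF _ _ F(1)] by blast
      then show False using F(2) by blast
    qed
  qed
qed

lemma second_order_quotient:
  fixes f :: "complex \<Rightarrow> complex"
  assumes "\<And>t. norm t \<le> 1 \<Longrightarrow> norm (f t - p - t * q - t\<^sup>2 * r) \<le> C * norm t ^ 3"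
  shows "((\<lambda>t. (f t - p - t * q) / t\<^sup>2) \<longlongrightarrow> r) (at 0)"
proof -
  have "((\<lambda>t. (f t - p - t * q) / t\<^sup>2 - r) \<longlongrightarrow> 0) (at 0)"
  proof (rule Lim_null_comparison)
    show "((\<lambda>t::complex. C * norm t) \<longlongrightarrow> 0) (at 0)" by (auto intro!: tendsto_eq_intros)
    have "\<forall>\<^sub>F t :: complex in at 0. t \<in> ball 0 1 - {0}"
      by (rule eventually_at_in_open) auto
    then show "\<forall>\<^sub>F t in at 0. norm ((f t - p - t * q) / t\<^sup>2 - r) \<le> C * norm t"
    proof eventually_elim
      case (elim t)
      then have t: "t \<noteq> 0" "norm t \<le> 1" by auto
      have "(f t - p - t * q) / t\<^sup>2 - r = (f t - p - t * q - t\<^sup>2 * r) / t\<^sup>2" using t by (simp add: field_simps)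
      then have "norm ((f t - p - t * q) / t\<^sup>2 - r) = norm (f t - p - t * q - t\<^sup>2 * r) / (norm t)\<^sup>2"
        by (simp add: norm_divide norm_power)
      also have "... \<le> C * norm t ^ 3 / (norm t)\<^sup>2" by (intro divide_right_mono assms t) auto
      finally show ?case using t by (simp add: power2_eq_square power3_eq_cube)
    qed
  qed
  then show ?thesis by (simp add: LIM_zero_iff)
qed

abbreviation "char_fun \<equiv> \<lambda>la. 4 - (\<Delta> la)\<^sup>2"

lemma char_fun_expansion:
  "\<exists>h. (h \<longlongrightarrow> D2 la) (at 0) \<and> (\<forall>t. t \<noteq> 0 \<longrightarrow> char_fun (la + t) = D0 la + t * D1 la + t\<^sup>2 * h t)"
proof -
  obtain C where C: "\<And>t. norm t \<le> 1 \<Longrightarrow>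
    norm (m1 (la + t) 2 - m1 la 2 - t * a1 la - t\<^sup>2 * a2 la) \<le> C * norm t ^ 3 \<and>
    norm (m3 (la + t) 2 - m3 la 2 - t * c1 la - t\<^sup>2 * c2 la) \<le> C * norm t ^ 3"
    using expansion[of 2 la 1 0] unfolding m1_def m3_def a1_def a2_def c1_def c2_def by fastforce
  obtain C' where C': "\<And>t. norm t \<le> 1 \<Longrightarrow>
    norm (m2 (la + t) 2 - m2 la 2 - t * b1 la - t\<^sup>2 * b2 la) \<le> C' * norm t ^ 3 \<and>
    norm (m4 (la + t) 2 - m4 la 2 - t * d1 la - t\<^sup>2 * d2 la) \<le> C' * norm t ^ 3"
    using expansion[of 2 la 0 1] unfolding m2_def m4_def b1_def b2_def d1_def d2_def by fastforce
  define ra rb rc rd where "ra t = (m1 (la + t) 2 - m1 la 2 - t * a1 la) / t\<^sup>2"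
    and "rb t = (m2 (la + t) 2 - m2 la 2 - t * b1 la) / t\<^sup>2"
    and "rc t = (m3 (la + t) 2 - m3 la 2 - t * c1 la) / t\<^sup>2"
    and "rd t = (m4 (la + t) 2 - m4 la 2 - t * d1 la) / t\<^sup>2" for t
  have lim: "(ra \<longlongrightarrow> a2 la) (at 0)" "(rb \<longlongrightarrow> b2 la) (at 0)" "(rc \<longlongrightarrow> c2 la) (at 0)" "(rd \<longlongrightarrow> d2 la) (at 0)"
    unfolding ra_def rb_def rc_def rd_def
    using second_order_quotient[of "\<lambda>t. m1 (la + t) 2"] second_order_quotient[of "\<lambda>t. m2 (la + t) 2"]
      second_order_quotient[of "\<lambda>t. m3 (la + t) 2"] second_order_quotient[of "\<lambda>t. m4 (la + t) 2"] C C' by blast+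
  define h where "h t = (a0 la * rd t + a1 la * d1 la + ra t * d0 la - b0 la * rc t - b1 la * c1 la - rb t * c0 la)
    + t * (a1 la * rd t + ra t * d1 la - b1 la * rc t - rb t * c1 la) + t\<^sup>2 * (ra t * rd t - rb t * rc t)" for t
  have "(h \<longlongrightarrow> D2 la) (at 0)"
    unfolding h_def D2_def by (auto intro!: tendsto_eq_intros lim)
  moreover have "char_fun (la + t) = D0 la + t * D1 la + t\<^sup>2 * h t" if t: "t \<noteq> 0" for t
  proof -
    have e: "m1 (la + t) 2 - 1 = a0 la + t * a1 la + t\<^sup>2 * ra t" "m2 (la + t) 2 = b0 la + t * b1 la + t\<^sup>2 * rb t"
      "m3 (la + t) 2 = c0 la + t * c1 la + t\<^sup>2 * rc t" "m4 (la + t) 2 - 1 = d0 la + t * d1 la + t\<^sup>2 * rd t"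
      using t by (simp_all add: ra_def rb_def rc_def rd_def a0_def b0_def c0_def d0_def)
    show ?thesis unfolding det_period2[symmetric] e D0_def D1_def h_def by algebra
  qed
  ultimately show ?thesis by blast
qed

lemma char_fun_holomorphic: "char_fun holomorphic_on A"
  by (intro holomorphic_intros discr_holomorphic)

text \<open>Multiplicities above two would require longer chains; they do not occur far from the origin, where each disc
  around a multiple of \<open>\<pi>\<close> contains exactly two eigenvalues.\<close>

lemma alg_mult_eq_zero_mult:
  assumes nz: "char_fun z0 \<noteq> 0" and le: "zero_mult char_fun la \<le> 2"
  shows "alg_mult \<phi>1 \<phi>2 la = zero_mult char_fun la"
proof (cases "char_fun la = 0")
  case False
  have "D0 la = char_fun la" using det_period2[of la] by (simp add: D0_def a0_def b0_def c0_def d0_def)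
  then have "alg_mult \<phi>1 \<phi>2 la = 0" using False by (intro alg_mult_0) simp
  then show ?thesis using False unfolding zero_mult_def by presburger
next
  case True
  define n where "n = zorder char_fun la"
  define g where "g = zor_poly char_fun la"
  have D00: "D0 la = 0" using det_period2[of la] True by (simp add: D0_def a0_def b0_def c0_def d0_def)
  have ex: "\<exists>w\<in>UNIV. char_fun w \<noteq> 0" using nz by (intro bexI[of _ z0]) auto
  have "0 < n \<and> (\<exists>r>0. g holomorphic_on cball la r \<and> (\<forall>w\<in>cball la r. char_fun w = g w * (w - la) ^ nat n \<and> g w \<noteq> 0))"
    unfolding n_def g_def
    using zorder_exist_zero[OF char_fun_holomorphic open_UNIV connected_UNIV UNIV_I ex, of la] True by auto
  then obtain r where n0: "n > 0" and r: "r > 0" and gh: "g holomorphic_on cball la r"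
    and fg: "\<And>w. w \<in> cball la r \<Longrightarrow> char_fun w = g w * (w - la) ^ nat n \<and> g w \<noteq> 0"
    by blast
  obtain h where h: "(h \<longlongrightarrow> D2 la) (at 0)" and eq: "\<And>t. t \<noteq> 0 \<Longrightarrow> char_fun (la + t) = D0 la + t * D1 la + t\<^sup>2 * h t"
    using char_fun_expansion by blast
  have ev: "\<forall>\<^sub>F t :: complex in at 0. t \<in> ball 0 r - {0}"
    by (rule eventually_at_in_open) (use r in auto)
  have gc: "((\<lambda>t. g (la + t)) \<longlongrightarrow> g la) (at 0)"
  proof -
    have "isCont g la" using holomorphic_on_imp_continuous_on[OF gh] r by (intro continuous_on_interior[of "cball la r"]) auto
    then show ?thesis by (simp add: isCont_iff)
  qed
  have gm: "g la \<noteq> 0" using fg[of la] r by auto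
  have key: "g (la + t) * t ^ nat n = t * D1 la + t\<^sup>2 * h t" if "t \<in> ball 0 r - {0}" for t
    using fg[of "la + t"] eq[of t] that D00 by (auto simp: dist_norm)
  have zm: "zero_mult char_fun la = nat n" using True by (simp add: zero_mult_def n_def)
  consider "n = 1" | "n = 2" using n0 le zm by linarith
  then show ?thesis
  proof cases
    case 1
    have "\<forall>\<^sub>F t in at 0. D1 la + t * h t = g (la + t)"
      using ev
    proof eventually_elim
      case (elim t)
      have "t * g (la + t) = t * (D1 la + t * h t)" using key[OF elim] 1 by (simp add: power2_eq_square algebra_simps)
      then show ?case using elim by simp
    qed
    moreover have "((\<lambda>t. D1 la + t * h t) \<longlongrightarrow> D1 la) (at 0)" by (auto intro!: tendsto_eq_intros h)
    ultimately have "((\<lambda>t. g (la + t)) \<longlongrightarrow> D1 la) (at 0)" by (rule Lim_transform_eventually[rotated])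
    then have "D1 la = g la" using gc by (metis LIM_unique)
    then show ?thesis using alg_mult_1[OF D00] gm zm 1 by simp
  next
    case 2
    have "\<forall>\<^sub>F t in at 0. D1 la + t * h t = t * g (la + t)"
      using ev
    proof eventually_elim
      case (elim t)
      have "t * (t * g (la + t)) = t * (D1 la + t * h t)" using key[OF elim] 2 by (simp add: power2_eq_square algebra_simps)
      then show ?case using elim by simp
    qed
    moreover have "((\<lambda>t. D1 la + t * h t) \<longlongrightarrow> D1 la) (at 0)" by (auto intro!: tendsto_eq_intros h)
    ultimately have "((\<lambda>t. t * g (la + t)) \<longlongrightarrow> D1 la) (at 0)" by (rule Lim_transform_eventually[rotated])
    moreover have "((\<lambda>t. t * g (la + t)) \<longlongrightarrow> 0) (at 0)" by (auto intro!: tendsto_eq_intros gc)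
    ultimately have D1: "D1 la = 0" by (metis LIM_unique)
    have "\<forall>\<^sub>F t in at 0. h t = g (la + t)"
      using ev
    proof eventually_elim
      case (elim t)
      have "t\<^sup>2 * g (la + t) = t\<^sup>2 * h t" using key[OF elim] 2 D1 by (simp add: algebra_simps)
      then show ?case using elim by simp
    qed
    with h have "((\<lambda>t. g (la + t)) \<longlongrightarrow> D2 la) (at 0)" by (rule Lim_transform_eventually)
    then have "D2 la = g la" using gc by (metis LIM_unique)
    then show ?thesis using alg_mult_2[OF D00 D1] gm zm 2 by simp
  qed
qed

end

section \<open>Tools for approximate diagonalisation\<close>

text \<open>The recursion says that the powers of \<open>ka\<close> below \<open>N\<close> cancel in the Riccati equation; what is left over are
  the contribution of \<open>s (N + 1)\<close> and the products whose order exceeds \<open>N\<close>.\<close>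

lemma formal_riccati:
  fixes s s' :: "nat \<Rightarrow> complex"
  assumes ka: "ka \<noteq> 0" and rec: "\<And>k. k \<in> {1..N} \<Longrightarrow> s' k = s (Suc k) - \<i> * f * (\<Sum>j\<in>{1..<k}. s j * s (k - j))"
    and N: "N \<ge> 1"
  shows "(\<Sum>k=1..N. s k * ka ^ k) / ka - s 1 - (\<Sum>k=1..N. s' k * ka ^ k) - \<i> * f * (\<Sum>k=1..N. s k * ka ^ k)\<^sup>2 =
    - s (Suc N) * ka ^ N - \<i> * f * (\<Sum>(j,l)\<in>{(j,l)\<in>{1..N}\<times>{1..N}. N < j + l}. s j * s l * ka ^ (j + l))"
proof -
  have tele: "(\<Sum>k=1..n. s k * ka ^ k) / ka - s 1 - (\<Sum>k=1..n. s (Suc k) * ka ^ k) = - s (Suc n) * ka ^ n" if "n \<ge> 1" for n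
    using that
  proof (induction n rule: dec_induct)
    case base show ?case using ka by simp
  next
    case (step n)
    then show ?case using ka by (simp add: add_divide_distrib algebra_simps)
  qed
  define g where "g = (\<lambda>(j,l). s j * s l * ka ^ (j + l))"
  have sq: "(\<Sum>k=1..N. s k * ka ^ k)\<^sup>2 = sum g ({1..N}\<times>{1..N})"
    unfolding power2_eq_square sum_product sum.cartesian_product g_def by (intro sum.cong) (auto simp: power_add mult_ac)
  have split: "sum g ({1..N}\<times>{1..N}) = sum g {(j,l)\<in>{1..N}\<times>{1..N}. j + l \<le> N} + sum g {(j,l)\<in>{1..N}\<times>{1..N}. N < j + l}"
  proof -
    have fin: "finite {(j,l)\<in>{1..N}\<times>{1..N}. P j l}" for P
      by (rule finite_subset[of _ "{1..N}\<times>{1..N}"]) auto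
    have U: "{1..N}\<times>{1..N} = {(j,l)\<in>{1..N}\<times>{1..N}. j + l \<le> N} \<union> {(j,l)\<in>{1..N}\<times>{1..N}. N < j + l}" by auto
    have "sum g ({(j,l)\<in>{1..N}\<times>{1..N}. j + l \<le> N} \<union> {(j,l)\<in>{1..N}\<times>{1..N}. N < j + l}) =
        sum g {(j,l)\<in>{1..N}\<times>{1..N}. j + l \<le> N} + sum g {(j,l)\<in>{1..N}\<times>{1..N}. N < j + l}"
      by (rule sum.union_disjoint[OF fin fin]) auto
    then show ?thesis by (simp only: U[symmetric])
  qed
  have conv: "(\<Sum>k=1..N. (\<Sum>j\<in>{1..<k}. s j * s (k - j)) * ka ^ k) = sum g {(j,l)\<in>{1..N}\<times>{1..N}. j + l \<le> N}"
  proof -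
    have "(\<Sum>k=1..N. (\<Sum>j\<in>{1..<k}. s j * s (k - j)) * ka ^ k) = (\<Sum>k=1..N. \<Sum>j\<in>{1..<k}. g (j, k - j))"
      by (intro sum.cong refl) (auto simp: sum_distrib_right g_def intro!: sum.cong)
    also have "... = (\<Sum>(k,j)\<in>(SIGMA k:{1..N}. {1..<k}). g (j, k - j))"
      by (rule sum.Sigma) auto
    also have "... = sum g {(j,l)\<in>{1..N}\<times>{1..N}. j + l \<le> N}"
      by (rule sum.reindex_bij_witness[where i="\<lambda>(j,l). (j + l, j)" and j="\<lambda>(k,j). (j, k - j)"]) auto
    finally show ?thesis .
  qed
  have "(\<Sum>k=1..N. s' k * ka ^ k) = (\<Sum>k=1..N. s (Suc k) * ka ^ k - \<i> * f * ((\<Sum>j\<in>{1..<k}. s j * s (k - j)) * ka ^ k))"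
    by (intro sum.cong refl) (simp add: rec algebra_simps)
  also have "... = (\<Sum>k=1..N. s (Suc k) * ka ^ k) - \<i> * f * sum g {(j,l)\<in>{1..N}\<times>{1..N}. j + l \<le> N}"
    by (simp only: sum_subtractf sum_distrib_left[symmetric] conv)
  finally have d: "(\<Sum>k=1..N. s' k * ka ^ k) = ..." .
  show ?thesis unfolding d sq split using tele[OF N] unfolding g_def by (simp add: algebra_simps)
qed

text \<open>The difference of \<open>u\<close> and 1 is an iterated integral of \<open>a\<close> and \<open>b\<close>. It is bounded by the size of \<open>a\<close> and that
  of the indefinite integral of \<open>b\<close>, which is small if \<open>b\<close> oscillates.\<close>

lemma second_order_term:
  assumes u: "ac_on 1 u (\<lambda>t. a t * v t)" and v: "ac_on 1 v (\<lambda>t. b t * u t)"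
    and init: "u 0 = 1" "v 0 = 0"
    and a: "L2b a A" and b: "L2b b B" and X: "L2b (\<lambda>t. integral {0..t} b) K"
  shows "norm (u 1 - 1) \<le> exp (A + B) * (1 + A) * (A * K)"
proof -
  note ai = L2b_absint(1)[OF a] and bi = L2b_absint(1)[OF b]
  define Y where "Y = exp (A + B)"
  define X where "X t = integral {0..t} b" for t
  have XL: "L2b X K" using X by (simp add: X_def[abs_def])
  have Xac: "ac_on 1 X b" unfolding X_def using ac_on_indefinite[OF bi, where c=0] by simp
  note cX = ac_on_continuous[OF Xac] and cu = ac_on_continuous[OF u] and cv = ac_on_continuous[OF v]
  have sys: "linsys 1 (\<lambda>t. 0) a b (\<lambda>t. 0) (\<lambda>t. 0) (\<lambda>t. 0) u v"
    using u v by (simp add: linsys_def)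
  have co: "coeffs_int 1 (\<lambda>t. 0) a b (\<lambda>t. 0)" using ai bi by (simp add: coeffs_int_def)
  have cn: "integral {0..1} (coeffs_norm (\<lambda>t. 0) a b (\<lambda>t. 0)) \<le> A + B"
    using L2b_absint(2)[OF a] L2b_absint(2)[OF b]
    by (simp add: coeffs_norm_def[abs_def] HK_integral_add[OF absint_norm_int[OF ai] absint_norm_int[OF bi]])
  have bd: "norm (u x) \<le> Y" "norm (v x) \<le> Y" if "x \<in> {0..1}" for x
  proof -
    have "norm (u x) + norm (v x) \<le> exp (integral {0..1} (coeffs_norm (\<lambda>t. 0) a b (\<lambda>t. 0)))"
      using linsys_bound[OF sys co _ _ that] by (simp add: init)
    also have "... \<le> Y" using cn by (simp add: Y_def)
    finally show "norm (u x) \<le> Y" "norm (v x) \<le> Y"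
      using norm_ge_zero[of "u x"] norm_ge_zero[of "v x"] by linarith+
  qed
  have Y0: "Y > 0" by (simp add: Y_def)
  have aX: "(\<lambda>t. a t * X t) absint_on {0..1}" by (rule absint_continuous_mult'[OF cX ai])
  define I where "I = integral {0..1} (\<lambda>t. norm (a t * X t))"
  have IK: "I \<le> A * K" unfolding I_def by (rule L2b_mult(2)[OF a XL])
  have I0: "I \<ge> 0" unfolding I_def by (rule integral_nonneg[OF absint_norm_int[OF aX]]) simp
  have vx: "norm (v x) \<le> Y * (norm (X x) + I)" if x: "x \<in> {0..1}" for x
  proof -
    have P: "ac_on 1 (\<lambda>t. v t - X t * u t) (\<lambda>t. - (X t * (a t * v t)))"
      by (rule ac_on_cong[OF ac_on_diff[OF v ac_on_mult[OF Xac u]]]) auto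
    have avX: "(\<lambda>t. X t * (a t * v t)) absint_on {0..x}"
      using absint_sub[OF absint_continuous_mult[OF cX ac_on_integrable[OF u]], of 0 x] x by simp
    have "v x - X x * u x = - integral {0..x} (\<lambda>t. X t * (a t * v t))"
      using ac_on_eq[OF P, of x] x by (simp add: init X_def)
    moreover have "norm (integral {0..x} (\<lambda>t. X t * (a t * v t))) \<le> integral {0..x} (\<lambda>t. Y * norm (a t * X t))"
    proof (rule integral_norm_bound_integral[OF absint_int[OF avX]])
      show "(\<lambda>t. Y * norm (a t * X t)) integrable_on {0..x}"
        by (rule integrable_on_mult_right[OF absint_norm_int[OF absint_sub[OF aX]]]) (use x in auto)
      fix t assume t: "t \<in> {0..x}"
      have "norm (X t * (a t * v t)) = norm (v t) * norm (a t * X t)" by (simp add: norm_mult mult_ac)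
      also have "... \<le> Y * norm (a t * X t)" using bd(2)[of t] t x by (intro mult_right_mono) auto
      finally show "norm (X t * (a t * v t)) \<le> Y * norm (a t * X t)" .
    qed
    moreover have "integral {0..x} (\<lambda>t. Y * norm (a t * X t)) \<le> Y * I"
      unfolding integral_mult_right I_def using Y0 x
      by (intro mult_left_mono integral_nonneg_mono[OF absint_norm_int[OF aX]]) auto
    moreover have "norm (X x * u x) \<le> Y * norm (X x)"
      using mult_left_mono[OF bd(1)[OF x], of "norm (X x)"] by (simp add: norm_mult mult_ac)
    moreover have "norm (v x) \<le> norm (v x - X x * u x) + norm (X x * u x)"
      using norm_triangle_ineq[of "v x - X x * u x" "X x * u x"] by simp
    ultimately show ?thesis by (simp add: norm_minus_commute distrib_left)
  qed
  have "norm (u 1 - u 0) \<le> integral {0..1} (\<lambda>t. norm (a t * v t))"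
    by (rule ac_on_norm_diff[OF u]) auto
  also have "... \<le> integral {0..1} (\<lambda>t. Y * norm (a t * X t) + (Y * I) * norm (a t))"
  proof (rule integral_le[OF absint_norm_int[OF ac_on_integrable[OF u]]])
    show "(\<lambda>t. Y * norm (a t * X t) + (Y * I) * norm (a t)) integrable_on {0..1}"
      by (intro integrable_add integrable_on_mult_right absint_norm_int aX ai)
    fix t :: real assume t: "t \<in> {0..1}"
    have "norm (a t * v t) \<le> norm (a t) * (Y * (norm (X t) + I))"
      unfolding norm_mult by (intro mult_left_mono vx t) auto
    then show "norm (a t * v t) \<le> Y * norm (a t * X t) + (Y * I) * norm (a t)" by (simp add: norm_mult algebra_simps)
  qed
  also have "... = Y * I + (Y * I) * integral {0..1} (\<lambda>t. norm (a t))"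
    unfolding I_def
    by (subst HK_integral_add[OF integrable_on_mult_right[OF absint_norm_int[OF aX]]
          integrable_on_mult_right[OF absint_norm_int[OF ai]]]) simp
  also have "... \<le> Y * I + (Y * I) * A"
    using L2b_absint(2)[OF a] Y0 I0 by (intro add_left_mono mult_left_mono) auto
  also have "... = Y * (1 + A) * I" by (simp add: algebra_simps)
  also have "... \<le> Y * (1 + A) * (A * K)"
    using IK Y0 L2b_nonneg[OF a] by (intro mult_left_mono) auto
  finally show ?thesis by (simp add: init Y_def)
qed

lemma L2b_le:
  assumes "L2b g K" "f \<in> borel_measurable (lebesgue_on {0..1})" "\<And>x. x \<in> {0..1} \<Longrightarrow> norm (f x) \<le> norm (g x)"
  shows "L2b f K"
proof -
  have gi: "(\<lambda>x. (norm (g x))\<^sup>2) integrable_on {0..1}" using assms(1) by (simp add: L2b_def)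
  have le: "(norm (f x))\<^sup>2 \<le> (norm (g x))\<^sup>2" if "x \<in> {0..1}" for x using assms(3)[OF that] by (intro power_mono) auto
  have int: "(\<lambda>x. (norm (f x))\<^sup>2) integrable_on {0..1}"
    by (rule measurable_bounded_by_integrable_imp_integrable_real[OF _ gi])
       (use le assms(2) in \<open>auto intro: borel_measurable_power borel_measurable_norm\<close>)
  have "integral {0..1} (\<lambda>x. (norm (f x))\<^sup>2) \<le> integral {0..1} (\<lambda>x. (norm (g x))\<^sup>2)"
    by (rule integral_le[OF int gi]) (use le in auto)
  then show ?thesis using assms(1,2) int by (simp add: L2b_def)
qed

lemma L2b_norm: "L2b f K \<Longrightarrow> L2b (\<lambda>x. complex_of_real (norm (f x))) K"
  by (rule L2b_le[of f]) (auto simp: L2b_def)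

text \<open>Integration by parts: a smooth amplitude \<open>w\<close> does not destroy the smallness of an indefinite integral.\<close>

lemma oscillatory_L2b:
  assumes f: "f absint_on {0..1}" and A: "L2b (\<lambda>t. integral {0..t} f) K"
    and w: "ac_on 1 w (\<lambda>t. g t * w t)" and w0: "\<And>t. t \<in> {0..1} \<Longrightarrow> norm (w t) \<le> M" and g: "L2b g G"
  shows "L2b (\<lambda>t. integral {0..t} (\<lambda>s. f s * w s)) (M * (1 + G) * K)"
proof -
  define F where "F t = integral {0..t} f" for t
  have FL: "L2b F K" using A by (simp add: F_def[abs_def])
  have Fac: "ac_on 1 F f" unfolding F_def using ac_on_indefinite[OF f, where c=0] by simp
  note cF = ac_on_continuous[OF Fac] and cw = ac_on_continuous[OF w]
  have M0: "M \<ge> 0" by (rule order_trans[OF norm_ge_zero w0[of 0]]) simp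
  have fw: "(\<lambda>s. f s * w s) absint_on {0..1}" by (rule absint_continuous_mult'[OF cw f])
  have Xac: "ac_on 1 (\<lambda>t. integral {0..t} (\<lambda>s. f s * w s)) (\<lambda>s. f s * w s)"
    using ac_on_indefinite[OF fw, where c=0] by simp
  have Fg: "L2b (\<lambda>t. complex_of_real (norm (F t))) K" by (rule L2b_norm[OF FL])
  have FgI: "integral {0..1} (\<lambda>t. norm (F t * g t)) \<le> K * G" and Fgi: "(\<lambda>t. F t * g t) absint_on {0..1}"
    using L2b_mult[OF FL g] by auto
  have le: "norm (integral {0..t} (\<lambda>s. f s * w s)) \<le> M * norm (F t) + M * (K * G)" if t: "t \<in> {0..1}" for t
  proof -
    have P: "ac_on 1 (\<lambda>t. F t * w t - integral {0..t} (\<lambda>s. f s * w s)) (\<lambda>t. F t * (g t * w t))"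
      by (rule ac_on_cong[OF ac_on_diff[OF ac_on_mult[OF Fac w] Xac]]) auto
    have "F t * w t - integral {0..t} (\<lambda>s. f s * w s) = integral {0..t} (\<lambda>t. F t * (g t * w t))"
      using ac_on_eq[OF P, of t] t by (simp add: F_def)
    then have "norm (F t * w t - integral {0..t} (\<lambda>s. f s * w s)) = norm (integral {0..t} (\<lambda>t. F t * (g t * w t)))"
      by (rule arg_cong)
    moreover have "norm (integral {0..t} (\<lambda>t. F t * (g t * w t))) \<le> integral {0..t} (\<lambda>t. M * norm (F t * g t))"
    proof (rule integral_norm_bound_integral)
      show "(\<lambda>t. F t * (g t * w t)) integrable_on {0..t}" by (rule ac_on_int_sub[OF P]) (use t in auto)
      show "(\<lambda>t. M * norm (F t * g t)) integrable_on {0..t}"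
        by (rule integrable_on_mult_right[OF absint_norm_int[OF absint_sub[OF Fgi]]]) (use t in auto)
      fix s assume s: "s \<in> {0..t}"
      have "norm (F s * (g s * w s)) = norm (w s) * norm (F s * g s)" by (simp add: norm_mult mult_ac)
      also have "... \<le> M * norm (F s * g s)" using w0[of s] s t by (intro mult_right_mono) auto
      finally show "norm (F s * (g s * w s)) \<le> M * norm (F s * g s)" .
    qed
    moreover have "integral {0..t} (\<lambda>t. M * norm (F t * g t)) \<le> M * (K * G)"
    proof -
      have "integral {0..t} (\<lambda>t. norm (F t * g t)) \<le> integral {0..1} (\<lambda>t. norm (F t * g t))"
        by (rule integral_nonneg_mono[OF absint_norm_int[OF Fgi]]) (use t in auto)
      then show ?thesis unfolding integral_mult_right using FgI M0 by (intro mult_left_mono) auto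
    qed
    moreover have "norm (F t * w t) \<le> M * norm (F t)"
      using mult_left_mono[OF w0[OF t], of "norm (F t)"] by (simp add: norm_mult mult_ac)
    moreover have "norm (integral {0..t} (\<lambda>s. f s * w s)) \<le> norm (F t * w t) + norm (F t * w t - integral {0..t} (\<lambda>s. f s * w s))"
      using norm_triangle_ineq4[of "F t * w t" "F t * w t - integral {0..t} (\<lambda>s. f s * w s)"] by simp
    ultimately show ?thesis by linarith
  qed
  have "L2b (\<lambda>t. of_real M * complex_of_real (norm (F t)) + of_real (M * (K * G))) (norm (of_real M :: complex) * K + norm (of_real (M * (K * G)) :: complex))"
    by (intro L2b_add L2b_cmult Fg L2b_const)
  moreover have "norm (of_real M :: complex) * K + norm (of_real (M * (K * G)) :: complex) = M * (1 + G) * K"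
  proof -
    have "0 \<le> M * (K * G)" using M0 L2b_nonneg[OF FL] L2b_nonneg[OF g] by simp
    then have "norm (of_real (M * (K * G)) :: complex) = M * (K * G)" "norm (of_real M :: complex) = M"
      using M0 unfolding norm_of_real by simp_all
    then show ?thesis by (simp add: algebra_simps)
  qed
  ultimately have B: "L2b (\<lambda>t. of_real M * complex_of_real (norm (F t)) + of_real (M * (K * G))) (M * (1 + G) * K)" by simp
  show ?thesis
  proof (rule L2b_le[OF B])
    show "(\<lambda>t. integral {0..t} (\<lambda>s. f s * w s)) \<in> borel_measurable (lebesgue_on {0..1})"
      by (rule continuous_imp_measurable_on_sets_lebesgue[OF ac_on_continuous[OF Xac]]) auto
    fix x :: real assume x: "x \<in> {0..1}"
    have "of_real M * complex_of_real (norm (F x)) + of_real (M * (K * G)) = of_real (M * norm (F x) + M * (K * G))" by simp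
    then show "norm (integral {0..x} (\<lambda>s. f s * w s)) \<le> norm (of_real M * complex_of_real (norm (F x)) + of_real (M * (K * G)))"
      using le[OF x] by (simp only: norm_of_real)
  qed
qed

text \<open>Gronwall's inequality for \<open>exp (- \<bar>Im la\<bar> * t) * (norm (h t) + norm (g t))\<close>.\<close>

lemma perturbed_exponential_bound:
  assumes sys: "linsys 1 (\<lambda>t. - \<i> * la + q t) om rho (\<lambda>t. \<i> * la - q t) (\<lambda>t. 0) (\<lambda>t. 0) h g"
    and i: "q absint_on {0..1}" "om absint_on {0..1}" "rho absint_on {0..1}"
    and k: "integral {0..1} (\<lambda>t. norm (q t) + norm (om t) + norm (rho t)) \<le> K" and init: "norm (h 0) + norm (g 0) \<le> 1"
  shows "norm (h 1 - exp (- \<i> * la) * h 0) \<le> K * exp K * exp \<bar>Im la\<bar>"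
    "norm (g 1 - exp (\<i> * la) * g 0) \<le> K * exp K * exp \<bar>Im la\<bar>"
proof -
  let ?k = "\<lambda>t. norm (q t) + norm (om t) + norm (rho t)"
  define m where "m = \<bar>Im la\<bar>"
  have ki: "?k absint_on {0..1}"
    by (intro set_integral_add absolutely_integrable_norm[unfolded o_def] i)
  have h: "ac_on 1 h (\<lambda>t. (- \<i> * la + q t) * h t + om t * g t)" and g: "ac_on 1 g (\<lambda>t. rho t * h t + (\<i> * la - q t) * g t)"
    using sys by (simp_all add: linsys_def)
  note ch = ac_on_continuous[OF h] and cg = ac_on_continuous[OF g]
  have id: "ac_on 1 (\<lambda>t. complex_of_real t) (\<lambda>t. 1)"
    by (rule ac_on_C1) (auto intro!: derivative_eq_intros)
  have e1: "ac_on 1 (\<lambda>t. exp (\<i> * la * of_real t)) (\<lambda>t. (\<i> * la * 1) * exp (\<i> * la * of_real t))"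
    by (intro ac_on_exp ac_on_cmult id)
  have e2: "ac_on 1 (\<lambda>t. exp (- \<i> * la * of_real t)) (\<lambda>t. (- \<i> * la * 1) * exp (- \<i> * la * of_real t))"
    by (intro ac_on_exp ac_on_cmult id)
  have P1: "ac_on 1 (\<lambda>t. exp (\<i> * la * of_real t) * h t) (\<lambda>t. exp (\<i> * la * of_real t) * (q t * h t + om t * g t))"
    by (rule ac_on_cong[OF ac_on_mult[OF e1 h]]) (auto simp: algebra_simps)
  have P2: "ac_on 1 (\<lambda>t. exp (- \<i> * la * of_real t) * g t) (\<lambda>t. exp (- \<i> * la * of_real t) * (rho t * h t - q t * g t))"
    by (rule ac_on_cong[OF ac_on_mult[OF e2 g]]) (auto simp: algebra_simps)
  define y where "y t = exp (- m * t) * (norm (h t) + norm (g t))" for t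
  have yc: "continuous_on {0..1} y" unfolding y_def by (intro continuous_intros ch cg)
  have ky: "(\<lambda>t. ?k t * y t) absint_on {0..1}" by (rule absint_continuous_mult'[OF yc ki])
  \<comment> \<open>common estimate for the two components\<close>
  have comp: "exp (- m * x) * norm (w x - exp (c * of_real x) * w 0) \<le> integral {0..x} F"
    if P: "ac_on 1 (\<lambda>t. exp (- c * of_real t) * w t) (\<lambda>t. exp (- c * of_real t) * G t)"
      and c: "\<bar>Re c\<bar> \<le> m" and G: "\<And>t. t \<in> {0..1} \<Longrightarrow> exp (- m * t) * norm (G t) \<le> F t" and F: "F absint_on {0..1}"
      and x: "x \<in> {0..1}" for c w G F x
  proof -
    have ex: "exp (c * of_real x) * exp (- c * of_real x) = 1" by (simp flip: exp_add)
    have "exp (- c * of_real x) * w x - w 0 = integral {0..x} (\<lambda>t. exp (- c * of_real t) * G t)"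
      using ac_on_eq[OF P, of x] x by simp
    then have "w x - exp (c * of_real x) * w 0 = exp (c * of_real x) * integral {0..x} (\<lambda>t. exp (- c * of_real t) * G t)"
      by (simp only: right_diff_distrib mult.assoc[symmetric] ex flip: \<open>exp (- c * of_real x) * w x - w 0 = _\<close>) simp
    also have "norm ... \<le> exp (Re c * x) * integral {0..x} (\<lambda>t. exp (- Re c * t) * (exp (m * t) * F t))"
      unfolding norm_mult
    proof (intro mult_mono)
      show "norm (exp (c * of_real x)) \<le> exp (Re c * x)" by simp
      have cF: "(\<lambda>t. exp (- Re c * t) * (exp (m * t) * F t)) integrable_on {0..x}"
        using absint_sub[OF F, of 0 x] x by (intro absint_int absint_continuous_mult continuous_intros) auto
      show "norm (integral {0..x} (\<lambda>t. exp (- c * of_real t) * G t)) \<le> integral {0..x} (\<lambda>t. exp (- Re c * t) * (exp (m * t) * F t))"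
      proof (rule integral_norm_bound_integral[OF ac_on_int_sub[OF P] cF])
        fix t assume t: "t \<in> {0..x}"
        have "norm (G t) \<le> exp (m * t) * F t"
          using mult_left_mono[OF G[of t], of "exp (m * t)"] t x by (simp add: exp_minus field_simps)
        then show "norm (exp (- c * of_real t) * G t) \<le> exp (- Re c * t) * (exp (m * t) * F t)"
          by (simp add: norm_mult)
      qed (use x in auto)
    qed auto
    also have "... = integral {0..x} (\<lambda>t. exp (Re c * x) * (exp (- Re c * t) * (exp (m * t) * F t)))" by simp
    also have "... \<le> integral {0..x} (\<lambda>t. exp (m * x) * F t)"
    proof (rule integral_le)
      show "(\<lambda>t. exp (Re c * x) * (exp (- Re c * t) * (exp (m * t) * F t))) integrable_on {0..x}"
        using absint_sub[OF F, of 0 x] x by (intro absint_int absint_continuous_mult continuous_intros) auto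
      show "(\<lambda>t. exp (m * x) * F t) integrable_on {0..x}"
        using absint_sub[OF F, of 0 x] x by (intro integrable_on_mult_right absint_int) auto
      fix t assume t: "t \<in> {0..x}"
      have F0: "F t \<ge> 0" using G[of t] t x by (meson atLeastAtMost_iff mult_nonneg_nonneg exp_ge_zero norm_ge_zero order_trans)
      have "Re c * (x - t) \<le> m * (x - t)" using c t by (intro mult_right_mono) auto
      then have "exp (Re c * x + (- Re c * t + m * t)) \<le> exp (m * x)" by (simp add: algebra_simps)
      then have "exp (Re c * x) * (exp (- Re c * t) * exp (m * t)) \<le> exp (m * x)" by (simp only: exp_add)
      from mult_right_mono[OF this F0] show "exp (Re c * x) * (exp (- Re c * t) * (exp (m * t) * F t)) \<le> exp (m * x) * F t"
        by (simp add: mult_ac)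
    qed
    also have "... = exp (m * x) * integral {0..x} F" by simp
    finally show ?thesis by (simp add: exp_minus field_simps)
  qed
  have P1': "ac_on 1 (\<lambda>t. exp (- (- \<i> * la) * of_real t) * h t) (\<lambda>t. exp (- (- \<i> * la) * of_real t) * (q t * h t + om t * g t))"
    using P1 by simp
  have P2': "ac_on 1 (\<lambda>t. exp (- (\<i> * la) * of_real t) * g t) (\<lambda>t. exp (- (\<i> * la) * of_real t) * (rho t * h t - q t * g t))"
    using P2 by simp
  have sum_le: "norm (q t * h t + om t * g t) + norm (rho t * h t - q t * g t) \<le> ?k t * (norm (h t) + norm (g t))" for t
  proof -
    have "norm (q t * h t + om t * g t) \<le> norm (q t) * norm (h t) + norm (om t) * norm (g t)"
      by (metis norm_mult norm_triangle_ineq)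
    moreover have "norm (rho t * h t - q t * g t) \<le> norm (rho t) * norm (h t) + norm (q t) * norm (g t)"
      by (metis norm_mult norm_triangle_ineq4)
    moreover have "0 \<le> norm (om t) * norm (h t)" "0 \<le> norm (rho t) * norm (g t)" by auto
    ultimately show ?thesis unfolding distrib_left distrib_right by linarith
  qed
  define F1 where "F1 t = exp (- m * t) * norm (q t * h t + om t * g t)" for t
  define F2 where "F2 t = exp (- m * t) * norm (rho t * h t - q t * g t)" for t
  have G1: "(\<lambda>t. q t * h t + om t * g t) absint_on {0..1}" and G2: "(\<lambda>t. rho t * h t - q t * g t) absint_on {0..1}"
    by (intro set_integral_add set_integral_diff absint_continuous_mult' ch cg i)+
  have F1i: "F1 absint_on {0..1}" and F2i: "F2 absint_on {0..1}"
    unfolding F1_def F2_def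
    by (intro absint_continuous_mult continuous_intros absolutely_integrable_norm[unfolded o_def] G1 G2)+
  have FF: "F1 t + F2 t \<le> ?k t * y t" for t
    using mult_left_mono[OF sum_le[of t], of "exp (- m * t)"] by (simp add: F1_def F2_def y_def algebra_simps)
  have c1: "exp (- m * x) * norm (h x - exp (- \<i> * la * of_real x) * h 0) \<le> integral {0..x} F1"
    "exp (- m * x) * norm (g x - exp (\<i> * la * of_real x) * g 0) \<le> integral {0..x} F2" if "x \<in> {0..1}" for x
    by (rule comp[OF P1' _ _ F1i that]; simp add: m_def F1_def) (rule comp[OF P2' _ _ F2i that]; simp add: m_def F2_def)
  have FI: "integral {0..x} F1 + integral {0..x} F2 \<le> integral {0..x} (\<lambda>t. ?k t * y t)" if "x \<in> {0..1}" for x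
  proof -
    have j: "F1 integrable_on {0..x}" "F2 integrable_on {0..x}" "(\<lambda>t. ?k t * y t) integrable_on {0..x}"
      by (rule absint_int[OF absint_sub[OF F1i]] absint_int[OF absint_sub[OF F2i]] absint_int[OF absint_sub[OF ky]]; use that in simp)+
    have "integral {0..x} F1 + integral {0..x} F2 = integral {0..x} (\<lambda>t. F1 t + F2 t)"
      by (rule HK_integral_add[OF j(1,2), symmetric])
    also have "... \<le> integral {0..x} (\<lambda>t. ?k t * y t)"
      by (rule integral_le[OF integrable_add[OF j(1,2)] j(3)]) (rule FF)
    finally show ?thesis .
  qed
  have gr: "y x \<le> 1 * exp (integral {0..x} ?k)" if x: "x \<in> {0..1}" for x
  proof (rule gronwall[OF ki _ yc _ x])
    fix x :: real assume x: "x \<in> {0..1}"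
    have ne: "exp (- m * x) * norm (exp (c * of_real x) * w) \<le> norm w" if "\<bar>Re c\<bar> \<le> m" for c w
    proof -
      have "Re c * x \<le> m * x" using that x by (intro mult_right_mono) auto
      then have "exp (- m * x) * exp (Re c * x) \<le> 1" by (simp flip: exp_add)
      from mult_right_mono[OF this norm_ge_zero[of w]] show ?thesis by (simp add: norm_mult mult_ac)
    qed
    have tri: "norm a \<le> norm (a - b) + norm b" for a b :: complex
      using norm_triangle_ineq[of "a - b" b] by simp
    have "y x \<le> exp (- m * x) * (norm (h x - exp (- \<i> * la * of_real x) * h 0) + norm (exp (- \<i> * la * of_real x) * h 0)
        + (norm (g x - exp (\<i> * la * of_real x) * g 0) + norm (exp (\<i> * la * of_real x) * g 0)))"
      unfolding y_def by (intro mult_left_mono add_mono tri) auto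
    also have "... \<le> integral {0..x} F1 + norm (h 0) + (integral {0..x} F2 + norm (g 0))"
      unfolding distrib_left by (intro add_mono c1 x ne) (auto simp: m_def)
    also have "... \<le> 1 + integral {0..x} (\<lambda>t. ?k t * y t)" using FI[OF x] init by linarith
    finally show "y x \<le> 1 + integral {0..x} (\<lambda>t. ?k t * y t)" .
  qed auto
  have y_le: "y x \<le> exp K" if "x \<in> {0..1}" for x
  proof -
    have "integral {0..x} ?k \<le> integral {0..1} ?k"
      by (rule integral_nonneg_mono[OF absint_int[OF ki]]) (use that in auto)
    then have "integral {0..x} ?k \<le> K" using k by linarith
    then show ?thesis using gr[OF that] by (auto intro: order_trans)
  qed
  have kyI: "integral {0..1} (\<lambda>t. ?k t * y t) \<le> K * exp K"
  proof -
    have "integral {0..1} (\<lambda>t. ?k t * y t) \<le> integral {0..1} (\<lambda>t. ?k t * exp K)"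
      by (rule integral_le[OF absint_int[OF ky] integrable_on_mult_left[OF absint_int[OF ki]]])
         (use y_le in \<open>auto intro!: mult_left_mono\<close>)
    also have "... \<le> K * exp K" using k by simp
    finally show ?thesis .
  qed
  have nn: "0 \<le> integral {0..1} F1" "0 \<le> integral {0..1} F2"
    by (rule integral_nonneg[OF absint_int[OF F1i]], simp add: F1_def)
       (rule integral_nonneg[OF absint_int[OF F2i]], simp add: F2_def)
  have "exp (- m) * norm (h 1 - exp (- \<i> * la) * h 0) \<le> K * exp K"
    using c1(1)[of 1] FI[of 1] kyI nn by simp
  then show "norm (h 1 - exp (- \<i> * la) * h 0) \<le> K * exp K * exp \<bar>Im la\<bar>"
    by (simp add: exp_minus m_def field_simps)
  have "exp (- m) * norm (g 1 - exp (\<i> * la) * g 0) \<le> K * exp K"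
    using c1(2)[of 1] FI[of 1] kyI nn by simp
  then show "norm (g 1 - exp (\<i> * la) * g 0) \<le> K * exp K * exp \<bar>Im la\<bar>"
    by (simp add: exp_minus m_def field_simps)
qed

section \<open>The gauged system and a first bound for the discriminant\<close>

text \<open>The Fourier coefficient of \<open>f\<close> cut off at \<open>t\<close>, and its root mean square over the position \<open>t\<close> of the cut.\<close>

definition osc :: "cfun \<Rightarrow> int \<Rightarrow> real \<Rightarrow> complex" where
  "osc f n t = integral {0..t} (\<lambda>s. f s * exp (2 * of_real pi * \<i> * of_int n * of_real s))"

definition osc_norm :: "cfun \<Rightarrow> int \<Rightarrow> real" where
  "osc_norm f n = sqrt (integral {0..1} (\<lambda>t. (norm (osc f n t))\<^sup>2))"

lemma osc_integrand:
  assumes "L2b f K"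
  shows "(\<lambda>s. f s * exp (2 * of_real pi * \<i> * of_int n * of_real s)) absint_on {0..1}"
  by (intro absint_continuous_mult' continuous_intros L2b_absint(1)[OF assms])

lemma osc_continuous:
  assumes "L2b f K" shows "continuous_on {0..1} (osc f n)"
  using ac_on_continuous[OF ac_on_indefinite[OF osc_integrand[OF assms], where c=0]]
  by (simp add: osc_def[abs_def])

lemma osc_sq_int: "L2b f K \<Longrightarrow> (\<lambda>t. (norm (osc f n t))\<^sup>2) integrable_on {0..1}"
  by (intro integrable_continuous_real continuous_intros osc_continuous)

lemma osc_norm_sq: "L2b f K \<Longrightarrow> (osc_norm f n)\<^sup>2 = integral {0..1} (\<lambda>t. (norm (osc f n t))\<^sup>2)"
  unfolding osc_norm_def by (intro real_sqrt_pow2 integral_nonneg osc_sq_int) auto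

lemma osc_norm_nonneg: "L2b f K \<Longrightarrow> osc_norm f n \<ge> 0"
  unfolding osc_norm_def by (intro real_sqrt_ge_zero integral_nonneg osc_sq_int) auto

lemma osc_L2b: "L2b f K \<Longrightarrow> L2b (osc f n) (osc_norm f n)"
  unfolding L2b_def[of "osc f n"]
  by (auto simp: osc_norm_sq osc_sq_int osc_norm_nonneg intro!: continuous_imp_measurable_on_sets_lebesgue osc_continuous)

lemma osc_norm_sum:
  assumes f: "L2b f K" and S: "finite S"
  shows "(\<Sum>n\<in>S. (osc_norm f n)\<^sup>2) \<le> K\<^sup>2"
proof -
  have "(\<Sum>n\<in>S. (osc_norm f n)\<^sup>2) = integral {0..1} (\<lambda>t. \<Sum>n\<in>S. (norm (osc f n t))\<^sup>2)"
    unfolding osc_norm_sq[OF f] by (rule integral_sum[symmetric, OF S]) (rule osc_sq_int[OF f])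
  also have "... \<le> integral {0..1} (\<lambda>t::real. K\<^sup>2)"
    by (rule integral_le) (use bessel[OF f _ S] osc_sq_int[OF f] S in \<open>auto intro: integrable_sum simp: osc_def\<close>)
  finally show ?thesis by simp
qed

text \<open>Bounds for the coefficients of the gauged system. What matters is that they depend on \<open>N\<close> and \<open>C\<close> only.\<close>

definition "wkb_1 N C = C + (real N)\<^sup>2 * C ^ 3"
definition "wkb_2 N C = real N * C\<^sup>2 + C * wkb_1 N C"
definition "wkb_3 N C = C + 2 * real N * C ^ 3 + C\<^sup>2 * wkb_1 N C"
definition "wkb_W N C = wkb_1 N C + wkb_2 N C + wkb_3 N C"

locale wkb = zs +
  fixes N :: nat and C :: real and p dp :: cfun and r dr :: "nat \<Rightarrow> real \<Rightarrow> complex"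
  assumes wd: "wkb_data N C \<phi>1 \<phi>2 p dp r dr"
begin

abbreviation "FN \<equiv> zs_F N \<phi>1 \<phi>2"

lemma data:
  "N \<ge> 1" "C \<ge> 1" "ac_on 1 p dp" "p 0 = p 1" "AE x in lebesgue. x \<in> {0..1} \<longrightarrow> \<phi>1 x = p x"
  "\<And>x. x \<in> {0..1} \<Longrightarrow> norm (p x) \<le> C" "L2b dp C"
  "\<And>k. k \<in> {1..N} \<Longrightarrow> ac_on 1 (r k) (dr k)" "\<And>k. k \<in> {1..N} \<Longrightarrow> r k 0 = r k 1"
  "\<And>k x. k \<in> {1..N} \<Longrightarrow> x \<in> {0..1} \<Longrightarrow> norm (r k x) \<le> C"
  "\<And>k. k \<in> {1..N} \<Longrightarrow> AE x in lebesgue. x \<in> {0..1} \<longrightarrow> r (Suc k) x = dr k x + p x * (\<Sum>j\<in>{1..<k}. r j x * r (k - j) x)"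
  "L2b (r (Suc N)) C" "\<And>k. k \<in> {1..Suc N} \<Longrightarrow> AE x in lebesgue. x \<in> {0..1} \<longrightarrow> zs_r \<phi>1 \<phi>2 k x = r k x"
  "AE x in lebesgue. x \<in> {0..1} \<longrightarrow> \<phi>2 x = - r 1 x"
  using wd unfolding wkb_data_def by blast+

lemma C0: "C \<ge> 0" using data(2) by simp

lemma W_bounds: "0 \<le> wkb_1 N C" "0 \<le> wkb_2 N C" "0 \<le> wkb_3 N C" "wkb_1 N C \<le> wkb_W N C" "wkb_2 N C \<le> wkb_W N C" "wkb_3 N C \<le> wkb_W N C"
  "(real N)\<^sup>2 * C ^ 3 \<le> wkb_1 N C" "0 \<le> wkb_W N C" "2 * real N * C ^ 3 + C\<^sup>2 * wkb_1 N C \<le> wkb_3 N C"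
proof -
  show 1: "0 \<le> wkb_1 N C" using C0 by (simp add: wkb_1_def)
  show 2: "0 \<le> wkb_2 N C" using C0 1 by (simp add: wkb_2_def)
  show 3: "0 \<le> wkb_3 N C" using C0 1 by (simp add: wkb_3_def)
  show "wkb_1 N C \<le> wkb_W N C" "wkb_2 N C \<le> wkb_W N C" "wkb_3 N C \<le> wkb_W N C" "0 \<le> wkb_W N C"
    using 1 2 3 by (simp_all add: wkb_W_def)
  show "(real N)\<^sup>2 * C ^ 3 \<le> wkb_1 N C" "2 * real N * C ^ 3 + C\<^sup>2 * wkb_1 N C \<le> wkb_3 N C"
    using C0 by (simp_all add: wkb_1_def wkb_3_def)
qed

text \<open>With \<open>ka = 1 / (2 i la)\<close>, the sum \<open>sg\<close> is the formal solution, cut off after \<open>N\<close> terms, of the Riccati equation for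
  \<open>v / u\<close>, and \<open>rho\<close> is its residual. The term \<open>al\<close> serves to remove the leading part of the other off-diagonal entry.
  \<open>qq\<close>, \<open>om\<close> and \<open>rho\<close> are the coefficients of the transformed system.\<close>

definition "J = {(j,l)\<in>{1..N}\<times>{1..N}. N < j + l}"
definition "sg ka x = (\<Sum>k=1..N. - \<i> * r k x * ka ^ k)"
definition "dsg ka x = (\<Sum>k=1..N. - \<i> * dr k x * ka ^ k)"
definition "rho1 ka x = \<i> * p x * (\<Sum>(j,l)\<in>J. (- \<i> * r j x) * (- \<i> * r l x) * ka ^ (j + l - Suc N))"
definition "rho ka x = ka ^ N * (\<i> * r (Suc N) x - ka * rho1 ka x)"
definition "al1 x = - \<i> * p x"
definition "al ka x = ka * al1 x"
definition "dal ka x = ka * (- \<i> * dp x)"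
definition "PP1 ka x = \<i> * p x * (\<Sum>k=1..N. - \<i> * r k x * ka ^ (k - 1))"
definition "PP ka x = ka * PP1 ka x"
definition "qq ka x = PP ka x + al ka x * rho ka x"
definition "om1 ka x = - (2 * al1 x * PP1 ka x) - (al1 x)\<^sup>2 * rho ka x"
definition "om ka x = dal ka x + ka\<^sup>2 * om1 ka x"

abbreviation "gauged la ka \<equiv> linsys 1 (\<lambda>t. - \<i> * la + qq ka t) (om ka) (rho ka) (\<lambda>t. \<i> * la - qq ka t) (\<lambda>t. 0) (\<lambda>t. 0)"

lemma finite_J: "finite J" "card J \<le> N\<^sup>2"
proof -
  have s: "J \<subseteq> {1..N}\<times>{1..N}" by (auto simp: J_def)
  then show "finite J" by (rule finite_subset) auto
  show "card J \<le> N\<^sup>2" using card_mono[OF _ s] by (simp add: card_cartesian_product power2_eq_square)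
qed

lemma PP_eq: "PP ka x = \<i> * p x * sg ka x"
proof -
  have "ka * (\<Sum>k=1..N. - \<i> * r k x * ka ^ (k - 1)) = (\<Sum>k=1..N. - \<i> * r k x * ka ^ k)"
    unfolding sum_distrib_left
  proof (rule sum.cong)
    fix k assume "k \<in> {1..N}"
    then show "ka * (- \<i> * r k x * ka ^ (k - 1)) = - \<i> * r k x * ka ^ k" by (cases k) auto
  qed simp
  then have "\<i> * p x * (ka * (\<Sum>k=1..N. - \<i> * r k x * ka ^ (k - 1))) = \<i> * p x * (\<Sum>k=1..N. - \<i> * r k x * ka ^ k)" by simp
  then show ?thesis unfolding PP_def PP1_def sg_def by (simp only: mult.left_commute[of ka])
qed

lemma r_cont: "k \<in> {1..N} \<Longrightarrow> continuous_on {0..1} (r k)" by (rule ac_on_continuous[OF data(8)])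
lemma p_cont: "continuous_on {0..1} p" by (rule ac_on_continuous[OF data(3)])

lemma cont1: "continuous_on {0..1} (rho1 ka)" "continuous_on {0..1} (PP1 ka)" "continuous_on {0..1} al1"
  unfolding rho1_def PP1_def al1_def split_def
  by (intro continuous_intros p_cont r_cont; auto simp: J_def)+

lemma meas1: "rho1 ka \<in> borel_measurable (lebesgue_on {0..1})" "PP1 ka \<in> borel_measurable (lebesgue_on {0..1})" "al1 \<in> borel_measurable (lebesgue_on {0..1})"
  by (intro continuous_imp_measurable_on_sets_lebesgue cont1; simp)+

lemma bound1:
  assumes ka: "norm ka \<le> 1" and x: "x \<in> {0..1}"
  shows "norm (rho1 ka x) \<le> (real N)\<^sup>2 * C ^ 3" "norm (PP1 ka x) \<le> real N * C\<^sup>2" "norm (al1 x) \<le> C"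
proof -
  have pw: "norm ka ^ m \<le> 1" for m using ka by (simp add: power_le_one)
  have "norm (\<Sum>(j,l)\<in>J. (- \<i> * r j x) * (- \<i> * r l x) * ka ^ (j + l - Suc N)) \<le> (\<Sum>(j,l)\<in>J. C * C)"
    unfolding split_def
  proof (rule sum_norm_le)
    fix i assume "i \<in> J"
    then have "fst i \<in> {1..N}" "snd i \<in> {1..N}" by (auto simp: J_def)
    then show "norm ((- \<i> * r (fst i) x) * (- \<i> * r (snd i) x) * ka ^ (fst i + snd i - Suc N)) \<le> C * C"
      using mult_mono[OF mult_mono[OF data(10)[of "fst i" x] data(10)[of "snd i" x]] pw[of "fst i + snd i - Suc N"]] x C0
      by (simp add: norm_mult norm_power)
  qed
  also have "... = real (card J) * (C * C)" by (simp add: split_def)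
  also have "... \<le> real (N\<^sup>2) * (C * C)" using finite_J(2) C0 by (intro mult_right_mono) auto
  finally have "norm (\<Sum>(j,l)\<in>J. (- \<i> * r j x) * (- \<i> * r l x) * ka ^ (j + l - Suc N)) \<le> real (N\<^sup>2) * (C * C)" .
  from mult_mono[OF data(6)[OF x] this C0] show "norm (rho1 ka x) \<le> (real N)\<^sup>2 * C ^ 3"
    by (simp add: rho1_def norm_mult power3_eq_cube mult_ac)
  have "norm (\<Sum>k=1..N. - \<i> * r k x * ka ^ (k - 1)) \<le> (\<Sum>k=1..N. C)"
  proof (rule sum_norm_le)
    fix k assume "k \<in> {1..N}"
    then show "norm (- \<i> * r k x * ka ^ (k - 1)) \<le> C"
      using mult_mono[OF data(10)[of k x] pw[of "k - 1"]] x C0 by (simp add: norm_mult norm_power)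
  qed
  then have "norm (\<Sum>k=1..N. - \<i> * r k x * ka ^ (k - 1)) \<le> real N * C" by simp
  from mult_mono[OF data(6)[OF x] this C0] show "norm (PP1 ka x) \<le> real N * C\<^sup>2"
    by (simp add: PP1_def norm_mult power2_eq_square mult_ac)
  show "norm (al1 x) \<le> C" using data(6)[OF x] by (simp add: al1_def norm_mult)
qed

lemma rho_L2b: assumes "norm ka \<le> 1" shows "L2b (rho ka) (norm ka ^ N * wkb_1 N C)"
proof -
  have "L2b (\<lambda>x. ka ^ N * (\<i> * r (Suc N) x + (- ka) * rho1 ka x)) (norm (ka ^ N) * (norm \<i> * C + norm (- ka) * ((real N)\<^sup>2 * C ^ 3)))"
    by (intro L2b_cmult L2b_add data(12) L2b_bdd meas1 bound1(1) assms)
  moreover have "norm (ka ^ N) * (norm \<i> * C + norm (- ka) * ((real N)\<^sup>2 * C ^ 3)) \<le> norm ka ^ N * wkb_1 N C"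
    using C0 mult_right_mono[OF assms, of "(real N)\<^sup>2 * C ^ 3"] by (auto simp: wkb_1_def norm_power intro!: mult_left_mono)
  ultimately show ?thesis using L2b_mono by (simp add: rho_def[abs_def])
qed

lemma rho_L2b': assumes "norm ka \<le> 1" shows "L2b (rho ka) (norm ka * wkb_1 N C)"
  by (rule L2b_mono[OF rho_L2b[OF assms]])
     (use power_decreasing[of 1 N "norm ka"] assms data(1) W_bounds in \<open>auto intro!: mult_right_mono\<close>)

lemma product_L2b:
  assumes ka: "norm ka \<le> 1"
  shows "L2b (PP1 ka) (real N * C\<^sup>2)" "L2b (\<lambda>x. al1 x * PP1 ka x) (C * (real N * C\<^sup>2))"
    "L2b (\<lambda>x. al1 x * rho ka x) (C * (norm ka ^ N * wkb_1 N C))"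
    "L2b (\<lambda>x. al1 x * (al1 x * rho ka x)) (C * (C * (norm ka ^ N * wkb_1 N C)))"
proof -
  show 1: "L2b (PP1 ka) (real N * C\<^sup>2)" by (rule L2b_bdd[OF meas1(2) bound1(2)[OF ka]])
  have al: "norm (al1 x) \<le> C" if "x \<in> {0..1}" for x using bound1(3)[OF ka that] .
  show "L2b (\<lambda>x. al1 x * PP1 ka x) (C * (real N * C\<^sup>2))" by (rule L2b_bdd_mult[OF meas1(3) al 1])
  show 2: "L2b (\<lambda>x. al1 x * rho ka x) (C * (norm ka ^ N * wkb_1 N C))" by (rule L2b_bdd_mult[OF meas1(3) al rho_L2b[OF ka]])
  show "L2b (\<lambda>x. al1 x * (al1 x * rho ka x)) (C * (C * (norm ka ^ N * wkb_1 N C)))" by (rule L2b_bdd_mult[OF meas1(3) al 2])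
qed

lemma qq_L2b: assumes "norm ka \<le> 1" shows "L2b (qq ka) (norm ka * wkb_2 N C)"
proof -
  have ka1: "norm ka ^ N \<le> 1" using assms by (simp add: power_le_one)
  have "L2b (\<lambda>x. ka * PP1 ka x + ka * (al1 x * rho ka x)) (norm ka * (real N * C\<^sup>2) + norm ka * (C * (norm ka ^ N * wkb_1 N C)))"
    by (intro L2b_cmult L2b_add product_L2b assms)
  moreover have "norm ka * (real N * C\<^sup>2) + norm ka * (C * (norm ka ^ N * wkb_1 N C)) \<le> norm ka * wkb_2 N C"
  proof -
    have "C * (norm ka ^ N * wkb_1 N C) \<le> C * (1 * wkb_1 N C)"
      using ka1 C0 W_bounds by (intro mult_left_mono mult_right_mono) auto
    then show ?thesis unfolding wkb_2_def distrib_left[symmetric] by (intro mult_left_mono) auto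
  qed
  ultimately show ?thesis using L2b_mono by (simp add: qq_def[abs_def] PP_def al_def mult.assoc)
qed

lemma om1_L2b: assumes "norm ka \<le> 1" shows "L2b (om1 ka) (wkb_3 N C)"
proof -
  have ka1: "norm ka ^ N \<le> 1" using assms by (simp add: power_le_one)
  have "L2b (\<lambda>x. (- 2) * (al1 x * PP1 ka x) + (- 1) * (al1 x * (al1 x * rho ka x)))
     (norm (- 2 :: complex) * (C * (real N * C\<^sup>2)) + norm (- 1 :: complex) * (C * (C * (norm ka ^ N * wkb_1 N C))))"
    by (intro L2b_cmult L2b_add product_L2b assms)
  moreover have "norm (- 2 :: complex) * (C * (real N * C\<^sup>2)) + norm (- 1 :: complex) * (C * (C * (norm ka ^ N * wkb_1 N C))) \<le> wkb_3 N C"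
  proof -
    have "C * (C * (norm ka ^ N * wkb_1 N C)) \<le> C * (C * (1 * wkb_1 N C))"
      using ka1 C0 W_bounds by (intro mult_left_mono mult_right_mono) auto
    then show ?thesis using W_bounds(9) by (simp add: power2_eq_square power3_eq_cube mult_ac)
  qed
  ultimately have "L2b (\<lambda>x. (- 2) * (al1 x * PP1 ka x) + (- 1) * (al1 x * (al1 x * rho ka x))) (wkb_3 N C)" by (rule L2b_mono)
  then show ?thesis by (simp add: om1_def[abs_def] power2_eq_square mult_ac)
qed

lemma om_L2b: assumes "norm ka \<le> 1" shows "L2b (om ka) (norm ka * wkb_3 N C)"
proof -
  have "L2b (\<lambda>x. ka * (- \<i> * dp x) + ka * (ka * ((- 2) * (al1 x * PP1 ka x) + (- 1) * (al1 x * (al1 x * rho ka x)))))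
     (norm ka * (norm (- \<i>) * C) + norm ka * (norm ka * (norm (- 2 :: complex) * (C * (real N * C\<^sup>2)) + norm (- 1 :: complex) * (C * (C * (norm ka ^ N * wkb_1 N C))))))"
    by (intro L2b_cmult L2b_add data(7) product_L2b assms)
  moreover have "norm ka * (norm (- \<i>) * C) + norm ka * (norm ka * (norm (- 2 :: complex) * (C * (real N * C\<^sup>2)) + norm (- 1 :: complex) * (C * (C * (norm ka ^ N * wkb_1 N C)))))
     \<le> norm ka * wkb_3 N C"
  proof -
    have ka1: "norm ka ^ N \<le> 1" using assms by (simp add: power_le_one)
    have "C * (C * (norm ka ^ N * wkb_1 N C)) \<le> C * (C * (1 * wkb_1 N C))"
      using ka1 C0 W_bounds by (intro mult_left_mono mult_right_mono) auto
    then have "norm (- 2 :: complex) * (C * (real N * C\<^sup>2)) + norm (- 1 :: complex) * (C * (C * (norm ka ^ N * wkb_1 N C))) \<le> 2 * real N * C ^ 3 + C\<^sup>2 * wkb_1 N C"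
      by (simp add: power2_eq_square power3_eq_cube mult_ac)
    then have "norm ka * (norm (- 2 :: complex) * (C * (real N * C\<^sup>2)) + norm (- 1 :: complex) * (C * (C * (norm ka ^ N * wkb_1 N C)))) \<le> 1 * (2 * real N * C ^ 3 + C\<^sup>2 * wkb_1 N C)"
      using assms C0 W_bounds by (intro mult_mono) auto
    then show ?thesis unfolding wkb_3_def distrib_left[symmetric] by (intro mult_left_mono) auto
  qed
  ultimately have "L2b (\<lambda>x. ka * (- \<i> * dp x) + ka * (ka * ((- 2) * (al1 x * PP1 ka x) + (- 1) * (al1 x * (al1 x * rho ka x))))) (norm ka * wkb_3 N C)"
    by (rule L2b_mono)
  then show ?thesis by (simp add: om_def[abs_def] dal_def om1_def power2_eq_square algebra_simps)
qed

lemma coeff_integral: assumes "norm ka \<le> 1"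
  shows "integral {0..1} (\<lambda>t. norm (qq ka t) + norm (om ka t) + norm (rho ka t)) \<le> norm ka * wkb_W N C"
proof -
  note i = absint_norm_int[OF L2b_absint(1)[OF qq_L2b[OF assms]]] absint_norm_int[OF L2b_absint(1)[OF om_L2b[OF assms]]]
    absint_norm_int[OF L2b_absint(1)[OF rho_L2b'[OF assms]]]
  have "integral {0..1} (\<lambda>t. norm (qq ka t) + norm (om ka t) + norm (rho ka t)) =
     integral {0..1} (\<lambda>t. norm (qq ka t)) + integral {0..1} (\<lambda>t. norm (om ka t)) + integral {0..1} (\<lambda>t. norm (rho ka t))"
    by (simp add: HK_integral_add[OF integrable_add[OF i(1,2)] i(3)] HK_integral_add[OF i(1,2)])
  also have "... \<le> norm ka * wkb_2 N C + norm ka * wkb_3 N C + norm ka * wkb_1 N C"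
    by (intro add_mono L2b_absint(2) qq_L2b om_L2b rho_L2b' assms)
  finally show ?thesis by (simp add: wkb_W_def algebra_simps)
qed

lemma sg_ac: "ac_on 1 (sg ka) (dsg ka)"
proof -
  have "ac_on 1 (\<lambda>x. \<Sum>k\<in>{1..N}. (- \<i> * ka ^ k) * r k x) (\<lambda>x. \<Sum>k\<in>{1..N}. (- \<i> * ka ^ k) * dr k x)"
    by (intro ac_on_sum ac_on_cmult data(8))
  then show ?thesis by (simp add: sg_def[abs_def] dsg_def[abs_def] mult_ac)
qed

lemma al_ac: "ac_on 1 (al ka) (dal ka)"
  unfolding al_def al1_def dal_def by (intro ac_on_cmult data(3))

lemma riccati_residual:
  assumes ka: "ka \<noteq> 0"
  shows "AE x in lebesgue. x \<in> {0..1} \<longrightarrow> sg ka x / ka + \<i> * r 1 x - dsg ka x - \<i> * p x * (sg ka x)\<^sup>2 = rho ka x"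
proof -
  have "AE x in lebesgue. \<forall>k\<in>{1..N}. x \<in> {0..1} \<longrightarrow> r (Suc k) x = dr k x + p x * (\<Sum>j\<in>{1..<k}. r j x * r (k - j) x)"
    using data(11) by (intro AE_finite_allI) auto
  then show ?thesis
  proof eventually_elim
    case (elim x)
    show ?case
    proof
      assume x: "x \<in> {0..1}"
      have rec: "- \<i> * dr k x = - \<i> * r (Suc k) x - \<i> * p x * (\<Sum>j\<in>{1..<k}. (- \<i> * r j x) * (- \<i> * r (k - j) x))" if "k \<in> {1..N}" for k
      proof -
        have "(\<Sum>j\<in>{1..<k}. (- \<i> * r j x) * (- \<i> * r (k - j) x)) = - (\<Sum>j\<in>{1..<k}. r j x * r (k - j) x)"
          unfolding sum_negf[symmetric] by (intro sum.cong refl) (simp add: algebra_simps)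
        then show ?thesis using elim that x by (simp add: algebra_simps)
      qed
      have T: "\<i> * p x * (\<Sum>(j,l)\<in>J. (- \<i> * r j x) * (- \<i> * r l x) * ka ^ (j + l)) = ka ^ Suc N * rho1 ka x"
      proof -
        have "(\<Sum>(j,l)\<in>J. (- \<i> * r j x) * (- \<i> * r l x) * ka ^ (j + l)) =
          ka ^ Suc N * (\<Sum>(j,l)\<in>J. (- \<i> * r j x) * (- \<i> * r l x) * ka ^ (j + l - Suc N))"
          unfolding sum_distrib_left split_def
        proof (intro sum.cong refl)
          fix i assume "i \<in> J"
          then have "fst i + snd i = Suc N + (fst i + snd i - Suc N)" by (auto simp: J_def)
          then have "ka ^ (fst i + snd i) = ka ^ Suc N * ka ^ (fst i + snd i - Suc N)" by (metis power_add)
          then show "(- \<i> * r (fst i) x) * (- \<i> * r (snd i) x) * ka ^ (fst i + snd i) = ka ^ Suc N * ((- \<i> * r (fst i) x) * (- \<i> * r (snd i) x) * ka ^ (fst i + snd i - Suc N))"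
            by (simp only: mult_ac)
        qed
        then show ?thesis by (simp add: rho1_def mult_ac)
      qed
      have "(\<Sum>k=1..N. (- \<i> * r k x) * ka ^ k) / ka - (- \<i> * r 1 x) - (\<Sum>k=1..N. (- \<i> * dr k x) * ka ^ k) - \<i> * p x * (\<Sum>k=1..N. (- \<i> * r k x) * ka ^ k)\<^sup>2 =
        - (- \<i> * r (Suc N) x) * ka ^ N - \<i> * p x * (\<Sum>(j,l)\<in>{(j,l)\<in>{1..N}\<times>{1..N}. N < j + l}. (- \<i> * r j x) * (- \<i> * r l x) * ka ^ (j + l))"
        by (rule formal_riccati[where s="\<lambda>k. - \<i> * r k x" and s'="\<lambda>k. - \<i> * dr k x", OF ka rec data(1)])
      also have "... = rho ka x"
        unfolding J_def[symmetric] T rho_def by (simp add: algebra_simps)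
      finally show "sg ka x / ka + \<i> * r 1 x - dsg ka x - \<i> * p x * (sg ka x)\<^sup>2 = rho ka x"
        unfolding sg_def dsg_def by simp
    qed
  qed
qed

text \<open>Replacing \<open>v\<close> by \<open>g = v - sg * u\<close> leaves only the Riccati residual \<open>rho\<close> below the diagonal. Adding \<open>al * g\<close> to \<open>u\<close> cancels
  the entry \<open>i \<phi>1\<close> above the diagonal, because \<open>al = - i p ka\<close> picks up the factor \<open>2 i la = 1 / ka\<close>; this costs the derivative
  \<open>dal\<close> and terms of second order.\<close>

lemma gauge:
  assumes ka: "ka \<noteq> 0" and la: "1 / ka = 2 * \<i> * la" and Z: "ZS 1 la (\<lambda>t. 0) (\<lambda>t. 0) u v"
  shows "gauged la ka
     (\<lambda>t. u t + al ka t * (v t - sg ka t * u t)) (\<lambda>t. v t - sg ka t * u t)"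
proof -
  have la': "2 * \<i> * la * ka = 1" using ka la by (metis nonzero_eq_divide_eq)
  define g where "g t = v t - sg ka t * u t" for t
  define h where "h t = u t + al ka t * g t" for t
  have u: "ac_on 1 u (\<lambda>t. - \<i> * la * u t + \<i> * \<phi>1 t * v t)" and v: "ac_on 1 v (\<lambda>t. - \<i> * \<phi>2 t * u t + \<i> * la * v t)"
    using Z by (simp_all add: linsys_def)
  have AEs: "AE x in lebesgue. x \<in> {0..1} \<longrightarrow> \<phi>1 x = p x \<and> \<phi>2 x = - r 1 x \<and> 2 * \<i> * la * sg ka x + \<i> * r 1 x - dsg ka x - \<i> * p x * (sg ka x)\<^sup>2 = rho ka x"
    using data(5) data(14) riccati_residual[OF ka]
  proof eventually_elim
    case (elim x)
    have "sg ka x / ka = 2 * \<i> * la * sg ka x" using la by (metis mult.commute times_divide_eq_right mult_1_right)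
    with elim show ?case by auto
  qed
  have gac: "ac_on 1 g (\<lambda>t. (\<i> * la - PP ka t) * g t + rho ka t * u t)"
    unfolding g_def
  proof (rule ac_on_AE[OF ac_on_diff[OF v ac_on_mult[OF sg_ac u]]], use AEs in eventually_elim, intro impI, elim impE)
    fix x :: real assume x: "x \<in> {0..1}"
    assume a: "\<phi>1 x = p x \<and> \<phi>2 x = - r 1 x \<and> 2 * \<i> * la * sg ka x + \<i> * r 1 x - dsg ka x - \<i> * p x * (sg ka x)\<^sup>2 = rho ka x"
    then have ph: "\<phi>1 x = p x" "\<phi>2 x = - r 1 x" and R: "rho ka x = 2 * \<i> * la * sg ka x + \<i> * r 1 x - dsg ka x - \<i> * p x * (sg ka x)\<^sup>2" by auto
    show "(\<i> * la - PP ka x) * (v x - sg ka x * u x) + rho ka x * u x =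
       - \<i> * \<phi>2 x * u x + \<i> * la * v x - (dsg ka x * u x + sg ka x * (- \<i> * la * u x + \<i> * \<phi>1 x * v x))"
      unfolding R ph PP_eq by (simp add: power2_eq_square algebra_simps)
  qed auto
  have hac: "ac_on 1 h (\<lambda>t. (- \<i> * la + qq ka t) * h t + om ka t * g t)"
    unfolding h_def
  proof (rule ac_on_AE[OF ac_on_add[OF u ac_on_mult[OF al_ac gac]]], use AEs in eventually_elim, intro impI, elim impE)
    fix x :: real assume x: "x \<in> {0..1}"
    assume a: "\<phi>1 x = p x \<and> \<phi>2 x = - r 1 x \<and> 2 * \<i> * la * sg ka x + \<i> * r 1 x - dsg ka x - \<i> * p x * (sg ka x)\<^sup>2 = rho ka x"
    have vg: "v x = g x + sg ka x * u x" by (simp add: g_def)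
    have A: "2 * \<i> * la * al ka x = - \<i> * p x"
    proof -
      have "2 * \<i> * la * al ka x = (2 * \<i> * la * ka) * al1 x" by (simp add: al_def mult_ac)
      then show ?thesis unfolding la' by (simp add: al1_def)
    qed
    have omx: "om ka x = dal ka x - 2 * al ka x * PP ka x - (al ka x)\<^sup>2 * rho ka x"
      by (simp add: om_def om1_def al_def PP_def power2_eq_square algebra_simps)
    have "(- \<i> * la + qq ka x) * (u x + al ka x * g x) + om ka x * g x
       - (- \<i> * la * u x + \<i> * p x * v x + (dal ka x * g x + al ka x * ((\<i> * la - PP ka x) * g x + rho ka x * u x)))
       = - (2 * \<i> * la * al ka x + \<i> * p x) * g x"
      unfolding omx qq_def vg PP_eq by (simp add: power2_eq_square algebra_simps)
    also have "... = 0" unfolding A by simp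
    finally show "(- \<i> * la + qq ka x) * (u x + al ka x * g x) + om ka x * g x =
       - \<i> * la * u x + \<i> * \<phi>1 x * v x + (dal ka x * g x + al ka x * ((\<i> * la - PP ka x) * g x + rho ka x * u x))"
      using a by simp
  qed auto
  have gac': "ac_on 1 g (\<lambda>t. rho ka t * h t + (\<i> * la - qq ka t) * g t)"
    by (rule ac_on_cong[OF gac]) (auto simp: h_def qq_def algebra_simps)
  have "gauged la ka h g"
    using hac gac' by (simp add: linsys_def)
  then show ?thesis by (simp add: h_def[abs_def] g_def[abs_def])
qed

lemma gauged_monodromy:
  assumes ka: "ka \<noteq> 0" and la: "1 / ka = 2 * \<i> * la"
  obtains h1 g1 h2 g2 where
    "gauged la ka h1 g1"
    "gauged la ka h2 g2"
    "h1 0 = 1" "g1 0 = 0" "h2 0 = 0" "g2 0 = 1" "\<Delta> la = h1 1 + g2 1"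
proof -
  define s a where "s = sg ka 0" and "a = al ka 0"
  have s1: "sg ka 1 = s" unfolding s_def sg_def by (intro sum.cong refl) (simp add: data(9))
  have a1: "al ka 1 = a" unfolding a_def al_def al1_def using data(4) by simp
  note L1 = gauge[OF ka la ZS_f[of 1 la 1 s]]
  note L2 = gauge[OF ka la ZS_f[of 1 la "- a" "1 - a * s"]]
  show ?thesis
  proof (rule that[OF L1 L2])
    show "\<Delta> la = f1 la 1 s 1 + al ka 1 * (f2 la 1 s 1 - sg ka 1 * f1 la 1 s 1) + (f2 la (- a) (1 - a * s) 1 - sg ka 1 * f1 la (- a) (1 - a * s) 1)"
      unfolding s1 a1 discr_eq f1_def f2_def by (simp add: algebra_simps)
  qed (simp_all add: init s_def[symmetric] a_def[symmetric] algebra_simps)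
qed

text \<open>Valid in the whole plane up to a disc, hence suited to counting zeros.\<close>

lemma discr_crude:
  assumes la: "norm la \<ge> 1"
  shows "norm (\<Delta> la - 2 * cos la) \<le> wkb_W N C * exp (wkb_W N C) / norm la * exp \<bar>Im la\<bar>"
proof -
  define ka where "ka = 1 / (2 * \<i> * la)"
  have la0: "la \<noteq> 0" using la by auto
  have ka0: "ka \<noteq> 0" and kl: "1 / ka = 2 * \<i> * la" using la0 by (auto simp: ka_def)
  have nka: "norm ka = 1 / (2 * norm la)" by (simp add: ka_def norm_divide norm_mult)
  have ka1: "norm ka \<le> 1" using la unfolding nka by (simp add: divide_le_eq)
  note i = L2b_absint(1)[OF qq_L2b[OF ka1]] L2b_absint(1)[OF om_L2b[OF ka1]] L2b_absint(1)[OF rho_L2b'[OF ka1]]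
  obtain h1 g1 h2 g2 where S1: "gauged la ka h1 g1"
    and S2: "gauged la ka h2 g2"
    and I: "h1 0 = 1" "g1 0 = 0" "h2 0 = 0" "g2 0 = 1" and D: "\<Delta> la = h1 1 + g2 1"
    by (rule gauged_monodromy[OF ka0 kl])
  let ?K = "norm ka * wkb_W N C"
  have b1: "norm (h1 1 - exp (- \<i> * la)) \<le> ?K * exp ?K * exp \<bar>Im la\<bar>"
    using perturbed_exponential_bound(1)[OF S1 i coeff_integral[OF ka1]] I by simp
  have b2: "norm (g2 1 - exp (\<i> * la)) \<le> ?K * exp ?K * exp \<bar>Im la\<bar>"
    using perturbed_exponential_bound(2)[OF S2 i coeff_integral[OF ka1]] I by simp
  have eq: "\<Delta> la - 2 * cos la = (h1 1 - exp (- \<i> * la)) + (g2 1 - exp (\<i> * la))"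
    unfolding D cos_exp_eq by (simp add: field_simps)
  have "norm (\<Delta> la - 2 * cos la) \<le> 2 * (?K * exp ?K * exp \<bar>Im la\<bar>)"
    unfolding eq using norm_triangle_ineq[of "h1 1 - exp (- \<i> * la)" "g2 1 - exp (\<i> * la)"] b1 b2 by linarith
  also have "... \<le> 2 * (?K * exp (wkb_W N C) * exp \<bar>Im la\<bar>)"
    using ka1 W_bounds mult_right_mono[OF ka1, of "wkb_W N C"] by (intro mult_left_mono mult_right_mono) auto
  also have "... = wkb_W N C * exp (wkb_W N C) / norm la * exp \<bar>Im la\<bar>" by (simp add: nka)
  finally show ?thesis .
qed

end

section \<open>The refined expansion of the discriminant\<close>

abbreviation "npi n \<equiv> of_int n * of_real pi :: complex" for n :: int

text \<open>Constants of the refined expansion. The 4 in the exponent stems from the discs of radius 2.\<close>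

definition "sharp_M W = exp (4 + 2 * W)" for W :: real
definition "sharp_1 W = exp (2 * (W * sharp_M W)) * (1 + W * sharp_M W) * (W * sharp_M W) * (sharp_M W * (5 + 2 * W) + W * sharp_M W)" for W :: real
definition "sharp_2 W C = 2 * sharp_M W * sharp_1 W + 2 * sharp_M W * exp (C * W) * (C * W)" for W C :: real

lemma exp_le_sharp: "0 \<le> W \<Longrightarrow> x \<le> 4 + 2 * W \<Longrightarrow> exp x \<le> sharp_M W"
  by (simp add: sharp_M_def)

lemma L2b_indef:
  assumes f: "f absint_on {0..1}" and I: "integral {0..1} (\<lambda>t. norm (f t)) \<le> K"
  shows "L2b (\<lambda>t. integral {0..t} f) K"
proof (rule L2b_bdd)
  have ac: "ac_on 1 (\<lambda>t. integral {0..t} f) f" using ac_on_indefinite[OF f, where c=0] by simp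
  show "(\<lambda>t. integral {0..t} f) \<in> borel_measurable (lebesgue_on {0..1})"
    by (rule continuous_imp_measurable_on_sets_lebesgue[OF ac_on_continuous[OF ac]]) auto
  fix x :: real assume x: "x \<in> {0..1}"
  have "norm (integral {0..x} f) \<le> integral {0..x} (\<lambda>t. norm (f t))"
    by (rule norm_integral_le_absint[OF absint_sub[OF f]]) (use x in auto)
  also have "... \<le> integral {0..1} (\<lambda>t. norm (f t))"
    by (rule integral_nonneg_mono[OF absint_norm_int[OF f]]) (use x in auto)
  finally show "norm (integral {0..x} f) \<le> K" using I by simp
qed

text \<open>An off-diagonal entry consists of a square integrable function times an oscillating factor, and of a
  remainder that is smaller by one power of \<open>ka\<close>.\<close>

lemma split_coefficient_L2b:
  fixes f R w :: cfun
  assumes f: "L2b f K" and w: "ac_on 1 w (\<lambda>t. g t * w t)" "\<And>t. t \<in> {0..1} \<Longrightarrow> norm (w t) \<le> M" "L2b g S"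
    and R: "R absint_on {0..1}" "integral {0..1} (\<lambda>t. norm (R t)) \<le> V"
    and b: "\<And>t. b t = c * (e * (f t * exp (2 * of_real pi * \<i> * of_int n * of_real t) * w t) + e' * R t)"
  shows "L2b (\<lambda>t. integral {0..t} b) (norm c * (norm e * (M * (1 + S) * osc_norm f n) + norm e' * V))"
proof -
  let ?f = "\<lambda>s. f s * exp (2 * of_real pi * \<i> * of_int n * of_real s)"
  let ?I = "\<lambda>t. c * (e * integral {0..t} (\<lambda>s. ?f s * w s) + e' * integral {0..t} R)"
  have fi: "?f absint_on {0..1}" by (rule osc_integrand[OF f])
  have "L2b (\<lambda>t. integral {0..t} (\<lambda>s. ?f s * w s)) (M * (1 + S) * osc_norm f n)"
    by (rule oscillatory_L2b[OF fi _ w]) (use osc_L2b[OF f, of n] in \<open>auto simp: osc_def[abs_def]\<close>)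
  then have L: "L2b ?I (norm c * (norm e * (M * (1 + S) * osc_norm f n) + norm e' * V))"
    by (intro L2b_cmult L2b_add L2b_indef[OF R])
  have "integral {0..t} b = ?I t" if t: "t \<in> {0..1}" for t
  proof -
    have j: "(\<lambda>s. ?f s * w s) integrable_on {0..t}" "R integrable_on {0..t}"
      by (rule absint_int[OF absint_sub[OF absint_continuous_mult'[OF ac_on_continuous[OF w(1)] fi]]] absint_int[OF absint_sub[OF R(1)]];
        use t in simp)+
    have "b = (\<lambda>s. c * (e * (?f s * w s) + e' * R s))" using b by (simp add: fun_eq_iff)
    then show ?thesis
      by (simp only: integral_mult_right HK_integral_add[OF j[THEN integrable_on_mult_right]])
  qed
  with L show ?thesis by - (erule L2b_cong_AE, auto)
qed

context wkb
begin

abbreviation "W \<equiv> wkb_W N C"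

abbreviation "oscs n \<equiv> osc_norm (r (Suc N)) (- n) + osc_norm dp n + 1 / \<bar>real_of_int n\<bar>"

lemma lint_coeff:
  assumes "k \<in> {1..Suc N}"
  shows "(LINT t:{0..1}|lebesgue. \<phi>1 t * zs_r \<phi>1 \<phi>2 k t) = integral {0..1} (\<lambda>t. p t * r k t)"
    "(\<lambda>t. p t * r k t) absint_on {0..1}"
    "norm (integral {0..1} (\<lambda>t. p t * r k t)) \<le> C\<^sup>2"
proof -
  have rL: "L2b (r k) C"
  proof (cases "k = Suc N")
    case False
    then have k: "k \<in> {1..N}" using assms by auto
    show ?thesis
      by (rule L2b_bdd[OF continuous_imp_measurable_on_sets_lebesgue[OF r_cont[OF k]] data(10)[OF k]]) auto
  qed (use data(12) in simp)
  have pL: "L2b p C"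
    by (rule L2b_bdd[OF continuous_imp_measurable_on_sets_lebesgue[OF p_cont] data(6)]) auto
  show ai: "(\<lambda>t. p t * r k t) absint_on {0..1}" by (rule L2b_mult(1)[OF pL rL])
  have AE: "AE t in lebesgue. t \<in> {0..1} \<longrightarrow> p t * r k t = \<phi>1 t * zs_r \<phi>1 \<phi>2 k t"
    using data(5) data(13)[OF assms] by eventually_elim auto
  show "(LINT t:{0..1}|lebesgue. \<phi>1 t * zs_r \<phi>1 \<phi>2 k t) = integral {0..1} (\<lambda>t. p t * r k t)"
    using set_lebesgue_integral_eq_integral(2)[OF AE_absint[OF AE ai]] AE_integral_eq[OF AE] by simp
  show "norm (integral {0..1} (\<lambda>t. p t * r k t)) \<le> C\<^sup>2"
    using norm_integral_le_absint[OF ai] L2b_mult(2)[OF pL rL] by (simp add: power2_eq_square)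
qed

lemma zs_F_at:
  assumes kl: "1 / ka = 2 * \<i> * la" and ka: "ka \<noteq> 0"
  shows "\<i> * FN (1 / la) = - (\<Sum>k=1..Suc N. integral {0..1} (\<lambda>t. p t * r k t) * ka ^ k)"
proof -
  have kae: "ka = 1 / (2 * \<i> * la)" using kl ka by (metis div_by_1 divide_divide_eq_right mult_1)
  have "(LINT t:{0..1}|lebesgue. \<phi>1 t * zs_r \<phi>1 \<phi>2 k t) / (2 * \<i>) ^ k * (1 / la) ^ k = integral {0..1} (\<lambda>t. p t * r k t) * ka ^ k" if "k \<in> {1..Suc N}" for k
    unfolding lint_coeff(1)[OF that] kae by (simp add: power_divide power_mult_distrib)
  then show ?thesis unfolding zs_F_def by (simp add: mult.assoc[symmetric] del: sum.cl_ivl_Suc)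
qed

text \<open>The terms with \<open>k \<le> N\<close> come from \<open>sg\<close>, the one with \<open>k = N + 1\<close> from the product \<open>al * rho\<close>.\<close>

lemma qq_integral:
  assumes ka1: "norm ka \<le> 1"
  shows "norm (integral {0..1} (qq ka) - (\<Sum>k=1..Suc N. integral {0..1} (\<lambda>t. p t * r k t) * ka ^ k)) \<le> norm ka ^ (N + 2) * (C * W)"
proof -
  have i1: "(\<lambda>t. p t * r k t) integrable_on {0..1}" if "k \<in> {1..Suc N}" for k
    by (rule absint_int[OF lint_coeff(2)[OF that]])
  have i2: "(\<lambda>t. p t * rho1 ka t) integrable_on {0..1}"
    by (intro integrable_continuous_real continuous_intros p_cont cont1)
  have e: "qq ka t = (\<Sum>k=1..Suc N. p t * r k t * ka ^ k) + \<i> * ka ^ (N + 2) * (p t * rho1 ka t)" for t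
  proof -
    have "PP ka t = (\<Sum>k=1..N. p t * r k t * ka ^ k)"
      unfolding PP_eq sg_def sum_distrib_left by (intro sum.cong refl) (simp add: algebra_simps)
    moreover have "al ka t * rho ka t = p t * r (Suc N) t * ka ^ Suc N + \<i> * ka ^ (N + 2) * (p t * rho1 ka t)"
      unfolding al_def al1_def rho_def by (simp add: algebra_simps power_add power2_eq_square)
    ultimately show ?thesis by (simp add: qq_def)
  qed
  have i3: "(\<lambda>t. \<Sum>k=1..Suc N. p t * r k t * ka ^ k) integrable_on {0..1}"
    by (intro integrable_sum integrable_on_mult_left i1) auto
  have "integral {0..1} (qq ka) = integral {0..1} (\<lambda>t. \<Sum>k=1..Suc N. p t * r k t * ka ^ k) + integral {0..1} (\<lambda>t. \<i> * ka ^ (N + 2) * (p t * rho1 ka t))"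
    unfolding e[abs_def]
    by (rule HK_integral_add[OF i3 integrable_on_mult_right[OF i2]])
  also have "integral {0..1} (\<lambda>t. \<Sum>k=1..Suc N. p t * r k t * ka ^ k) = (\<Sum>k=1..Suc N. integral {0..1} (\<lambda>t. p t * r k t * ka ^ k))"
    by (rule integral_sum) (auto intro!: integrable_on_mult_left i1)
  also have "... = (\<Sum>k=1..Suc N. integral {0..1} (\<lambda>t. p t * r k t) * ka ^ k)" by simp
  finally have eq: "integral {0..1} (qq ka) - (\<Sum>k=1..Suc N. integral {0..1} (\<lambda>t. p t * r k t) * ka ^ k) = \<i> * ka ^ (N + 2) * integral {0..1} (\<lambda>t. p t * rho1 ka t)"
    by simp
  have "norm (integral {0..1} (\<lambda>t. p t * rho1 ka t)) \<le> integral {0..1} (\<lambda>t::real. C * W)"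
  proof (rule integral_norm_bound_integral[OF i2])
    fix t :: real assume t: "t \<in> {0..1}"
    have "norm (rho1 ka t) \<le> W" using bound1(1)[OF ka1 t] W_bounds by linarith
    then show "norm (p t * rho1 ka t) \<le> C * W"
      unfolding norm_mult using data(6)[OF t] C0 by (intro mult_mono) auto
  qed auto
  then have "norm (integral {0..1} (\<lambda>t. p t * rho1 ka t)) \<le> C * W" by simp
  then show ?thesis unfolding eq by (simp add: norm_mult norm_power mult_left_mono del: power_Suc)
qed

text \<open>Conjugating the gauged system with \<open>exp E\<close>, where \<open>E\<close> is the integral of its diagonal entry, leaves a system with the
  off-diagonal entries \<open>a\<close> and \<open>b\<close> only. Their sizes are \<open>O(1/n)\<close> and \<open>O(1/n^N)\<close>, and their indefinite integrals gain the
  factors \<open>osc_norm\<close>; \<open>second_order_term\<close> then bounds the deviation of the two diagonal entries of the monodromy matrix from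
  \<open>exp (E 1)\<close> and \<open>exp (- E 1)\<close>. Finally \<open>E 1\<close> is compared with \<open>- i (la + F (1/la))\<close>.\<close>

lemma discr_sharp:
  assumes n: "n \<noteq> 0" and la: "norm (la - npi n) \<le> 2"
  shows "norm (\<Delta> la - 2 * cos (la + FN (1 / la)))
    \<le> sharp_2 W C / \<bar>real_of_int n\<bar> ^ (N + 1) * oscs n"
proof -
  define ze where "ze = la - npi n"
  have ze: "norm ze \<le> 2" using la by (simp add: ze_def)
  have nla: "norm la \<ge> \<bar>real_of_int n\<bar>"
  proof -
    have "norm (npi n) = \<bar>real_of_int n\<bar> * pi" by (simp add: norm_mult)
    moreover have "norm (npi n) \<le> norm la + norm ze"
      using norm_triangle_ineq4[of la ze] by (simp add: ze_def)
    moreover have "\<bar>real_of_int n\<bar> * 3 \<le> \<bar>real_of_int n\<bar> * pi" using pi_gt3 by (intro mult_left_mono) auto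
    moreover have "\<bar>real_of_int n\<bar> \<ge> 1" using n by simp
    ultimately show ?thesis using ze by linarith
  qed
  have n1: "\<bar>real_of_int n\<bar> \<ge> 1" using n by simp
  define ka where "ka = 1 / (2 * \<i> * la)"
  have la0: "la \<noteq> 0" using nla n1 by auto
  have ka0: "ka \<noteq> 0" and kl: "1 / ka = 2 * \<i> * la" using la0 by (auto simp: ka_def)
  have nka: "norm ka = 1 / (2 * norm la)" by (simp add: ka_def norm_divide norm_mult)
  have kan: "norm ka \<le> 1 / \<bar>real_of_int n\<bar>" unfolding nka by (rule frac_le) (use nla n1 in auto)
  have ka1: "norm ka \<le> 1" 
  proof -
    have "1 / \<bar>real_of_int n\<bar> \<le> 1" using n1 by (simp add: divide_le_eq_1)
    with kan show ?thesis by linarith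
  qed
  have W0: "W \<ge> 0" by (rule W_bounds)
  obtain h1 g1 h2 g2 where S1: "gauged la ka h1 g1"
    and S2: "gauged la ka h2 g2"
    and I: "h1 0 = 1" "g1 0 = 0" "h2 0 = 0" "g2 0 = 1" and D: "\<Delta> la = h1 1 + g2 1"
    by (rule gauged_monodromy[OF ka0 kl])
  note qL = qq_L2b[OF ka1]
  note qi = L2b_absint(1)[OF qL]
  define Q where "Q t = integral {0..t} (qq ka)" for t
  have Qac: "ac_on 1 Q (qq ka)" unfolding Q_def using ac_on_indefinite[OF qi, where c=0] by simp
  have Qb: "norm (Q t) \<le> W" if t: "t \<in> {0..1}" for t
  proof -
    have "norm (Q t - Q 0) \<le> integral {0..t} (\<lambda>t. norm (qq ka t))" by (rule ac_on_norm_diff[OF Qac]) (use t in auto)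
    also have "... \<le> integral {0..1} (\<lambda>t. norm (qq ka t))"
      by (rule integral_nonneg_mono[OF absint_norm_int[OF qi]]) (use t in auto)
    also have "... \<le> norm ka * wkb_2 N C" by (rule L2b_absint(2)[OF qL])
    also have "... \<le> 1 * W" using ka1 W_bounds by (intro mult_mono) auto
    finally show ?thesis by (simp add: Q_def)
  qed
  have id: "ac_on 1 (\<lambda>t. complex_of_real t) (\<lambda>t. 1)"
    by (rule ac_on_C1) (auto intro!: derivative_eq_intros)
  define E where "E t = - \<i> * la * of_real t + Q t" for t
  have E: "ac_on 1 E (\<lambda>t. - \<i> * la * 1 + qq ka t)" unfolding E_def by (intro ac_on_add ac_on_cmult id Qac)
  have eE: "ac_on 1 (\<lambda>t. exp (E t)) (\<lambda>t. (- \<i> * la * 1 + qq ka t) * exp (E t))" by (rule ac_on_exp[OF E])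
  have eE': "ac_on 1 (\<lambda>t. exp (- E t)) (\<lambda>t. - (- \<i> * la * 1 + qq ka t) * exp (- E t))" by (rule ac_on_exp[OF ac_on_uminus[OF E]])
  define a where "a t = om ka t * exp (- 2 * E t)" for t
  define b where "b t = rho ka t * exp (2 * E t)" for t
  have ee: "exp (- 2 * E t) * exp (E t) = exp (- E t)" "exp (2 * E t) * exp (- E t) = exp (E t)" for t
    by (simp_all flip: exp_add)
  have tr: "ac_on 1 (\<lambda>t. exp (- E t) * h t) (\<lambda>t. a t * (exp (E t) * g t)) \<and> ac_on 1 (\<lambda>t. exp (E t) * g t) (\<lambda>t. b t * (exp (- E t) * h t))"
    if S: "gauged la ka h g" for h g
  proof
    have h: "ac_on 1 h (\<lambda>t. (- \<i> * la + qq ka t) * h t + om ka t * g t)" and g: "ac_on 1 g (\<lambda>t. rho ka t * h t + (\<i> * la - qq ka t) * g t)"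
      using S by (simp_all add: linsys_def)
    show "ac_on 1 (\<lambda>t. exp (- E t) * h t) (\<lambda>t. a t * (exp (E t) * g t))"
    proof (rule ac_on_cong[OF ac_on_mult[OF eE' h] refl])
      fix x
      have "a x * (exp (E x) * g x) = om ka x * (exp (- 2 * E x) * exp (E x)) * g x" by (simp add: a_def mult_ac)
      then show "a x * (exp (E x) * g x) = - (- \<i> * la * 1 + qq ka x) * exp (- E x) * h x + exp (- E x) * ((- \<i> * la + qq ka x) * h x + om ka x * g x)"
        unfolding ee by (simp add: algebra_simps)
    qed
    show "ac_on 1 (\<lambda>t. exp (E t) * g t) (\<lambda>t. b t * (exp (- E t) * h t))"
    proof (rule ac_on_cong[OF ac_on_mult[OF eE g] refl])
      fix x
      have "b x * (exp (- E x) * h x) = rho ka x * (exp (2 * E x) * exp (- E x)) * h x" by (simp add: b_def mult_ac)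
      then show "b x * (exp (- E x) * h x) = (- \<i> * la * 1 + qq ka x) * exp (E x) * g x + exp (E x) * (rho ka x * h x + (\<i> * la - qq ka x) * g x)"
        unfolding ee by (simp add: algebra_simps)
    qed
  qed
  \<comment> \<open>the non-oscillating factor of \<open>exp (2 E)\<close>\<close>
  let ?M = "sharp_M W"
  define G where "G t = - 2 * \<i> * ze * 1 + 2 * qq ka t" for t
  define B where "B t = - 2 * \<i> * ze * of_real t + 2 * Q t" for t
  have Bac: "ac_on 1 B G" unfolding B_def G_def by (intro ac_on_add ac_on_cmult id Qac)
  have Bb: "\<bar>Re (B t)\<bar> \<le> 4 + 2 * W" if t: "t \<in> {0..1}" for t
  proof -
    have "\<bar>Re (B t)\<bar> \<le> norm (B t)" by (rule abs_Re_le_cmod)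
    also have "... \<le> norm (- 2 * \<i> * ze * of_real t) + norm (2 * Q t)" unfolding B_def by (rule norm_triangle_ineq)
    also have "... \<le> 2 * (2 * 1) + 2 * W"
      using mult_mono[OF ze, of "norm (of_real t :: complex)" 1] t Qb[OF t] by (simp add: norm_mult)
    finally show ?thesis by simp
  qed
  have w: "ac_on 1 (\<lambda>t. exp (B t)) (\<lambda>t. G t * exp (B t))" by (rule ac_on_exp[OF Bac])
  have w': "ac_on 1 (\<lambda>t. exp (- B t)) (\<lambda>t. - G t * exp (- B t))" by (rule ac_on_exp[OF ac_on_uminus[OF Bac]])
  have wb: "norm (exp (B t)) \<le> ?M" "norm (exp (- B t)) \<le> ?M" if "t \<in> {0..1}" for t
    using Bb[OF that] unfolding norm_exp_eq_Re by (auto intro!: exp_le_sharp W0)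
  have GL: "L2b G (4 + 2 * W)"
  proof (rule L2b_mono)
    show "L2b G (norm (- 2 * \<i> * ze * 1) + norm (2::complex) * (norm ka * wkb_2 N C))"
      unfolding G_def by (intro L2b_add L2b_const L2b_cmult qL)
    have "norm ka * wkb_2 N C \<le> 1 * W" using ka1 W_bounds by (intro mult_mono) auto
    then show "norm (- 2 * \<i> * ze * 1) + norm (2::complex) * (norm ka * wkb_2 N C) \<le> 4 + 2 * W" using ze by (simp add: norm_mult)
  qed
  have GL': "L2b (\<lambda>t. - G t) (4 + 2 * W)" using L2b_cmult[OF GL, of "-1"] by simp
  have e2E: "exp (2 * E t) = exp (2 * of_real pi * \<i> * of_int (- n) * of_real t) * exp (B t)"
    "exp (- 2 * E t) = exp (2 * of_real pi * \<i> * of_int n * of_real t) * exp (- B t)" for t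
    unfolding exp_add[symmetric] B_def E_def ze_def by (simp_all add: algebra_simps)
  have nE: "norm (exp (2 * E t)) \<le> ?M" "norm (exp (- 2 * E t)) \<le> ?M" if "t \<in> {0..1}" for t
    using wb[OF that] unfolding e2E norm_mult by (simp_all add: norm_exp_eq_Re)
  have cE: "continuous_on {0..1} E" by (rule ac_on_continuous[OF E])
  have mE: "(\<lambda>t. exp (2 * E t)) \<in> borel_measurable (lebesgue_on {0..1})" "(\<lambda>t. exp (- 2 * E t)) \<in> borel_measurable (lebesgue_on {0..1})"
    by (intro continuous_imp_measurable_on_sets_lebesgue continuous_intros cE; simp)+
  have aL: "L2b a (norm ka * (W * ?M))"
  proof (rule L2b_mono)
    show "L2b a (?M * (norm ka * wkb_3 N C))"
      unfolding a_def using L2b_bdd_mult[OF mE(2) nE(2) om_L2b[OF ka1]] by (simp add: mult.commute)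
    show "?M * (norm ka * wkb_3 N C) \<le> norm ka * (W * ?M)"
      using W_bounds(6) by (simp add: sharp_M_def mult_left_mono mult_right_mono mult_ac)
  qed
  have bL: "L2b b (norm ka ^ N * (W * ?M))"
  proof (rule L2b_mono)
    show "L2b b (?M * (norm ka ^ N * wkb_1 N C))"
      unfolding b_def using L2b_bdd_mult[OF mE(1) nE(1) rho_L2b[OF ka1]] by (simp add: mult.commute)
    show "?M * (norm ka ^ N * wkb_1 N C) \<le> norm ka ^ N * (W * ?M)"
      using W_bounds(4) by (simp add: sharp_M_def mult_left_mono mult_right_mono mult_ac)
  qed
  define A1 A2 where "A1 = osc_norm (r (Suc N)) (- n)" and "A2 = osc_norm dp n"
  have A0: "A1 \<ge> 0" "A2 \<ge> 0" unfolding A1_def A2_def by (rule osc_norm_nonneg[OF data(12)] osc_norm_nonneg[OF data(7)])+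
  have r1i: "(\<lambda>s. rho1 ka s * exp (2 * E s)) absint_on {0..1}"
    by (intro continuous_absint continuous_intros cE cont1)
  have bX: "L2b (\<lambda>t. integral {0..t} b) (norm ka ^ N * (?M * (5 + 2 * W) * A1 + norm ka * (W * ?M)))"
  proof -
    have "L2b (\<lambda>t. integral {0..t} b) (norm (ka ^ N) * (norm \<i> * (?M * (1 + (4 + 2 * W)) * osc_norm (r (Suc N)) (- n)) + norm (- ka) * (W * ?M)))"
    proof (rule split_coefficient_L2b[OF data(12) w wb(1) GL r1i])
      have "integral {0..1} (\<lambda>t. norm (rho1 ka t * exp (2 * E t))) \<le> integral {0..1} (\<lambda>t::real. W * ?M)"
      proof (rule integral_le[OF absint_norm_int[OF r1i]])
        fix t :: real assume t: "t \<in> {0..1}"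
        have "norm (rho1 ka t) \<le> W" using bound1(1)[OF ka1 t] W_bounds by linarith
        then show "norm (rho1 ka t * exp (2 * E t)) \<le> W * ?M"
          unfolding norm_mult using nE(1)[OF t] W0 by (intro mult_mono) auto
      qed auto
      then show "integral {0..1} (\<lambda>t. norm (rho1 ka t * exp (2 * E t))) \<le> W * ?M" by simp
      show "b t = ka ^ N * (\<i> * (r (Suc N) t * exp (2 * of_real pi * \<i> * of_int (- n) * of_real t) * exp (B t)) + (- ka) * (rho1 ka t * exp (2 * E t)))" for t
        unfolding b_def rho_def using e2E(1)[of t] by (simp add: algebra_simps)
    qed
    then show ?thesis by (simp add: norm_power A1_def)
  qed
  have oi: "(\<lambda>s. om1 ka s * exp (- 2 * E s)) absint_on {0..1}"
    by (intro absint_continuous_mult' continuous_intros cE L2b_absint(1)[OF om1_L2b[OF ka1]])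
  have aX: "L2b (\<lambda>t. integral {0..t} a) (norm ka * (?M * (5 + 2 * W) * A2 + norm ka * (W * ?M)))"
  proof -
    have "L2b (\<lambda>t. integral {0..t} a) (norm ka * (norm (- \<i>) * (?M * (1 + (4 + 2 * W)) * osc_norm dp n) + norm ka * (W * ?M)))"
    proof (rule split_coefficient_L2b[OF data(7) w' wb(2) GL' oi])
      note o1 = om1_L2b[OF ka1]
      have "integral {0..1} (\<lambda>t. norm (om1 ka t * exp (- 2 * E t))) \<le> integral {0..1} (\<lambda>t. norm (om1 ka t) * ?M)"
      proof (rule integral_le[OF absint_norm_int[OF oi] integrable_on_mult_left[OF absint_norm_int[OF L2b_absint(1)[OF o1]]]])
        fix t :: real assume t: "t \<in> {0..1}"
        show "norm (om1 ka t * exp (- 2 * E t)) \<le> norm (om1 ka t) * ?M"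
          unfolding norm_mult[of "om1 ka t"] using nE(2)[OF t] by (intro mult_left_mono) auto
      qed
      also have "... \<le> W * ?M"
      proof -
        have "integral {0..1} (\<lambda>t. norm (om1 ka t)) \<le> W" using L2b_absint(2)[OF o1] W_bounds(6) by linarith
        then show ?thesis by (simp add: sharp_M_def)
      qed
      finally show "integral {0..1} (\<lambda>t. norm (om1 ka t * exp (- 2 * E t))) \<le> W * ?M" .
      fix t
      have "a t = ka * (- \<i> * (dp t * exp (- 2 * E t)) + ka * (om1 ka t * exp (- 2 * E t)))"
        unfolding a_def om_def dal_def by (simp only: power2_eq_square) (simp only: ring_distribs mult_ac)
      then show "a t = ka * (- \<i> * (dp t * exp (2 * of_real pi * \<i> * of_int n * of_real t) * exp (- B t)) + ka * (om1 ka t * exp (- 2 * E t)))"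
        using e2E(2)[of t] by (simp only: mult.assoc)
    qed
    then show ?thesis by (simp add: A2_def)
  qed
  define k N1 where "k = norm ka" and "N1 = k ^ (N + 1)"
  have k0: "k \<ge> 0" and k1: "k \<le> 1" using ka1 by (auto simp: k_def)
  have kN: "k ^ N \<le> 1" using k0 k1 by (simp add: power_le_one)
  let ?V = "W * ?M"
  have M0: "?M > 0" "?M \<ge> 1" using W0 by (simp_all add: sharp_M_def)
  have V0: "?V \<ge> 0" using W0 M0 by simp
  \<comment> \<open>both corrections are bounded in the same way\<close>
  have fin: "exp (x + y) * (1 + x) * (x * (z * (?M * (5 + 2 * W) * A + k * ?V))) \<le> N1 * sharp_1 W * (A + k)"
    if x: "0 \<le> x" "x \<le> ?V" and y: "y \<le> ?V" and xz: "x * z = N1 * ?V" and A: "A \<ge> 0" for x y z A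
  proof -
    have F1: "exp (x + y) * (1 + x) \<le> exp (2 * ?V) * (1 + ?V)"
      using x y V0 by (intro mult_mono) auto
    have F2: "x * (z * (?M * (5 + 2 * W) * A + k * ?V)) \<le> N1 * ?V * ((?M * (5 + 2 * W) + ?V) * (A + k))"
    proof -
      have "?M * (5 + 2 * W) * A + k * ?V \<le> (?M * (5 + 2 * W) + ?V) * (A + k)"
        using V0 W0 M0 A k0 by (simp add: algebra_simps)
      then have "(N1 * ?V) * (?M * (5 + 2 * W) * A + k * ?V) \<le> (N1 * ?V) * ((?M * (5 + 2 * W) + ?V) * (A + k))"
        using V0 k0 by (intro mult_left_mono) (auto simp: N1_def)
      then show ?thesis by (simp only: xz[symmetric] mult.assoc)
    qed
    have F3: "0 \<le> x * (z * (?M * (5 + 2 * W) * A + k * ?V))"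
    proof -
      have "0 \<le> (N1 * ?V) * (?M * (5 + 2 * W) * A + k * ?V)"
        using V0 W0 M0 A k0 by (intro mult_nonneg_nonneg add_nonneg_nonneg) (auto simp: N1_def)
      then show ?thesis by (simp only: xz[symmetric] mult.assoc)
    qed
    have "exp (x + y) * (1 + x) * (x * (z * (?M * (5 + 2 * W) * A + k * ?V))) \<le> (exp (2 * ?V) * (1 + ?V)) * (N1 * ?V * ((?M * (5 + 2 * W) + ?V) * (A + k)))"
      by (rule mult_mono[OF F1 F2 _ F3]) (use V0 in simp)
    also have "... = N1 * sharp_1 W * (A + k)" unfolding sharp_1_def by (simp only: mult_ac)
    finally show ?thesis .
  qed
  have kV: "k * ?V \<le> ?V" "k ^ N * ?V \<le> ?V" using mult_right_mono[OF k1 V0] mult_right_mono[OF kN V0] by simp_all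
  have u1: "norm (exp (- E 1) * h1 1 - 1) \<le> N1 * sharp_1 W * (A1 + k)"
  proof -
    have "norm (exp (- E 1) * h1 1 - 1) \<le> exp (k * ?V + k ^ N * ?V) * (1 + k * ?V) * ((k * ?V) * (k ^ N * (?M * (5 + 2 * W) * A1 + k * ?V)))"
      unfolding k_def
      by (rule second_order_term[OF conjunct1[OF tr[OF S1]] conjunct2[OF tr[OF S1]] _ _ aL bL bX]) (use I in \<open>auto simp: E_def Q_def\<close>)
    also have "... \<le> N1 * sharp_1 W * (A1 + k)"
      by (rule fin) (use kV V0 k0 A0 in \<open>auto simp: N1_def\<close>)
    finally show ?thesis .
  qed
  have v1: "norm (exp (E 1) * g2 1 - 1) \<le> N1 * sharp_1 W * (A2 + k)"
  proof -
    have "norm (exp (E 1) * g2 1 - 1) \<le> exp (k ^ N * ?V + k * ?V) * (1 + k ^ N * ?V) * ((k ^ N * ?V) * (k * (?M * (5 + 2 * W) * A2 + k * ?V)))"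
      unfolding k_def
      by (rule second_order_term[OF conjunct2[OF tr[OF S2]] conjunct1[OF tr[OF S2]] _ _ bL aL aX]) (use I in \<open>auto simp: E_def Q_def\<close>)
    also have "... \<le> N1 * sharp_1 W * (A2 + k)"
      by (rule fin) (use kV V0 k0 A0 in \<open>auto simp: N1_def\<close>)
    finally show ?thesis .
  qed
  \<comment> \<open>comparison of the exponents\<close>
  let ?th = "la + FN (1 / la)"
  define de where "de = E 1 + \<i> * ?th"
  have de: "norm de \<le> k ^ (N + 2) * (C * W)"
  proof -
    have "de = integral {0..1} (qq ka) - (\<Sum>k=1..Suc N. integral {0..1} (\<lambda>t. p t * r k t) * ka ^ k)"
      unfolding de_def E_def Q_def distrib_left zs_F_at[OF kl ka0] by simp
    then show ?thesis using qq_integral[OF ka1] by (simp add: k_def)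
  qed
  have CW: "C * W \<ge> 0" using C0 W0 by simp
  have k2: "k ^ (N + 2) \<le> 1" using k0 k1 by (simp add: power_le_one del: power_Suc)
  have de1: "norm de \<le> C * W" using de mult_right_mono[OF k2 CW] by linarith
  have nE1: "norm (exp (E 1)) \<le> ?M" "norm (exp (- E 1)) \<le> ?M"
  proof -
    have "\<bar>Re (E 1)\<bar> \<le> 2 + W"
    proof -
      have "\<bar>Im la\<bar> = \<bar>Im ze\<bar>" by (simp add: ze_def)
      also have "... \<le> 2" using abs_Im_le_cmod[of ze] ze by linarith
      finally show ?thesis using abs_Re_le_cmod[of "Q 1"] Qb[of 1] by (simp add: E_def)
    qed
    then show "norm (exp (E 1)) \<le> ?M" "norm (exp (- E 1)) \<le> ?M"
      using W0 unfolding norm_exp_eq_Re by (auto intro!: exp_le_sharp)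
  qed
  have ed: "norm (exp z - 1) \<le> exp (C * W) * norm z" if "norm z \<le> C * W" for z :: complex
    using norm_exp_diff_le[OF that, of 0] CW by simp
  have ex: "norm (exp x - exp y) \<le> ?M * (exp (C * W) * norm de)" if "norm (exp x) \<le> ?M" "norm (y - x) = norm de" for x y :: complex
  proof -
    have "exp x - exp y = - (exp x * (exp (y - x) - 1))" unfolding right_diff_distrib exp_add[symmetric] by simp
    then have "norm (exp x - exp y) = norm (exp x) * norm (exp (y - x) - 1)" by (simp only: norm_minus_cancel norm_mult)
    also have "... \<le> ?M * (exp (C * W) * norm de)" using ed[of "y - x"] de1 that M0 by (intro mult_mono) auto
    finally show ?thesis .
  qed
  have x1: "norm (exp (E 1) - exp (- \<i> * ?th)) \<le> ?M * (exp (C * W) * norm de)"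
    by (rule ex[OF nE1(1)]) (simp add: de_def norm_minus_commute[of _ "E 1"])
  have x2: "norm (exp (- E 1) - exp (\<i> * ?th)) \<le> ?M * (exp (C * W) * norm de)"
    by (rule ex[OF nE1(2)]) (simp add: de_def add.commute)
  have hE: "h1 1 = exp (E 1) * (exp (- E 1) * h1 1)" "g2 1 = exp (- E 1) * (exp (E 1) * g2 1)"
    by (simp_all add: mult.assoc[symmetric] exp_minus_inverse[symmetric] exp_add[symmetric] flip: exp_add)
  have "2 * cos ?th = exp (\<i> * ?th) + exp (- \<i> * ?th)" unfolding cos_exp_eq by simp
  then have "\<Delta> la - 2 * cos ?th = (exp (E 1) * (exp (- E 1) * h1 1 - 1) + exp (- E 1) * (exp (E 1) * g2 1 - 1))
      + ((exp (E 1) - exp (- \<i> * ?th)) + (exp (- E 1) - exp (\<i> * ?th)))"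
    unfolding D right_diff_distrib hE[symmetric] by simp
  also have "norm ... \<le> (?M * (N1 * sharp_1 W * (A1 + k)) + ?M * (N1 * sharp_1 W * (A2 + k))) + (?M * (exp (C * W) * norm de) + ?M * (exp (C * W) * norm de))"
  proof (intro order_trans[OF norm_triangle_ineq] add_mono x1 x2)
    show "norm (exp (E 1) * (exp (- E 1) * h1 1 - 1)) \<le> ?M * (N1 * sharp_1 W * (A1 + k))"
      unfolding norm_mult[of "exp (E 1)"] using nE1 u1 M0 by (intro mult_mono) auto
    show "norm (exp (- E 1) * (exp (E 1) * g2 1 - 1)) \<le> ?M * (N1 * sharp_1 W * (A2 + k))"
      unfolding norm_mult[of "exp (- E 1)"] using nE1 v1 M0 by (intro mult_mono) auto
  qed
  also have "... \<le> sharp_2 W C * (N1 * (A1 + A2 + k))"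
  proof -
    have s1: "sharp_1 W \<ge> 0" unfolding sharp_1_def using W0 M0 V0 by (intro mult_nonneg_nonneg) auto
    have N10: "N1 \<ge> 0" using k0 by (simp add: N1_def)
    have "?M * (exp (C * W) * norm de) \<le> ?M * (exp (C * W) * (k ^ (N + 2) * (C * W)))"
      using de M0 by (intro mult_left_mono) auto
    also have "... = N1 * k * (?M * exp (C * W) * (C * W))" by (simp add: N1_def)
    also have "... \<le> N1 * (A1 + A2 + k) * (?M * exp (C * W) * (C * W))"
      using A0 N10 M0 CW by (intro mult_right_mono mult_left_mono) auto
    finally have 1: "?M * (exp (C * W) * norm de) \<le> N1 * (A1 + A2 + k) * (?M * exp (C * W) * (C * W))" .
    have "A1 + k + (A2 + k) \<le> 2 * (A1 + A2 + k)" using A0 by simp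
    from mult_left_mono[OF this, of "?M * (N1 * sharp_1 W)"] s1 N10 M0
    have 2: "?M * (N1 * sharp_1 W * (A1 + k)) + ?M * (N1 * sharp_1 W * (A2 + k)) \<le> 2 * (?M * (N1 * sharp_1 W) * (A1 + A2 + k))"
      by (simp add: algebra_simps)
    show ?thesis using 1 2 unfolding sharp_2_def by (simp add: algebra_simps)
  qed
  also have "... \<le> sharp_2 W C * ((1 / \<bar>real_of_int n\<bar>) ^ (N + 1) * (A1 + A2 + 1 / \<bar>real_of_int n\<bar>))"
  proof (intro mult_left_mono mult_mono)
    show "N1 \<le> (1 / \<bar>real_of_int n\<bar>) ^ (N + 1)" unfolding N1_def k_def using kan by (intro power_mono) auto
    show "A1 + A2 + k \<le> A1 + A2 + 1 / \<bar>real_of_int n\<bar>" using kan by (simp add: k_def)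
    have "sharp_1 W \<ge> 0" unfolding sharp_1_def using W0 M0 V0 by (intro mult_nonneg_nonneg) auto
    then show "0 \<le> sharp_2 W C" unfolding sharp_2_def using M0 CW by simp
  qed (use A0 k0 in \<open>auto simp: N1_def\<close>)
  finally show ?thesis unfolding A1_def A2_def by (simp add: power_divide)
qed

end

section \<open>The implicit function and the coefficients of the expansion\<close>

lemma taylor_remainder_bound:
  fixes f :: "complex \<Rightarrow> complex"
  assumes f: "f holomorphic_on ball 0 d" and d: "d > 0" and B: "\<And>z. z \<in> ball 0 d \<Longrightarrow> norm (f z) \<le> B"
    and z: "norm z \<le> d / 2"
  shows "norm (f z - (\<Sum>k\<le>m. (deriv ^^ k) f 0 / fact k * z ^ k)) \<le> 3 * B * (norm z / (3 * d / 4)) ^ Suc m"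
proof -
  define q where "q = norm z / (3 * d / 4)"
  have q: "0 \<le> q" "q \<le> 2/3" using d z by (auto simp: q_def field_simps)
  define t where "t k = (deriv ^^ k) f 0 / fact k * z ^ k" for k
  have coeff: "norm (t k) \<le> B * q ^ k" for k
  proof -
    have "norm ((deriv ^^ k) f 0) \<le> fact k * B / (3 * d / 4) ^ k"
    proof (rule Cauchy_inequality)
      show "f holomorphic_on ball 0 (3 * d / 4)" by (rule holomorphic_on_subset[OF f]) (use d in auto)
      show "continuous_on (cball 0 (3 * d / 4)) f"
        by (rule holomorphic_on_imp_continuous_on, rule holomorphic_on_subset[OF f]) (use d in auto)
      show "norm (f x) \<le> B" if "norm (0 - x) = 3 * d / 4" for x by (rule B) (use that d in auto)
    qed (use d in auto)
    hence "norm ((deriv ^^ k) f 0) / fact k * norm z ^ k \<le> (B / (3 * d / 4) ^ k) * norm z ^ k"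
      by (intro mult_right_mono) (use d in \<open>auto simp: divide_simps mult_ac\<close>)
    thus ?thesis by (simp add: t_def norm_mult norm_divide norm_power q_def power_divide power_mult_distrib mult_ac)
  qed
  have B0: "B \<ge> 0" using order_trans[OF norm_ge_zero B[of 0]] d by simp
  have "z \<in> ball 0 d" using z d by auto
  from holomorphic_power_series[OF f this] have "t sums f z" by (simp add: t_def[abs_def])
  hence "(\<lambda>k. t (k + Suc m)) sums (f z - (\<Sum>k<Suc m. t k))" by (rule sums_split_initial_segment)
  hence eq: "f z - (\<Sum>k\<le>m. t k) = (\<Sum>k. t (k + Suc m))" by (simp add: sums_iff lessThan_Suc_atMost)
  have geo: "(\<lambda>k. B * q ^ Suc m * q ^ k) sums (B * q ^ Suc m * (1 / (1 - q)))"
    by (intro sums_mult geometric_sums) (use q in auto)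
  have "norm (\<Sum>k. t (k + Suc m)) \<le> (\<Sum>k. B * q ^ Suc m * q ^ k)"
    by (rule norm_suminf_le) (use coeff[of "_ + Suc m"] geo in \<open>auto simp: power_add mult_ac sums_iff\<close>)
  also have "... = B * q ^ Suc m * (1 / (1 - q))" using geo by (simp add: sums_iff)
  also have "... \<le> B * q ^ Suc m * 3" by (rule mult_left_mono) (use q B0 in \<open>auto simp: field_simps\<close>)
  finally show ?thesis using eq by (simp add: t_def q_def mult_ac)
qed

text \<open>With \<open>w = z / (\<pi> + z * \<zeta> z)\<close> the equation for \<open>\<zeta>\<close> reads \<open>\<zeta> z = - F w\<close> and \<open>h w = z\<close>, where
  \<open>h w = \<pi> w / (1 + w F w)\<close>. So \<open>\<zeta>\<close> is \<open>- F\<close> composed with the inverse of \<open>h\<close> near 0. As \<open>h w - \<pi> w\<close> is of third order, \<open>h\<close> is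
  invertible on a disc whose radius depends on \<open>A\<close> only.\<close>

locale zeta_eq =
  fixes F :: "complex \<Rightarrow> complex" and A :: real
  assumes F_hol: "F holomorphic_on UNIV" and A1: "A \<ge> 1"
    and F_bd: "\<And>w. norm w \<le> 1 \<Longrightarrow> norm (F w) \<le> A * norm w"
begin

definition rho where "rho = 1 / (8 * A)"
definition h where "h w = of_real pi * w / (1 + w * F w)"

lemma rho: "rho > 0" "rho \<le> 1/8" "A * rho = 1/8"
  using A1 by (auto simp: rho_def field_simps)

lemma F0: "F 0 = 0" using F_bd[of 0] by simp

lemma wF: assumes "norm w \<le> 2 * rho" shows "norm (w * F w) \<le> 1/16"
proof -
  have w1: "norm w \<le> 1" using assms rho by linarith
  have "norm (w * F w) \<le> norm w * (A * norm w)" unfolding norm_mult by (rule mult_left_mono[OF F_bd[OF w1]]) auto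
  also have "... = norm w * norm w * A" by simp
  also have "... \<le> (2 * rho) * (2 * rho) * A"
    by (intro mult_right_mono mult_mono) (use assms A1 rho in auto)
  also have "... = 4 * rho * (A * rho)" by simp
  also have "... \<le> 1/16" unfolding rho(3) using rho by simp
  finally show ?thesis .
qed

lemma den: assumes "norm w \<le> 2 * rho" shows "norm (1 + w * F w) \<ge> 15/16" "1 + w * F w \<noteq> 0"
proof -
  have "norm (1::complex) \<le> norm (1 + w * F w) + norm (w * F w)" by norm
  thus a: "norm (1 + w * F w) \<ge> 15/16" using wF[OF assms] by simp
  thus "1 + w * F w \<noteq> 0" by auto
qed

lemma h_hol: "h holomorphic_on ball 0 (2 * rho)"
  unfolding h_def[abs_def] by (intro holomorphic_intros holomorphic_on_subset[OF F_hol]) (use den in auto)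

lemma h_dev: assumes "norm w \<le> 2 * rho" shows "norm (h w - of_real pi * w) \<le> pi * rho / 4"
proof -
  have "h w - of_real pi * w = - of_real pi * w * (w * F w) / (1 + w * F w)"
    using den[OF assms] by (simp add: h_def field_simps)
  hence "norm (h w - of_real pi * w) = pi * norm w * norm (w * F w) / norm (1 + w * F w)"
    by (simp add: norm_mult norm_divide mult_ac)
  also have "... \<le> (pi * (2 * rho) * (1/16)) / (15/16)"
    by (intro frac_le mult_mono) (use den[OF assms] wF[OF assms] assms rho in auto)
  also have "... \<le> pi * rho / 4" using rho by (simp add: field_simps)
  finally show ?thesis .
qed

lemma h_deriv: assumes "norm w < rho" shows "norm (deriv h w - of_real pi) \<le> pi / 4"
proof -
  have sub: "cball w rho \<subseteq> ball 0 (2 * rho)"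
  proof
    fix x assume "x \<in> cball w rho"
    hence "norm x \<le> norm w + norm (w - x)" "norm (w - x) \<le> rho" by (norm, simp add: dist_norm)
    thus "x \<in> ball 0 (2 * rho)" using assms by simp
  qed
  define g where "g x = h x - of_real pi * x" for x
  have gh: "g holomorphic_on ball 0 (2 * rho)" unfolding g_def[abs_def] by (intro holomorphic_intros h_hol)
  have "norm ((deriv ^^ 1) g w) \<le> fact 1 * (pi * rho / 4) / rho ^ 1"
  proof (rule Cauchy_inequality)
    show "g holomorphic_on ball w rho" by (rule holomorphic_on_subset[OF gh]) (use sub in auto)
    show "continuous_on (cball w rho) g"
      by (rule holomorphic_on_imp_continuous_on, rule holomorphic_on_subset[OF gh sub])
    show "norm (g x) \<le> pi * rho / 4" if "norm (w - x) = rho" for x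
      unfolding g_def by (rule h_dev) (use subsetD[OF sub, of x] that in \<open>auto simp: dist_norm\<close>)
  qed (use rho in auto)
  moreover have "deriv g w = deriv h w - of_real pi"
  proof -
    have "h field_differentiable at w"
      using h_hol assms rho holomorphic_on_imp_differentiable_at[of h "ball 0 (2 * rho)" w] by auto
    hence "(h has_field_derivative deriv h w) (at w)" by (simp add: field_differentiable_derivI)
    hence "(g has_field_derivative (deriv h w - of_real pi)) (at w)"
      unfolding g_def[abs_def] by (auto intro!: derivative_eq_intros)
    thus ?thesis by (rule DERIV_imp_deriv)
  qed
  ultimately show ?thesis using rho by simp
qed

lemma h_inj: "inj_on h (ball 0 rho)"
proof
  fix x y assume xy: "x \<in> ball 0 rho" "y \<in> ball 0 rho" "h x = h y"
  have "norm ((h x - of_real pi * x) - (h y - of_real pi * y)) \<le> pi / 4 * norm (x - y)"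
  proof (rule field_differentiable_bound[where S="ball 0 rho" and f' = "\<lambda>w. deriv h w - of_real pi"])
    fix z :: complex assume z: "z \<in> ball 0 rho"
    have "h field_differentiable at z"
      using h_hol z rho holomorphic_on_imp_differentiable_at[of h "ball 0 (2 * rho)" z] by auto
    hence "(h has_field_derivative deriv h z) (at z)" by (simp add: field_differentiable_derivI)
    hence "((\<lambda>w. h w - of_real pi * w) has_field_derivative (deriv h z - of_real pi)) (at z)"
      by (auto intro!: derivative_eq_intros)
    thus "((\<lambda>w. h w - of_real pi * w) has_field_derivative (deriv h z - of_real pi)) (at z within ball 0 rho)"
      by (rule has_field_derivative_at_within)
    show "norm (deriv h z - of_real pi) \<le> pi / 4" using z by (intro h_deriv) auto
  qed (use xy in auto)
  moreover have "(h x - of_real pi * x) - (h y - of_real pi * y) = of_real pi * (y - x)"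
    using xy by (simp add: algebra_simps)
  ultimately have "pi * norm (x - y) \<le> pi / 4 * norm (x - y)" by (simp add: norm_mult norm_minus_commute)
  hence "norm (x - y) \<le> 0" by (simp add: mult_le_cancel_right zero_less_norm_iff) 
  thus "x = y" by simp
qed

text \<open>Bloch's lemma, with \<open>(3 - 2 * sqrt 2) * \<pi> > 1/4\<close>.\<close>

lemma h_image: "ball 0 (rho / 4) \<subseteq> h ` ball 0 rho"
proof -
  have d0: "norm (deriv h w) \<le> 5/4 * pi" if "norm w < rho" for w
    using norm_triangle_ineq[of "deriv h w - of_real pi" "of_real pi"] h_deriv[OF that] by simp
  have h0: "deriv h 0 = of_real pi"
  proof -
    have "(h has_field_derivative of_real pi) (at 0)"
    proof -
      have "F field_differentiable at 0" using F_hol by (simp add: holomorphic_on_imp_differentiable_at[of F UNIV])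
      hence "(F has_field_derivative deriv F 0) (at 0)" by (simp add: field_differentiable_derivI)
      thus ?thesis unfolding h_def[abs_def] by (auto intro!: derivative_eq_intros simp: F0)
    qed
    thus ?thesis by (rule DERIV_imp_deriv)
  qed
  have "ball (h 0) ((3 - 2 * sqrt 2) * rho * norm (deriv h 0)) \<subseteq> h ` ball 0 rho"
  proof (rule Bloch_lemma)
    show "h holomorphic_on cball 0 rho" by (rule holomorphic_on_subset[OF h_hol]) (use rho in auto)
    show "norm (deriv h z) \<le> 2 * norm (deriv h 0)" if "z \<in> ball 0 rho" for z
      unfolding h0 using d0[of z] that pi_gt_zero by (simp, linarith)
  qed (use rho in auto)
  moreover have "rho / 4 \<le> (3 - 2 * sqrt 2) * rho * norm (deriv h 0)"
  proof -
    have "sqrt 2 \<le> 1.42" by (rule real_le_lsqrt) (auto simp: power2_eq_square)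
    hence "0.16 \<le> 3 - 2 * sqrt 2" by simp
    hence "0.16 * 3 \<le> (3 - 2 * sqrt 2) * pi" by (intro mult_mono) (use pi_gt3 in auto)
    hence "(1/4) * rho \<le> ((3 - 2 * sqrt 2) * pi) * rho" by (intro mult_right_mono) (use rho in auto)
    thus ?thesis using h0 by (simp add: mult_ac)
  qed
  moreover have "h 0 = 0" by (simp add: h_def)
  ultimately show ?thesis by (metis subset_ball subset_trans)
qed

definition is_zeta where
  "is_zeta \<zeta> \<longleftrightarrow> \<zeta> analytic_on {0} \<and> \<zeta> 0 = 0 \<and>
     (\<forall>\<^sub>F z in nhds 0. \<zeta> z + F (z / (of_real pi + z * \<zeta> z)) = 0)"

lemma solves_h:
  assumes "u + F (z / (of_real pi + z * u)) = 0" "of_real pi + z * u \<noteq> 0"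
  shows "h (z / (of_real pi + z * u)) = z"
proof -
  define w where "w = z / (of_real pi + z * u)"
  have Fw: "F w = - u" using assms(1) by (simp add: w_def add_eq_0_iff)
  have "1 + w * F w = of_real pi / (of_real pi + z * u)"
    unfolding Fw using assms(2) by (simp add: w_def field_simps)
  hence "h w = z" unfolding h_def by (simp add: w_def assms(2))
  thus ?thesis by (simp add: w_def)
qed

lemma zeta_exists:
  obtains \<zeta> where "\<zeta> holomorphic_on ball 0 (rho / 4)" "\<zeta> 0 = 0"
    "\<And>z. z \<in> ball 0 (rho / 4) \<Longrightarrow> norm (\<zeta> z) \<le> 1"
    "\<And>z. z \<in> ball 0 (rho / 4) \<Longrightarrow> \<zeta> z + F (z / (of_real pi + z * \<zeta> z)) = 0"
    "is_zeta \<zeta>" "\<And>\<zeta>'. is_zeta \<zeta>' \<Longrightarrow> \<forall>\<^sub>F z in nhds 0. \<zeta>' z = \<zeta> z"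
proof -
  have hh: "h holomorphic_on ball 0 rho" by (rule holomorphic_on_subset[OF h_hol]) (use rho in auto)
  obtain g where g: "g holomorphic_on (h ` ball 0 rho)" "\<And>z. z \<in> ball 0 rho \<Longrightarrow> g (h z) = z"
    by (rule holomorphic_has_inverse[OF hh _ h_inj]) auto
  define \<zeta> where "\<zeta> z = - F (g z)" for z
  have gb: "g z \<in> ball 0 rho" "h (g z) = z" if "z \<in> ball 0 (rho / 4)" for z
    using subsetD[OF h_image that] g(2) by auto
  have g0: "g 0 = 0" using g(2)[of 0] rho by (simp add: h_def)
  have hol: "\<zeta> holomorphic_on ball 0 (rho / 4)"
    unfolding \<zeta>_def[abs_def]
    by (intro holomorphic_intros holomorphic_on_compose_gen[OF holomorphic_on_subset[OF g(1) h_image] F_hol, unfolded o_def]) auto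
  have z0: "\<zeta> 0 = 0" by (simp add: \<zeta>_def g0 F0)
  have bd: "norm (\<zeta> z) \<le> 1" if z: "z \<in> ball 0 (rho / 4)" for z
  proof -
    have "norm (F (g z)) \<le> A * norm (g z)" by (rule F_bd) (use gb[OF z] rho in auto)
    also have "... \<le> A * rho" by (rule mult_left_mono) (use gb[OF z] A1 in auto)
    finally show ?thesis using rho by (simp add: \<zeta>_def)
  qed
  have nz: "norm (z * u) \<le> 1" if "z \<in> ball 0 (rho / 4)" "norm u \<le> 1" for z u :: complex
    unfolding norm_mult by (rule mult_le_one) (use that rho in auto)
  have pin: "of_real pi + v \<noteq> 0" if "norm v \<le> 1" for v :: complex
  proof
    assume "of_real pi + v = 0"
    hence "v = - of_real pi" by (simp add: add_eq_0_iff2)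
    hence "norm v = pi" by simp
    thus False using that pi_gt3 by simp
  qed
  have eq: "\<zeta> z + F (z / (of_real pi + z * \<zeta> z)) = 0" if z: "z \<in> ball 0 (rho / 4)" for z
  proof -
    have d: "1 + g z * F (g z) \<noteq> 0" by (rule den) (use gb[OF z] rho in auto)
    have "of_real pi * g z = z * (1 + g z * F (g z))"
      using gb(2)[OF z] d unfolding h_def by (simp add: field_simps)
    hence "z = g z * (of_real pi + z * \<zeta> z)" by (simp add: \<zeta>_def algebra_simps)
    moreover have "of_real pi + z * \<zeta> z \<noteq> 0" using pin[OF nz[OF z bd[OF z]]] .
    ultimately have "z / (of_real pi + z * \<zeta> z) = g z" by (metis nonzero_mult_div_cancel_right)
    thus ?thesis by (simp add: \<zeta>_def)
  qed
  have ball: "\<forall>\<^sub>F z in nhds 0. z \<in> ball 0 (rho / 4)" by (rule eventually_nhds_in_open) (use rho in auto)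
  have isz: "is_zeta \<zeta>"
    unfolding is_zeta_def
  proof (intro conjI z0)
    show "\<zeta> analytic_on {0}" unfolding analytic_at using hol rho by (intro exI[of _ "ball 0 (rho / 4)"]) auto
    show "\<forall>\<^sub>F z in nhds 0. \<zeta> z + F (z / (of_real pi + z * \<zeta> z)) = 0"
      using ball by (rule eventually_mono) (rule eq)
  qed
  have uni: "\<forall>\<^sub>F z in nhds 0. \<zeta>' z = \<zeta> z" if "is_zeta \<zeta>'" for \<zeta>'
  proof -
    from that have a: "\<zeta>' analytic_on {0}" "\<zeta>' 0 = 0"
      "\<forall>\<^sub>F z in nhds 0. \<zeta>' z + F (z / (of_real pi + z * \<zeta>' z)) = 0" by (auto simp: is_zeta_def)
    have c: "isCont \<zeta>' 0" using analytic_at_imp_isCont[OF a(1)] .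
    have c2: "isCont (\<lambda>z. z * \<zeta>' z) 0" "isCont (\<lambda>z. z / (of_real pi + z * \<zeta>' z)) 0"
      by (intro continuous_intros c; simp)+
    have t: "((\<lambda>z. z * \<zeta>' z) \<longlongrightarrow> 0) (nhds 0)" "((\<lambda>z. z / (of_real pi + z * \<zeta>' z)) \<longlongrightarrow> 0) (nhds 0)"
      using iffD1[OF tendsto_at_iff_tendsto_nhds c2(1)[unfolded isCont_def]]
        iffD1[OF tendsto_at_iff_tendsto_nhds c2(2)[unfolded isCont_def]] by (simp_all only: mult_zero_left div_0)
    have e1: "\<forall>\<^sub>F z in nhds 0. norm (z * \<zeta>' z) < 1" using tendstoD[OF t(1), of 1] by (simp add: dist_norm)
    have e2: "\<forall>\<^sub>F z in nhds 0. norm (z / (of_real pi + z * \<zeta>' z)) < rho" using tendstoD[OF t(2), of rho] rho by (simp only: dist_norm diff_0_right)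
    from a(3) e1 e2 show ?thesis
    proof eventually_elim
      case (elim z)
      have "h (z / (of_real pi + z * \<zeta>' z)) = z" by (rule solves_h[OF elim(1)]) (rule pin, use elim in simp)
      hence "z / (of_real pi + z * \<zeta>' z) = g z" using g(2)[of "z / (of_real pi + z * \<zeta>' z)"] elim(3) by (simp only: mem_ball dist_0_norm)
      thus ?case using elim(1) by (simp add: \<zeta>_def add_eq_0_iff2)
    qed
  qed
  show ?thesis by (rule that[OF hol z0 bd eq isz uni])
qed

end

lemma (in wkb) zs_F_bound:
  assumes "norm w \<le> 1" shows "norm (FN w) \<le> (real N + 1) * C\<^sup>2 * norm w"
proof -
  have "norm (\<Sum>k=1..N+1. (LINT t:{0..1}|lebesgue. \<phi>1 t * zs_r \<phi>1 \<phi>2 k t) / (2 * \<i>) ^ k * w ^ k)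
     \<le> (\<Sum>k=1..N+1. C\<^sup>2 * norm w)"
  proof (rule sum_norm_le)
    fix k assume k: "k \<in> {1..N+1}"
    have k': "k \<in> {1..Suc N}" using k by simp
    have "norm ((LINT t:{0..1}|lebesgue. \<phi>1 t * zs_r \<phi>1 \<phi>2 k t) / (2 * \<i>) ^ k) \<le> C\<^sup>2 / 1"
      unfolding norm_divide lint_coeff(1)[OF k']
      by (rule frac_le) (use lint_coeff(3)[OF k'] in \<open>auto simp: norm_power norm_mult\<close>)
    moreover have "norm (w ^ k) \<le> norm w"
      using assms k power_decreasing[of 1 k "norm w"] by (simp add: norm_power)
    ultimately show "norm ((LINT t:{0..1}|lebesgue. \<phi>1 t * zs_r \<phi>1 \<phi>2 k t) / (2 * \<i>) ^ k * w ^ k) \<le> C\<^sup>2 * norm w"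
      unfolding norm_mult[of _ "w ^ k"] by (intro mult_mono) auto
  qed
  thus ?thesis unfolding zs_F_def by (simp add: norm_mult algebra_simps del: sum.cl_ivl_Suc)
qed

lemma (in wkb) zs_F_zeta_eq: "zeta_eq (FN) ((real N + 1) * C\<^sup>2)"
proof
  show "FN holomorphic_on UNIV" unfolding zs_F_def[abs_def] by (intro holomorphic_intros)
  have "1 * 1 \<le> (real N + 1) * C\<^sup>2" by (rule mult_mono) (use data(2) in auto)
  thus "1 \<le> (real N + 1) * C\<^sup>2" by simp
qed (rule zs_F_bound)

definition "wkb_A N C = (real N + 1) * C\<^sup>2"

text \<open>The point \<open>ls = n\<pi> + \<zeta>(1/n)\<close> solves \<open>ls + F (1/ls) = n\<pi>\<close> exactly, and the expansion in question is
  the Taylor polynomial of \<open>\<zeta>\<close> at \<open>1/n\<close>.\<close>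

lemma (in wkb) expansion_root:
  assumes n: "\<bar>real_of_int n\<bar> \<ge> 64 * wkb_A N C"
  obtains ls where "norm (ls - npi n) \<le> 1"
    "ls + FN (1 / ls) = npi n"
    "norm (zs_expansion N \<phi>1 \<phi>2 n - ls) \<le> 3 * (128 * wkb_A N C / 3) ^ (N + 2) / \<bar>real_of_int n\<bar> ^ (N + 2)"
proof -
  interpret Z: zeta_eq "FN" "wkb_A N C" unfolding wkb_A_def by (rule zs_F_zeta_eq)
  obtain \<zeta> where z: "\<zeta> holomorphic_on ball 0 (Z.rho / 4)" "\<zeta> 0 = 0"
    "\<And>z. z \<in> ball 0 (Z.rho / 4) \<Longrightarrow> norm (\<zeta> z) \<le> 1"
    "\<And>z. z \<in> ball 0 (Z.rho / 4) \<Longrightarrow> \<zeta> z + FN (z / (of_real pi + z * \<zeta> z)) = 0"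
    "Z.is_zeta \<zeta>" "\<And>\<zeta>'. Z.is_zeta \<zeta>' \<Longrightarrow> \<forall>\<^sub>F z in nhds 0. \<zeta>' z = \<zeta> z"
    using Z.zeta_exists by blast
  have "Z.is_zeta (zs_zeta N \<phi>1 \<phi>2)"
    unfolding zs_zeta_def using z(5) by (metis (mono_tags, lifting) Z.is_zeta_def someI)
  from fps_expansion_cong[OF z(6)[OF this]] have c: "zs_c N \<phi>1 \<phi>2 k = (deriv ^^ k) \<zeta> 0 / fact k" for k
    by (simp add: zs_c_def fps_expansion_def)
  have A: "wkb_A N C \<ge> 1" by (rule Z.A1)
  have npos: "\<bar>real_of_int n\<bar> > 0" "n \<noteq> 0" using n A by auto
  define u where "u = (1 / of_int n :: complex)"
  have nu: "norm u = 1 / \<bar>real_of_int n\<bar>" by (simp add: u_def norm_divide)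
  have u2: "norm u \<le> (Z.rho / 4) / 2"
    using n A npos unfolding nu Z.rho_def by (simp add: field_simps)
  hence ub: "u \<in> ball 0 (Z.rho / 4)" using Z.rho by auto
  define ls where "ls = npi n + \<zeta> u"
  have inv: "1 / ls = u / (of_real pi + u * \<zeta> u)" using npos by (simp add: ls_def u_def field_simps)
  show ?thesis
  proof (rule that[of ls])
    show "norm (ls - npi n) \<le> 1" using z(3)[OF ub] by (simp add: ls_def)
    show "ls + FN (1 / ls) = npi n"
      unfolding inv using z(4)[OF ub] by (simp add: ls_def add.assoc)
    have "norm (\<zeta> u - (\<Sum>k\<le>N+1. (deriv ^^ k) \<zeta> 0 / fact k * u ^ k)) \<le> 3 * 1 * (norm u / (3 * (Z.rho / 4) / 4)) ^ Suc (N+1)"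
      by (rule taylor_remainder_bound[OF z(1) _ z(3) u2]) (use Z.rho in auto)
    also have "norm u / (3 * (Z.rho / 4) / 4) = (128 * wkb_A N C / 3) / \<bar>real_of_int n\<bar>"
      using A npos by (simp add: nu Z.rho_def field_simps)
    also have "(\<Sum>k\<le>N+1. (deriv ^^ k) \<zeta> 0 / fact k * u ^ k) = (\<Sum>k=1..N+1. zs_c N \<phi>1 \<phi>2 k / of_int n ^ k)"
    proof -
      have "(\<Sum>k\<le>N+1. zs_c N \<phi>1 \<phi>2 k * u ^ k) = zs_c N \<phi>1 \<phi>2 0 * u ^ 0 + (\<Sum>k=1..N+1. zs_c N \<phi>1 \<phi>2 k * u ^ k)"
        by (simp add: atMost_atLeast0 sum.atLeast_Suc_atMost)
      also have "zs_c N \<phi>1 \<phi>2 0 = 0" by (simp add: c z(2))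
      finally show ?thesis by (simp add: c u_def power_one_over divide_inverse power_inverse)
    qed
    finally show "norm (zs_expansion N \<phi>1 \<phi>2 n - ls) \<le> 3 * (128 * wkb_A N C / 3) ^ (N + 2) / \<bar>real_of_int n\<bar> ^ (N + 2)"
      by (simp add: zs_expansion_def ls_def norm_minus_commute power_divide mult_ac del: sum.cl_ivl_Suc)
  qed
qed

section \<open>Counting zeros far from the origin\<close>

lemma finite_zeros_cball:
  fixes f :: "complex \<Rightarrow> complex"
  assumes "f holomorphic_on UNIV" "f z0 \<noteq> 0"
  shows "finite {z\<in>cball a R. f z = 0}"
proof (cases "f constant_on UNIV")
  case True
  hence "{z\<in>cball a R. f z = 0} = {}" using assms(2) by (auto simp: constant_on_def)
  thus ?thesis by (simp only: finite.emptyI)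
next
  case False
  show ?thesis by (rule holomorphic_compact_finite_zeros[OF assms(1) open_UNIV connected_UNIV compact_cball _ False]) simp
qed

lemma zero_mult_eq_zorder:
  assumes "f holomorphic_on UNIV" "f z0 \<noteq> 0"
  shows "int (zero_mult f z) = zorder f z" "f z = 0 \<Longrightarrow> zero_mult f z > 0"
proof -
  have "(if f z = 0 then zorder f z > 0 else zorder f z = 0)"
    using zorder_exist_zero[OF assms(1) open_UNIV connected_UNIV UNIV_I] assms(2) by (metis UNIV_I)
  thus "int (zero_mult f z) = zorder f z" "f z = 0 \<Longrightarrow> zero_mult f z > 0"
    by (auto simp: zero_mult_def split: if_splits)
qed

lemma rouche_disc:
  fixes f g :: "complex \<Rightarrow> complex"
  assumes f: "f holomorphic_on UNIV" and g: "g holomorphic_on UNIV" and R: "R > 0"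
    and less: "\<And>z. norm (z - a) = R \<Longrightarrow> norm (g z) < norm (f z)"
  shows "(\<Sum>p\<in>{p\<in>ball a R. f p + g p = 0}. zero_mult (\<lambda>p. f p + g p) p) = (\<Sum>p\<in>{p\<in>ball a R. f p = 0}. zero_mult f p)"
proof -
  define h where "h p = f p + g p" for p
  have h: "h holomorphic_on UNIV" unfolding h_def[abs_def] by (intro holomorphic_intros f g)
  have circ: "f z \<noteq> 0" "h z \<noteq> 0" if "norm (z - a) = R" for z
    using less[OF that] by (auto simp: h_def add_eq_0_iff2)
  have nz: "f (a + of_real R) \<noteq> 0" "h (a + of_real R) \<noteq> 0" using circ[of "a + of_real R"] R by auto
  have wind: "winding_number (circlepath a R) z = (if z \<in> ball a R then 1 else 0)" if "norm (z - a) \<noteq> R" for z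
  proof (cases "z \<in> ball a R")
    case True thus ?thesis by (simp add: winding_number_circlepath dist_norm norm_minus_commute)
  next
    case False
    hence "z \<notin> cball a R" using that by (auto simp: dist_norm norm_minus_commute)
    hence "winding_number (circlepath a R) z = 0"
      by (intro winding_number_zero_outside[where s="cball a R"]) (use R in auto)
    thus ?thesis using False by simp
  qed
  have S: "(\<Sum>p\<in>{p\<in>ball a (2*R). k p = 0}. winding_number (circlepath a R) p * of_int (zorder k p))
      = of_nat (\<Sum>p\<in>{p\<in>ball a R. k p = 0}. zero_mult k p)" (is "?L = _")
    if k: "k holomorphic_on UNIV" "\<And>z. norm (z - a) = R \<Longrightarrow> k z \<noteq> 0" for k
  proof -
    have k0: "k (a + of_real R) \<noteq> 0" using k(2)[of "a + of_real R"] R by auto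
    have fin: "finite {p\<in>ball a (2*R). k p = 0}"
      by (rule finite_subset[OF _ finite_zeros_cball[OF k(1) k0, of a "2*R"]]) auto
    have "?L = (\<Sum>p\<in>{p\<in>ball a (2*R). k p = 0}. if p \<in> ball a R then of_nat (zero_mult k p) else 0)"
    proof (rule sum.cong[OF refl])
      fix p assume "p \<in> {p\<in>ball a (2*R). k p = 0}"
      hence "norm (p - a) \<noteq> R" using k(2) by auto
      moreover have "(of_int (zorder k p) :: complex) = of_nat (zero_mult k p)"
        unfolding zero_mult_eq_zorder(1)[OF k(1) k0, symmetric] by simp
      ultimately show "winding_number (circlepath a R) p * of_int (zorder k p) =
          (if p \<in> ball a R then of_nat (zero_mult k p) else 0)"
        by (simp add: wind)
    qed
    also have "... = (\<Sum>p\<in>{p\<in>ball a (2*R). k p = 0} \<inter> ball a R. of_nat (zero_mult k p))"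
      by (rule sum.inter_restrict[OF fin, symmetric])
    also have "{p\<in>ball a (2*R). k p = 0} \<inter> ball a R = {p\<in>ball a R. k p = 0}" using R by auto
    finally show ?thesis by simp
  qed
  have fin: "finite {p\<in>ball a (2*R). k p = 0}" if "k holomorphic_on UNIV" "k (a + of_real R) \<noteq> 0" for k
    by (rule finite_subset[OF _ finite_zeros_cball[OF that, of a "2*R"]]) auto
  have "(\<Sum>p\<in>{p\<in>ball a (2*R). f p + g p = 0}. winding_number (circlepath a R) p * zorder (\<lambda>p. f p + g p) p)
      = (\<Sum>p\<in>{p\<in>ball a (2*R). f p = 0}. winding_number (circlepath a R) p * zorder f p)"
  proof (rule Rouche_theorem)
    show "finite {p \<in> ball a (2 * R). f p + g p = 0}" using fin[OF h nz(2)] by (simp add: h_def)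
    show "finite {p \<in> ball a (2 * R). f p = 0}" using fin[OF f nz(1)] .
    show "path_image (circlepath a R) \<subseteq> ball a (2 * R)" using R by (auto simp: dist_norm)
    show "\<forall>z\<in>path_image (circlepath a R). cmod (g z) < cmod (f z)"
      using R less by (auto simp: dist_norm norm_minus_commute)
    show "\<forall>z. z \<notin> ball a (2 * R) \<longrightarrow> winding_number (circlepath a R) z = 0"
      using R by (auto simp: wind dist_norm norm_minus_commute)
  qed (use f g holomorphic_on_subset in \<open>auto simp: connected_ball\<close>)
  moreover have heq: "(\<lambda>p. f p + g p) = h" by (rule ext) (simp add: h_def)
  ultimately have "(of_nat (\<Sum>p\<in>{p\<in>ball a R. h p = 0}. zero_mult h p) :: complex) = of_nat (\<Sum>p\<in>{p\<in>ball a R. f p = 0}. zero_mult f p)"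
    using S[OF h circ(2)] S[OF f circ(1)] by (simp only: h_def[symmetric])
  hence "(\<Sum>p\<in>{p\<in>ball a R. h p = 0}. zero_mult h p) = (\<Sum>p\<in>{p\<in>ball a R. f p = 0}. zero_mult f p)"
    by (simp only: of_nat_eq_iff)
  thus ?thesis unfolding heq by (simp only: h_def[symmetric])
qed

lemma npi_facts:
  fixes n :: int
  defines "a \<equiv> npi n"
  obtains s :: complex where "s = 1 \<or> s = -1" "\<And>z. sin (z - a) = s * sin z" "\<And>z. cos (z - a) = s * cos z" "sin a = 0" "cos a = s"
proof -
  have r: "a = of_real (of_int n * pi)" by (simp add: a_def)
  have s0: "sin (of_int n * pi) = 0" using sin_zero_iff_int2 by blast
  hence "(cos (of_int n * pi))\<^sup>2 = 1" using sin_cos_squared_add[of "of_int n * pi"] by simp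
  hence c: "cos (of_int n * pi) = 1 \<or> cos (of_int n * pi) = -1" by (simp add: power2_eq_1_iff)
  have sa: "sin a = 0" unfolding r sin_of_real s0 by simp
  have ca: "cos a = of_real (cos (of_int n * pi))" unfolding r cos_of_real ..
  show ?thesis
    by (rule that[of "cos a"]) (use c in \<open>auto simp: sin_diff cos_diff sa ca\<close>)
qed

text \<open>A consequence of \<open>(norm (sin z))\<^sup>2 = (sin (Re z))\<^sup>2 + (sinh (Im z))\<^sup>2\<close>.\<close>

lemma sin_lower_strip:
  fixes z :: complex assumes "\<bar>Re z\<bar> \<le> pi / 2" shows "norm z / 2 \<le> norm (sin z)"
proof -
  define x y where "x = Re z" and "y = Im z"
  have n2: "(norm (sin z))\<^sup>2 = (sin x)\<^sup>2 + (sinh y)\<^sup>2"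
  proof -
    have "(norm (sin z))\<^sup>2 = (exp (2*y) + inverse (exp (2*y)) - 2 * cos (2 * x)) / 4"
      by (simp add: norm_sin_squared x_def y_def)
    also have "cos (2*x) = 1 - 2 * (sin x)\<^sup>2" by (rule cos_double_sin)
    also have "exp (2*y) + inverse (exp (2*y)) = 4 * (sinh y)\<^sup>2 + 2"
      unfolding exp_double by (simp add: sinh_def power2_eq_square exp_minus field_simps)
    finally show ?thesis by simp
  qed
  have sx: "\<bar>x\<bar> / 2 \<le> \<bar>sin x\<bar>"
  proof -
    have b: "\<bar>sin x - x\<bar> \<le> \<bar>x\<bar> ^ 3 / 6"
      using Maclaurin_sin_bound[of x 3] by (simp add: numeral_3_eq_3 sin_coeff_def fact_numeral)
    have "\<bar>x\<bar> ^ 2 \<le> (1.6)\<^sup>2" by (rule power_mono) (use assms pi_less_4 pi_half_less_two m2pi_less_pi pi_approx in \<open>auto simp: x_def\<close>)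
    hence "\<bar>x\<bar> * \<bar>x\<bar> ^ 2 \<le> \<bar>x\<bar> * 3" by (intro mult_left_mono) (auto simp: power2_eq_square)
    hence "\<bar>x\<bar> ^ 3 / 6 \<le> \<bar>x\<bar> / 2" by (simp add: power3_eq_cube power2_eq_square)
    thus ?thesis using b by linarith
  qed
  have sy: "\<bar>y\<bar> / 2 \<le> \<bar>sinh y\<bar>"
  proof -
    have "\<bar>y\<bar> \<le> sinh \<bar>y\<bar>"
    proof -
      have "((\<lambda>t. sinh t - t) 0) \<le> (\<lambda>t. sinh t - t) \<bar>y\<bar>"
      proof (rule DERIV_nonneg_imp_nondecreasing[where f="\<lambda>t. sinh t - t" and a=0 and b="\<bar>y\<bar>"])
        fix t assume "0 \<le> t" "t \<le> \<bar>y\<bar>"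
        show "\<exists>d. ((\<lambda>t. sinh t - t) has_real_derivative d) (at t) \<and> 0 \<le> d"
          by (rule exI[of _ "cosh t - 1"]) (auto intro!: derivative_eq_intros simp: cosh_real_ge_1)
      qed simp
      thus ?thesis by simp
    qed
    thus ?thesis using sinh_real_abs[of y] by simp
  qed
  have "(norm z / 2)\<^sup>2 = (\<bar>x\<bar> / 2)\<^sup>2 + (\<bar>y\<bar> / 2)\<^sup>2" by (simp add: x_def y_def power_divide cmod_power2 add_divide_distrib)
  also have "... \<le> \<bar>sin x\<bar>\<^sup>2 + \<bar>sinh y\<bar>\<^sup>2" by (intro add_mono power_mono sx sy) auto
  also have "... = (norm (sin z))\<^sup>2" using n2 by simp
  finally show ?thesis by (rule power2_le_imp_le) simp
qed

lemma norm_sin_Im_lower: "norm (sin z) \<ge> (exp \<bar>Im z\<bar> - exp (- \<bar>Im z\<bar>)) / 2"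
proof -
  have "\<bar>norm (exp (\<i> * z)) - norm (exp (- (\<i> * z)))\<bar> \<le> norm (exp (\<i> * z) - exp (- (\<i> * z)))" by (rule norm_triangle_ineq3)
  hence "\<bar>exp (- Im z) - exp (Im z)\<bar> \<le> norm (exp (\<i> * z) - exp (- (\<i> * z)))" by (simp add: norm_exp_eq_Re)
  also have "... = 2 * norm (sin z)" by (simp add: sin_exp_eq norm_divide norm_mult)
  finally have "\<bar>exp (- Im z) - exp (Im z)\<bar> \<le> 2 * norm (sin z)" .
  hence "exp (- Im z) - exp (Im z) \<le> 2 * norm (sin z)" "exp (Im z) - exp (- Im z) \<le> 2 * norm (sin z)" by linarith+
  thus ?thesis by (cases "Im z \<ge> 0") simp_all
qed

lemma norm_cos_upper: "norm (cos z) \<le> exp \<bar>Im z\<bar>"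
proof -
  have "norm (cos z) \<le> (norm (exp (\<i> * z)) + norm (exp (- (\<i> * z)))) / 2"
    unfolding cos_exp_eq norm_divide using norm_triangle_ineq[of "exp (\<i> * z)" "exp (- (\<i> * z))"] by simp
  also have "... \<le> (exp \<bar>Im z\<bar> + exp \<bar>Im z\<bar>) / 2" by (intro divide_right_mono add_mono) (auto simp: norm_exp_eq_Re)
  finally show ?thesis by simp
qed

lemma sin_lower_outside:
  fixes z :: complex
  assumes out: "\<And>n::int. norm (z - npi n) \<ge> 1"
  shows "exp \<bar>Im z\<bar> / 5 \<le> norm (sin z)"
proof (cases "\<bar>Im z\<bar> \<ge> 4/5")
  case True
  have "exp (- \<bar>Im z\<bar>) \<le> 1" by simp
  moreover have "(1 + 4/5) \<le> exp \<bar>Im z\<bar>" using exp_ge_add_one_self[of "\<bar>Im z\<bar>"] True by linarith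
  moreover have "E / 5 \<le> X" if "E' \<le> 1" "1 + 4/5 \<le> E" "X \<ge> (E - E') / 2" for E E' X :: real using that by simp
  ultimately show ?thesis using norm_sin_Im_lower[of z] by blast
next
  case False
  define n where "n = round (Re z / pi)"
  obtain s :: complex where s: "s = 1 \<or> s = -1" "\<And>z. sin (z - npi n) = s * sin z" using npi_facts by metis
  have "\<bar>of_int n - Re z / pi\<bar> \<le> 1/2" unfolding n_def by (rule of_int_round_abs_le)
  hence "\<bar>of_int n - Re z / pi\<bar> * pi \<le> 1/2 * pi" by (intro mult_right_mono) auto
  hence "\<bar>(of_int n - Re z / pi) * pi\<bar> \<le> pi / 2" by (simp add: abs_mult)
  hence "\<bar>Re (z - npi n)\<bar> \<le> pi / 2" by (simp add: algebra_simps abs_minus_commute)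
  from sin_lower_strip[OF this] have "1 / 2 \<le> norm (s * sin z)" using out[of n] s(2) by (metis divide_right_mono order_trans zero_le_numeral)
  hence "1/2 \<le> norm (sin z)" using s(1) by (auto simp: norm_mult)
  moreover have "exp \<bar>Im z\<bar> \<le> 5/2"
  proof -
    have "exp \<bar>Im z\<bar> \<le> exp (4/5)" using False by simp
    also have "exp (4/5 :: real) \<le> 5/2"
    proof -
      have "exp (4/5 :: real) = exp (2/5) ^ 2" by (simp add: exp_double[symmetric])
      also have "exp (2/5 :: real) \<le> 1 + 2/5 + (2/5)\<^sup>2" by (rule exp_bound) auto
      hence "exp (2/5 :: real) ^ 2 \<le> (1 + 2/5 + (2/5)\<^sup>2) ^ 2" by (rule power_mono) auto
      also have "... \<le> 5/2" by (simp add: power2_eq_square)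
      finally show ?thesis .
    qed
    finally show ?thesis .
  qed
  ultimately show ?thesis by linarith
qed

text \<open>Beyond the distance \<open>1000 * Q\<close> from the origin, a generous choice, the deviations of \<open>D\<close> from \<open>2 cos\<close> and of its
  derivative from \<open>- 2 sin\<close> are dominated by \<open>sin\<close> outside the discs of radius 1 around the multiples of \<open>\<pi>\<close>, where \<open>norm (sin z)\<close>
  is at least \<open>exp \<bar>Im z\<bar> / 5\<close>. Rouche's theorem then counts the zeros in each disc.\<close>

locale near_cosine =
  fixes D :: "complex \<Rightarrow> complex" and Q :: real
  assumes hol: "D holomorphic_on UNIV" and Q1: "Q \<ge> 1"
    and crude: "\<And>la. norm la \<ge> 1 \<Longrightarrow> norm (D la - 2 * cos la) \<le> Q / norm la * exp \<bar>Im la\<bar>"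
begin

lemma deriv_hol: "deriv D holomorphic_on UNIV" by (rule holomorphic_deriv[OF hol]) simp

lemma D_deriv: "(D has_field_derivative deriv D z) (at z)"
  using holomorphic_on_imp_differentiable_at[OF hol] by (simp add: field_differentiable_derivI)

lemma D_small: assumes "norm la \<ge> 1000 * Q" shows "norm (D la - 2 * cos la) \<le> exp \<bar>Im la\<bar> / 100"
proof -
  have "norm la > 0" "norm la \<ge> 1" using assms Q1 by linarith+
  moreover from this have "Q / norm la \<le> 1 / 1000" using assms by (simp add: field_simps)
  hence "Q / norm la * exp \<bar>Im la\<bar> \<le> 1 / 1000 * exp \<bar>Im la\<bar>" by (rule mult_right_mono) simp
  ultimately show ?thesis using crude[of la] exp_gt_zero[of "\<bar>Im la\<bar>"] by linarith
qed

lemma deriv_small: assumes la: "norm la \<ge> 1000 * Q" shows "norm (deriv D la + 2 * sin la) \<le> exp \<bar>Im la\<bar> / 100"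
proof -
  define g where "g z = D z - 2 * cos z" for z
  have gh: "g holomorphic_on UNIV" unfolding g_def[abs_def] by (intro holomorphic_intros hol)
  have "norm ((deriv ^^ 1) g la) \<le> fact 1 * (exp \<bar>Im la\<bar> / 100) / 1 ^ 1"
  proof (rule Cauchy_inequality)
    show "g holomorphic_on ball la 1" "continuous_on (cball la 1) g"
      using gh by (auto intro: holomorphic_on_subset holomorphic_on_imp_continuous_on)
    fix x assume x: "norm (la - x) = 1"
    have nx: "norm x \<ge> norm la - 1" using norm_triangle_ineq2[of la x] x by linarith
    have Ix: "\<bar>Im x\<bar> \<le> \<bar>Im la\<bar> + 1" using abs_Im_le_cmod[of "la - x"] x by auto
    have nx': "norm x \<ge> 999 * Q" "norm x \<ge> 1" using nx la Q1 by linarith+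
    have "norm (g x) \<le> Q / norm x * exp \<bar>Im x\<bar>" unfolding g_def by (rule crude) (use nx' in simp)
    also have "... \<le> (1 / 999) * exp (\<bar>Im la\<bar> + 1)"
    proof (rule mult_mono)
      have "norm x > 0" using nx' by linarith
      thus "Q / norm x \<le> 1 / 999" using nx' by (simp add: field_simps)
    qed (use Ix in auto)
    also have "exp (\<bar>Im la\<bar> + 1) \<le> exp \<bar>Im la\<bar> * 3" unfolding exp_add by (intro mult_left_mono exp_le) auto
    finally show "norm (g x) \<le> exp \<bar>Im la\<bar> / 100" using exp_gt_zero[of "\<bar>Im la\<bar>"] by linarith
  qed simp
  moreover have "deriv g la = deriv D la + 2 * sin la"
    unfolding g_def[abs_def] by (rule DERIV_imp_deriv) (auto intro!: derivative_eq_intros D_deriv)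
  ultimately show ?thesis by simp
qed

lemma char_small: assumes "norm la \<ge> 1000 * Q"
  shows "norm ((4 - (D la)\<^sup>2) - 4 * (sin la)\<^sup>2) \<le> exp \<bar>Im la\<bar> ^ 2 / 20"
proof -
  define e where "e = exp \<bar>Im la\<bar>"
  have "(4 - (D la)\<^sup>2) - 4 * (sin la)\<^sup>2 = - ((D la - 2 * cos la) * ((D la - 2 * cos la) + 4 * cos la))"
    unfolding sin_squared_eq by (simp add: algebra_simps power2_eq_square)
  hence "norm ((4 - (D la)\<^sup>2) - 4 * (sin la)\<^sup>2) = norm (D la - 2 * cos la) * norm ((D la - 2 * cos la) + 4 * cos la)"
    by (simp add: norm_mult)
  also have "norm ((D la - 2 * cos la) + 4 * cos la) \<le> e / 100 + 4 * e"
    using norm_triangle_ineq[of "D la - 2 * cos la" "4 * cos la"] D_small[OF assms] norm_cos_upper[of la]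
    by (simp add: norm_mult e_def)
  hence "norm (D la - 2 * cos la) * norm ((D la - 2 * cos la) + 4 * cos la) \<le> e / 100 * (e / 100 + 4 * e)"
    by (intro mult_mono) (use D_small[OF assms] in \<open>auto simp: e_def\<close>)
  also have "... \<le> e ^ 2 / 20" by (simp add: power2_eq_square algebra_simps)
  finally show ?thesis by (simp add: e_def)
qed

context
  fixes la :: complex
  assumes big: "norm la \<ge> 1000 * Q" and out: "\<And>n::int. norm (la - npi n) \<ge> 1"
begin

lemma deriv_dominated: "norm (deriv D la + 2 * sin la) < norm (- 2 * sin la)"
proof -
  have "x < 2 * t" if "x \<le> e / 100" "e / 5 \<le> t" "0 < e" for x e t :: real using that by simp
  from this[OF deriv_small[OF big] sin_lower_outside[OF out] exp_gt_zero] show ?thesis by (simp add: norm_mult)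
qed

lemma char_dominated: "norm ((4 - (D la)\<^sup>2) - 4 * (sin la)\<^sup>2) < norm (4 * (sin la)\<^sup>2)"
proof -
  have "(exp \<bar>Im la\<bar> / 5) ^ 2 \<le> norm (sin la) ^ 2" by (rule power_mono[OF sin_lower_outside[OF out]]) simp
  hence "4 * exp \<bar>Im la\<bar> ^ 2 / 25 \<le> norm (4 * (sin la)\<^sup>2)" by (simp add: norm_mult norm_power power_divide)
  thus ?thesis using char_small[OF big] zero_less_power[OF exp_gt_zero[of "\<bar>Im la\<bar>"], of 2] by linarith
qed

lemma nonzero_outside: "deriv D la \<noteq> 0" "4 - (D la)\<^sup>2 \<noteq> 0"
  using deriv_dominated char_dominated by (auto simp: norm_mult norm_power)

end

lemma circle_far:
  fixes n :: int and z :: complex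
  assumes n: "\<bar>real_of_int n\<bar> \<ge> 1000 * Q" and z: "norm (z - npi n) \<le> 1"
  shows "norm z \<ge> 1000 * Q" "norm (z - npi n) = 1 \<Longrightarrow> norm (z - npi m) \<ge> 1"
proof -
  have "norm (npi n) = \<bar>real_of_int n\<bar> * pi" by (simp add: norm_mult)
  also have "... \<ge> \<bar>real_of_int n\<bar> * 3" by (intro mult_left_mono) (use pi_gt3 in auto)
  finally have "norm (npi n) \<ge> 3 * \<bar>real_of_int n\<bar>" by simp
  moreover have "norm (npi n) \<le> norm (z - npi n) + norm z" by norm
  ultimately show "norm z \<ge> 1000 * Q" using n z Q1 by linarith
  assume e: "norm (z - npi n) = 1"
  show "norm (z - npi m) \<ge> 1"
  proof (cases "m = n")
    case False
    hence "\<bar>real_of_int (n - m)\<bar> \<ge> 1" by linarith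
    hence "\<bar>real_of_int (n - m)\<bar> * pi \<ge> 1 * pi" by (intro mult_right_mono) auto
    hence "norm (npi n - npi m) \<ge> pi"
      by (metis (no_types, lifting) left_diff_distrib mult_1 norm_mult norm_of_int norm_of_real of_int_diff abs_of_pos pi_gt_zero)
    moreover have "norm (npi n - npi m) \<le> norm (z - npi m) + norm (z - npi n)" by norm
    ultimately show ?thesis using e pi_gt3 by linarith
  qed (use e in simp)
qed

lemma sin_zeros_in_disc: "{p \<in> ball (npi n) 1. sin p = 0} = {npi n}"
proof -
  obtain s :: complex where s: "\<And>z. sin (z - npi n) = s * sin z" "sin (npi n) = 0" using npi_facts by metis
  have "p = npi n" if p: "norm (p - npi n) < 1" "sin p = 0" for p :: complex
  proof -
    have "\<bar>Re (p - npi n)\<bar> \<le> pi / 2"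
      using abs_Re_le_cmod[of "p - npi n"] p(1) pi_gt3 by linarith
    from sin_lower_strip[OF this] show ?thesis unfolding s(1) p(2) by simp
  qed
  thus ?thesis using s(2) by (auto simp: dist_norm norm_minus_commute)
qed

lemma count_deriv:
  fixes n :: int
  assumes n: "\<bar>real_of_int n\<bar> \<ge> 1000 * Q"
  shows "(\<Sum>p\<in>{p\<in>ball (npi n) 1. deriv D p = 0}. zero_mult (deriv D) p) = 1"
proof -
  let ?a = "npi n"
  obtain s :: complex where s: "s = 1 \<or> s = -1" "sin ?a = 0" "cos ?a = s" using npi_facts by metis
  have z: "zorder (\<lambda>z. - 2 * sin z) ?a = 1"
  proof (rule zorder_zero_eqI[where S=UNIV])
    have "deriv (\<lambda>z. - 2 * sin z) ?a = - 2 * cos ?a" by (rule DERIV_imp_deriv) (auto intro!: derivative_eq_intros)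
    thus "(deriv ^^ nat 1) (\<lambda>z. - 2 * sin z) ?a \<noteq> 0" using s by auto
  qed (use s in \<open>auto intro!: holomorphic_intros\<close>)
  have "(\<Sum>p\<in>{p\<in>ball ?a 1. - 2 * sin p + (deriv D p + 2 * sin p) = 0}. zero_mult (\<lambda>p. - 2 * sin p + (deriv D p + 2 * sin p)) p)
      = (\<Sum>p\<in>{p\<in>ball ?a 1. - 2 * sin p = 0}. zero_mult (\<lambda>p. - 2 * sin p) p)"
    by (rule rouche_disc) (use circle_far[OF n] deriv_dominated in \<open>auto intro!: holomorphic_intros deriv_hol\<close>)
  also have "{p\<in>ball ?a 1. - 2 * sin p = 0} = {?a}" using sin_zeros_in_disc[of n] by auto
  finally show ?thesis using z s(2) by (simp add: zero_mult_def)
qed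

lemma count_char:
  fixes n :: int
  assumes n: "\<bar>real_of_int n\<bar> \<ge> 1000 * Q"
  shows "(\<Sum>p\<in>{p\<in>ball (npi n) 1. 4 - (D p)\<^sup>2 = 0}. zero_mult (\<lambda>p. 4 - (D p)\<^sup>2) p) = 2"
proof -
  let ?a = "npi n"
  obtain s :: complex where s: "s = 1 \<or> s = -1" "sin ?a = 0" "cos ?a = s" using npi_facts by metis
  have d1: "deriv (\<lambda>z. 4 * (sin z)\<^sup>2) = (\<lambda>z. 8 * sin z * cos z)"
    by (rule ext, rule DERIV_imp_deriv) (auto intro!: derivative_eq_intros)
  have d2: "deriv (\<lambda>z. 8 * sin z * cos z) ?a = 8 * cos ?a * cos ?a - 8 * sin ?a * sin ?a"
    by (rule DERIV_imp_deriv) (auto intro!: derivative_eq_intros)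
  have z: "zorder (\<lambda>z. 4 * (sin z)\<^sup>2) ?a = 2"
  proof (rule zorder_zero_eqI[where S=UNIV])
    show "(deriv ^^ nat 2) (\<lambda>z. 4 * (sin z)\<^sup>2) ?a \<noteq> 0" 
    proof -
      have two: "nat 2 = Suc (Suc 0)" by simp
      show ?thesis unfolding two funpow.simps o_apply id_apply d1 d2 using s by auto
    qed
    show "(deriv ^^ i) (\<lambda>z. 4 * (sin z)\<^sup>2) ?a = 0" if "i < nat 2" for i
    proof -
      have "i = 0 \<or> i = 1" using that by auto
      thus ?thesis using s by (auto simp: d1)
    qed
  qed (auto intro!: holomorphic_intros)
  have "(\<Sum>p\<in>{p\<in>ball ?a 1. 4 * (sin p)\<^sup>2 + ((4 - (D p)\<^sup>2) - 4 * (sin p)\<^sup>2) = 0}. zero_mult (\<lambda>p. 4 * (sin p)\<^sup>2 + ((4 - (D p)\<^sup>2) - 4 * (sin p)\<^sup>2)) p)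
      = (\<Sum>p\<in>{p\<in>ball ?a 1. 4 * (sin p)\<^sup>2 = 0}. zero_mult (\<lambda>p. 4 * (sin p)\<^sup>2) p)"
    by (rule rouche_disc) (use circle_far[OF n] char_dominated in \<open>auto intro!: holomorphic_intros hol\<close>)
  also have "{p\<in>ball ?a 1. 4 * (sin p)\<^sup>2 = 0} = {?a}" using sin_zeros_in_disc[of n] by auto
  finally show ?thesis using z s(2) by (simp add: zero_mult_def)
qed

end

section \<open>Zeros of functions close to a cosine inside a disc\<close>

text \<open>The situation in one disc: \<open>a = n\<pi>\<close>, \<open>G\<close> is the discriminant up to sign, \<open>K la = F (1/la)\<close>, and \<open>ls\<close> is the
  root of the unperturbed equation. The aim is to show that critical points and midpoints of pairs of level points differ from \<open>ls\<close> by \<open>O(E)\<close>.\<close>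

locale zero_location =
  fixes G K :: "complex \<Rightarrow> complex" and a ls :: complex and E :: real
  assumes G: "G holomorphic_on UNIV" and K: "K holomorphic_on ball a 3"
    and K_small: "\<And>la. norm (la - a) \<le> 2 \<Longrightarrow> norm (K la) \<le> 1 / 100"
    and err: "\<And>la. norm (la - a) \<le> 2 \<Longrightarrow> norm (G la - 2 * cos (la - a + K la)) \<le> E"
    and E1: "E \<le> 1"
    and ls: "norm (ls - a) \<le> 1" "ls - a + K ls = 0"
begin

definition Th where "Th la = la - a + K la"

lemma E0: "E \<ge> 0" using order_trans[OF norm_ge_zero err[of a]] by simp

lemma cauchy:
  assumes h: "h holomorphic_on ball a 3" and la: "norm (la - a) \<le> 1"
    and B: "\<And>z. norm (z - a) \<le> 2 \<Longrightarrow> norm (h z) \<le> B"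
  shows "norm ((deriv ^^ k) h la) \<le> fact k * B"
proof -
  have sub: "norm (x - a) \<le> 2" if "norm (x - la) \<le> 1" for x
    using norm_triangle_ineq[of "x - la" "la - a"] that la by simp
  have sub2: "cball la 1 \<subseteq> ball a 3"
  proof
    fix x assume "x \<in> cball la 1"
    hence "norm (x - a) \<le> 2" by (intro sub) (simp add: dist_norm norm_minus_commute)
    thus "x \<in> ball a 3" by (simp add: dist_norm norm_minus_commute)
  qed
  have "norm ((deriv ^^ k) h la) \<le> fact k * B / 1 ^ k"
  proof (rule Cauchy_inequality)
    show "h holomorphic_on ball la 1" by (rule holomorphic_on_subset[OF h]) (use sub2 in auto)
    show "continuous_on (cball la 1) h"
      by (rule holomorphic_on_imp_continuous_on, rule holomorphic_on_subset[OF h sub2])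
    show "norm (h x) \<le> B" if "norm (la - x) = 1" for x
      by (rule B, rule sub) (use that in \<open>simp add: norm_minus_commute\<close>)
  qed simp
  thus ?thesis by simp
qed

lemma K_deriv: assumes "norm (la - a) \<le> 1" shows "(K has_field_derivative deriv K la) (at la)" "norm (deriv K la) \<le> 1 / 100"
proof -
  have "la \<in> ball a 3" using assms by (simp add: dist_norm norm_minus_commute)
  thus "(K has_field_derivative deriv K la) (at la)"
    using holomorphic_on_imp_differentiable_at[OF K] by (simp add: field_differentiable_derivI)
  show "norm (deriv K la) \<le> 1 / 100" using cauchy[OF K assms K_small, of 1] by simp
qed

lemma Th_bilipschitz:
  assumes "norm (x - a) \<le> 1" "norm (y - a) \<le> 1"
  shows "norm (x - y) \<le> 2 * norm (Th x - Th y)"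
proof -
  have "norm (K x - K y) \<le> 1 / 100 * norm (x - y)"
    by (rule field_differentiable_bound[where S="cball a 1" and f' = "deriv K"])
      (use assms K_deriv in \<open>auto simp: dist_norm norm_minus_commute intro: has_field_derivative_at_within\<close>)
  moreover have "norm (x - y) \<le> norm (Th x - Th y) + norm (K x - K y)"
    using norm_triangle_ineq4[of "Th x - Th y" "K x - K y"] by (simp add: Th_def algebra_simps)
  ultimately show ?thesis using norm_ge_zero[of "x - y"] by argo
qed

lemma near_root:
  assumes "norm (la - a) \<le> 1" shows "norm (la - ls) \<le> 2 * norm (Th la)"
  using Th_bilipschitz[OF assms ls(1)] ls(2) by (simp add: Th_def)

lemma Th_Re: assumes "norm (la - a) \<le> 1" shows "\<bar>Re (Th la)\<bar> \<le> pi / 2"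
proof -
  have "norm (Th la) \<le> 1 + 1 / 100" unfolding Th_def
    using norm_triangle_ineq[of "la - a" "K la"] K_small[of la] assms by linarith
  thus ?thesis using abs_Re_le_cmod[of "Th la"] pi_gt3 by linarith
qed

lemma near_critical:
  assumes la: "norm (la - a) \<le> 1" and X: "norm (deriv G la) \<le> X"
  shows "norm (la - ls) \<le> 3 * (X + E)"
proof -
  define g where "g z = G z - 2 * cos (z - a + K z)" for z
  have gh: "g holomorphic_on ball a 3"
    unfolding g_def[abs_def] by (intro holomorphic_intros K holomorphic_on_subset[OF G]) auto
  have g': "norm (deriv g la) \<le> E"
    using cauchy[OF gh la, of E 1] err by (simp add: g_def)
  have "deriv g la = deriv G la + 2 * (sin (Th la) * (1 + deriv K la))"
    unfolding g_def[abs_def] Th_def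
    by (rule DERIV_imp_deriv)
      (auto intro!: derivative_eq_intros K_deriv(1)[OF la] holomorphic_derivI[OF G open_UNIV UNIV_I] simp: algebra_simps)
  hence "2 * (sin (Th la) * (1 + deriv K la)) = deriv g la - deriv G la" by simp
  hence "norm (2 * (sin (Th la) * (1 + deriv K la))) \<le> E + X"
    using norm_triangle_ineq4[of "deriv g la" "deriv G la"] g' X by simp
  hence "2 * norm (sin (Th la)) * norm (1 + deriv K la) \<le> E + X" by (simp add: norm_mult)
  moreover have "norm (1 + deriv K la) \<ge> 99 / 100"
    using norm_triangle_ineq4[of "1 + deriv K la" "deriv K la"] K_deriv(2)[OF la] by simp
  hence "2 * norm (sin (Th la)) * norm (1 + deriv K la) \<ge> 2 * norm (sin (Th la)) * (99 / 100)"
    by (intro mult_left_mono) auto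
  ultimately have "norm (Th la) * (99 / 100) \<le> E + X" using sin_lower_strip[OF Th_Re[OF la]] by linarith
  thus ?thesis using near_root[OF la] norm_ge_zero[of "Th la"] by argo
qed

text \<open>The unperturbed function \<open>2 cos\<close> takes the value 2 twice at \<open>ls\<close>, so only the square of the distance is \<open>O(E)\<close>.\<close>

lemma near_level:
  assumes la: "norm (la - a) \<le> 1" and G2: "G la = 2"
  shows "(norm (la - ls))\<^sup>2 \<le> 16 * E"
proof -
  have c: "cos (Th la) = 1 - 2 * sin (Th la / 2) ^ 2"
    using cos_double_sin[of "Th la / 2"] by simp
  have "norm (G la - 2 * cos (Th la)) \<le> E" using err[of la] la by (simp add: Th_def)
  also have "G la - 2 * cos (Th la) = 4 * sin (Th la / 2) ^ 2" unfolding G2 c by simp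
  finally have "4 * norm (sin (Th la / 2)) ^ 2 \<le> E" by (simp add: norm_mult norm_power)
  moreover have "norm (Th la / 2) / 2 \<le> norm (sin (Th la / 2))"
    by (rule sin_lower_strip) (use Th_Re[OF la] in simp)
  hence "(norm (Th la / 2) / 2)\<^sup>2 \<le> norm (sin (Th la / 2)) ^ 2" by (rule power_mono) simp
  ultimately have "norm (Th la) ^ 2 \<le> 4 * E" by (simp add: norm_divide power_divide)
  moreover have "norm (la - ls) ^ 2 \<le> (2 * norm (Th la))\<^sup>2" by (rule power_mono[OF near_root[OF la]]) simp
  ultimately show ?thesis by (simp add: power_mult_distrib)
qed

lemma third_derivative: assumes "norm (la - a) \<le> 1" shows "norm ((deriv ^^ 3) G la) \<le> 330"
proof -
  have "norm ((deriv ^^ 3) G la) \<le> fact 3 * 55"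
  proof (rule cauchy[OF holomorphic_on_subset[OF G] assms])
    fix z assume z: "norm (z - a) \<le> 2"
    have "norm (Th z) \<le> 2 + 1 / 100" unfolding Th_def
      using norm_triangle_ineq[of "z - a" "K z"] K_small[OF z] z by linarith
    hence "exp \<bar>Im (Th z)\<bar> \<le> exp (1 + 1 + 1)" using abs_Im_le_cmod[of "Th z"] by simp
    also have "... = exp 1 * exp 1 * exp (1::real)" by (simp only: exp_add)
    also have "... \<le> 3 * 3 * 3" by (intro mult_mono exp_le) auto
    finally have "norm (cos (Th z)) \<le> 27" using norm_cos_upper[of "Th z"] by simp
    moreover have "norm (G z) \<le> norm (G z - 2 * cos (Th z)) + 2 * norm (cos (Th z))"
      using norm_triangle_ineq[of "G z - 2 * cos (Th z)" "2 * cos (Th z)"] by (simp add: norm_mult)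
    ultimately show "norm (G z) \<le> 55" using err[OF z] E1 by (simp add: Th_def)
  qed auto
  thus ?thesis by (simp add: fact_numeral)
qed

text \<open>In the Taylor expansion of \<open>G (t + h) - G (t - h) = 0\<close> about the midpoint \<open>t\<close> the even terms cancel, which leaves
  \<open>deriv G t = O(h\<^sup>2)\<close>. By \<open>near_level\<close> this is \<open>O(E)\<close>: the midpoint is almost critical.\<close>

lemma near_midpoint:
  assumes p: "norm (p - a) \<le> 1" "G p = 2" and q: "norm (q - a) \<le> 1" "G q = 2"
    and pq: "p = q \<Longrightarrow> deriv G p = 0"
  shows "norm ((p + q) / 2 - ls) \<le> 8000 * E"
proof -
  define t h where "t = (p + q) / 2" and "h = (p - q) / 2"
  have pt: "p = t + h" and qt: "q = t - h" by (auto simp: t_def h_def field_simps)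
  have tS: "norm (t - a) \<le> 1"
  proof -
    have "t - a = (p - a) / 2 + (q - a) / 2" by (simp add: t_def field_simps)
    thus ?thesis using norm_triangle_ineq[of "(p - a) / 2" "(q - a) / 2"] p(1) q(1) by (simp add: norm_divide)
  qed
  have h2: "norm h ^ 2 \<le> 16 * E"
  proof -
    have "norm h \<le> (norm (p - ls) + norm (q - ls)) / 2"
      using norm_triangle_ineq4[of "p - ls" "q - ls"] by (simp add: h_def norm_divide)
    hence "norm h ^ 2 \<le> ((norm (p - ls) + norm (q - ls)) / 2) ^ 2" by (rule power_mono) simp
    also have "... \<le> (norm (p - ls) ^ 2 + norm (q - ls) ^ 2) / 2"
      using sum_squares_bound[of "norm (p - ls)" "norm (q - ls)"] by (simp add: power2_eq_square field_simps)
    also have "... \<le> 16 * E" using near_level[OF p] near_level[OF q] by simp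
    finally show ?thesis .
  qed
  have "norm (deriv G t) \<le> 165 * norm h ^ 2"
  proof (cases "h = 0")
    case True
    hence "p = q" "t = p" by (auto simp: h_def t_def)
    thus ?thesis using pq True by simp
  next
    case False
    have D: "((deriv ^^ i) G has_field_derivative (deriv ^^ Suc i) G x) (at x within cball a 1)" for i x
      unfolding funpow.simps o_apply by (rule holomorphic_derivI[OF holomorphic_higher_deriv[OF G open_UNIV] open_UNIV UNIV_I])
    have tay: "norm (G z - (\<Sum>i\<le>2. (deriv ^^ i) G t * (z - t) ^ i / fact i)) \<le> 330 * norm (z - t) ^ Suc 2 / fact 2"
      if "norm (z - a) \<le> 1" for z
      using complex_Taylor[of "cball a 1" 2 "\<lambda>i. (deriv ^^ i) G" 330 t z] D third_derivative tS that
      by (simp add: dist_norm norm_minus_commute numeral_3_eq_3)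
    define c where "c = (deriv ^^ 2) G t"
    have sumeq: "(\<Sum>i\<le>2. (deriv ^^ i) G t * y ^ i / fact i) = G t + deriv G t * y + c * y ^ 2 / 2" for y
      by (simp add: numeral_2_eq_2 c_def)
    have P: "norm (G p - (G t + deriv G t * h + c * h ^ 2 / 2)) \<le> 165 * norm h ^ 3"
      using tay[OF p(1)] unfolding sumeq by (simp add: pt numeral_3_eq_3)
    have Qq: "norm (G q - (G t - deriv G t * h + c * h ^ 2 / 2)) \<le> 165 * norm h ^ 3"
      using tay[OF q(1)] unfolding sumeq by (simp add: qt numeral_3_eq_3)
    have "norm (2 * deriv G t * h) = norm ((G q - (G t - deriv G t * h + c * h ^ 2 / 2)) - (G p - (G t + deriv G t * h + c * h ^ 2 / 2)))"
      unfolding p(2) q(2) by (rule arg_cong[where f=norm]) (simp add: algebra_simps)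
    also have "... \<le> 165 * norm h ^ 3 + 165 * norm h ^ 3" using norm_triangle_ineq4 P Qq by (meson add_mono order_trans)
    finally have "norm (deriv G t) * norm h \<le> 165 * norm h ^ 2 * norm h" by (simp add: norm_mult power3_eq_cube power2_eq_square mult_ac)
    thus ?thesis using False by (simp add: mult_le_cancel_right)
  qed
  hence "norm (deriv G t) \<le> 2640 * E" using h2 by linarith
  from near_critical[OF tS this] show ?thesis using E0 by (simp add: t_def)
qed

end

section \<open>Listings of points in lexicographic order\<close>

abbreviation "npi_disc n \<equiv> ball (npi n) 1"

lemma npi_disc_Re: "z \<in> npi_disc n \<Longrightarrow> \<bar>Re z - of_int n * pi\<bar> < 1"
  using abs_Re_le_cmod[of "z - npi n"] by (simp add: dist_norm norm_minus_commute)

lemma npi_disc_between: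
  assumes z: "z \<in> npi_disc k" and "of_int n * pi - 1 \<le> Re z" "Re z \<le> of_int m * pi + 1"
  shows "n \<le> k" "k \<le> m"
proof -
  have r: "\<bar>Re z - of_int k * pi\<bar> < 1" by (rule npi_disc_Re[OF z])
  have "of_int n * pi < (of_int k + 1) * pi" using r assms(2) pi_gt3 by (simp add: algebra_simps)
  hence "real_of_int n < of_int k + 1" by (simp add: mult_less_cancel_right)
  thus "n \<le> k" by linarith
  have "of_int k * pi < (of_int m + 1) * pi" using r assms(3) pi_gt3 by (simp add: algebra_simps)
  hence "real_of_int k < of_int m + 1" by (simp add: mult_less_cancel_right)
  thus "k \<le> m" by linarith
qed

lemma Re_mono_int:
  fixes b :: "int \<Rightarrow> complex"
  assumes "\<And>j. Re (b j) \<le> Re (b (j + 1))" "i \<le> j" shows "Re (b i) \<le> Re (b j)"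
  using assms(2) by (induction rule: int_ge_induct) (auto intro: order_trans assms(1))

text \<open>Downward induction on \<open>n\<close>. If all later discs contain the indices they should, then the indices of the points in
  disc \<open>n\<close> lie below \<open>q * (n + 1)\<close>. If they were not the last \<open>q\<close> of those, some point with one of these last indices would,
  by monotonicity, come neither before disc \<open>n\<close> nor after disc \<open>n + 1\<close>, and yet lie in no disc.\<close>

lemma listing_right:
  fixes b :: "int \<Rightarrow> complex" and q n0 :: int
  assumes q: "q > 0" and mono: "\<And>j. Re (b j) \<le> Re (b (j + 1))"
    and cnt: "\<And>n. n \<ge> n0 \<Longrightarrow> card {j. b j \<in> npi_disc n} = nat q"
    and out: "\<And>j. Re (b j) \<ge> of_int n0 * pi - 1 \<Longrightarrow> \<exists>k. b j \<in> npi_disc k"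
    and ev: "\<And>n i. n \<ge> n1 \<Longrightarrow> i \<in> {0..<q} \<Longrightarrow> b (q * n + i) \<in> npi_disc n"
    and n: "n \<ge> n0" and i: "i \<in> {0..<q}"
  shows "b (q * n + i) \<in> npi_disc n"
proof -
  define P where "P n \<longleftrightarrow> (\<forall>m\<ge>n. \<forall>i\<in>{0..<q}. b (q * m + i) \<in> npi_disc m)" for n
  define J where "J n = {j. b j \<in> npi_disc n}" for n
  define I where "I n = {q * n..<q * n + q}" for n
  have cardI: "card (I n) = nat q" "finite (I n)" for n by (auto simp: I_def)
  have finJ: "finite (J n)" if "n \<ge> n0" for n using cnt[OF that] q card_ge_0_finite[of "J n"] by (simp add: J_def)
  have full: "J m = I m" if "P k" "k \<le> m" "n0 \<le> m" for k m
  proof (rule sym, rule card_subset_eq)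
    show "I m \<subseteq> J m"
    proof
      fix j assume j: "j \<in> I m"
      hence "b (q * m + (j - q * m)) \<in> npi_disc m" using that(1,2) j unfolding P_def by (metis I_def atLeastLessThan_iff add.commute diff_ge_0_iff_ge less_diff_eq diff_less_eq)
      thus "j \<in> J m" by (simp add: J_def)
    qed
  qed (use finJ[OF that(3)] cnt[OF that(3)] cardI in \<open>auto simp: J_def\<close>)
  have step: "P n" if Pn: "P (n + 1)" and n: "n \<ge> n0" for n
  proof -
    have lt: "j < q * (n + 1)" if j: "j \<in> J n" for j
    proof (rule ccontr)
      assume "\<not> j < q * (n + 1)"
      hence "(q * (n + 1)) div q \<le> j div q" by (intro zdiv_mono1 q) simp
      hence "n + 1 \<le> j div q" using q by simp
      moreover have "j \<in> I (j div q)"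
      proof -
        have "j = q * (j div q) + j mod q" by simp
        hence "q * (j div q) \<le> j" "j < q * (j div q) + q"
          using pos_mod_bound[OF q, of j] pos_mod_sign[OF q, of j] by linarith+
        thus ?thesis by (simp add: I_def)
      qed
      ultimately have jd: "b j \<in> npi_disc (j div q)" using full[OF Pn, of "j div q"] n by (auto simp: J_def)
      have "\<bar>Re (b j) - of_int n * pi\<bar> < 1" using j by (intro npi_disc_Re) (simp add: J_def)
      hence "j div q \<le> n" by (intro npi_disc_between(2)[OF jd, of n n]) auto
      thus False using \<open>n + 1 \<le> j div q\<close> by simp
    qed
    have "J n = I n"
    proof (rule ccontr)
      assume ne: "J n \<noteq> I n"
      have cJ: "card (J n) = card (I n)" using cnt[OF n] cardI by (simp add: J_def)
      have "\<not> I n \<subseteq> J n" using card_subset_eq[OF finJ[OF n], of "I n"] cJ ne by auto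
      then obtain j' where j': "j' \<in> I n" "j' \<notin> J n" by auto
      have "\<not> J n \<subseteq> I n" using card_subset_eq[OF cardI(2), of "J n" n] cJ ne by auto
      then obtain j where j: "j \<in> J n" "j \<notin> I n" by auto
      have jj: "j \<le> j'" using lt[OF j(1)] j(2) j'(1) by (auto simp: I_def algebra_simps)
      have "q * (n + 1) \<in> J (n + 1)" using full[OF Pn, of "n + 1"] n q by (auto simp: I_def)
      hence r1: "Re (b (q * (n + 1))) \<le> of_int (n + 1) * pi + 1"
        using npi_disc_Re[of "b (q * (n + 1))" "n + 1"] by (simp add: J_def)
      have "Re (b j') \<le> Re (b (q * (n + 1)))" by (rule Re_mono_int[where b=b, OF mono]) (use j'(1) in \<open>auto simp: I_def algebra_simps\<close>)
      hence r2: "Re (b j') \<le> of_int (n + 1) * pi + 1" using r1 by simp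
      have r3: "of_int n * pi - 1 \<le> Re (b j')"
        using Re_mono_int[where b=b, OF mono jj] npi_disc_Re[of "b j" n] j(1) by (simp add: J_def)
      have "of_int n0 * pi \<le> of_int n * pi" using n by (intro mult_right_mono) auto
      hence "of_int n0 * pi - 1 \<le> Re (b j')" using r3 by linarith
      from out[OF this] obtain k where k: "b j' \<in> npi_disc k" by blast
      have "n \<le> k" "k \<le> n + 1" using npi_disc_between[OF k r3 r2] by auto
      hence "k = n + 1" using k j'(2) by (cases "k = n") (auto simp: J_def)
      hence "j' \<in> I (n + 1)" using full[OF Pn, of "n + 1"] n k by (auto simp: J_def)
      thus False using j'(1) by (auto simp: I_def algebra_simps)
    qed
    have "b (q * n + i) \<in> npi_disc n" if "i \<in> {0..<q}" for i
    proof -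
      have "q * n + i \<in> I n" using that by (simp add: I_def)
      thus ?thesis using \<open>J n = I n\<close> by (auto simp: J_def)
    qed
    thus ?thesis using Pn unfolding P_def by (metis order_le_less zless_imp_add1_zle)
  qed
  have top: "P (max n0 n1)" using ev by (auto simp: P_def)
  have down: "P m \<longrightarrow> P n0" if "n0 \<le> m" for m
    using that by (induction rule: int_ge_induct) (use step in auto)
  have "P n0" using down[of "max n0 n1"] top by (simp only: max.cobounded1 simp_thms)
  thus ?thesis using n i by (auto simp: P_def)
qed

text \<open>Discs on the left are treated by reflecting the points at 0 and reversing the order of the indices.\<close>

lemma listing_localised:
  fixes b :: "int \<Rightarrow> complex" and q n0 :: int
  assumes q: "q > 0" and mono: "\<And>j. Re (b j) \<le> Re (b (j + 1))"
    and cnt: "\<And>n. \<bar>n\<bar> \<ge> n0 \<Longrightarrow> card {j. b j \<in> npi_disc n} = nat q"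
    and out: "\<And>j. \<bar>Re (b j)\<bar> \<ge> of_int n0 * pi - 1 \<Longrightarrow> \<exists>k. b j \<in> npi_disc k"
    and ev: "\<And>n i. \<bar>n\<bar> \<ge> n1 \<Longrightarrow> i \<in> {0..<q} \<Longrightarrow> b (q * n + i) \<in> npi_disc n"
    and n: "\<bar>n\<bar> \<ge> n0" "n0 > 0" and i: "i \<in> {0..<q}"
  shows "b (q * n + i) \<in> npi_disc n"
proof (cases "n \<ge> n0")
  case True
  show ?thesis
    by (rule listing_right[where ?n1.0="max n1 n0" and ?n0.0=n0 and b=b, OF q mono]) (use cnt out ev n i True in auto)
next
  case False
  hence nn: "- n \<ge> n0" using n by simp
  define b' where "b' j = - b (q - 1 - j)" for j
  have disc: "- z \<in> npi_disc k \<longleftrightarrow> z \<in> npi_disc (- k)" for z k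
  proof -
    have "norm (npi k + z) = norm (- (of_int (- k) * of_real pi - z))" by (simp add: algebra_simps)
    thus ?thesis by (simp add: dist_norm norm_minus_commute add.commute)
  qed
  have "b' (q * (- n) + (q - 1 - i)) \<in> npi_disc (- n)"
  proof (rule listing_right[where ?n1.0="max n1 n0" and ?n0.0=n0 and b=b', OF q])
    show "Re (b' j) \<le> Re (b' (j + 1))" for j
    proof -
      have "q - 1 - (j + 1) + 1 = q - 1 - j" by simp
      thus ?thesis using mono[of "q - 1 - (j + 1)"] unfolding b'_def by (simp only: uminus_complex.simps neg_le_iff_le)
    qed
    show "card {j. b' j \<in> npi_disc m} = nat q" if "m \<ge> n0" for m
    proof -
      have "bij_betw (\<lambda>j. q - 1 - j) {j. b' j \<in> npi_disc m} {j. b j \<in> npi_disc (- m)}"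
        by (rule bij_betwI[where g="\<lambda>j. q - 1 - j"]) (auto simp: b'_def disc simp del: mem_ball)
      thus ?thesis using cnt[of "- m"] that n by (simp add: bij_betw_same_card)
    qed
    show "\<exists>k. b' j \<in> npi_disc k" if "Re (b' j) \<ge> of_int n0 * pi - 1" for j
    proof -
      have "\<bar>Re (b (q - 1 - j))\<bar> \<ge> of_int n0 * pi - 1" using that by (simp add: b'_def)
      then obtain k where "b (q - 1 - j) \<in> npi_disc k" using out by blast
      thus ?thesis unfolding b'_def disc by (metis minus_minus)
    qed
    show "b' (q * m + l) \<in> npi_disc m" if "m \<ge> max n1 n0" "l \<in> {0..<q}" for m l
    proof -
      have "q - 1 - (q * m + l) = q * (- m) + (q - 1 - l)" by simp
      moreover have "b (q * (- m) + (q - 1 - l)) \<in> npi_disc (- m)" by (rule ev) (use that n in auto)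
      ultimately show ?thesis unfolding b'_def disc by (simp only:)
    qed
  qed (use nn i in auto)
  moreover have "q - 1 - (q * (- n) + (q - 1 - i)) = q * n + i" by simp
  ultimately show ?thesis unfolding b'_def disc by (simp only: minus_minus)
qed

lemma card_listing_in:
  assumes l: "ordered_listing m b" and fin: "finite {p\<in>S. m p \<noteq> 0}"
  shows "card {j. b j \<in> S} = (\<Sum>p\<in>{p\<in>S. m p \<noteq> 0}. m p)"
proof -
  have f: "finite {j. b j = z}" "card {j. b j = z} = m z" for z using l by (auto simp: ordered_listing_def)
  have pos: "m (b j) \<noteq> 0" for j
  proof
    assume "m (b j) = 0"
    hence "{i. b i = b j} = {}" using f[of "b j"] by simp
    thus False by blast
  qed
  have "{j. b j \<in> S} = (\<Union>p\<in>{p\<in>S. m p \<noteq> 0}. {j. b j = p})" using pos by auto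
  also have "card ... = (\<Sum>p\<in>{p\<in>S. m p \<noteq> 0}. card {j. b j = p})"
    by (rule card_UN_disjoint[OF fin]) (use f in auto)
  finally show ?thesis using f by simp
qed

lemma listing_mult_pos:
  assumes "ordered_listing m b" shows "m (b j) \<noteq> 0"
proof
  assume "m (b j) = 0"
  hence "{i. b i = b j} = {}" using assms by (metis (no_types) card_0_eq ordered_listing_def)
  thus False by blast
qed

lemma l2_near_npi_eventually:
  assumes "l2_near_npi x" obtains n1 :: int where "\<And>n. \<bar>n\<bar> \<ge> n1 \<Longrightarrow> x n \<in> npi_disc n"
proof -
  have s: "(\<lambda>n. (norm (x n - npi n))\<^sup>2) summable_on UNIV" using assms by (simp add: l2_near_npi_def)
  have fin: "finite {n. 1 \<le> (norm (x n - npi n))\<^sup>2}"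
  proof (rule ccontr)
    assume inf: "\<not> finite {n. 1 \<le> (norm (x n - npi n))\<^sup>2}"
    define S where "S = (\<Sum>\<^sub>\<infinity>n. (norm (x n - npi n))\<^sup>2)"
    obtain F where F: "finite F" "card F = nat \<lceil>S\<rceil> + 1" "F \<subseteq> {n. 1 \<le> (norm (x n - npi n))\<^sup>2}"
      using infinite_arbitrarily_large[OF inf] by blast
    have "real (card F) \<le> (\<Sum>n\<in>F. (norm (x n - npi n))\<^sup>2)"
      using sum_mono[of F "\<lambda>_. 1" "\<lambda>n. (norm (x n - npi n))\<^sup>2"] F(3) by auto
    also have "... \<le> S" unfolding S_def by (rule finite_sum_le_infsum[OF s F(1)]) auto
    finally show False using F(2) by linarith
  qed
  obtain n1 where n1: "\<And>n. n \<in> {n. 1 \<le> (norm (x n - npi n))\<^sup>2} \<Longrightarrow> \<bar>n\<bar> \<le> n1"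
    using Max_ge[OF finite_imageI[OF fin, of abs]] by blast
  show ?thesis
  proof (rule that[of "n1 + 1"])
    fix n :: int assume "\<bar>n\<bar> \<ge> n1 + 1"
    hence "(norm (x n - npi n))\<^sup>2 < 1" using n1[of n] by fastforce
    hence "norm (x n - npi n) < 1" using power_less_imp_less_base[of "norm (x n - npi n)" 2 1] by simp
    thus "x n \<in> npi_disc n" by (simp add: dist_norm norm_minus_commute)
  qed
qed

section \<open>Localisation of the listings and conclusion\<close>

text \<open>The value \<open>-2\<close> is excluded since \<open>cos\<close> has nonnegative real part near \<open>a\<close>.\<close>

lemma (in zero_location) level_sign:
  assumes la: "norm (la - a) \<le> 1" and G4: "(G la)\<^sup>2 = 4"
  shows "G la = 2"
proof -
  have "G la = 2 \<or> G la = - 2"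
    using G4 power2_eq_iff[of "G la" 2] by simp
  moreover have "G la \<noteq> - 2"
  proof
    assume "G la = - 2"
    define x y where "x = Re (Th la)" and "y = Im (Th la)"
    have "norm (Th la) \<le> 1 + 1 / 100" unfolding Th_def
      using norm_triangle_ineq[of "la - a" "K la"] K_small[of la] la by linarith
    hence "\<bar>x / 2\<bar> \<le> 51 / 100" using abs_Re_le_cmod[of "Th la"] by (simp add: x_def)
    hence "(sin (x / 2))\<^sup>2 \<le> (51 / 100)\<^sup>2"
      using abs_sin_x_le_abs_x[of "x / 2"] by (intro abs_le_square_iff[THEN iffD1]) linarith
    hence c: "cos x \<ge> 0.4" using cos_double_sin[of "x / 2"] by (simp add: power2_eq_square)
    have "exp y + exp (- y) \<ge> 2" using cosh_real_ge_1[of y] by (simp add: cosh_def)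
    hence "cos x * ((exp y + exp (- y)) / 2) \<ge> 0" using c by (intro mult_nonneg_nonneg) auto
    hence "Re (cos (Th la)) \<ge> 0" by (simp add: Re_cos x_def y_def)
    hence "2 \<le> Re (2 * cos (Th la) - G la)" using \<open>G la = - 2\<close> by simp
    also have "... \<le> norm (G la - 2 * cos (Th la))" using abs_Re_le_cmod[of "G la - 2 * cos (Th la)"] by simp
    also have "... \<le> 1" using err[of la] la E1 by (simp add: Th_def)
    finally show False by simp
  qed
  ultimately show ?thesis by blast
qed

text \<open>The margin 2 in the bound for \<open>n0\<close> guarantees that a zero \<open>z\<close> with \<open>\<bar>Re z\<bar> \<ge> n0 * \<pi> - 1\<close> lies in a disc to which the
  counting hypothesis applies.\<close>

lemma (in near_cosine) listing_localised:
  fixes q n0 n i :: int and b :: "int \<Rightarrow> complex"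
  assumes q: "q > 0" "q \<le> 2" and l: "ordered_listing m b"
    and f: "f holomorphic_on UNIV"
    and nz: "\<And>la. norm la \<ge> 1000 * Q \<Longrightarrow> (\<And>n::int. norm (la - npi n) \<ge> 1) \<Longrightarrow> f la \<noteq> 0"
    and cnt: "\<And>n. \<bar>real_of_int n\<bar> \<ge> 1000 * Q \<Longrightarrow> (\<Sum>p\<in>{p\<in>npi_disc n. f p = 0}. zero_mult f p) = nat q"
    and m: "\<And>z. zero_mult f z \<le> 2 \<Longrightarrow> m z = zero_mult f z"
    and ev: "\<And>n i. \<bar>n\<bar> \<ge> n1 \<Longrightarrow> i \<in> {0..<q} \<Longrightarrow> b (q * n + i) \<in> npi_disc n"
    and n0: "real_of_int n0 \<ge> 1000 * Q + 2" and n: "\<bar>n\<bar> \<ge> n0" and i: "i \<in> {0..<q}"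
  shows "b (q * n + i) \<in> npi_disc n" "f (b (q * n + i)) = 0"
    "int (card {j. b j = b (q * n + i)}) = zorder f (b (q * n + i))"
proof -
  define z0 where "z0 = \<i> * of_real (1000 * Q)"
  have f0: "f z0 \<noteq> 0"
  proof (rule nz)
    show "norm z0 \<ge> 1000 * Q" using Q1 by (simp add: z0_def norm_mult)
    show "norm (z0 - npi k) \<ge> 1" for k :: int
      using abs_Im_le_cmod[of "z0 - npi k"] Q1 by (simp add: z0_def)
  qed
  have fin: "finite {p\<in>npi_disc k. f p = 0}" for k
    by (rule finite_subset[OF _ finite_zeros_cball[OF f f0, of "npi k" 1]]) auto
  have zpos: "zero_mult f z \<noteq> 0 \<longleftrightarrow> f z = 0" for z
    using zero_mult_eq_zorder(2)[OF f f0, of z] by (auto simp: zero_mult_def)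
  define far where "far z \<longleftrightarrow> \<bar>Re z\<bar> \<ge> of_int n0 * pi - 1" for z :: complex
  have n03: "of_int n0 * pi \<ge> 3 * real_of_int n0" using pi_gt3 n0 Q1 by simp
  have far_norm: "norm z \<ge> 1000 * Q" if "far z" for z
    using that abs_Re_le_cmod[of z] n0 n03 Q1 unfolding far_def by linarith
  have far_zero: "\<exists>k. z \<in> npi_disc k \<and> \<bar>real_of_int k\<bar> \<ge> 1000 * Q" if z: "far z" "f z = 0" for z
  proof -
    obtain k :: int where k: "norm (z - npi k) < 1"
      using nz[OF far_norm[OF z(1)]] z(2) by (meson not_le)
    hence zk: "z \<in> npi_disc k" by (simp add: dist_norm norm_minus_commute)
    have "of_int n0 * pi - 2 \<le> \<bar>of_int k * pi\<bar>" using npi_disc_Re[OF zk] z(1) unfolding far_def by linarith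
    hence "(of_int n0 - 1) * pi \<le> \<bar>of_int k\<bar> * pi" using pi_gt3 by (simp add: abs_mult algebra_simps)
    hence "of_int n0 - 1 \<le> \<bar>real_of_int k\<bar>" by (simp add: mult_le_cancel_right)
    hence "\<bar>real_of_int k\<bar> \<ge> 1000 * Q" using n0 by linarith
    thus ?thesis using zk by blast
  qed
  have far_m: "m z = zero_mult f z" if z: "far z" for z
  proof (rule m, cases "f z = 0")
    case True
    then obtain k where k: "z \<in> npi_disc k" "\<bar>real_of_int k\<bar> \<ge> 1000 * Q" using far_zero z by blast
    have "zero_mult f z \<le> (\<Sum>p\<in>{p\<in>npi_disc k. f p = 0}. zero_mult f p)"
      by (rule member_le_sum) (use fin k True in auto)
    also have "... = nat q" by (rule cnt[OF k(2)])
    finally show "zero_mult f z \<le> 2" using q by linarith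
  qed (simp add: zero_mult_def)
  have far_disc: "far z" if "z \<in> npi_disc k" "\<bar>k\<bar> \<ge> n0" for z k
  proof -
    have "of_int n0 * pi \<le> \<bar>of_int k * pi\<bar>" using that(2) by (simp add: abs_mult)
    thus ?thesis using npi_disc_Re[OF that(1)] unfolding far_def by linarith
  qed
  have sets: "{p\<in>npi_disc k. m p \<noteq> 0} = {p\<in>npi_disc k. f p = 0}" if "\<bar>k\<bar> \<ge> n0" for k
    using far_disc[OF _ that] far_m zpos by (metis (no_types, lifting))
  show disc: "b (q * n + i) \<in> npi_disc n"
  proof (rule listing_localised[where ?n1.0=n1 and ?n0.0=n0 and b=b, OF q(1)])
    show "Re (b j) \<le> Re (b (j + 1))" for j
      using l unfolding ordered_listing_def lex_le_def by (metis less_imp_le order_refl)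
    show "card {j. b j \<in> npi_disc k} = nat q" if k: "\<bar>k\<bar> \<ge> n0" for k
    proof -
      have "card {j. b j \<in> npi_disc k} = (\<Sum>p\<in>{p\<in>npi_disc k. m p \<noteq> 0}. m p)"
        by (rule card_listing_in[OF l]) (use fin sets[OF k] in simp)
      also have "... = (\<Sum>p\<in>{p\<in>npi_disc k. f p = 0}. zero_mult f p)"
        unfolding sets[OF k] by (rule sum.cong) (use far_disc[OF _ k] far_m in auto)
      also have "... = nat q" by (rule cnt) (use k n0 in linarith)
      finally show ?thesis .
    qed
    show "\<exists>k. b j \<in> npi_disc k" if "\<bar>Re (b j)\<bar> \<ge> of_int n0 * pi - 1" for j
    proof -
      have fj: "far (b j)" using that by (simp add: far_def)
      hence "f (b j) = 0" using listing_mult_pos[OF l, of j] far_m zpos by metis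
      thus ?thesis using far_zero[OF fj] by blast
    qed
  qed (use ev n n0 Q1 i in auto)
  have farb: "far (b (q * n + i))" by (rule far_disc[OF disc n])
  show "f (b (q * n + i)) = 0" using listing_mult_pos[OF l, of "q * n + i"] far_m[OF farb] zpos by metis
  show "int (card {j. b j = b (q * n + i)}) = zorder f (b (q * n + i))"
    using l far_m[OF farb] zero_mult_eq_zorder(1)[OF f f0, of "b (q * n + i)"] by (metis (no_types) ordered_listing_def)
qed

context wkb begin

text \<open>\<open>QQ\<close> and \<open>nn0\<close> say from where on the estimates apply, \<open>EE n\<close> is the error in the \<open>n\<close>-th disc, and \<open>MM\<close> is the final
  constant. Except for \<open>EE\<close>, they depend on \<open>N\<close> and \<open>C\<close> only.\<close>

definition "QQ = 1 + wkb_W N C * exp (wkb_W N C)"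

sublocale near_cosine "\<Delta>" QQ
proof
  show "\<Delta> holomorphic_on UNIV" by (rule discr_holomorphic)
  show "1 \<le> QQ" using W_bounds(8) by (simp add: QQ_def)
  fix la :: complex assume la: "1 \<le> norm la"
  have "wkb_W N C * exp (wkb_W N C) / norm la * exp \<bar>Im la\<bar> \<le> QQ / norm la * exp \<bar>Im la\<bar>"
    by (intro mult_right_mono divide_right_mono) (auto simp: QQ_def)
  thus "norm (\<Delta> la - 2 * cos la) \<le> QQ / norm la * exp \<bar>Im la\<bar>"
    using discr_crude[OF la] by linarith
qed

lemma critical_points_localised:
  assumes "critical_points \<phi>1 \<phi>2 ld" and n: "\<bar>real_of_int n\<bar> \<ge> 1000 * QQ + 3"
  shows "ld n \<in> npi_disc n" "deriv (\<Delta>) (ld n) = 0"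
proof -
  have l: "ordered_listing (zero_mult (deriv (\<Delta>))) ld" "l2_near_npi ld"
    using assms(1) by (auto simp: critical_points_def)
  obtain n1 :: int where n1: "\<And>n. \<bar>n\<bar> \<ge> n1 \<Longrightarrow> ld n \<in> npi_disc n" using l2_near_npi_eventually[OF l(2)] by blast
  define n0 where "n0 = \<lceil>1000 * QQ + 2\<rceil>"
  have n0: "real_of_int n0 \<ge> 1000 * QQ + 2" "\<bar>n\<bar> \<ge> n0" using n unfolding n0_def by linarith+
  have ev: "ld (1 * k + i) \<in> npi_disc k" if "\<bar>k\<bar> \<ge> n1" "i \<in> {0..<1}" for k i
  proof -
    have "i = 0" using that(2) by auto
    thus ?thesis using n1[OF that(1)] by simp
  qed
  note L = listing_localised[where q=1 and f="deriv (\<Delta>)" and ?n0.0=n0 and ?n1.0=n1 and n=n and i=0, OF _ _ l(1) deriv_hol nonzero_outside(1) _ _ ev n0]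
  have "ld (1 * n + 0) \<in> npi_disc n \<and> deriv (\<Delta>) (ld (1 * n + 0)) = 0"
    by (intro conjI; rule L) (use count_deriv in auto)
  thus "ld n \<in> npi_disc n" "deriv (\<Delta>) (ld n) = 0" by simp_all
qed

lemma periodic_eigenvalues_localised:
  assumes "periodic_eigenvalues \<phi>1 \<phi>2 lm lp" and n: "\<bar>real_of_int n\<bar> \<ge> 1000 * QQ + 3"
  shows "lm n \<in> npi_disc n" "lp n \<in> npi_disc n" "(\<Delta> (lm n))\<^sup>2 = 4" "(\<Delta> (lp n))\<^sup>2 = 4"
    "lm n = lp n \<Longrightarrow> deriv (\<Delta>) (lm n) = 0"
proof -
  define b where "b = (\<lambda>j. if even j then lm (j div 2) else lp (j div 2))"
  have l: "ordered_listing (alg_mult \<phi>1 \<phi>2) b" "l2_near_npi lm" "l2_near_npi lp"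
    using assms(1) by (auto simp: periodic_eigenvalues_def b_def)
  have b01: "b (2 * k + 0) = lm k" "b (2 * k + 1) = lp k" for k by (simp_all add: b_def)
  obtain k1 :: int where k1: "\<And>n. \<bar>n\<bar> \<ge> k1 \<Longrightarrow> lm n \<in> npi_disc n" using l2_near_npi_eventually[OF l(2)] by blast
  obtain k2 :: int where k2: "\<And>n. \<bar>n\<bar> \<ge> k2 \<Longrightarrow> lp n \<in> npi_disc n" using l2_near_npi_eventually[OF l(3)] by blast
  have ev: "b (2 * k + i) \<in> npi_disc k" if "\<bar>k\<bar> \<ge> max k1 k2" "i \<in> {0..<2}" for k i
  proof -
    have "i = 0 \<or> i = 1" using that(2) by auto
    thus ?thesis using k1[of k] k2[of k] that(1) by (auto simp del: mem_ball simp: b01[simplified])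
  qed
  define n0 where "n0 = \<lceil>1000 * QQ + 2\<rceil>"
  have n0: "real_of_int n0 \<ge> 1000 * QQ + 2" "\<bar>n\<bar> \<ge> n0" using n unfolding n0_def by linarith+
  define z0 where "z0 = \<i> * of_real (1000 * QQ)"
  have z0: "char_fun z0 \<noteq> 0"
  proof (rule nonzero_outside(2))
    show "norm z0 \<ge> 1000 * QQ" using Q1 by (simp add: z0_def norm_mult)
    show "norm (z0 - npi k) \<ge> 1" for k :: int
      using abs_Im_le_cmod[of "z0 - npi k"] Q1 by (simp add: z0_def)
  qed
  note L = listing_localised[where q=2 and f=char_fun and ?n0.0=n0 and ?n1.0="max k1 k2" and n=n, OF _ _ l(1) char_fun_holomorphic nonzero_outside(2) _ _ ev n0]
  have cnt: "(\<Sum>p\<in>{p\<in>npi_disc k. char_fun p = 0}. zero_mult char_fun p) = nat 2" if "\<bar>real_of_int k\<bar> \<ge> 1000 * QQ" for k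
    using count_char[OF that] by simp
  have P: "b (2 * n + i) \<in> npi_disc n \<and> char_fun (b (2 * n + i)) = 0 \<and> int (card {j. b j = b (2 * n + i)}) = zorder char_fun (b (2 * n + i))"
    if "i \<in> {0..<2}" for i
    by (intro conjI; rule L) (use that cnt alg_mult_eq_zero_mult[OF z0] in auto)
  show "lm n \<in> npi_disc n" "lp n \<in> npi_disc n" using P[of 0] P[of 1] unfolding b01 by auto
  show "(\<Delta> (lm n))\<^sup>2 = 4" "(\<Delta> (lp n))\<^sup>2 = 4" using P[of 0] P[of 1] unfolding b01 by auto
  assume eq: "lm n = lp n"
  have "{2 * n + 0, 2 * n + 1} \<subseteq> {j. b j = b (2 * n + 0)}" using eq b01 by auto
  moreover have "finite {j. b j = b (2 * n + 0)}" using l(1) by (auto simp: ordered_listing_def)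
  ultimately have "card {2 * n + 0, 2 * n + 1} \<le> card {j. b j = b (2 * n + 0)}" by (rule card_mono[rotated])
  hence two: "zorder char_fun (lm n) \<ge> 2" using P[of 0] unfolding b01 by simp
  show "deriv (\<Delta>) (lm n) = 0"
  proof (rule ccontr)
    assume ne: "deriv (\<Delta>) (lm n) \<noteq> 0"
    have "deriv char_fun (lm n) = - 2 * \<Delta> (lm n) * deriv (\<Delta>) (lm n)"
      by (rule DERIV_imp_deriv) (auto intro!: derivative_eq_intros D_deriv)
    moreover have "\<Delta> (lm n) \<noteq> 0" using P[of 0] unfolding b01 by auto
    ultimately have d: "deriv char_fun (lm n) \<noteq> 0" using ne by simp
    have "zorder char_fun (lm n) = 1"
      by (rule zorder_zero_eqI[where S=UNIV, OF char_fun_holomorphic]) (use d P[of 0] in \<open>auto simp: b01[simplified]\<close>)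
    thus False using two by simp
  qed
qed

definition "EE n = sharp_2 (wkb_W N C) C / \<bar>real_of_int n\<bar> ^ (N + 1) * oscs n"

definition "nn0 = 1000 * QQ + 3 + 100 * wkb_A N C + sharp_2 (wkb_W N C) C * (2 * C + 1)"

lemma sharp_2_nonneg: "sharp_2 (wkb_W N C) C \<ge> 0"
  using W_bounds(8) data(2) by (simp add: sharp_2_def sharp_1_def sharp_M_def)

lemma osc_le: "L2b f C \<Longrightarrow> osc_norm f n \<le> C"
  using osc_norm_sum[of f C "{n}"] data(2) by (auto intro: power2_le_imp_le)

lemma zero_location:
  assumes n: "\<bar>real_of_int n\<bar> \<ge> nn0"
  obtains s ls where "s = 1 \<or> s = -1"
    "zero_location (\<lambda>la. s * \<Delta> la) (\<lambda>la. FN (1 / la)) (npi n) ls (EE n)"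
    "norm (zs_expansion N \<phi>1 \<phi>2 n - ls) \<le> 3 * (128 * wkb_A N C / 3) ^ (N + 2) / \<bar>real_of_int n\<bar> ^ (N + 2)"
proof -
  let ?a = "npi n"
  interpret Z: zeta_eq "FN" "wkb_A N C" unfolding wkb_A_def by (rule zs_F_zeta_eq)
  have A1: "wkb_A N C \<ge> 1" by (rule Z.A1)
  have pos: "0 \<le> sharp_2 (wkb_W N C) C * (2 * C + 1)" using sharp_2_nonneg data(2) by simp
  have n': "\<bar>real_of_int n\<bar> \<ge> 100 * wkb_A N C" "\<bar>real_of_int n\<bar> \<ge> 1000" "\<bar>real_of_int n\<bar> \<ge> 64 * wkb_A N C"
    "\<bar>real_of_int n\<bar> \<ge> sharp_2 (wkb_W N C) C * (2 * C + 1)"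
    using n A1 Q1 pos unfolding nn0_def by linarith+
  have nz: "n \<noteq> 0" using n'(2) by auto
  obtain ls where ls: "norm (ls - ?a) \<le> 1" "ls + FN (1 / ls) = ?a"
    "norm (zs_expansion N \<phi>1 \<phi>2 n - ls) \<le> 3 * (128 * wkb_A N C / 3) ^ (N + 2) / \<bar>real_of_int n\<bar> ^ (N + 2)"
    using expansion_root[OF n'(3)] by blast
  obtain s :: complex where s: "s = 1 \<or> s = -1" "\<And>z. cos (z - ?a) = s * cos z" using npi_facts by metis
  have na: "norm ?a \<ge> 3 * \<bar>real_of_int n\<bar>"
  proof -
    have "\<bar>real_of_int n\<bar> * 3 \<le> \<bar>real_of_int n\<bar> * pi" by (intro mult_left_mono) (use pi_gt3 in auto)
    thus ?thesis by (simp add: norm_mult)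
  qed
  have far: "norm la \<ge> \<bar>real_of_int n\<bar>" if "norm (la - ?a) \<le> 3" for la
    using norm_triangle_ineq2[of ?a la] that na n'(2) by (simp add: norm_minus_commute)
  have "zero_location (\<lambda>la. s * \<Delta> la) (\<lambda>la. FN (1 / la)) ?a ls (EE n)"
  proof
    show "(\<lambda>la. s * \<Delta> la) holomorphic_on UNIV" by (intro holomorphic_intros discr_holomorphic)
    show "(\<lambda>la. FN (1 / la)) holomorphic_on ball ?a 3"
    proof -
      have "la \<noteq> 0" if "la \<in> ball ?a 3" for la
        using far[of la] that n'(2) by (auto simp: dist_norm norm_minus_commute)
      hence "(\<lambda>la. 1 / la) holomorphic_on ball ?a 3" by (intro holomorphic_intros) auto
      from holomorphic_on_compose_gen[OF this Z.F_hol] show ?thesis by (simp add: o_def)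
    qed
    fix la assume la: "norm (la - ?a) \<le> 2"
    have f: "norm la \<ge> 100 * wkb_A N C" using far[of la] la n'(1) by simp
    have f0: "norm la > 0" using f A1 by linarith
    have "norm (1 / la) \<le> 1" using f f0 A1 by (simp add: norm_divide field_simps)
    from Z.F_bd[OF this] have "norm (FN (1 / la)) \<le> wkb_A N C * norm (1 / la)" .
    also have "... \<le> 1 / 100" using f f0 by (simp add: norm_divide field_simps)
    finally show "norm (FN (1 / la)) \<le> 1 / 100" .
    have "cos (la - ?a + FN (1 / la)) = s * cos (la + FN (1 / la))"
      using s(2)[of "la + FN (1 / la)"] by (simp add: algebra_simps)
    hence "norm (s * \<Delta> la - 2 * cos (la - ?a + FN (1 / la))) =
        norm (s * (\<Delta> la - 2 * cos (la + FN (1 / la))))" by (simp add: algebra_simps)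
    also have "... = norm (\<Delta> la - 2 * cos (la + FN (1 / la)))" using s(1) by (auto simp: norm_mult)
    finally show "norm (s * \<Delta> la - 2 * cos (la - ?a + FN (1 / la))) \<le> EE n"
      using discr_sharp[OF nz la] by (simp add: EE_def)
  next
    have "osc_norm (r (Suc N)) (- n) + osc_norm dp n + 1 / \<bar>real_of_int n\<bar> \<le> C + C + 1"
      by (intro add_mono osc_le data) (use n'(2) in auto)
    moreover have "\<bar>real_of_int n\<bar> ^ 1 \<le> \<bar>real_of_int n\<bar> ^ (N + 1)" by (rule power_increasing) (use n'(2) in auto)
    ultimately have "EE n \<le> sharp_2 (wkb_W N C) C / \<bar>real_of_int n\<bar> * (C + C + 1)"
      unfolding EE_def
      by (intro mult_mono divide_left_mono) (use sharp_2_nonneg n'(2) data(2) osc_norm_nonneg[OF data(7)] osc_norm_nonneg[OF data(12)] in \<open>auto intro!: add_nonneg_nonneg mult_pos_pos\<close>)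
    also have "... \<le> 1" using n'(2,4) by (simp add: field_simps)
    finally show "EE n \<le> 1" .
  qed (use ls in \<open>auto simp: algebra_simps\<close>)
  thus ?thesis by (rule that[OF s(1) _ ls(3)])
qed

definition "MM = 8000 * sharp_2 (wkb_W N C) C + 3 * (128 * wkb_A N C / 3) ^ (N + 2)"

lemma combine:
  assumes n: "\<bar>real_of_int n\<bar> \<ge> nn0" and x: "norm (x - ls) \<le> 8000 * EE n"
    and ls: "norm (zs_expansion N \<phi>1 \<phi>2 n - ls) \<le> 3 * (128 * wkb_A N C / 3) ^ (N + 2) / \<bar>real_of_int n\<bar> ^ (N + 2)"
  shows "norm (x - zs_expansion N \<phi>1 \<phi>2 n) \<le> MM / \<bar>real_of_int n\<bar> ^ (N + 1) *
    oscs n"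
proof -
  define t O1 k where "t = \<bar>real_of_int n\<bar>" and "O1 = osc_norm (r (Suc N)) (- n) + osc_norm dp n" and "k = 3 * (128 * wkb_A N C / 3) ^ (N + 2)"
  have O1: "O1 \<ge> 0" using osc_norm_nonneg[OF data(7)] osc_norm_nonneg[OF data(12)] by (simp add: O1_def)
  have k: "k \<ge> 0" by (simp add: k_def wkb_A_def)
  have "norm (x - zs_expansion N \<phi>1 \<phi>2 n) \<le> norm (x - ls) + norm (zs_expansion N \<phi>1 \<phi>2 n - ls)"
    using norm_triangle_ineq4[of "x - ls" "zs_expansion N \<phi>1 \<phi>2 n - ls"] by simp
  also have "... \<le> 8000 * EE n + k / t ^ (N + 2)" using x ls by (simp add: t_def k_def)
  also have "k / t ^ (N + 2) = k / t ^ (N + 1) * (1 / t)" by simp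
  also have "... \<le> k / t ^ (N + 1) * (O1 + 1 / t)" by (rule mult_left_mono) (use O1 k in \<open>auto simp: t_def\<close>)
  finally have "norm (x - zs_expansion N \<phi>1 \<phi>2 n) \<le> 8000 * EE n + k / t ^ (N + 1) * (O1 + 1 / t)" by simp
  also have "... = MM / t ^ (N + 1) * (O1 + 1 / t)"
    unfolding EE_def MM_def t_def[symmetric] O1_def[symmetric] k_def[symmetric]
    by (simp only: add_divide_distrib distrib_right times_divide_eq_right[symmetric] mult.assoc)
  finally show ?thesis by (simp only: t_def O1_def)
qed

text \<open>Covers the critical points as well as the midpoints of pairs of periodic eigenvalues.\<close>

lemma near_expansion:
  assumes n: "\<bar>real_of_int n\<bar> \<ge> nn0"
    and x: "x \<in> npi_disc n \<and> deriv (\<Delta>) x = 0 \<or>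
      (\<exists>u v. x = (u + v) / 2 \<and> u \<in> npi_disc n \<and> v \<in> npi_disc n \<and> (\<Delta> u)\<^sup>2 = 4 \<and> (\<Delta> v)\<^sup>2 = 4 \<and>
        (u = v \<longrightarrow> deriv (\<Delta>) u = 0))"
  shows "norm (x - zs_expansion N \<phi>1 \<phi>2 n) \<le> MM / \<bar>real_of_int n\<bar> ^ (N + 1) *
    oscs n"
proof -
  obtain s ls where s: "s = 1 \<or> s = -1" and Z: "zero_location (\<lambda>la. s * \<Delta> la) (\<lambda>la. FN (1 / la)) (npi n) ls (EE n)"
    and ls: "norm (zs_expansion N \<phi>1 \<phi>2 n - ls) \<le> 3 * (128 * wkb_A N C / 3) ^ (N + 2) / \<bar>real_of_int n\<bar> ^ (N + 2)"
    using zero_location[OF n] by blast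
  interpret Z: zero_location "\<lambda>la. s * \<Delta> la" "\<lambda>la. FN (1 / la)" "npi n" ls "EE n" by (rule Z)
  have d: "deriv (\<lambda>la. s * \<Delta> la) z = s * deriv (\<Delta>) z" for z
    by (rule DERIV_imp_deriv) (auto intro!: derivative_eq_intros D_deriv)
  have disc: "norm (z - npi n) \<le> 1" if "z \<in> npi_disc n" for z
    using that by (simp add: dist_norm norm_minus_commute)
  have s2: "(s * z)\<^sup>2 = z\<^sup>2" for z using s by (auto simp: power_mult_distrib)
  from x have "norm (x - ls) \<le> 8000 * EE n"
  proof (elim disjE exE conjE)
    assume x: "x \<in> npi_disc n" "deriv (\<Delta>) x = 0"
    have "norm (x - ls) \<le> 3 * (0 + EE n)" by (rule Z.near_critical[OF disc[OF x(1)]]) (simp add: d x(2))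
    moreover have "3 * (0 + EE n) \<le> 8000 * EE n" using Z.E0 by simp
    ultimately show ?thesis by (rule order_trans)
  next
    fix u v assume uv: "x = (u + v) / 2" "u \<in> npi_disc n" "v \<in> npi_disc n" "(\<Delta> u)\<^sup>2 = 4" "(\<Delta> v)\<^sup>2 = 4"
      "u = v \<longrightarrow> deriv (\<Delta>) u = 0"
    have 2: "s * \<Delta> u = 2" "s * \<Delta> v = 2"
      by (rule Z.level_sign[OF disc]; simp only: s2 uv)+
    show ?thesis unfolding uv(1) by (rule Z.near_midpoint[OF disc[OF uv(2)] 2(1) disc[OF uv(3)] 2(2)]) (use uv(6) d in auto)
  qed
  thus ?thesis by (rule combine[OF n _ ls])
qed

lemma nn0_ge: "nn0 \<ge> 1000 * QQ + 3"
  using sharp_2_nonneg data(2) mult_nonneg_nonneg[of "sharp_2 (wkb_W N C) C" "2 * C + 1"] zeta_eq.A1[OF zs_F_zeta_eq]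
  unfolding nn0_def wkb_A_def by linarith

end

lemma sum_inverse_squares_le: "(\<Sum>k=1..m. 1 / (real k)\<^sup>2) \<le> 2"
proof -
  have "(\<Sum>k=1..Suc m. 1 / (real k)\<^sup>2) \<le> 2 - 1 / real (Suc m)" for m
  proof (induction m)
    case (Suc m)
    have "1 / (real (Suc (Suc m)))\<^sup>2 \<le> 1 / real (Suc m) - 1 / real (Suc (Suc m))"
    proof -
      have "1 / (real (Suc (Suc m)))\<^sup>2 \<le> 1 / (real (Suc m) * real (Suc (Suc m)))"
        unfolding power2_eq_square by (intro divide_left_mono mult_right_mono) auto
      also have "... = 1 / real (Suc m) - 1 / real (Suc (Suc m))" by (simp add: field_simps)
      finally show ?thesis .
    qed
    with Suc show ?case by simp
  qed simp
  hence "(\<Sum>k=1..Suc m. 1 / (real k)\<^sup>2) \<le> 2" by (meson diff_le_eq le_add_same_cancel1 of_nat_0_le_iff order_trans zero_le_divide_1_iff)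
  moreover have "(\<Sum>k=1..m. 1 / (real k)\<^sup>2) \<le> (\<Sum>k=1..Suc m. 1 / (real k)\<^sup>2)" by simp
  ultimately show ?thesis by linarith
qed

lemma sum_inverse_squares_int_le:
  assumes F: "finite F" "0 \<notin> F" shows "(\<Sum>n\<in>F. 1 / (real_of_int n)\<^sup>2) \<le> 4"
proof -
  have half: "(\<Sum>n\<in>G. 1 / (real_of_int n)\<^sup>2) \<le> 2" if G: "finite G" "inj_on (\<lambda>n. nat \<bar>n\<bar>) G" "0 \<notin> G" for G
  proof -
    define m where "m = Max (insert 0 ((\<lambda>n. nat \<bar>n\<bar>) ` G))"
    have "(\<Sum>n\<in>G. 1 / (real_of_int n)\<^sup>2) = (\<Sum>n\<in>G. 1 / (real (nat \<bar>n\<bar>))\<^sup>2)" by (rule sum.cong) auto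
    also have "... = (\<Sum>k\<in>(\<lambda>n. nat \<bar>n\<bar>) ` G. 1 / (real k)\<^sup>2)" by (simp add: sum.reindex[OF G(2)])
    also have "... \<le> (\<Sum>k=1..m. 1 / (real k)\<^sup>2)"
    proof (rule sum_mono2)
      show "(\<lambda>n. nat \<bar>n\<bar>) ` G \<subseteq> {1..m}"
      proof
        fix k assume k: "k \<in> (\<lambda>n. nat \<bar>n\<bar>) ` G"
        hence "k \<le> m" unfolding m_def by (intro Max_ge) (use G in auto)
        moreover have "k \<ge> 1"
        proof -
          obtain n where "n \<in> G" "k = nat \<bar>n\<bar>" using k by blast
          moreover from this have "n \<noteq> 0" using G(3) by metis
          ultimately show ?thesis by linarith
        qed
        ultimately show "k \<in> {1..m}" by simp
      qed
    qed auto
    finally show ?thesis using sum_inverse_squares_le[of m] by linarith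
  qed
  have "(\<Sum>n\<in>F. 1 / (real_of_int n)\<^sup>2) = (\<Sum>n\<in>{n\<in>F. n > 0}. 1 / (real_of_int n)\<^sup>2) + (\<Sum>n\<in>{n\<in>F. n \<le> 0}. 1 / (real_of_int n)\<^sup>2)"
    by (subst sum.union_disjoint[symmetric]) (use F in \<open>auto intro!: sum.cong\<close>)
  also have "... \<le> 2 + 2" by (intro add_mono half) (use F in \<open>auto simp: inj_on_def\<close>)
  finally show ?thesis by simp
qed

lemma l2_remainderI:
  assumes f: "L2b f C" and g: "L2b g C" and M: "M \<ge> 0" and n0: "n0 \<ge> 1"
    and close: "\<And>n. \<bar>n\<bar> \<ge> int n0 \<Longrightarrow> norm (x n - y n) \<le> M / \<bar>real_of_int n\<bar> ^ s * (osc_norm f (- n) + osc_norm g n + 1 / \<bar>real_of_int n\<bar>)"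
  shows "l2_remainder n0 (3 * M\<^sup>2 * (2 * C\<^sup>2 + 4)) s x y"
proof -
  define e where "e n = (x n - y n) * of_int \<bar>n\<bar> ^ s" for n
  define A where "A = {n. \<bar>n\<bar> \<ge> int n0}"
  have nz: "n \<noteq> 0" if "n \<in> A" for n using that n0 by (auto simp: A_def)
  have e1: "(norm (e n))\<^sup>2 \<le> 3 * M\<^sup>2 * ((osc_norm f (- n))\<^sup>2 + (osc_norm g n)\<^sup>2 + 1 / (real_of_int n)\<^sup>2)" if n: "n \<in> A" for n
  proof -
    define a b c where "a = osc_norm f (- n)" and "b = osc_norm g n" and "c = 1 / \<bar>real_of_int n\<bar>"
    have "norm (e n) = norm (x n - y n) * \<bar>real_of_int n\<bar> ^ s" by (simp add: e_def norm_mult norm_power)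
    also have "... \<le> M / \<bar>real_of_int n\<bar> ^ s * (a + b + c) * \<bar>real_of_int n\<bar> ^ s"
      by (rule mult_right_mono) (use close[of n] n in \<open>auto simp: A_def a_def b_def c_def\<close>)
    also have "... = M * (a + b + c)" using nz[OF n] by simp
    finally have "(norm (e n))\<^sup>2 \<le> (M * (a + b + c))\<^sup>2" by (rule power_mono) simp
    also have "... = M\<^sup>2 * (a + b + c)\<^sup>2" by (simp add: power_mult_distrib)
    also have "... \<le> M\<^sup>2 * (3 * (a\<^sup>2 + b\<^sup>2 + c\<^sup>2))"
    proof (rule mult_left_mono)
      show "(a + b + c)\<^sup>2 \<le> 3 * (a\<^sup>2 + b\<^sup>2 + c\<^sup>2)"
        using sum_squares_bound[of a b] sum_squares_bound[of a c] sum_squares_bound[of b c]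
        by (simp add: power2_eq_square algebra_simps)
    qed simp
    finally show ?thesis by (simp add: a_def b_def c_def power_divide algebra_simps)
  qed
  have bd: "(\<Sum>n\<in>F. (norm (e n))\<^sup>2) \<le> 3 * M\<^sup>2 * (2 * C\<^sup>2 + 4)" if F: "finite F" "F \<subseteq> A" for F
  proof -
    have "(\<Sum>n\<in>F. (norm (e n))\<^sup>2) \<le> (\<Sum>n\<in>F. 3 * M\<^sup>2 * ((osc_norm f (- n))\<^sup>2 + (osc_norm g n)\<^sup>2 + 1 / (real_of_int n)\<^sup>2))"
      by (rule sum_mono) (use e1 F in auto)
    also have "... = 3 * M\<^sup>2 * ((\<Sum>n\<in>F. (osc_norm f (- n))\<^sup>2) + (\<Sum>n\<in>F. (osc_norm g n)\<^sup>2) + (\<Sum>n\<in>F. 1 / (real_of_int n)\<^sup>2))"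
      by (simp only: sum_distrib_left[symmetric] sum.distrib)
    also have "(\<Sum>n\<in>F. (osc_norm f (- n))\<^sup>2) = (\<Sum>n\<in>uminus ` F. (osc_norm f n)\<^sup>2)"
      by (subst sum.reindex) (auto simp: inj_on_def)
    also have "3 * M\<^sup>2 * ((\<Sum>n\<in>uminus ` F. (osc_norm f n)\<^sup>2) + (\<Sum>n\<in>F. (osc_norm g n)\<^sup>2) + (\<Sum>n\<in>F. 1 / (real_of_int n)\<^sup>2))
        \<le> 3 * M\<^sup>2 * (C\<^sup>2 + C\<^sup>2 + 4)"
      by (intro mult_left_mono add_mono osc_norm_sum[OF f] osc_norm_sum[OF g] sum_inverse_squares_int_le)
        (use F nz in auto)
    finally show ?thesis by simp
  qed
  have sm: "(\<lambda>n. (norm (e n))\<^sup>2) summable_on A"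
    by (rule nonneg_bdd_above_summable_on) (use bd in \<open>auto simp: bdd_above_def\<close>)
  have "(\<Sum>\<^sub>\<infinity>n\<in>A. (norm (e n))\<^sup>2) \<le> 3 * M\<^sup>2 * (2 * C\<^sup>2 + 4)" by (rule infsum_le_finite_sums[OF sm bd])
  moreover have "x n = y n + e n / of_int \<bar>n\<bar> ^ s" if "\<bar>n\<bar> \<ge> int n0" for n
    using nz[of n] that by (simp add: A_def e_def)
  ultimately show ?thesis unfolding l2_remainder_def using sm by (auto simp: A_def)
qed

lemma (in wkb) remainder:
  assumes "\<And>n. \<bar>real_of_int n\<bar> \<ge> nn0 \<Longrightarrow> x n \<in> npi_disc n \<and> deriv (\<Delta>) (x n) = 0 \<or>
      (\<exists>u v. x n = (u + v) / 2 \<and> u \<in> npi_disc n \<and> v \<in> npi_disc n \<and> (\<Delta> u)\<^sup>2 = 4 \<and> (\<Delta> v)\<^sup>2 = 4 \<and>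
        (u = v \<longrightarrow> deriv (\<Delta>) u = 0))"
  shows "l2_remainder (nat \<lceil>nn0\<rceil> + 1) (3 * MM\<^sup>2 * (2 * C\<^sup>2 + 4) + 1) (N + 1) x (zs_expansion N \<phi>1 \<phi>2)"
proof -
  have "l2_remainder (nat \<lceil>nn0\<rceil> + 1) (3 * MM\<^sup>2 * (2 * C\<^sup>2 + 4)) (N + 1) x (zs_expansion N \<phi>1 \<phi>2)"
  proof (rule l2_remainderI[OF data(12) data(7)])
    show "MM \<ge> 0" using sharp_2_nonneg by (simp add: MM_def wkb_A_def)
    fix n :: int assume "\<bar>n\<bar> \<ge> int (nat \<lceil>nn0\<rceil> + 1)"
    hence "\<bar>real_of_int n\<bar> \<ge> nn0" by linarith
    thus "norm (x n - zs_expansion N \<phi>1 \<phi>2 n) \<le> MM / \<bar>real_of_int n\<bar> ^ (N + 1) *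
        oscs n"
      using assms by (intro near_expansion)
  qed simp
  thus ?thesis unfolding l2_remainder_def by fastforce
qed

theorem theorem1p3:
  fixes N :: nat
    and B :: "((real \<Rightarrow> complex) \<times> (real \<Rightarrow> complex)) set"
  assumes "N \<ge> 1"
    and "bounded_in_Hc N B"
  shows "(\<exists>n0\<ge>1. \<exists>C>0. \<forall>(\<phi>1, \<phi>2)\<in>B. \<forall>ld. critical_points \<phi>1 \<phi>2 ld \<longrightarrow>
            l2_remainder n0 C (N + 1) ld (zs_expansion N \<phi>1 \<phi>2)) \<and>
         (\<exists>n0\<ge>1. \<exists>C>0. \<forall>(\<phi>1, \<phi>2)\<in>B. \<forall>lm lp. periodic_eigenvalues \<phi>1 \<phi>2 lm lp \<longrightarrow>
            l2_remainder n0 C (N + 1) (\<lambda>n. (lp n + lm n) / 2) (zs_expansion N \<phi>1 \<phi>2))"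
proof -
  obtain C where C: "\<And>\<phi>1 \<phi>2. (\<phi>1, \<phi>2) \<in> B \<Longrightarrow> \<exists>p dp r dr. wkb_data N C \<phi>1 \<phi>2 p dp r dr"
    using bounded_wkb_data[OF assms] by blast
  define nn where "nn = nat \<lceil>wkb.nn0 N C\<rceil> + 1"
  define K where "K = 3 * (wkb.MM N C)\<^sup>2 * (2 * C\<^sup>2 + 4) + 1"
  have K: "K > 0" by (simp add: K_def add_nonneg_pos)
  have "(\<forall>ld. critical_points \<phi>1 \<phi>2 ld \<longrightarrow> l2_remainder nn K (N + 1) ld (zs_expansion N \<phi>1 \<phi>2)) \<and>
      (\<forall>lm lp. periodic_eigenvalues \<phi>1 \<phi>2 lm lp \<longrightarrow>
        l2_remainder nn K (N + 1) (\<lambda>n. (lp n + lm n) / 2) (zs_expansion N \<phi>1 \<phi>2))"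
    if B: "(\<phi>1, \<phi>2) \<in> B" for \<phi>1 \<phi>2
  proof -
    obtain p dp r dr where wd: "wkb_data N C \<phi>1 \<phi>2 p dp r dr" using C[OF B] by blast
    interpret wkb \<phi>1 \<phi>2 N C p dp r dr
      by unfold_locales (use wd in \<open>auto simp: wkb_data_def\<close>)
    show ?thesis unfolding nn_def K_def
      by (intro conjI allI impI remainder)
        (use critical_points_localised periodic_eigenvalues_localised nn0_ge in \<open>metis (no_types, lifting) order_trans\<close>)+
  qed
  moreover have "nn \<ge> 1" by (simp add: nn_def)
  ultimately show ?thesis using K by blast
qed

end
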